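(* Let $\{X(t),t\in\mathbb{R}^d\}$ be a stationary centered Gaussian field with unit variance and covariance function $\rho\in L^1(\mathbb{R}^d)$. For $T>0$ and $u\in\mathbb{R}$, let $$S_T(u)=\int_{[0,T]^d}1_{(X(t)\ge u)}\,dt$$ be the excursion volume above level $u$. Under the hypothesis that $$\int_{\mathbb{R}^d\setminus[-a,a]^d}|\rho(t)|\,dt=O\left(\frac{1}{\log a}\right),\quad a\to+\infty,$$ we have, as $T\to+\infty$, $$d_W\left(\frac{S_T(u)-T^d\,\Phi(u)}{\sqrt{T^d}},\ \mathcal{N}(0,\sigma^2(u))\right)=O\left(\frac{1}{(\log T)^{1/12}}\right),$$ where the constant involved in the $O$-notation only depends on the field $\{X(t),t\in\mathbb{R}^d\}$ (in particular not on the level $u$), and $$0<\sigma^2(u):=\sum_{n=1}^{+\infty}\frac{\phi^2(u)\,H_{n-1}^2(u)}{n!}\int_{\mathbb{R}^d}\rho^n(t)\,dt<+\infty.$$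
   Context: $\phi$ is the density function of the standard Gaussian distribution and $\Phi$ is the tail of its distribution, $\Phi(u)=\int_u^{+\infty}\phi(x)\,dx$. $H_n$ denotes the $n$-th (probabilists') Hermite polynomial, e.g. $H_0=1$, $H_1(y)=y$, $H_2(y)=y^2-1$. The Wasserstein distance is $d_W(Z_1,Z_2)=\sup_{h\in\mathcal{H}}|\mathbb{E}[h(Z_1)]-\mathbb{E}[h(Z_2)]|$, where $\mathcal{H}$ is the set of Lipschitz functions $\mathbb{R}\to\mathbb{R}$ with Lipschitz constant $\le1$. *)

theory Defs
  imports "HOL-Probability.Probability"
begin

text \<open>The degenerate case \<open>v = 0\<close> is a Dirac mass, so that degenerate linear combinations
  count as Gaussian.\<close>

definition normal_law :: "real \<Rightarrow> real \<Rightarrow> real measure" where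
  "normal_law m v = (if v = 0 then return borel m else density lborel (normal_density m (sqrt v)))"

text \<open>Random fields \<open>X\<close> on \<open>\<real>\<^sup>d\<close> are written \<open>X t \<omega>\<close>; \<open>M\<close> is the underlying probability space.\<close>

definition gaussian_field :: "'w measure \<Rightarrow> ('t \<Rightarrow> 'w \<Rightarrow> real) \<Rightarrow> bool" where
  "gaussian_field M X \<longleftrightarrow>
     (\<forall>t. X t \<in> borel_measurable M) \<and>
     (\<forall>F c. finite F \<longrightarrow>
        (\<exists>m v. v \<ge> 0 \<and> distr M borel (\<lambda>\<omega>. \<Sum>t\<in>F. c t * X t \<omega>) = normal_law m v))"

text \<open>Strict stationarity: the finite-dimensional distributions are translation invariant.\<close>

definition stationary_field :: "'w measure \<Rightarrow> ('t::ab_group_add \<Rightarrow> 'w \<Rightarrow> real) \<Rightarrow> bool" where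
  "stationary_field M X \<longleftrightarrow>
     (\<forall>F h. finite F \<longrightarrow>
        distr M (Pi\<^sub>M F (\<lambda>_. borel)) (\<lambda>\<omega>. \<lambda>t\<in>F. X (t + h) \<omega>) =
        distr M (Pi\<^sub>M F (\<lambda>_. borel)) (\<lambda>\<omega>. \<lambda>t\<in>F. X t \<omega>))"

text \<open>Joint measurability; it is what makes the excursion volume a random variable.\<close>

definition measurable_field :: "'w measure \<Rightarrow> ('t::euclidean_space \<Rightarrow> 'w \<Rightarrow> real) \<Rightarrow> bool" where
  "measurable_field M X \<longleftrightarrow> (\<lambda>(t, \<omega>). X t \<omega>) \<in> borel_measurable (lborel \<Otimes>\<^sub>M M)"

definition cov :: "'w measure \<Rightarrow> ('w \<Rightarrow> real) \<Rightarrow> ('w \<Rightarrow> real) \<Rightarrow> real" where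
  "cov M Y Z =
     (\<integral>\<omega>. (Y \<omega> - (\<integral>\<omega>'. Y \<omega>' \<partial>M)) * (Z \<omega> - (\<integral>\<omega>'. Z \<omega>' \<partial>M)) \<partial>M)"

definition normal_tail :: "real \<Rightarrow> real" where
  "normal_tail u = (LBINT x:{u..}. std_normal_density x)"

text \<open>Probabilists' Hermite polynomials, by the three-term recurrence
  \<open>H\<^bsub>n+2\<^esub>(y) = y H\<^bsub>n+1\<^esub>(y) - (n+1) H\<^bsub>n\<^esub>(y)\<close>.\<close>

fun hermite :: "nat \<Rightarrow> real \<Rightarrow> real" where
  "hermite 0 y = 1"
| "hermite (Suc 0) y = y"
| "hermite (Suc (Suc n)) y = y * hermite (Suc n) y - real (Suc n) * hermite n y"

definition excursion_volume ::
    "(real ^ 'd \<Rightarrow> 'w \<Rightarrow> real) \<Rightarrow> real \<Rightarrow> real \<Rightarrow> 'w \<Rightarrow> real" where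
  "excursion_volume X T u \<omega> =
     (LINT t:cbox 0 (\<chi> i. T)|lborel. indicator {s. X s \<omega> \<ge> u} t)"

definition normalized_excursion_volume ::
    "(real ^ 'd \<Rightarrow> 'w \<Rightarrow> real) \<Rightarrow> real \<Rightarrow> real \<Rightarrow> 'w \<Rightarrow> real" where
  "normalized_excursion_volume X T u \<omega> =
     (excursion_volume X T u \<omega> - T ^ CARD('d) * normal_tail u) / sqrt (T ^ CARD('d))"

text \<open>The Wasserstein distance between the laws of two random variables, with values in
  \<open>[0, \<infinity>]\<close>, so that no boundedness is needed for the supremum to be meaningful. The Bochner
  integrals are the expectations whenever both laws have a finite first moment, as is the case
  for a bounded variable and for a normal law.\<close>

definition wasserstein :: "real measure \<Rightarrow> real measure \<Rightarrow> ennreal" where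
  "wasserstein \<mu> \<nu> =
     (SUP h\<in>{h :: real \<Rightarrow> real. 1-lipschitz_on UNIV h}.
        ennreal \<bar>(\<integral>x. h x \<partial>\<mu>) - (\<integral>x. h x \<partial>\<nu>)\<bar>)"

text \<open>The \<open>n\<close>-th term, for \<open>n \<ge> 1\<close>, of the series defining the asymptotic variance.\<close>

definition variance_term :: "(real ^ 'd \<Rightarrow> real) \<Rightarrow> real \<Rightarrow> nat \<Rightarrow> real" where
  "variance_term \<rho> u n =
     (std_normal_density u)\<^sup>2 * (hermite (n - 1) u)\<^sup>2 / fact n * (\<integral>t. \<rho> t ^ n \<partial>lborel)"

definition asymptotic_variance :: "(real ^ 'd \<Rightarrow> real) \<Rightarrow> real \<Rightarrow> real" where
  "asymptotic_variance \<rho> u = (\<Sum>n. variance_term \<rho> u (Suc n))"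

end

theory Submission
  imports Defs "HOL-Real_Asymp.Real_Asymp"
begin

text \<open>The indicator of \<open>[u, \<infinity>)\<close> is smoothed by an Ornstein--Uhlenbeck step of correlation \<open>a\<close> close to
  \<open>1\<close>. For the smoothed functional, Stein's method applies by leaving variables out: the residual field
  \<open>X\<^sub>s - \<rho>(t - s) X\<^sub>t\<close> is independent of \<open>X\<^sub>t\<close>, and the products that remain decorrelate from the functional
  after removing two variables (one, when \<open>X\<^sub>s\<close> and \<open>X\<^sub>t\<close> are almost proportional). Both steps cost only a
  power of \<open>T\<close>, and no lower bound on the variance is used because Lipschitz test functions are smoothed
  first. The smoothing errors are read off the series
  \<open>Cov(1(X\<^sub>s \<ge> u), 1(X\<^sub>t \<ge> u)) = \<Sum>\<^sub>n \<phi>(u)\<^sup>2 H\<^sub>n\<^sub>-\<^sub>1(u)\<^sup>2 \<rho>(t - s)\<^sup>n / n!\<close>, in which an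
  Ornstein--Uhlenbeck step multiplies \<open>\<rho>\<close> by \<open>a\<close>. Only the convergence of the variances needs the decay of
  \<open>\<rho>\<close>; the rate obtained is \<open>(ln T) powr (-1/2)\<close>, better than claimed.

  Joint measurability forces \<open>\<rho>\<close> to be continuous at \<open>0\<close>, and integrability then keeps \<open>\<bar>\<rho>\<bar>\<close> away from \<open>1\<close> off
  the origin. Hence \<open>\<integral> \<rho>\<^sup>n > 0\<close> for all large \<open>n\<close>, while consecutive Hermite polynomials have no common
  zero, so the asymptotic variance is positive.\<close>

section \<open>Uniqueness of joint laws\<close>

text \<open>Gaussianity is given only through finite linear combinations, but the argument needs
  independence of two variables from a functional of uncountably many. Hence the order:
  characteristic functions determine finite joint laws, orthogonality gives product formulas for
  finite families, Fubini carries them to powers of an integral over the index set, and polynomial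
  approximation to continuous functions of it. The integral is taken against Lebesgue measure on the
  cube divided by \<open>sqrt (T ^ CARD('d))\<close>. This measure has mass T^(d/2), and the
  correlations of one variable with the field integrate to order T^(-d/2), so a product of mass and
  two such factors is small. Derivatives of the smoothed indicator cost powers of
  \<open>1 / (1 - a\<^sup>2)\<close>; therefore \<open>1 - a\<close> is a small negative power of
  \<open>T\<close>. The variance error, of order \<open>1 / ln T\<close>, gets divided by the
  smoothing width of the test function, and the two balance at width
  \<open>(ln T) powr (-1/2)\<close>. Bounds uniform in the level come from two facts: an indicator
  has variance at most 1, and the joint normal density is at most (1 - x)^(-1/2) at correlation x in
  [0, 1).\<close>

lemma (in prob_space) integrable_bounded_fun:
  fixes f :: "'a \<Rightarrow> real"
  assumes "f \<in> borel_measurable M" "\<And>x. \<bar>f x\<bar> \<le> K"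
  shows "integrable M f"
  using assms by (intro integrable_const_bound[where B = K]) auto

text \<open>After division by its total mass the weight is a probability density, and the two
  hypotheses give the real and imaginary parts of the characteristic function of the variable under
  it, so Levy uniqueness applies. At \<open>s = 0\<close> the cosine hypothesis says that the masses
  agree.\<close>

lemma weighted_law_eqI:
  fixes Z :: "'a \<Rightarrow> real" and Z' :: "'b \<Rightarrow> real"
  assumes "prob_space M" "prob_space N"
    and [measurable]: "w \<in> borel_measurable M" "w' \<in> borel_measurable N"
      "Z \<in> borel_measurable M" "Z' \<in> borel_measurable N"
    and w: "\<And>x. 0 \<le> w x" "\<And>x. w x \<le> K" and w': "\<And>x. 0 \<le> w' x" "\<And>x. w' x \<le> K"
    and cos: "\<And>s. (\<integral>x. w x * cos (s * Z x) \<partial>M) = (\<integral>x. w' x * cos (s * Z' x) \<partial>N)"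
    and sin: "\<And>s. (\<integral>x. w x * sin (s * Z x) \<partial>M) = (\<integral>x. w' x * sin (s * Z' x) \<partial>N)"
    and A[measurable]: "A \<in> sets borel"
  shows "(\<integral>x. w x * indicator A (Z x) \<partial>M) = (\<integral>x. w' x * indicator A (Z' x) \<partial>N)"
proof -
  have *: "\<exists>\<mu>. real_distribution \<mu> \<and> char \<mu> = (\<lambda>s. Complex ((\<integral>x. w x * cos (s * Z x) \<partial>M) / c) ((\<integral>x. w x * sin (s * Z x) \<partial>M) / c))
      \<and> (\<integral>x. w x * indicator A (Z x) \<partial>M) = c * measure \<mu> A"
    if "prob_space M" and [measurable]: "w \<in> borel_measurable M" "Z \<in> borel_measurable M"
      and w: "\<And>x. 0 \<le> w x" "\<And>x. w x \<le> K" and c: "c = (\<integral>x. w x \<partial>M)" "c \<noteq> 0"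
    for M :: "'c measure" and w Z :: "'c \<Rightarrow> real" and c
  proof -
    interpret prob_space M by fact
    have wi: "integrable M w" using w by (intro integrable_bounded_fun[where K = K]) auto
    have c0: "c > 0" using c w by (metis integral_nonneg_AE AE_I2 order_le_less)
    define D where "D = density M (\<lambda>x. ennreal (w x / c))"
    have D: "prob_space D"
    proof
      have "(\<integral>\<^sup>+x. ennreal (w x / c) \<partial>M) = ennreal (\<integral>x. w x / c \<partial>M)"
        using w wi c0 by (intro nn_integral_eq_integral) auto
      also have "\<dots> = 1" using c by simp
      finally show "emeasure D (space D) = 1" by (simp add: D_def emeasure_density cong: nn_integral_cong)
    qed
    interpret D: prob_space D by fact
    have [measurable]: "Z \<in> borel_measurable D" by (simp add: D_def)
    define \<mu> where "\<mu> = distr D borel Z"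
    have "real_distribution \<mu>" unfolding \<mu>_def by (simp add: D.real_distribution_distr)
    moreover have "char \<mu> s = Complex ((\<integral>x. w x * cos (s * Z x) \<partial>M) / c) ((\<integral>x. w x * sin (s * Z x) \<partial>M) / c)" for s
    proof -
      have e: "char \<mu> s = (\<integral>x. (w x / c) *\<^sub>R iexp (s * Z x) \<partial>M)"
        unfolding char_def \<mu>_def D_def using c0 w by (subst integral_distr) (simp_all add: integral_density)
      have i: "integrable M (\<lambda>x. (w x / c) *\<^sub>R iexp (s * Z x))"
        using w c0 by (intro integrable_const_bound[where B = "K / c"]) (auto intro!: AE_I2 divide_right_mono)
      show ?thesis unfolding e complex_eq_iff
        using integral_Re[OF i] integral_Im[OF i] by (simp add: Re_exp Im_exp)
    qed
    moreover have "(\<integral>x. w x * indicator A (Z x) \<partial>M) = c * measure \<mu> A"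
    proof -
      have "measure \<mu> A = (\<integral>x. indicator A x \<partial>\<mu>)" by (simp add: \<mu>_def)
      also have "\<dots> = (\<integral>x. (w x / c) * indicator A (Z x) \<partial>M)"
        unfolding \<mu>_def D_def using c0 w by (subst integral_distr) (simp_all add: integral_density)
      also have "\<dots> = (\<integral>x. w x * indicator A (Z x) \<partial>M) / c" by simp
      finally show ?thesis using c0 by simp
    qed
    ultimately show ?thesis by blast
  qed
  \<comment> \<open>With total mass 0 no normalisation is possible, but then the weight vanishes
    almost everywhere.\<close>
  have z: "(\<integral>x. w x * indicator A (Z x) \<partial>M) = 0"
    if "prob_space M" and [measurable]: "w \<in> borel_measurable M" "Z \<in> borel_measurable M"
      and w: "\<And>x. 0 \<le> w x" "\<And>x. w x \<le> K" and c: "(\<integral>x. w x \<partial>M) = 0"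
    for M :: "'c measure" and w Z :: "'c \<Rightarrow> real"
  proof -
    interpret prob_space M by fact
    have wi: "integrable M w" using w by (intro integrable_bounded_fun[where K = K]) auto
    have "AE x in M. w x = 0" using c w by (subst integral_nonneg_eq_0_iff_AE[OF wi, symmetric]) auto
    then have "(\<integral>x. w x * indicator A (Z x) \<partial>M) = (\<integral>x. 0 \<partial>M)" by (intro integral_cong_AE) auto
    then show ?thesis by simp
  qed
  have c: "(\<integral>x. w x \<partial>M) = (\<integral>x. w' x \<partial>N)" using cos[of 0] by simp
  show ?thesis
  proof (cases "(\<integral>x. w x \<partial>M) = 0")
    case True
    then show ?thesis using z[of M w Z] z[of N w' Z'] assms c by simp
  next
    case False
    obtain \<mu> where \<mu>: "real_distribution \<mu>"
      "char \<mu> = (\<lambda>s. Complex ((\<integral>x. w x * cos (s * Z x) \<partial>M) / (\<integral>x. w x \<partial>M)) ((\<integral>x. w x * sin (s * Z x) \<partial>M) / (\<integral>x. w x \<partial>M)))"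
      "(\<integral>x. w x * indicator A (Z x) \<partial>M) = (\<integral>x. w x \<partial>M) * measure \<mu> A"
      using *[OF assms(1,3,5) w refl False] by blast
    obtain \<nu> where \<nu>: "real_distribution \<nu>"
      "char \<nu> = (\<lambda>s. Complex ((\<integral>x. w' x * cos (s * Z' x) \<partial>N) / (\<integral>x. w' x \<partial>N)) ((\<integral>x. w' x * sin (s * Z' x) \<partial>N) / (\<integral>x. w' x \<partial>N)))"
      "(\<integral>x. w' x * indicator A (Z' x) \<partial>N) = (\<integral>x. w' x \<partial>N) * measure \<nu> A"
      using *[OF assms(2,4,6) w' refl] False c by auto
    have "\<mu> = \<nu>" using \<mu>(2) \<nu>(2) cos sin c by (intro Levy_uniqueness \<mu>(1) \<nu>(1)) simp
    then show ?thesis using \<mu>(3) \<nu>(3) c by simp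
  qed
qed

text \<open>Coordinates are passed from trigonometric functions to indicators one at a time. The weights
  \<open>1 + cos\<close> and \<open>1 + sin\<close> are nonnegative, so that one-dimensional uniqueness applies.\<close>

lemma cylinder_trig_eq:
  fixes X :: "'i \<Rightarrow> 'a \<Rightarrow> real" and X' :: "'i \<Rightarrow> 'b \<Rightarrow> real"
  assumes M: "prob_space M" and N: "prob_space N" and I: "finite I"
    and X[measurable]: "\<And>i. i \<in> I \<Longrightarrow> X i \<in> borel_measurable M"
    and X'[measurable]: "\<And>i. i \<in> I \<Longrightarrow> X' i \<in> borel_measurable N"
    and cos: "\<And>c. (\<integral>x. cos (\<Sum>i\<in>I. c i * X i x) \<partial>M) = (\<integral>x. cos (\<Sum>i\<in>I. c i * X' i x) \<partial>N)"
    and sin: "\<And>c. (\<integral>x. sin (\<Sum>i\<in>I. c i * X i x) \<partial>M) = (\<integral>x. sin (\<Sum>i\<in>I. c i * X' i x) \<partial>N)"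
    and J: "J \<subseteq> I" and A: "\<And>i. A i \<in> sets borel"
  shows "(\<integral>x. (\<Prod>j\<in>J. indicator (A j) (X j x)) * cos (\<Sum>i\<in>I-J. c i * X i x) \<partial>M) =
         (\<integral>x. (\<Prod>j\<in>J. indicator (A j) (X' j x)) * cos (\<Sum>i\<in>I-J. c i * X' i x) \<partial>N) \<and>
         (\<integral>x. (\<Prod>j\<in>J. indicator (A j) (X j x)) * sin (\<Sum>i\<in>I-J. c i * X i x) \<partial>M) =
         (\<integral>x. (\<Prod>j\<in>J. indicator (A j) (X' j x)) * sin (\<Sum>i\<in>I-J. c i * X' i x) \<partial>N)"
  using finite_subset[OF J I] J
proof (induction J arbitrary: c rule: finite_induct)
  case empty
  then show ?case using cos sin by simp
next
  case (insert a J)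
  interpret M: prob_space M by fact
  interpret N: prob_space N by fact
  have aI: "a \<in> I" "a \<notin> J" "J \<subseteq> I" using insert by auto
  note IH = insert.IH[OF \<open>J \<subseteq> I\<close>]
  let ?K = "I - insert a J"
  define P where "P x = (\<Prod>j\<in>J. indicator (A j) (X j x) :: real)" for x
  define P' where "P' x = (\<Prod>j\<in>J. indicator (A j) (X' j x) :: real)" for x
  have Pb: "0 \<le> P x" "P x \<le> 1" "0 \<le> P' y" "P' y \<le> 1" for x y
    by (auto simp: P_def P'_def intro!: prod_nonneg prod_le_1)
  have [measurable]: "X i \<in> borel_measurable M" "X' i \<in> borel_measurable N" if "i \<in> J" for i
    using that aI X X' by auto
  have [measurable]: "X a \<in> borel_measurable M" "X' a \<in> borel_measurable N" using aI X X' by auto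
  have [measurable]: "A i \<in> sets borel" for i by fact
  have Pm[measurable]: "P \<in> borel_measurable M" "P' \<in> borel_measurable N"
    unfolding P_def[abs_def] P'_def[abs_def] by measurable
  define th where "th c x = (\<Sum>i\<in>?K. c i * X i x)" for c x
  define th' where "th' c x = (\<Sum>i\<in>?K. c i * X' i x)" for c x
  have [measurable]: "th c \<in> borel_measurable M" "th' c \<in> borel_measurable N" for c
    unfolding th_def[abs_def] th'_def[abs_def] using X X' by (auto intro!: borel_measurable_sum borel_measurable_times)
  have split: "(\<Sum>i\<in>I-J. (c(a:=s)) i * X i x) = th c x + s * X a x"
     "(\<Sum>i\<in>I-J. (c(a:=s)) i * X' i y) = th' c y + s * X' a y" for c s x y
  proof -
    have e: "I - J = insert a ?K" using aI by auto
    have f: "(\<Sum>i\<in>I-J. (c(a:=s)) i * g i) = (\<Sum>i\<in>?K. c i * g i) + s * g a" for g :: "'i \<Rightarrow> real"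
      unfolding e using I by (subst sum.insert) (auto intro!: sum.cong)
    show "(\<Sum>i\<in>I-J. (c(a:=s)) i * X i x) = th c x + s * X a x"
     "(\<Sum>i\<in>I-J. (c(a:=s)) i * X' i y) = th' c y + s * X' a y"
      unfolding f th_def th'_def by (rule refl)+
  qed
  have C: "(\<integral>x. P x * cos (th c x + s * X a x) \<partial>M) = (\<integral>x. P' x * cos (th' c x + s * X' a x) \<partial>N)" for c s
    using IH[of "c(a := s)"] unfolding split by (simp add: P_def P'_def)
  have S: "(\<integral>x. P x * sin (th c x + s * X a x) \<partial>M) = (\<integral>x. P' x * sin (th' c x + s * X' a x) \<partial>N)" for c s
    using IH[of "c(a := s)"] unfolding split by (simp add: P_def P'_def)
  have t0: "th (\<lambda>_. 0) x = 0" "th' (\<lambda>_. 0) y = 0" for x y by (auto simp: th_def th'_def)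
  have ab: "\<bar>P x * t\<bar> \<le> 1" "\<bar>P' y * t\<bar> \<le> 1" if "\<bar>t\<bar> \<le> 1" for x y t
    using that Pb by (auto simp: abs_mult intro!: mult_le_one)
  have iM[simp, intro]: "integrable M (\<lambda>x. P x * cos (f x))" "integrable M (\<lambda>x. P x * sin (f x))"
    if [measurable]: "f \<in> borel_measurable M" for f
    using ab by (auto intro!: M.integrable_bounded_fun[where K = 1])
  have iN[simp, intro]: "integrable N (\<lambda>x. P' x * cos (f x))" "integrable N (\<lambda>x. P' x * sin (f x))"
    if [measurable]: "f \<in> borel_measurable N" for f
    using ab by (auto intro!: N.integrable_bounded_fun[where K = 1])
  \<comment> \<open>Product-to-sum formulas: they express the weighted integrals through the
    induction hypothesis at \<open>s\<close> and \<open>-s\<close>. The sums \<open>0 + y\<close>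
    and \<open>t + - y\<close> are left as they are so as to match it.\<close>
  have tr: "p * (1 + cos t) * cos y = p * cos (0 + y) + (p * cos (t + y) + p * cos (t + - y)) / 2"
      "p * (1 + cos t) * sin y = p * sin (0 + y) + (p * sin (t + y) - p * sin (t + - y)) / 2"
      "p * (1 + sin t) * cos y = p * cos (0 + y) + (p * sin (t + y) + p * sin (t + - y)) / 2"
      "p * (1 + sin t) * sin y = p * sin (0 + y) + (p * cos (t + - y) - p * cos (t + y)) / 2" for p t y :: real
    by (simp_all add: cos_add sin_add cos_diff sin_diff field_simps)
  have C0: "(\<integral>x. P x * cos (0 + s * X a x) \<partial>M) = (\<integral>x. P' x * cos (0 + s * X' a x) \<partial>N)"
    and S0: "(\<integral>x. P x * sin (0 + s * X a x) \<partial>M) = (\<integral>x. P' x * sin (0 + s * X' a x) \<partial>N)" for s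
    using C[of "\<lambda>_. 0" s] S[of "\<lambda>_. 0" s] unfolding t0 by simp_all
  have Cm: "(\<integral>x. P x * cos (th c x + - (s * X a x)) \<partial>M) = (\<integral>x. P' x * cos (th' c x + - (s * X' a x)) \<partial>N)"
    and Sm: "(\<integral>x. P x * sin (th c x + - (s * X a x)) \<partial>M) = (\<integral>x. P' x * sin (th' c x + - (s * X' a x)) \<partial>N)" for c s
    using C[of c "-s"] S[of c "-s"] by simp_all
  have le2: "0 \<le> 1 + cos t" "1 + cos t \<le> 2" "0 \<le> 1 + sin t" "1 + sin t \<le> 2" for t :: real
    using cos_le_one[of t] cos_ge_minus_one[of t] sin_le_one[of t] sin_ge_minus_one[of t] by linarith+
  have le: "p * q \<le> 2" if "0 \<le> p" "p \<le> 1" "0 \<le> q" "q \<le> 2" for p q :: real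
    using mult_mono[of p 1 q 2] that by simp
  have c1: "(\<integral>x. P x * (1 + cos (th c x)) * indicator (A a) (X a x) \<partial>M) =
        (\<integral>x. P' x * (1 + cos (th' c x)) * indicator (A a) (X' a x) \<partial>N)" for c
  proof (rule weighted_law_eqI[OF M N, where K = 2])
    show "0 \<le> P x * (1 + cos (th c x))" "P x * (1 + cos (th c x)) \<le> 2" for x using Pb le2 by (simp_all add: le)
    show "0 \<le> P' x * (1 + cos (th' c x))" "P' x * (1 + cos (th' c x)) \<le> 2" for x using Pb le2 by (simp_all add: le)
    show "(\<integral>x. P x * (1 + cos (th c x)) * cos (s * X a x) \<partial>M) = (\<integral>x. P' x * (1 + cos (th' c x)) * cos (s * X' a x) \<partial>N)" for s
      unfolding tr using C0[of s] C[of c s] Cm[of c s] S[of c s] Sm[of c s] by (simp del: add_uminus_conv_diff add_0_left)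
    show "(\<integral>x. P x * (1 + cos (th c x)) * sin (s * X a x) \<partial>M) = (\<integral>x. P' x * (1 + cos (th' c x)) * sin (s * X' a x) \<partial>N)" for s
      unfolding tr using S0[of s] C[of c s] Cm[of c s] S[of c s] Sm[of c s] by (simp del: add_uminus_conv_diff add_0_left)
  qed measurable
  have s1: "(\<integral>x. P x * (1 + sin (th c x)) * indicator (A a) (X a x) \<partial>M) =
        (\<integral>x. P' x * (1 + sin (th' c x)) * indicator (A a) (X' a x) \<partial>N)" for c
  proof (rule weighted_law_eqI[OF M N, where K = 2])
    show "0 \<le> P x * (1 + sin (th c x))" "P x * (1 + sin (th c x)) \<le> 2" for x using Pb le2 by (simp_all add: le)
    show "0 \<le> P' x * (1 + sin (th' c x))" "P' x * (1 + sin (th' c x)) \<le> 2" for x using Pb le2 by (simp_all add: le)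
    show "(\<integral>x. P x * (1 + sin (th c x)) * cos (s * X a x) \<partial>M) = (\<integral>x. P' x * (1 + sin (th' c x)) * cos (s * X' a x) \<partial>N)" for s
      unfolding tr using C0[of s] C[of c s] Cm[of c s] S[of c s] Sm[of c s] by (simp del: add_uminus_conv_diff add_0_left)
    show "(\<integral>x. P x * (1 + sin (th c x)) * sin (s * X a x) \<partial>M) = (\<integral>x. P' x * (1 + sin (th' c x)) * sin (s * X' a x) \<partial>N)" for s
      unfolding tr using S0[of s] C[of c s] Cm[of c s] S[of c s] Sm[of c s] by (simp del: add_uminus_conv_diff add_0_left)
  qed measurable
  define I1 where "I1 x = (indicator (A a) (X a x)::real)" for x
  define I1' where "I1' x = (indicator (A a) (X' a x)::real)" for x
  have [measurable]: "I1 \<in> borel_measurable M" "I1' \<in> borel_measurable N"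
    unfolding I1_def[abs_def] I1'_def[abs_def] by measurable
  have I1b: "0 \<le> I1 x" "I1 x \<le> 1" "0 \<le> I1' y" "I1' y \<le> 1" for x y by (auto simp: I1_def I1'_def indicator_def)
  have ab3: "\<bar>p * q * t\<bar> \<le> 1" if "0 \<le> p" "p \<le> 1" "0 \<le> q" "q \<le> 1" "\<bar>t\<bar> \<le> 1" for p q t :: real
    using that by (auto simp: abs_mult intro!: mult_le_one)
  have iM2[simp, intro]: "integrable M (\<lambda>x. P x * I1 x * cos (f x))" "integrable M (\<lambda>x. P x * I1 x * sin (f x))"
    if [measurable]: "f \<in> borel_measurable M" for f
    using Pb I1b by (auto intro!: M.integrable_bounded_fun[where K = 1] ab3)
  have iN2[simp, intro]: "integrable N (\<lambda>x. P' x * I1' x * cos (f x))" "integrable N (\<lambda>x. P' x * I1' x * sin (f x))"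
    if [measurable]: "f \<in> borel_measurable N" for f
    using Pb I1b by (auto intro!: N.integrable_bounded_fun[where K = 1] ab3)
  have iM3[simp, intro]: "integrable M (\<lambda>x. P x * I1 x)" and iN3[simp, intro]: "integrable N (\<lambda>x. P' x * I1' x)"
    using iM2(1)[of "\<lambda>_. 0"] iN2(1)[of "\<lambda>_. 0"] by auto
  \<comment> \<open>At zero coefficients the sine weight is just \<open>P\<close>; subtracting this
    from \<open>c1\<close> and \<open>s1\<close> removes the 1 from \<open>1 + cos\<close> and
    \<open>1 + sin\<close>.\<close>
  have z1: "(\<integral>x. P x * I1 x \<partial>M) = (\<integral>x. P' x * I1' x \<partial>N)"
    using s1[of "\<lambda>_. 0"] by (simp add: t0 I1_def I1'_def)
  have d: "p * (1 + t) * q = p * q + p * q * t" for p q t :: real by (simp add: algebra_simps)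
  have e1: "(\<integral>x. P x * I1 x * cos (th c x) \<partial>M) = (\<integral>x. P' x * I1' x * cos (th' c x) \<partial>N)"
    using c1[of c] z1 unfolding I1_def[symmetric] I1'_def[symmetric] d by simp
  have e2: "(\<integral>x. P x * I1 x * sin (th c x) \<partial>M) = (\<integral>x. P' x * I1' x * sin (th' c x) \<partial>N)"
    using s1[of c] z1 unfolding I1_def[symmetric] I1'_def[symmetric] d by simp
  have pr: "(\<Prod>j\<in>insert a J. indicator (A j) (X j x)) = P x * I1 x"
    "(\<Prod>j\<in>insert a J. indicator (A j) (X' j y)) = P' y * I1' y" for x y
    using insert.hyps by (simp_all add: P_def P'_def I1_def I1'_def mult.commute)
  show ?case using e1 e2 unfolding pr th_def th'_def by simp
qed

text \<open>The Cramer--Wold principle, with characteristic functions split into cosine and sine parts.\<close>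

lemma joint_law_eqI:
  fixes X :: "'i \<Rightarrow> 'a \<Rightarrow> real" and X' :: "'i \<Rightarrow> 'b \<Rightarrow> real"
  assumes M: "prob_space M" and N: "prob_space N" and I: "finite I"
    and X[measurable]: "\<And>i. i \<in> I \<Longrightarrow> X i \<in> borel_measurable M"
    and X'[measurable]: "\<And>i. i \<in> I \<Longrightarrow> X' i \<in> borel_measurable N"
    and cos: "\<And>c. (\<integral>x. cos (\<Sum>i\<in>I. c i * X i x) \<partial>M) = (\<integral>x. cos (\<Sum>i\<in>I. c i * X' i x) \<partial>N)"
    and sin: "\<And>c. (\<integral>x. sin (\<Sum>i\<in>I. c i * X i x) \<partial>M) = (\<integral>x. sin (\<Sum>i\<in>I. c i * X' i x) \<partial>N)"
  shows "distr M (PiM I (\<lambda>_. borel)) (\<lambda>x. \<lambda>i\<in>I. X i x) = distr N (PiM I (\<lambda>_. borel)) (\<lambda>x. \<lambda>i\<in>I. X' i x)"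
proof -
  interpret M: prob_space M by fact
  interpret N: prob_space N by fact
  have m[measurable]: "(\<lambda>x. \<lambda>i\<in>I. X i x) \<in> measurable M (PiM I (\<lambda>_. borel))" 
     "(\<lambda>x. \<lambda>i\<in>I. X' i x) \<in> measurable N (PiM I (\<lambda>_. borel))"
    using X X' by (auto intro!: measurable_restrict)
  show ?thesis
  proof (rule measure_eqI_PiM_finite[OF I])
    fix A :: "'i \<Rightarrow> real set" assume "\<And>i. i \<in> I \<Longrightarrow> A i \<in> sets borel"
    \<comment> \<open>\<open>cylinder_trig_eq\<close> expects a Borel set at every index, also
      outside \<open>I\<close>.\<close>
    define B where "B i = (if i \<in> I then A i else {})" for i
    have B[measurable]: "B i \<in> sets borel" for i using \<open>\<And>i. i \<in> I \<Longrightarrow> A i \<in> sets borel\<close> by (simp add: B_def)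
    have AB: "Pi\<^sub>E I A = Pi\<^sub>E I B" by (rule PiE_cong) (simp add: B_def)
    have PB[measurable]: "Pi\<^sub>E I B \<in> sets (PiM I (\<lambda>_. borel))" using I by (intro sets_PiM_I_finite) auto
    have p: "indicator (Pi\<^sub>E I B) (\<lambda>i\<in>I. f i) = (\<Prod>j\<in>I. indicator (B j) (f j) :: real)" for f
      using I by (auto simp: indicator_def PiE_iff)
    have "measure (distr M (PiM I (\<lambda>_. borel)) (\<lambda>x. \<lambda>i\<in>I. X i x)) (Pi\<^sub>E I B) = (\<integral>x. (\<Prod>j\<in>I. indicator (B j) (X j x)) \<partial>M)"
      unfolding p[symmetric] by (subst integral_distr[symmetric, OF m(1)]) auto
    also have "\<dots> = (\<integral>x. (\<Prod>j\<in>I. indicator (B j) (X' j x)) \<partial>N)"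
      using cylinder_trig_eq[OF assms order_refl B, where c = "\<lambda>_. 0"] by simp
    also have "\<dots> = measure (distr N (PiM I (\<lambda>_. borel)) (\<lambda>x. \<lambda>i\<in>I. X' i x)) (Pi\<^sub>E I B)"
      unfolding p[symmetric] by (subst integral_distr[symmetric, OF m(2)]) auto
    finally show "emeasure (distr M (PiM I (\<lambda>_. borel)) (\<lambda>x. \<lambda>i\<in>I. X i x)) (Pi\<^sub>E I A) =
        emeasure (distr N (PiM I (\<lambda>_. borel)) (\<lambda>x. \<lambda>i\<in>I. X' i x)) (Pi\<^sub>E I A)"
      unfolding AB
      by (simp add: finite_measure.emeasure_eq_measure[OF prob_space.finite_measure[OF M.prob_space_distr[OF m(1)]]]
          finite_measure.emeasure_eq_measure[OF prob_space.finite_measure[OF N.prob_space_distr[OF m(2)]]])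
  next
    have "prob_space (distr M (PiM I (\<lambda>_. borel)) (\<lambda>x. \<lambda>i\<in>I. X i x))" using m by (intro M.prob_space_distr)
    then show "emeasure (distr M (PiM I (\<lambda>_. borel)) (\<lambda>x. \<lambda>i\<in>I. X i x)) ((\<lambda>_::nat. space (PiM I (\<lambda>_. borel))) i) \<noteq> \<infinity>" for i
      by (auto simp: finite_measure.emeasure_finite[OF prob_space.finite_measure])
    show "range (\<lambda>_::nat. space (PiM I (\<lambda>_. borel))) \<subseteq> prod_algebra I (\<lambda>_. borel :: real measure)"
      by (auto simp: space_PiM intro!: prod_algebraI_finite I)
  qed auto
qed

section \<open>The linear span of a Gaussian field\<close>

abbreviation gam :: "real measure" where "gam \<equiv> std_normal_distribution"

lemma prob_space_gam: "prob_space gam"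
  using real_dist_normal_dist by (simp add: real_distribution_def)

lemma gam_moments:
  "integrable gam (\<lambda>x. x)" "(\<integral>x. x \<partial>gam) = 0" "integrable gam (\<lambda>x. x\<^sup>2)" "(\<integral>x. x\<^sup>2 \<partial>gam) = 1"
  "(\<integral>x. cos (s * x) \<partial>gam) = exp (- s\<^sup>2 / 2)" "(\<integral>x. sin (s * x) \<partial>gam) = 0"
proof -
  note odd = std_normal_moment_odd[of 0] and even = std_normal_moment_even[of 1]
  show "integrable gam (\<lambda>x. x)" "(\<integral>x. x \<partial>gam) = 0"
    using odd by (auto simp: integrable_density integral_density has_bochner_integral_iff)
  show "integrable gam (\<lambda>x. x\<^sup>2)" "(\<integral>x. x\<^sup>2 \<partial>gam) = 1"
    using even by (auto simp: integrable_density integral_density has_bochner_integral_iff)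
  interpret real_distribution gam by (rule real_dist_normal_dist)
  have i: "integrable gam (\<lambda>x. iexp (s * x))" by (intro integrable_const_bound[where B = 1]) auto
  have "Re (char gam s) = exp (- s\<^sup>2 / 2)" "Im (char gam s) = 0"
    by (simp_all add: char_std_normal_distribution)
  then show "(\<integral>x. cos (s * x) \<partial>gam) = exp (- s\<^sup>2 / 2)" "(\<integral>x. sin (s * x) \<partial>gam) = 0"
    unfolding char_def using integral_Re[OF i] integral_Im[OF i] by (simp_all add: Re_exp Im_exp)
qed

text \<open>As an affine image of \<open>gam\<close> the law needs no case distinction later: the
  Dirac mass is the image under a constant map.\<close>

lemma normal_law_eq_distr:
  assumes "v \<ge> 0"
  shows "normal_law m v = distr gam borel (\<lambda>x. m + sqrt v * x)"
proof (cases "v = 0")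
  case True
  interpret prob_space gam by (rule prob_space_gam)
  have "distr gam borel (\<lambda>x. m) = return borel m" by (rule measure_eqI) (auto simp: emeasure_distr indicator_def emeasure_space_1[simplified])
  then show ?thesis using True by (simp add: normal_law_def)
next
  case False
  interpret prob_space gam by (rule prob_space_gam)
  have "distributed gam lborel (\<lambda>x. x) (normal_density 0 1)"
    by (auto simp: distributed_def intro!: distr_id2)
  then have "distributed gam lborel (\<lambda>x. m + sqrt v * x) (normal_density (m + sqrt v * 0) (\<bar>sqrt v\<bar> * 1))"
    using False assms by (intro normal_density_affine) auto
  then have "distr gam lborel (\<lambda>x. m + sqrt v * x) = density lborel (normal_density m (sqrt v))"
    using assms by (auto simp: distributed_def)
  moreover have "distr gam borel (\<lambda>x. m + sqrt v * x) = distr gam lborel (\<lambda>x. m + sqrt v * x)"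
    by (rule distr_cong) auto
  ultimately show ?thesis using False by (simp add: normal_law_def)
qed

text \<open>The Gaussian hypothesis says that every variable in this set is normal. Residuals of
  regressions stay in it, so that they are handled like the field itself.\<close>

definition lin_span :: "('t \<Rightarrow> 'w \<Rightarrow> real) \<Rightarrow> ('w \<Rightarrow> real) set" where
  "lin_span X = {Z. \<exists>F c. finite F \<and> Z = (\<lambda>\<omega>. \<Sum>t\<in>F. c t * X t \<omega>)}"

lemma lin_span_zero: "(\<lambda>\<omega>. 0) \<in> lin_span X"
  unfolding lin_span_def by (auto intro!: exI[of _ "{}"])

lemma lin_span_base: "X t \<in> lin_span X"
  unfolding lin_span_def by (auto intro!: exI[of _ "{t}"] exI[of _ "\<lambda>_. 1"])

lemma lin_span_scale: "Z \<in> lin_span X \<Longrightarrow> (\<lambda>\<omega>. a * Z \<omega>) \<in> lin_span X"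
proof -
  assume "Z \<in> lin_span X"
  then obtain F c where "finite F" "Z = (\<lambda>\<omega>. \<Sum>t\<in>F. c t * X t \<omega>)" by (auto simp: lin_span_def)
  then show ?thesis unfolding lin_span_def
    by (auto simp: sum_distrib_left mult.assoc intro!: exI[of _ F] exI[of _ "\<lambda>t. a * c t"])
qed

lemma lin_span_add:
  assumes "Z \<in> lin_span X" "W \<in> lin_span X"
  shows "(\<lambda>\<omega>. Z \<omega> + W \<omega>) \<in> lin_span X"
proof -
  obtain F c G d where *: "finite F" "Z = (\<lambda>\<omega>. \<Sum>t\<in>F. c t * X t \<omega>)" "finite G" "W = (\<lambda>\<omega>. \<Sum>t\<in>G. d t * X t \<omega>)"
    using assms by (auto simp: lin_span_def)
  have "(\<Sum>t\<in>F \<union> G. ((if t \<in> F then c t else 0) + (if t \<in> G then d t else 0)) * X t \<omega>) = Z \<omega> + W \<omega>" for \<omega>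
  proof -
    have "(\<Sum>t\<in>F \<union> G. ((if t \<in> F then c t else 0) + (if t \<in> G then d t else 0)) * X t \<omega>)
      = (\<Sum>t\<in>F \<union> G. if t \<in> F then c t * X t \<omega> else 0) + (\<Sum>t\<in>F \<union> G. if t \<in> G then d t * X t \<omega> else 0)"
      by (subst sum.distrib[symmetric]) (auto intro!: sum.cong simp: algebra_simps)
    also have "\<dots> = Z \<omega> + W \<omega>" using * by (simp add: sum.If_cases Int_absorb1)
    finally show ?thesis .
  qed
  then show ?thesis using * unfolding lin_span_def
    by (auto intro!: exI[of _ "F \<union> G"] exI[of _ "\<lambda>t. (if t \<in> F then c t else 0) + (if t \<in> G then d t else 0)"])
qed

lemma lin_span_diff:
  assumes "Z \<in> lin_span X" "W \<in> lin_span X"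
  shows "(\<lambda>\<omega>. Z \<omega> - W \<omega>) \<in> lin_span X"
  using lin_span_add[OF assms(1) lin_span_scale[OF assms(2), of "-1"]] by simp

lemma lin_span_sum: "finite I \<Longrightarrow> (\<And>i. i \<in> I \<Longrightarrow> Z i \<in> lin_span X) \<Longrightarrow> (\<lambda>\<omega>. \<Sum>i\<in>I. a i * Z i \<omega>) \<in> lin_span X"
proof (induction I rule: finite_induct)
  case (insert x F)
  then have "(\<lambda>\<omega>. a x * Z x \<omega> + (\<Sum>i\<in>F. a i * Z i \<omega>)) \<in> lin_span X"
    by (intro lin_span_add lin_span_scale) auto
  then show ?case using insert by simp
qed (simp add: lin_span_zero)

locale centered_gaussian = prob_space M for M :: "'w measure" +
  fixes X :: "'t \<Rightarrow> 'w \<Rightarrow> real"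
  assumes gaussian: "gaussian_field M X" and centered: "\<And>t. (\<integral>\<omega>. X t \<omega> \<partial>M) = 0"
begin

lemma X_measurable[measurable]: "X t \<in> borel_measurable M"
  using gaussian by (auto simp: gaussian_field_def)

lemma lin_span_law:
  assumes Z: "Z \<in> lin_span X"
  shows lin_span_measurable: "Z \<in> borel_measurable M"
    and lin_span_distr: "\<exists>m v. v \<ge> 0 \<and> distr M borel Z = distr gam borel (\<lambda>x. m + sqrt v * x)"
proof -
  obtain F c where F: "finite F" "Z = (\<lambda>\<omega>. \<Sum>t\<in>F. c t * X t \<omega>)" using Z by (auto simp: lin_span_def)
  show "Z \<in> borel_measurable M" unfolding F by measurable
  obtain m v where "v \<ge> 0" "distr M borel Z = normal_law m v" 
    using gaussian F unfolding gaussian_field_def by blast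
  then show "\<exists>m v. v \<ge> 0 \<and> distr M borel Z = distr gam borel (\<lambda>x. m + sqrt v * x)"
    using normal_law_eq_distr[of v m] by auto
qed

lemma lin_span_integrable:
  assumes Z: "Z \<in> lin_span X"
  shows "integrable M Z" "integrable M (\<lambda>\<omega>. (Z \<omega>)\<^sup>2)"
proof -
  have [measurable]: "Z \<in> borel_measurable M" by (rule lin_span_measurable[OF Z])
  interpret G: prob_space gam by (rule prob_space_gam)
  obtain m v where v: "v \<ge> 0" and d: "distr M borel Z = distr gam borel (\<lambda>x. m + sqrt v * x)"
    using lin_span_distr[OF Z] by blast
  have "integrable gam (\<lambda>x. m + sqrt v * x)" using gam_moments by simp
  then have "integrable (distr M borel Z) (\<lambda>x. x)" unfolding d by (subst integrable_distr_eq) auto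
  then show "integrable M Z" by (subst (asm) integrable_distr_eq) auto
  have "integrable gam (\<lambda>x. (m + sqrt v * x)\<^sup>2)"
    using gam_moments by (simp add: power2_sum power_mult_distrib)
  then have "integrable (distr M borel Z) (\<lambda>x. x\<^sup>2)" unfolding d by (subst integrable_distr_eq) auto
  then show "integrable M (\<lambda>\<omega>. (Z \<omega>)\<^sup>2)" by (subst (asm) integrable_distr_eq) auto
qed

lemma lin_span_integrable_mult:
  assumes Z: "Z \<in> lin_span X" and W: "W \<in> lin_span X"
  shows "integrable M (\<lambda>\<omega>. Z \<omega> * W \<omega>)"
proof (rule Bochner_Integration.integrable_bound)
  show "integrable M (\<lambda>\<omega>. (Z \<omega>)\<^sup>2 + (W \<omega>)\<^sup>2)" using lin_span_integrable Z W by auto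
  show "(\<lambda>\<omega>. Z \<omega> * W \<omega>) \<in> borel_measurable M" using lin_span_measurable[OF Z] lin_span_measurable[OF W] by simp
  have "\<bar>a * b\<bar> \<le> a\<^sup>2 + b\<^sup>2" for a b :: real
    using sum_squares_bound[of "\<bar>a\<bar>" "\<bar>b\<bar>"] abs_ge_zero[of "a * b"]
    by (simp only: abs_mult power2_abs mult.assoc)
  then show "AE x in M. norm (Z x * W x) \<le> norm ((Z x)\<^sup>2 + (W x)\<^sup>2)" by simp
qed

lemma lin_span_mean:
  assumes Z: "Z \<in> lin_span X"
  shows "(\<integral>\<omega>. Z \<omega> \<partial>M) = 0"
proof -
  obtain F c where F: "finite F" "Z = (\<lambda>\<omega>. \<Sum>t\<in>F. c t * X t \<omega>)" using Z by (auto simp: lin_span_def)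
  show ?thesis unfolding F using lin_span_integrable[OF lin_span_base] centered by simp
qed

text \<open>Mean and second moment identify the two parameters of the normal law; the mean is 0
  because the field is centred.\<close>

lemma lin_span_distr':
  assumes Z: "Z \<in> lin_span X"
  shows "distr M borel Z = distr gam borel (\<lambda>x. sqrt (\<integral>\<omega>. (Z \<omega>)\<^sup>2 \<partial>M) * x)"
proof -
  have [measurable]: "Z \<in> borel_measurable M" by (rule lin_span_measurable[OF Z])
  interpret G: prob_space gam by (rule prob_space_gam)
  obtain m v where v: "v \<ge> 0" and d: "distr M borel Z = distr gam borel (\<lambda>x. m + sqrt v * x)"
    using lin_span_distr[OF Z] by blast
  have tr: "(\<integral>\<omega>. f (Z \<omega>) \<partial>M) = (\<integral>x. f (m + sqrt v * x) \<partial>gam)" if [measurable]: "f \<in> borel_measurable borel" for f :: "real \<Rightarrow> real"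
  proof -
    have "(\<integral>\<omega>. f (Z \<omega>) \<partial>M) = (\<integral>x. f x \<partial>distr M borel Z)" by (subst integral_distr) auto
    also have "\<dots> = (\<integral>x. f (m + sqrt v * x) \<partial>gam)" unfolding d by (subst integral_distr) auto
    finally show ?thesis .
  qed
  have g1: "measure gam UNIV = 1" using G.prob_space by simp
  have "(\<integral>x. m + sqrt v * x \<partial>gam) = (\<integral>x. m \<partial>gam) + sqrt v * (\<integral>x. x \<partial>gam)"
    using gam_moments(1) by (subst Bochner_Integration.integral_add) (simp_all only: integrable_mult_right integral_mult_right_zero G.integrable_const)
  then have "m = 0" using tr[of "\<lambda>x. x"] lin_span_mean[OF Z] g1 by (simp add: gam_moments(2))
  moreover have "(\<integral>\<omega>. (Z \<omega>)\<^sup>2 \<partial>M) = (\<integral>x. v * x\<^sup>2 \<partial>gam)"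
    using tr[of "\<lambda>x. x\<^sup>2"] v \<open>m = 0\<close> by (simp add: power_mult_distrib)
  then have "(\<integral>\<omega>. (Z \<omega>)\<^sup>2 \<partial>M) = v" by (simp only: integral_mult_right_zero gam_moments(4) mult_1_right)
  ultimately show ?thesis using d by simp
qed

lemma lin_span_expectation:
  fixes f :: "real \<Rightarrow> real"
  assumes Z: "Z \<in> lin_span X" and [measurable]: "f \<in> borel_measurable borel"
  shows "(\<integral>\<omega>. f (Z \<omega>) \<partial>M) = (\<integral>x. f (sqrt (\<integral>\<omega>. (Z \<omega>)\<^sup>2 \<partial>M) * x) \<partial>gam)"
  proof -
  have [measurable]: "Z \<in> borel_measurable M" by (rule lin_span_measurable[OF Z])
  have "(\<integral>\<omega>. f (Z \<omega>) \<partial>M) = (\<integral>x. f x \<partial>distr M borel Z)" by (subst integral_distr) auto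
  also have "\<dots> = (\<integral>x. f (sqrt (\<integral>\<omega>. (Z \<omega>)\<^sup>2 \<partial>M) * x) \<partial>gam)" unfolding lin_span_distr'[OF Z] by (subst integral_distr) auto
  finally show ?thesis .
qed

lemma lin_span_trig:
  assumes Z: "Z \<in> lin_span X"
  shows "(\<integral>\<omega>. cos (Z \<omega>) \<partial>M) = exp (- (\<integral>\<omega>. (Z \<omega>)\<^sup>2 \<partial>M) / 2)" "(\<integral>\<omega>. sin (Z \<omega>) \<partial>M) = 0"
  using lin_span_expectation[OF Z, of cos] lin_span_expectation[OF Z, of sin] by (simp_all add: gam_moments)

text \<open>For jointly Gaussian variables orthogonality is independence: by
  \<open>joint_law_eqI\<close> it is enough that variances add up, which makes the characteristic
  function of the family equal to that of a family on \<open>M \<Otimes>\<^sub>M M\<close> whose two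
  parts are independent by construction. Two variables \<open>B1\<close>, \<open>B2\<close> suffice
  because never more than two are left out.\<close>

lemma orthogonal_decouple:
  fixes R :: "'i \<Rightarrow> 'w \<Rightarrow> real"
  assumes I: "finite I" and R: "\<And>i. i \<in> I \<Longrightarrow> R i \<in> lin_span X"
    and B: "B1 \<in> lin_span X" "B2 \<in> lin_span X"
    and orth: "\<And>i. i \<in> I \<Longrightarrow> (\<integral>\<omega>. R i \<omega> * B1 \<omega> \<partial>M) = 0" "\<And>i. i \<in> I \<Longrightarrow> (\<integral>\<omega>. R i \<omega> * B2 \<omega> \<partial>M) = 0"
    and k[measurable]: "(\<lambda>(x, y). k x y) \<in> borel_measurable (borel \<Otimes>\<^sub>M borel)" and kb: "\<And>x y. \<bar>k x y :: real\<bar> \<le> K"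
    and G[measurable]: "G \<in> borel_measurable (PiM I (\<lambda>_. borel))" and Gb: "\<And>w. \<bar>G w :: real\<bar> \<le> L"
  shows "(\<integral>\<omega>. k (B1 \<omega>) (B2 \<omega>) * G (\<lambda>i\<in>I. R i \<omega>) \<partial>M) = (\<integral>\<omega>. k (B1 \<omega>) (B2 \<omega>) \<partial>M) * (\<integral>\<omega>. G (\<lambda>i\<in>I. R i \<omega>) \<partial>M)"
proof -
  interpret MM: pair_prob_space M M ..
  define J :: "(bool + 'i) set" where "J = {Inl True, Inl False} \<union> Inr ` I"
  have J: "finite J" using I by (simp add: J_def)
  define W where "W j \<omega> = (case j of Inl b \<Rightarrow> if b then B1 \<omega> else B2 \<omega> | Inr i \<Rightarrow> R i \<omega>)" for j \<omega>
  \<comment> \<open>\<open>B1\<close> and \<open>B2\<close> read the first coordinate and the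
    \<open>R i\<close> the second, so the two groups are independent under the product
    measure.\<close>
  define W' where "W' j = (\<lambda>(\<omega>, \<omega>'). case j of Inl b \<Rightarrow> if b then B1 \<omega> else B2 \<omega> | Inr i \<Rightarrow> R i \<omega>')" for j
  note [measurable] = lin_span_measurable[OF B(1)] lin_span_measurable[OF B(2)]
  have [measurable]: "R i \<in> borel_measurable M" if "i \<in> I" for i using lin_span_measurable R that by auto
  have Wm[measurable]: "W j \<in> borel_measurable M" if "j \<in> J" for j
    using that unfolding J_def W_def[abs_def] by (auto split: sum.split)
  have W'm[measurable]: "W' j \<in> borel_measurable (M \<Otimes>\<^sub>M M)" if "j \<in> J" for j
    using that unfolding J_def W'_def[abs_def] by auto
  define U where "U c \<omega> = c (Inl True) * B1 \<omega> + c (Inl False) * B2 \<omega>" for c :: "bool + 'i \<Rightarrow> real" and \<omega>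
  define S where "S c \<omega> = (\<Sum>i\<in>I. c (Inr i) * R i \<omega>)" for c :: "bool + 'i \<Rightarrow> real" and \<omega>
  have Us: "U c \<in> lin_span X" and Ss: "S c \<in> lin_span X" for c
    unfolding U_def[abs_def] S_def[abs_def] using I R B by (auto intro!: lin_span_add lin_span_scale lin_span_sum)
  have [measurable]: "U c \<in> borel_measurable M" "S c \<in> borel_measurable M" for c using lin_span_measurable Us Ss by auto
  have sj: "(\<Sum>j\<in>J. f j) = f (Inl True) + f (Inl False) + (\<Sum>i\<in>I. f (Inr i))" for f :: "bool + 'i \<Rightarrow> real"
  proof -
    have "{Inl True, Inl False} \<inter> Inr ` I = {}" by auto
    then show ?thesis unfolding J_def using I by (subst sum.union_disjoint) (auto simp: sum.reindex)
  qed
  have sW: "(\<Sum>j\<in>J. c j * W j \<omega>) = U c \<omega> + S c \<omega>" for c \<omega>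
    unfolding sj by (simp add: W_def U_def S_def)
  have sW': "(\<Sum>j\<in>J. c j * W' j p) = U c (fst p) + S c (snd p)" for c p
    unfolding sj by (simp add: W'_def U_def S_def split_beta)
  \<comment> \<open>The cross term vanishes by \<open>orth\<close>, and this is the only use of
    orthogonality. Since the variances add, the expected cosine and sine of \<open>U + S\<close>
    split into products.\<close>
  have US: "(\<integral>\<omega>. (U c \<omega> + S c \<omega>)\<^sup>2 \<partial>M) = (\<integral>\<omega>. (U c \<omega>)\<^sup>2 \<partial>M) + (\<integral>\<omega>. (S c \<omega>)\<^sup>2 \<partial>M)" for c
  proof -
    have RU: "(\<integral>\<omega>. R i \<omega> * U c \<omega> \<partial>M) = 0" if "i \<in> I" for i
    proof -
      have "(\<integral>\<omega>. R i \<omega> * U c \<omega> \<partial>M) = (\<integral>\<omega>. c (Inl True) * (R i \<omega> * B1 \<omega>) + c (Inl False) * (R i \<omega> * B2 \<omega>) \<partial>M)"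
        unfolding U_def by (simp only: algebra_simps)
      also have "\<dots> = 0" using that orth lin_span_integrable_mult[OF R[OF that] B(1)] lin_span_integrable_mult[OF R[OF that] B(2)] by simp
      finally show ?thesis .
    qed
    from this have "(\<integral>\<omega>. U c \<omega> * S c \<omega> \<partial>M) = 0"
    proof -
      have "(\<integral>\<omega>. U c \<omega> * S c \<omega> \<partial>M) = (\<integral>\<omega>. (\<Sum>i\<in>I. c (Inr i) * (R i \<omega> * U c \<omega>)) \<partial>M)"
        unfolding S_def sum_distrib_left by (simp only: ac_simps)
      also have "\<dots> = (\<Sum>i\<in>I. \<integral>\<omega>. c (Inr i) * (R i \<omega> * U c \<omega>) \<partial>M)"
        using R lin_span_integrable_mult[OF _ Us] by (intro Bochner_Integration.integral_sum) auto
      also have "\<dots> = 0" using RU by simp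
      finally show ?thesis .
    qed
    then show ?thesis using Us Ss lin_span_integrable lin_span_integrable_mult[OF Us Ss]
      by (simp add: power2_sum mult.assoc)
  qed
  have bd: "integrable M f" if "f \<in> borel_measurable M" "\<And>x. \<bar>f x\<bar> \<le> (1::real)" for f using that by (intro integrable_bounded_fun[where K = 1])
  have pm: "integrable (M \<Otimes>\<^sub>M M) (\<lambda>p. f (fst p) * g (snd p)) \<and>
     (\<integral>p. f (fst p) * g (snd p) \<partial>(M \<Otimes>\<^sub>M M)) = (\<integral>x. f x \<partial>M) * (\<integral>x. g x \<partial>M)"
    if [measurable]: "f \<in> borel_measurable M" "g \<in> borel_measurable M" and b: "\<And>x. \<bar>f x\<bar> \<le> a" "\<And>x. \<bar>g x\<bar> \<le> (b::real)"
    for f g :: "'w \<Rightarrow> real" and a b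
  proof -
    have i: "integrable M f" "integrable M g" using that integrable_bounded_fun by blast+
    have *: "integrable (M \<Otimes>\<^sub>M M) (\<lambda>p. f (fst p) * g (snd p))"
    proof (rule MM.integrable_bounded_fun[where K = "a * b"])
      fix x :: "'w \<times> 'w" show "\<bar>f (fst x) * g (snd x)\<bar> \<le> a * b"
        unfolding abs_mult using b by (intro mult_mono) (auto intro: order_trans[OF abs_ge_zero])
    qed measurable
    then have "(\<integral>p. f (fst p) * g (snd p) \<partial>(M \<Otimes>\<^sub>M M)) = (\<integral>x. f x \<partial>M) * (\<integral>x. g x \<partial>M)"
      using MM.integral_fst'[of "\<lambda>p. f (fst p) * g (snd p)"] by simp
    with * show ?thesis by blast
  qed
  have law: "distr M (PiM J (\<lambda>_. borel)) (\<lambda>x. \<lambda>j\<in>J. W j x) = distr (M \<Otimes>\<^sub>M M) (PiM J (\<lambda>_. borel)) (\<lambda>x. \<lambda>j\<in>J. W' j x)"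
  proof (rule joint_law_eqI[OF prob_space_axioms _ J])
    show "prob_space (M \<Otimes>\<^sub>M M)" by (rule MM.prob_space_axioms)
    show "(\<integral>x. cos (\<Sum>i\<in>J. c i * W i x) \<partial>M) = (\<integral>x. cos (\<Sum>i\<in>J. c i * W' i x) \<partial>(M \<Otimes>\<^sub>M M))" for c
      unfolding sW sW' lin_span_trig[OF lin_span_add[OF Us Ss]] US
      using pm[of "\<lambda>x. cos (U c x)" "\<lambda>x. cos (S c x)" 1 1] pm[of "\<lambda>x. sin (U c x)" "\<lambda>x. sin (S c x)" 1 1]
      by (simp add: cos_add lin_span_trig[OF Us] lin_span_trig[OF Ss] exp_add[symmetric] field_simps)
    show "(\<integral>x. sin (\<Sum>i\<in>J. c i * W i x) \<partial>M) = (\<integral>x. sin (\<Sum>i\<in>J. c i * W' i x) \<partial>(M \<Otimes>\<^sub>M M))" for c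
      unfolding sW sW' lin_span_trig[OF lin_span_add[OF Us Ss]]
      using pm[of "\<lambda>x. cos (U c x)" "\<lambda>x. sin (S c x)" 1 1] pm[of "\<lambda>x. sin (U c x)" "\<lambda>x. cos (S c x)" 1 1]
      by (simp add: sin_add lin_span_trig[OF Us] lin_span_trig[OF Ss])
  qed auto
  define H where "H w = k (w (Inl True)) (w (Inl False)) * G (\<lambda>i\<in>I. w (Inr i))" for w :: "bool + 'i \<Rightarrow> real"
  have in_J: "Inl b \<in> J" "i \<in> I \<Longrightarrow> Inr i \<in> J" for b i by (cases b) (auto simp: J_def)
  have [measurable]: "(\<lambda>w. w (Inl b)) \<in> borel_measurable (PiM J (\<lambda>_. borel))" for b using in_J by measurable
  have [measurable]: "(\<lambda>w. \<lambda>i\<in>I. w (Inr i)) \<in> measurable (PiM J (\<lambda>_. borel :: real measure)) (PiM I (\<lambda>_. borel))"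
    using in_J by (intro measurable_restrict measurable_component_singleton) auto
  have [measurable]: "H \<in> borel_measurable (PiM J (\<lambda>_. borel))"
  proof -
    have "(\<lambda>w. (\<lambda>(x, y). k x y) (w (Inl True), w (Inl False))) \<in> borel_measurable (PiM J (\<lambda>_. borel))"
      by (rule measurable_compose[OF _ k]) measurable
    then show ?thesis unfolding H_def[abs_def] by simp
  qed
  have Rm[measurable]: "(\<lambda>\<omega>. \<lambda>i\<in>I. R i \<omega>) \<in> measurable M (PiM I (\<lambda>_. borel))" by (intro measurable_restrict) auto
  have km: "(\<lambda>\<omega>. k (B1 \<omega>) (B2 \<omega>)) \<in> borel_measurable M"
  proof -
    have "(\<lambda>w. (\<lambda>(x, y). k x y) (B1 w, B2 w)) \<in> borel_measurable M"
      by (rule measurable_compose[OF _ k]) measurable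
    then show ?thesis by simp
  qed
  have r: "(\<lambda>i\<in>I. (\<lambda>j\<in>J. f j) (Inr i)) = (\<lambda>i\<in>I. f (Inr i))" for f :: "bool + 'i \<Rightarrow> real" using in_J by auto
  have "(\<integral>\<omega>. k (B1 \<omega>) (B2 \<omega>) * G (\<lambda>i\<in>I. R i \<omega>) \<partial>M) = (\<integral>\<omega>. H (\<lambda>j\<in>J. W j \<omega>) \<partial>M)"
    unfolding H_def r using in_J by (simp add: W_def)
  also have "\<dots> = (\<integral>w. H w \<partial>distr M (PiM J (\<lambda>_. borel)) (\<lambda>x. \<lambda>j\<in>J. W j x))"
    by (subst integral_distr) (auto intro!: measurable_restrict)
  also have "\<dots> = (\<integral>p. H (\<lambda>j\<in>J. W' j p) \<partial>(M \<Otimes>\<^sub>M M))" unfolding law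
    by (subst integral_distr) (auto intro!: measurable_restrict)
  also have "\<dots> = (\<integral>p. k (B1 (fst p)) (B2 (fst p)) * G (\<lambda>i\<in>I. R i (snd p)) \<partial>(M \<Otimes>\<^sub>M M))"
    unfolding H_def r using in_J by (simp add: W'_def split_beta)
  also have "\<dots> = (\<integral>\<omega>. k (B1 \<omega>) (B2 \<omega>) \<partial>M) * (\<integral>\<omega>. G (\<lambda>i\<in>I. R i \<omega>) \<partial>M)"
    using pm[of "\<lambda>\<omega>. k (B1 \<omega>) (B2 \<omega>)" "\<lambda>\<omega>. G (\<lambda>i\<in>I. R i \<omega>)" K L] km kb Gb by simp
  finally show ?thesis .
qed

end

section \<open>Occupation integrals\<close>

lemma (in pair_sigma_finite) integrable_bounded_pair:
  fixes f :: "'a \<times> 'b \<Rightarrow> real"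
  assumes "finite_measure M1" "finite_measure M2"
    and "f \<in> borel_measurable (M1 \<Otimes>\<^sub>M M2)" "\<And>x. \<bar>f x\<bar> \<le> K"
  shows "integrable (M1 \<Otimes>\<^sub>M M2) f"
proof -
  have "finite_measure (M1 \<Otimes>\<^sub>M M2)" using assms by (intro finite_measure_pair_measure)
  then interpret finite_measure "M1 \<Otimes>\<^sub>M M2" .
  show ?thesis using assms by (intro integrable_const_bound[where B = K]) auto
qed

text \<open>An arbitrary finite measure \<open>N\<close> stands for normalised Lebesgue measure on
  the cube, and an arbitrary covariance \<open>r\<close> for \<open>\<rho> (t - s)\<close>: the
  Stein argument then contains neither the volume nor the dimension.\<close>

locale gaussian_occupation = centered_gaussian M X + N: finite_measure N
  for M :: "'w measure" and X :: "'t \<Rightarrow> 'w \<Rightarrow> real" and N :: "'t measure" +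
  fixes r :: "'t \<Rightarrow> 't \<Rightarrow> real"
  assumes space_N: "space N = UNIV"
    and X_joint[measurable]: "case_prod X \<in> borel_measurable (N \<Otimes>\<^sub>M M)"
    and r_joint[measurable]: "case_prod r \<in> borel_measurable (N \<Otimes>\<^sub>M N)"
    and cov: "\<And>s t. (\<integral>\<omega>. X s \<omega> * X t \<omega> \<partial>M) = r s t"
    and unit: "\<And>t. r t t = 1"
begin

sublocale NM: pair_sigma_finite N M ..

lemma in_space_N[simp]: "t \<in> space N" by (simp add: space_N)

text \<open>The field is a parameter because the functional is also formed for residual fields, from
  which one or two variables have been removed.\<close>

definition occ :: "(real \<Rightarrow> real) \<Rightarrow> ('t \<Rightarrow> 'w \<Rightarrow> real) \<Rightarrow> 'w \<Rightarrow> real" where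
  "occ g R \<omega> = (\<integral>t. g (R t \<omega>) \<partial>N)"

lemma occ_measurable[measurable]:
  assumes [measurable]: "g \<in> borel_measurable borel" "case_prod R \<in> borel_measurable (N \<Otimes>\<^sub>M M)"
  shows "occ g R \<in> borel_measurable M"
proof -
  have "(\<lambda>(\<omega>, t). g (R t \<omega>)) \<in> borel_measurable (M \<Otimes>\<^sub>M N)" by measurable
  then show ?thesis unfolding occ_def[abs_def] by (intro N.borel_measurable_lebesgue_integral) simp
qed

lemma occ_bounded:
  assumes "\<And>x. \<bar>g x\<bar> \<le> K"
  shows "\<bar>occ g R \<omega>\<bar> \<le> K * measure N UNIV"
proof (cases "integrable N (\<lambda>t. g (R t \<omega>))")
  case True
  have "\<bar>occ g R \<omega>\<bar> \<le> (\<integral>t. \<bar>g (R t \<omega>)\<bar> \<partial>N)" unfolding occ_def by (rule integral_abs_bound)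
  also have "\<dots> \<le> (\<integral>t. K \<partial>N)" using True assms by (intro integral_mono) auto
  finally show ?thesis by (simp add: space_N mult.commute)
next
  case False
  have "0 \<le> K" using assms[of 0] abs_ge_zero[of "g 0"] by linarith
  then show ?thesis using False by (simp add: occ_def not_integrable_integral_eq)
qed

lemma occ_integrable:
  fixes g :: "real \<Rightarrow> real"
  assumes [measurable]: "g \<in> borel_measurable borel" "case_prod R \<in> borel_measurable (N \<Otimes>\<^sub>M M)"
    and g: "\<And>x. \<bar>g x\<bar> \<le> K" and [simp]: "\<omega> \<in> space M"
  shows "integrable N (\<lambda>t. g (R t \<omega>))"
  using g by (intro N.integrable_const_bound[where B = K]) auto

lemma occ_fubini:
  assumes [measurable]: "g \<in> borel_measurable borel" "case_prod R \<in> borel_measurable (N \<Otimes>\<^sub>M M)" "c \<in> borel_measurable M"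
    and g: "\<And>x. \<bar>g x\<bar> \<le> K" and c: "\<And>x. \<bar>c x\<bar> \<le> L"
  shows "(\<integral>\<omega>. c \<omega> * occ g R \<omega> \<partial>M) = (\<integral>t. (\<integral>\<omega>. c \<omega> * g (R t \<omega>) \<partial>M) \<partial>N)"
    and "integrable N (\<lambda>t. \<integral>\<omega>. c \<omega> * g (R t \<omega>) \<partial>M)"
proof -
  have "\<bar>c x * g y\<bar> \<le> L * K" for x y
    unfolding abs_mult using g c by (intro mult_mono) (auto intro: order_trans[OF abs_ge_zero])
  then have i: "integrable (N \<Otimes>\<^sub>M M) (\<lambda>(t, \<omega>). c \<omega> * g (R t \<omega>))"
    by (intro NM.integrable_bounded_pair[where K = "L * K"]) (auto intro: N.finite_measure_axioms finite_measure_axioms)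
  show "(\<integral>\<omega>. c \<omega> * occ g R \<omega> \<partial>M) = (\<integral>t. (\<integral>\<omega>. c \<omega> * g (R t \<omega>) \<partial>M) \<partial>N)"
    using NM.Fubini_integral[OF i] by (simp add: occ_def)
  show "integrable N (\<lambda>t. \<integral>\<omega>. c \<omega> * g (R t \<omega>) \<partial>M)" using NM.integrable_fst[OF i] by simp
qed

text \<open>The product over \<open>v\<close> makes the induction on \<open>m\<close> possible: a factor of the power is an integral
  over \<open>t\<close> and turns into one more factor of the product.\<close>

lemma occ_power_decouple:
  fixes n :: nat
  assumes R: "\<And>t. R t \<in> lin_span X" and B: "B1 \<in> lin_span X" "B2 \<in> lin_span X"
    and orth: "\<And>t. (\<integral>\<omega>. R t \<omega> * B1 \<omega> \<partial>M) = 0" "\<And>t. (\<integral>\<omega>. R t \<omega> * B2 \<omega> \<partial>M) = 0"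
    and k[measurable]: "(\<lambda>(x, y). k x y) \<in> borel_measurable (borel \<Otimes>\<^sub>M borel)" and kb: "\<And>x y. \<bar>k x y :: real\<bar> \<le> K"
    and g[measurable]: "g \<in> borel_measurable borel" and Rm[measurable]: "case_prod R \<in> borel_measurable (N \<Otimes>\<^sub>M M)"
    and gb: "\<And>x. \<bar>g x\<bar> \<le> 1"
  shows "(\<integral>\<omega>. k (B1 \<omega>) (B2 \<omega>) * (occ g R \<omega> ^ m * (\<Prod>j<n. g (R (v j) \<omega>))) \<partial>M) =
     (\<integral>\<omega>. k (B1 \<omega>) (B2 \<omega>) \<partial>M) * (\<integral>\<omega>. occ g R \<omega> ^ m * (\<Prod>j<n. g (R (v j) \<omega>)) \<partial>M)"
proof (induction m arbitrary: n v)
  case 0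
  have "(\<integral>\<omega>. k (B1 \<omega>) (B2 \<omega>) * (\<lambda>w. \<Prod>j<n. g (w j)) (\<lambda>j\<in>{..<n}. R (v j) \<omega>) \<partial>M) =
     (\<integral>\<omega>. k (B1 \<omega>) (B2 \<omega>) \<partial>M) * (\<integral>\<omega>. (\<lambda>w. \<Prod>j<n. g (w j)) (\<lambda>j\<in>{..<n}. R (v j) \<omega>) \<partial>M)"
    using gb by (intro orthogonal_decouple[OF _ R B orth k kb, where L = 1])
      (auto simp: abs_prod intro!: prod_le_1)
  then show ?case by simp
next
  case (Suc m)
  note [measurable] = lin_span_measurable[OF B(1)] lin_span_measurable[OF B(2)] lin_span_measurable[OF R]
  let ?n = "measure N UNIV"
  define P where "P \<omega> = occ g R \<omega> ^ m * (\<Prod>j<n. g (R (v j) \<omega>))" for \<omega>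
  have [measurable]: "P \<in> borel_measurable M" unfolding P_def by measurable
  have prb: "\<bar>\<Prod>j<n. g (R (v j) \<omega>)\<bar> \<le> 1" for \<omega> using gb by (auto simp: abs_prod intro!: prod_le_1)
  have Pb: "\<bar>P \<omega>\<bar> \<le> ?n ^ m * 1" for \<omega>
    unfolding P_def abs_mult power_abs using prb occ_bounded[of g 1, OF gb] by (intro mult_mono power_mono) auto
  have km[measurable]: "(\<lambda>\<omega>. k (B1 \<omega>) (B2 \<omega>)) \<in> borel_measurable M"
  proof -
    have "(\<lambda>w. (\<lambda>(x, y). k x y) (B1 w, B2 w)) \<in> borel_measurable M"
      by (rule measurable_compose[OF _ k]) measurable
    then show ?thesis by simp
  qed
  have kPb: "\<bar>k (B1 \<omega>) (B2 \<omega>) * P \<omega>\<bar> \<le> K * (?n ^ m * 1)" for \<omega>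
    unfolding abs_mult using kb Pb by (intro mult_mono) (auto intro: order_trans[OF abs_ge_zero])
  have s: "P \<omega> * g (R t \<omega>) = occ g R \<omega> ^ m * (\<Prod>j<Suc n. g (R ((v(n := t)) j) \<omega>))" for t \<omega>
    by (simp add: P_def mult.assoc)
  have "(\<integral>\<omega>. k (B1 \<omega>) (B2 \<omega>) * (occ g R \<omega> ^ Suc m * (\<Prod>j<n. g (R (v j) \<omega>))) \<partial>M) = (\<integral>\<omega>. (k (B1 \<omega>) (B2 \<omega>) * P \<omega>) * occ g R \<omega> \<partial>M)"
    by (simp add: P_def mult_ac)
  also have "\<dots> = (\<integral>t. (\<integral>\<omega>. (k (B1 \<omega>) (B2 \<omega>) * P \<omega>) * g (R t \<omega>) \<partial>M) \<partial>N)"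
    by (rule occ_fubini(1)[OF g Rm _ gb kPb]) measurable
  also have "\<dots> = (\<integral>t. (\<integral>\<omega>. k (B1 \<omega>) (B2 \<omega>) \<partial>M) * (\<integral>\<omega>. P \<omega> * g (R t \<omega>) \<partial>M) \<partial>N)"
    unfolding mult.assoc s Suc.IH ..
  also have "\<dots> = (\<integral>\<omega>. k (B1 \<omega>) (B2 \<omega>) \<partial>M) * (\<integral>\<omega>. P \<omega> * occ g R \<omega> \<partial>M)"
    using occ_fubini(1)[OF g Rm _ gb Pb] by simp
  finally show ?case by (simp add: P_def mult_ac)
qed

text \<open>The functional takes values in a compact interval, where \<open>F\<close> is a uniform
  limit of polynomials, and powers are covered by \<open>occ_power_decouple\<close>. This yields the
  product formula without the \<sigma>-algebra generated by uncountably many variables.\<close>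

lemma occ_decouple:
  assumes R: "\<And>t. R t \<in> lin_span X" and B: "B1 \<in> lin_span X" "B2 \<in> lin_span X"
    and orth: "\<And>t. (\<integral>\<omega>. R t \<omega> * B1 \<omega> \<partial>M) = 0" "\<And>t. (\<integral>\<omega>. R t \<omega> * B2 \<omega> \<partial>M) = 0"
    and k[measurable]: "(\<lambda>(x, y). k x y) \<in> borel_measurable (borel \<Otimes>\<^sub>M borel)" and kb: "\<And>x y. \<bar>k x y :: real\<bar> \<le> K"
    and g[measurable]: "g \<in> borel_measurable borel" and Rm[measurable]: "case_prod R \<in> borel_measurable (N \<Otimes>\<^sub>M M)"
    and gb: "\<And>x. \<bar>g x\<bar> \<le> 1"
    and F: "continuous_on UNIV (F :: real \<Rightarrow> real)"
  shows "(\<integral>\<omega>. k (B1 \<omega>) (B2 \<omega>) * F (occ g R \<omega>) \<partial>M) = (\<integral>\<omega>. k (B1 \<omega>) (B2 \<omega>) \<partial>M) * (\<integral>\<omega>. F (occ g R \<omega>) \<partial>M)"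
    (is "?L = ?k * ?R")
proof -
  note [measurable] = lin_span_measurable[OF B(1)] lin_span_measurable[OF B(2)] lin_span_measurable[OF R]
  let ?n = "measure N UNIV" and ?Y = "occ g R"
  let ?S = "cball 0 ?n :: real set"
  have K0: "0 \<le> K" using kb[of 0 0] by (rule order_trans[OF abs_ge_zero])
  have km[measurable]: "(\<lambda>\<omega>. k (B1 \<omega>) (B2 \<omega>)) \<in> borel_measurable M"
  proof -
    have "(\<lambda>w. (\<lambda>(x, y). k x y) (B1 w, B2 w)) \<in> borel_measurable M"
      by (rule measurable_compose[OF _ k]) measurable
    then show ?thesis by simp
  qed
  have [measurable]: "F \<in> borel_measurable borel" using F by (rule borel_measurable_continuous_onI)
  have YS: "?Y \<omega> \<in> ?S" for \<omega> using occ_bounded[of g 1, OF gb] by (simp add: dist_real_def)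
  \<comment> \<open>One \<open>K * e\<close> comes from each side when \<open>F\<close> is replaced
    by a polynomial.\<close>
  have "\<bar>?L - ?k * ?R\<bar> \<le> 2 * K * e" if e: "e > 0" for e
  proof -
    obtain p where p: "real_polynomial_function p" "\<And>x. x \<in> ?S \<Longrightarrow> \<bar>F x - p x\<bar> < e"
      using Stone_Weierstrass_polynomial_function[of ?S F e] F e continuous_on_subset[OF F subset_UNIV]
      by (auto simp: real_polynomial_function_eq)
    obtain a m where pa: "p = (\<lambda>x. \<Sum>i\<le>m. a i * x ^ i)" using p(1) unfolding real_polynomial_function_iff_sum by blast
    have [measurable]: "p \<in> borel_measurable borel" unfolding pa by measurable
    have yb: "\<bar>?Y \<omega> ^ i\<bar> \<le> ?n ^ i" for \<omega> i
      unfolding power_abs using occ_bounded[of g 1, OF gb] by (intro power_mono) auto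
    have kyb: "\<bar>k (B1 \<omega>) (B2 \<omega>) * ?Y \<omega> ^ i\<bar> \<le> K * ?n ^ i" for \<omega> i
      unfolding abs_mult using kb yb by (intro mult_mono) (auto simp: K0)
    have iy: "integrable M (\<lambda>\<omega>. ?Y \<omega> ^ i)" "integrable M (\<lambda>\<omega>. k (B1 \<omega>) (B2 \<omega>) * ?Y \<omega> ^ i)" for i
      using yb kyb by (auto intro!: integrable_bounded_fun)
    have ip: "integrable M (\<lambda>\<omega>. p (?Y \<omega>))" "integrable M (\<lambda>\<omega>. k (B1 \<omega>) (B2 \<omega>) * p (?Y \<omega>))"
      unfolding pa using iy by (simp_all add: sum_distrib_left mult.left_commute[of "k _ _"])
    have pp: "(\<integral>\<omega>. k (B1 \<omega>) (B2 \<omega>) * p (?Y \<omega>) \<partial>M) = ?k * (\<integral>\<omega>. p (?Y \<omega>) \<partial>M)"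
    proof -
      have "(\<integral>\<omega>. k (B1 \<omega>) (B2 \<omega>) * p (?Y \<omega>) \<partial>M) = (\<Sum>i\<le>m. a i * (\<integral>\<omega>. k (B1 \<omega>) (B2 \<omega>) * ?Y \<omega> ^ i \<partial>M))"
        unfolding pa using iy by (simp add: sum_distrib_left mult.left_commute[of "k _ _"])
      also have "\<dots> = (\<Sum>i\<le>m. a i * (?k * (\<integral>\<omega>. ?Y \<omega> ^ i \<partial>M)))"
        using occ_power_decouple[OF R B orth k kb g Rm gb, where n = 0] by simp
      also have "\<dots> = ?k * (\<integral>\<omega>. p (?Y \<omega>) \<partial>M)"
        unfolding pa using iy by (simp add: sum_distrib_left mult.left_commute[of "?k"])
      finally show ?thesis .
    qed
    have dm: "\<bar>F (?Y \<omega>) - p (?Y \<omega>)\<bar> \<le> e" for \<omega> using p(2)[OF YS] by (simp add: less_imp_le)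
    have kdm: "\<bar>k (B1 \<omega>) (B2 \<omega>) * (F (?Y \<omega>) - p (?Y \<omega>))\<bar> \<le> K * e" for \<omega>
      unfolding abs_mult using kb dm e by (intro mult_mono) (auto simp: K0)
    have id: "integrable M (\<lambda>\<omega>. F (?Y \<omega>) - p (?Y \<omega>))" "integrable M (\<lambda>\<omega>. k (B1 \<omega>) (B2 \<omega>) * (F (?Y \<omega>) - p (?Y \<omega>)))"
      using dm kdm by (auto intro!: integrable_bounded_fun)
    have bd: "\<bar>\<integral>\<omega>. f \<omega> \<partial>M\<bar> \<le> c" if "\<And>\<omega>. \<bar>f \<omega>\<bar> \<le> c" "integrable M f" for f and c :: real
    proof -
      have "\<bar>\<integral>\<omega>. f \<omega> \<partial>M\<bar> \<le> (\<integral>\<omega>. \<bar>f \<omega>\<bar> \<partial>M)" by (rule integral_abs_bound)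
      also have "\<dots> \<le> (\<integral>\<omega>. c \<partial>M)" using that by (intro integral_mono) auto
      finally show ?thesis using prob_space by simp
    qed
    have FL: "?L = (\<integral>\<omega>. k (B1 \<omega>) (B2 \<omega>) * (F (?Y \<omega>) - p (?Y \<omega>)) \<partial>M) + ?k * (\<integral>\<omega>. p (?Y \<omega>) \<partial>M)"
      unfolding pp[symmetric] using id(2) ip(2) by (subst Bochner_Integration.integral_add[symmetric]) (auto simp: algebra_simps)
    have FR: "?R = (\<integral>\<omega>. F (?Y \<omega>) - p (?Y \<omega>) \<partial>M) + (\<integral>\<omega>. p (?Y \<omega>) \<partial>M)"
      using id(1) ip(1) by (subst Bochner_Integration.integral_add[symmetric]) auto
    have kk: "\<bar>?k\<bar> \<le> K" using kb by (intro bd integrable_bounded_fun[where K = K]) auto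
    have "\<bar>?L - ?k * ?R\<bar> = \<bar>(\<integral>\<omega>. k (B1 \<omega>) (B2 \<omega>) * (F (?Y \<omega>) - p (?Y \<omega>)) \<partial>M) - ?k * (\<integral>\<omega>. F (?Y \<omega>) - p (?Y \<omega>) \<partial>M)\<bar>"
      unfolding FL FR by (simp add: algebra_simps)
    also have "\<dots> \<le> K * e + K * e"
      using bd[OF kdm id(2)] mult_mono[OF kk bd[OF dm id(1)] K0 abs_ge_zero] 
      by (intro order_trans[OF abs_triangle_ineq4] add_mono) (auto simp: abs_mult)
    finally show ?thesis by simp
  qed
  \<comment> \<open>The accuracy is \<open>e / (2 * K + 1)\<close> since \<open>K\<close> may be 0;
    the summand 0 fits \<open>field_le_epsilon\<close>.\<close>
  then have "\<bar>?L - ?k * ?R\<bar> \<le> 0 + e" if "e > 0" for e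
  proof -
    have "2 * K * (e / (2 * K + 1)) = e * ((2 * K) / (2 * K + 1))" by simp
    also have "\<dots> \<le> e * 1" using K0 that by (intro mult_left_mono) auto
    finally have "2 * K * (e / (2 * K + 1)) \<le> e" by simp
    moreover have "e / (2 * K + 1) > 0" using K0 that by simp
    ultimately show ?thesis using \<open>\<And>e. e > 0 \<Longrightarrow> \<bar>?L - ?k * ?R\<bar> \<le> 2 * K * e\<close>[of "e / (2 * K + 1)"] by linarith
  qed
  then have "\<bar>?L - ?k * ?R\<bar> \<le> 0" by (rule field_le_epsilon)
  then show ?thesis by simp
qed

end

section \<open>A Stein bound by leaving variables out\<close>

lemma lipschitz_real_continuous:
  fixes F :: "real \<Rightarrow> real"
  assumes "\<And>x y. \<bar>F x - F y\<bar> \<le> b * \<bar>x - y\<bar>"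
  shows "continuous_on UNIV F"
proof -
  have "0 \<le> b" using assms[of 1 0] abs_ge_zero[of "F 1 - F 0"] by simp
  then have "b-lipschitz_on UNIV F" using assms by (intro lipschitz_onI) (auto simp: dist_real_def)
  then show ?thesis by (rule lipschitz_on_continuous_on)
qed

text \<open>If \<open>f\<close> is not integrable its integral is 0 by convention, and
  \<open>h\<close> is nonnegative since it dominates an absolute value.\<close>

lemma (in prob_space) abs_expectation_le:
  fixes f :: "'a \<Rightarrow> real"
  assumes "integrable M h" "\<And>x. x \<in> space M \<Longrightarrow> \<bar>f x\<bar> \<le> h x"
  shows "\<bar>\<integral>x. f x \<partial>M\<bar> \<le> (\<integral>x. h x \<partial>M)"
proof (cases "integrable M f")
  case True
  have "\<bar>\<integral>x. f x \<partial>M\<bar> \<le> (\<integral>x. \<bar>f x\<bar> \<partial>M)" by (rule integral_abs_bound)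
  also have "\<dots> \<le> (\<integral>x. h x \<partial>M)" using True assms by (intro integral_mono) auto
  finally show ?thesis .
next
  case False
  have "0 \<le> h x" if "x \<in> space M" for x using assms(2)[OF that] by linarith
  then show ?thesis using False by (simp add: not_integrable_integral_eq integral_nonneg)
qed

section \<open>Absolute moments of Gaussian variables\<close>

context centered_gaussian begin

text \<open>Young's inequality with the weight \<kappa> attached to \<open>W\<close> replaces
  Cauchy-Schwarz; its two halves balance when \<open>U\<close> has variance
  \<open>\<kappa>\<^sup>2\<close> and \<open>W\<close> has variance 1.\<close>

lemma expectation_abs_mult_le:
  assumes U: "U \<in> lin_span X" and W: "W \<in> lin_span X" and \<kappa>: "\<kappa> > 0"
    and "(\<integral>\<omega>. (U \<omega>)\<^sup>2 \<partial>M) \<le> \<kappa>\<^sup>2" "(\<integral>\<omega>. (W \<omega>)\<^sup>2 \<partial>M) \<le> 1"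
  shows "(\<integral>\<omega>. \<bar>U \<omega>\<bar> * \<bar>W \<omega>\<bar> \<partial>M) \<le> \<kappa>"
proof -
  have "\<bar>u\<bar> * \<bar>w\<bar> \<le> u\<^sup>2 / (2 * \<kappa>) + \<kappa> / 2 * w\<^sup>2" for u w
  proof -
    have "2 * \<bar>u\<bar> * (\<kappa> * \<bar>w\<bar>) \<le> \<bar>u\<bar>\<^sup>2 + (\<kappa> * \<bar>w\<bar>)\<^sup>2" by (rule sum_squares_bound)
    then have "2 * \<kappa> * (\<bar>u\<bar> * \<bar>w\<bar>) \<le> 2 * \<kappa> * (u\<^sup>2 / (2 * \<kappa>) + \<kappa> / 2 * w\<^sup>2)"
      using \<kappa> by (simp add: power_mult_distrib distrib_left power2_eq_square mult_ac)
    then show ?thesis using \<kappa> by simp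
  qed
  then have "(\<integral>\<omega>. \<bar>U \<omega>\<bar> * \<bar>W \<omega>\<bar> \<partial>M) \<le> (\<integral>\<omega>. (U \<omega>)\<^sup>2 / (2 * \<kappa>) + \<kappa> / 2 * (W \<omega>)\<^sup>2 \<partial>M)"
    using lin_span_integrable[OF U] lin_span_integrable[OF W] integrable_abs[OF lin_span_integrable_mult[OF U W]]
    by (intro integral_mono) (auto simp: abs_mult)
  also have "\<dots> = (\<integral>\<omega>. (U \<omega>)\<^sup>2 \<partial>M) / (2 * \<kappa>) + \<kappa> / 2 * (\<integral>\<omega>. (W \<omega>)\<^sup>2 \<partial>M)"
    using lin_span_integrable[OF U] lin_span_integrable[OF W] by simp
  also have "\<dots> \<le> \<kappa>\<^sup>2 / (2 * \<kappa>) + \<kappa> / 2 * 1"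
    using assms by (intro add_mono divide_right_mono mult_left_mono) auto
  also have "\<dots> = \<kappa>" using \<kappa> by (simp add: power2_eq_square)
  finally show ?thesis .
qed

lemma expectation_abs_le:
  assumes U: "U \<in> lin_span X" and "(\<integral>\<omega>. (U \<omega>)\<^sup>2 \<partial>M) \<le> 1"
  shows "(\<integral>\<omega>. \<bar>U \<omega>\<bar> \<partial>M) \<le> 1"
proof -
  have "\<bar>u\<bar> \<le> 1/2 + u\<^sup>2 / 2" for u :: real using sum_squares_bound[of "\<bar>u\<bar>" 1] by simp
  then have "(\<integral>\<omega>. \<bar>U \<omega>\<bar> \<partial>M) \<le> (\<integral>\<omega>. 1/2 + (U \<omega>)\<^sup>2 / 2 \<partial>M)"
    using lin_span_integrable[OF U] by (intro integral_mono) auto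
  also have "\<dots> = 1/2 + (\<integral>\<omega>. (U \<omega>)\<^sup>2 \<partial>M) / 2" using lin_span_integrable[OF U] prob_space by simp
  finally show ?thesis using assms by linarith
qed

end

context gaussian_occupation begin

text \<open>The residual of \<open>X t\<close> after regression on \<open>X s\<close> has variance
  \<open>1 - (r s t)\<^sup>2\<close>.\<close>

lemma abs_cov_le_1: "\<bar>r s t\<bar> \<le> 1"
proof -
  have i: "integrable M (\<lambda>\<omega>. X s \<omega> * X t \<omega>)" for s t by (intro lin_span_integrable_mult lin_span_base)
  have "0 \<le> (\<integral>\<omega>. (X t \<omega> - r s t * X s \<omega>) * (X t \<omega> - r s t * X s \<omega>) \<partial>M)" by (intro Bochner_Integration.integral_nonneg) simp
  also have "\<dots> = (\<integral>\<omega>. X t \<omega> * X t \<omega> - 2 * r s t * (X s \<omega> * X t \<omega>) + (r s t)\<^sup>2 * (X s \<omega> * X s \<omega>) \<partial>M)"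
    by (simp add: power2_eq_square algebra_simps)
  also have "\<dots> = 1 - (r s t)\<^sup>2" using i by (simp add: cov unit power2_eq_square)
  finally show ?thesis by (simp add: abs_square_le_1)
qed

end

text \<open>\<open>g\<close> is the centred smoothed functional, and its mixed second differences
  take the place of a second derivative. \<delta> bounds the total correlation of one variable with
  the field; in the application \<open>\<delta> * measure N UNIV\<close> does not depend on
  \<open>T\<close>, so an error of order \<open>\<delta>\<^sup>2 * measure N UNIV\<close> is
  small.\<close>

locale stein_setup = gaussian_occupation M X N r
  for M :: "'w measure" and X :: "'t \<Rightarrow> 'w \<Rightarrow> real" and N :: "'t measure" and r +
  fixes g :: "real \<Rightarrow> real" and L1 L2 \<delta> :: real
  assumes g_le: "\<And>x. \<bar>g x\<bar> \<le> 1"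
    and g_lip: "\<And>x y. \<bar>g x - g y\<bar> \<le> L1 * \<bar>x - y\<bar>"
    and g_lip2: "\<And>x y z. \<bar>(g x - g (x - z)) - (g y - g (y - z))\<bar> \<le> L2 * \<bar>x - y\<bar> * \<bar>z\<bar>"
    and g_mean: "(\<integral>x. g x \<partial>gam) = 0"
    and r_integrable: "\<And>t. integrable N (\<lambda>v. r v t)"
    and r_le: "\<And>t. (\<integral>v. \<bar>r v t\<bar> \<partial>N) \<le> \<delta>"
begin

abbreviation Y where "Y \<equiv> occ g X"
abbreviation n where "n \<equiv> measure N UNIV"

lemma g_measurable[measurable]: "g \<in> borel_measurable borel"
  using lipschitz_real_continuous[OF g_lip] by (rule borel_measurable_continuous_onI)

lemma L_nonneg: "0 \<le> L1" "0 \<le> L2" "0 \<le> \<delta>"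
proof -
  show "0 \<le> L1" using order_trans[OF abs_ge_zero g_lip[of 1 0]] by simp
  show "0 \<le> L2" using order_trans[OF abs_ge_zero g_lip2[where x = 1 and y = 0 and z = 1]] by simp
  have "0 \<le> (\<integral>v. \<bar>r v undefined\<bar> \<partial>N)" by (rule Bochner_Integration.integral_nonneg) simp
  then show "0 \<le> \<delta>" using r_le[of undefined] by linarith
qed

lemma unit': "(\<integral>\<omega>. (X t \<omega>)\<^sup>2 \<partial>M) = 1"
  using cov[of t t] unit by (simp add: power2_eq_square)

lemma r_sym: "r s t = r t s"
  using cov[of s t] cov[of t s] by (simp add: mult.commute)

lemma g_mean_X: "(\<integral>\<omega>. g (X t \<omega>) \<partial>M) = 0"
  using lin_span_expectation[OF lin_span_base g_measurable, of t] unit' g_mean by simp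

lemma Y_measurable[measurable]: "Y \<in> borel_measurable M" by simp

lemma Y_bounded: "\<bar>Y \<omega>\<bar> \<le> n" using occ_bounded[of g 1, OF g_le] by simp

lemma lipschitz_Y_bounded:
  assumes "\<And>x y. \<bar>F x - F y\<bar> \<le> b * \<bar>x - y\<bar>"
  shows "\<bar>F (occ g R \<omega>)\<bar> \<le> \<bar>F 0\<bar> + b * n"
proof -
  have "0 \<le> b" using assms[of 1 0] abs_ge_zero[of "F 1 - F 0"] by simp
  then have "b * \<bar>occ g R \<omega> - 0\<bar> \<le> b * n" using occ_bounded[of g 1 R \<omega>, OF g_le] by (intro mult_left_mono) auto
  then show ?thesis using assms[of "occ g R \<omega>" 0] by linarith
qed

lemma occ_perturb:
  assumes B: "B1 \<in> lin_span X" "B2 \<in> lin_span X"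
    and a[simp]: "integrable N a" "integrable N b" and ab: "(\<integral>v. \<bar>a v\<bar> \<partial>N) \<le> \<alpha>" "(\<integral>v. \<bar>b v\<bar> \<partial>N) \<le> \<beta>"
    and [simp]: "\<omega> \<in> space M"
  shows "\<bar>Y \<omega> - occ g (\<lambda>v \<omega>. X v \<omega> - a v * B1 \<omega> - b v * B2 \<omega>) \<omega>\<bar> \<le> L1 * (\<alpha> * \<bar>B1 \<omega>\<bar> + \<beta> * \<bar>B2 \<omega>\<bar>)"
proof -
  note [measurable] = lin_span_measurable[OF B(1)] lin_span_measurable[OF B(2)]
  define R where "R v \<omega> = X v \<omega> - a v * B1 \<omega> - b v * B2 \<omega>" for v \<omega>
  have [measurable]: "a \<in> borel_measurable N" "b \<in> borel_measurable N" using a[THEN borel_measurable_integrable] by auto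
  have Rm[measurable]: "case_prod R \<in> borel_measurable (N \<Otimes>\<^sub>M M)" unfolding R_def[abs_def] by measurable
  have i: "integrable N (\<lambda>t. g (X t \<omega>))" "integrable N (\<lambda>t. g (R t \<omega>))"
    using occ_integrable[OF g_measurable X_joint g_le] occ_integrable[OF g_measurable Rm g_le] by simp_all
  have "\<bar>Y \<omega> - occ g R \<omega>\<bar> = \<bar>\<integral>t. g (X t \<omega>) - g (R t \<omega>) \<partial>N\<bar>" using i by (simp add: occ_def)
  also have "\<dots> \<le> (\<integral>t. \<bar>g (X t \<omega>) - g (R t \<omega>)\<bar> \<partial>N)" by (rule integral_abs_bound)
  also have "\<dots> \<le> (\<integral>t. L1 * (\<bar>a t\<bar> * \<bar>B1 \<omega>\<bar> + \<bar>b t\<bar> * \<bar>B2 \<omega>\<bar>) \<partial>N)"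
  proof (intro integral_mono)
    show "\<bar>g (X t \<omega>) - g (R t \<omega>)\<bar> \<le> L1 * (\<bar>a t\<bar> * \<bar>B1 \<omega>\<bar> + \<bar>b t\<bar> * \<bar>B2 \<omega>\<bar>)" for t
    proof -
      have "\<bar>X t \<omega> - R t \<omega>\<bar> \<le> \<bar>a t\<bar> * \<bar>B1 \<omega>\<bar> + \<bar>b t\<bar> * \<bar>B2 \<omega>\<bar>"
        unfolding R_def abs_mult[symmetric] by linarith
      then show ?thesis using g_lip[of "X t \<omega>" "R t \<omega>"] L_nonneg(1)
        by (meson mult_left_mono order_trans)
    qed
  qed (use i in auto)
  also have "\<dots> = L1 * ((\<integral>t. \<bar>a t\<bar> \<partial>N) * \<bar>B1 \<omega>\<bar> + (\<integral>t. \<bar>b t\<bar> \<partial>N) * \<bar>B2 \<omega>\<bar>)" by simp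
  also have "\<dots> \<le> L1 * (\<alpha> * \<bar>B1 \<omega>\<bar> + \<beta> * \<bar>B2 \<omega>\<bar>)"
    using ab L_nonneg by (intro mult_left_mono add_mono mult_right_mono) auto
  finally show ?thesis by (simp add: R_def[abs_def])
qed

text \<open>The functional of the residual field is independent of \<open>B1\<close> and
  \<open>B2\<close> and differs from \<open>Y\<close> by at most \<open>L1\<close> times the removed
  parts. The replacement is made twice, in the joint expectation and in the factor with
  \<open>F\<close> alone, hence the 2. The bound of \<open>k\<close> by
  \<open>l * \<bar>x\<bar>\<close> makes the error proportional to the size of
  \<open>k\<close>.\<close>

lemma leave_out:
  assumes B: "B1 \<in> lin_span X" "B2 \<in> lin_span X" "(\<integral>\<omega>. (B1 \<omega>)\<^sup>2 \<partial>M) \<le> 1" "(\<integral>\<omega>. (B2 \<omega>)\<^sup>2 \<partial>M) \<le> 1"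
    and a[simp]: "integrable N a" "integrable N b" and ab: "(\<integral>v. \<bar>a v\<bar> \<partial>N) \<le> \<alpha>" "(\<integral>v. \<bar>b v\<bar> \<partial>N) \<le> \<beta>"
    and orth: "\<And>v. (\<integral>\<omega>. (X v \<omega> - a v * B1 \<omega> - b v * B2 \<omega>) * B1 \<omega> \<partial>M) = 0"
       "\<And>v. (\<integral>\<omega>. (X v \<omega> - a v * B1 \<omega> - b v * B2 \<omega>) * B2 \<omega> \<partial>M) = 0"
    and k[measurable]: "(\<lambda>(x, y). k x y) \<in> borel_measurable (borel \<Otimes>\<^sub>M borel)" and kb: "\<And>x y. \<bar>k x y :: real\<bar> \<le> K"
    and kl: "\<And>x y. \<bar>k x y\<bar> \<le> l * \<bar>x\<bar>"
    and F: "\<And>x y. \<bar>F x - F y\<bar> \<le> b' * \<bar>x - y\<bar>"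
  shows "\<bar>(\<integral>\<omega>. F (Y \<omega>) * k (B1 \<omega>) (B2 \<omega>) \<partial>M) - (\<integral>\<omega>. F (Y \<omega>) \<partial>M) * (\<integral>\<omega>. k (B1 \<omega>) (B2 \<omega>) \<partial>M)\<bar>
    \<le> 2 * b' * L1 * (\<alpha> + \<beta>) * l"
proof -
  note [measurable] = lin_span_measurable[OF B(1)] lin_span_measurable[OF B(2)]
  define R where "R v \<omega> = X v \<omega> - a v * B1 \<omega> - b v * B2 \<omega>" for v \<omega>
  have [measurable]: "a \<in> borel_measurable N" "b \<in> borel_measurable N" using a[THEN borel_measurable_integrable] by auto
  have Rs: "R v \<in> lin_span X" for v
    unfolding R_def[abs_def] using B by (intro lin_span_diff lin_span_scale lin_span_base)
  have Rm[measurable]: "case_prod R \<in> borel_measurable (N \<Otimes>\<^sub>M M)" unfolding R_def[abs_def] by measurable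
  have Fc: "continuous_on UNIV F" by (rule lipschitz_real_continuous[OF F])
  have [measurable]: "F \<in> borel_measurable borel" using Fc by (rule borel_measurable_continuous_onI)
  have b0: "0 \<le> b'" using F[of 1 0] abs_ge_zero[of "F 1 - F 0"] by simp
  have l0: "0 \<le> l" using kl[of 1 0] abs_ge_zero[of "k 1 0"] by simp
  have ab0: "0 \<le> \<alpha>" "0 \<le> \<beta>" using ab Bochner_Integration.integral_nonneg[of N "\<lambda>v. \<bar>a v\<bar>"] Bochner_Integration.integral_nonneg[of N "\<lambda>v. \<bar>b v\<bar>"] by linarith+
  let ?Z = "occ g R"
  let ?k = "\<lambda>\<omega>. k (B1 \<omega>) (B2 \<omega>)"
  have km[measurable]: "?k \<in> borel_measurable M"
  proof -
    have "(\<lambda>w. (\<lambda>(x, y). k x y) (B1 w, B2 w)) \<in> borel_measurable M"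
      by (rule measurable_compose[OF _ k]) measurable
    then show ?thesis by simp
  qed
  define D where "D \<omega> = L1 * (\<alpha> * \<bar>B1 \<omega>\<bar> + \<beta> * \<bar>B2 \<omega>\<bar>)" for \<omega>
  have D: "\<bar>Y \<omega> - ?Z \<omega>\<bar> \<le> D \<omega>" if "\<omega> \<in> space M" for \<omega>
    using occ_perturb[OF B(1,2) a ab that] by (simp add: D_def R_def[abs_def])
  have FZ: "\<bar>F (Y \<omega>) - F (?Z \<omega>)\<bar> \<le> b' * D \<omega>" if "\<omega> \<in> space M" for \<omega>
    using F[of "Y \<omega>" "?Z \<omega>"] mult_left_mono[OF D[OF that] b0] by linarith
  let ?c = "\<bar>F 0\<bar> + b' * n"
  note FYb = lipschitz_Y_bounded[of F b', OF F]
  have c0: "0 \<le> ?c" using FYb[of X] abs_ge_zero order_trans by blast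
  have K0: "0 \<le> K" using kb[of 0 0] by (rule order_trans[OF abs_ge_zero])
  have iF: "integrable M (\<lambda>\<omega>. F (Y \<omega>))" "integrable M (\<lambda>\<omega>. F (?Z \<omega>))" using FYb by (auto intro!: integrable_bounded_fun)
  have ik: "integrable M ?k" using kb by (intro integrable_bounded_fun) auto
  have iFk: "integrable M (\<lambda>\<omega>. F (Y \<omega>) * ?k \<omega>)" "integrable M (\<lambda>\<omega>. F (?Z \<omega>) * ?k \<omega>)"
    using FYb kb c0 by (auto intro!: integrable_bounded_fun[where K = "?c * K"] mult_mono simp: abs_mult)
  have dec: "(\<integral>\<omega>. F (?Z \<omega>) * ?k \<omega> \<partial>M) = (\<integral>\<omega>. F (?Z \<omega>) \<partial>M) * (\<integral>\<omega>. ?k \<omega> \<partial>M)"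
    using occ_decouple[OF Rs B(1,2) _ _ k kb g_measurable Rm g_le Fc] orth unfolding R_def by (simp add: mult.commute)
  have i1: "integrable M (\<lambda>\<omega>. \<bar>B1 \<omega>\<bar>)" "integrable M (\<lambda>\<omega>. \<bar>B2 \<omega>\<bar>)"
    using lin_span_integrable B by auto
  have i2: "integrable M (\<lambda>\<omega>. \<bar>B1 \<omega>\<bar> * \<bar>B1 \<omega>\<bar>)" "integrable M (\<lambda>\<omega>. \<bar>B2 \<omega>\<bar> * \<bar>B1 \<omega>\<bar>)"
    using integrable_abs[OF lin_span_integrable_mult[OF B(1) B(1)]] integrable_abs[OF lin_span_integrable_mult[OF B(2) B(1)]] by (simp_all only: abs_mult)
  have e1: "(\<integral>\<omega>. \<bar>B1 \<omega>\<bar> * \<bar>B1 \<omega>\<bar> \<partial>M) \<le> 1" "(\<integral>\<omega>. \<bar>B2 \<omega>\<bar> * \<bar>B1 \<omega>\<bar> \<partial>M) \<le> 1"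
    using expectation_abs_mult_le[OF B(1) B(1), of 1] expectation_abs_mult_le[OF B(2) B(1), of 1] B by simp_all
  have e2: "(\<integral>\<omega>. \<bar>B1 \<omega>\<bar> \<partial>M) \<le> 1" "(\<integral>\<omega>. \<bar>B2 \<omega>\<bar> \<partial>M) \<le> 1" using expectation_abs_le B by auto
  \<comment> \<open>Here \<open>k\<close> contributes another factor
    \<open>\<bar>B1 \<omega>\<bar>\<close>, so that second-order moments appear; they are at most 1
    by \<open>e1\<close>.\<close>
  have t1: "\<bar>(\<integral>\<omega>. F (Y \<omega>) * ?k \<omega> \<partial>M) - (\<integral>\<omega>. F (?Z \<omega>) * ?k \<omega> \<partial>M)\<bar> \<le> b' * L1 * (\<alpha> + \<beta>) * l"
  proof -
    have "\<bar>\<integral>\<omega>. F (Y \<omega>) * ?k \<omega> - F (?Z \<omega>) * ?k \<omega> \<partial>M\<bar> \<le>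
        (\<integral>\<omega>. b' * L1 * l * (\<alpha> * (\<bar>B1 \<omega>\<bar> * \<bar>B1 \<omega>\<bar>) + \<beta> * (\<bar>B2 \<omega>\<bar> * \<bar>B1 \<omega>\<bar>)) \<partial>M)"
    proof (rule abs_expectation_le)
      fix \<omega> assume "\<omega> \<in> space M"
      then have "\<bar>F (Y \<omega>) - F (?Z \<omega>)\<bar> * \<bar>?k \<omega>\<bar> \<le> (b' * D \<omega>) * (l * \<bar>B1 \<omega>\<bar>)"
        using FZ[of \<omega>] kl by (intro mult_mono) (auto intro: order_trans[OF abs_ge_zero])
      then show "\<bar>F (Y \<omega>) * ?k \<omega> - F (?Z \<omega>) * ?k \<omega>\<bar> \<le> b' * L1 * l * (\<alpha> * (\<bar>B1 \<omega>\<bar> * \<bar>B1 \<omega>\<bar>) + \<beta> * (\<bar>B2 \<omega>\<bar> * \<bar>B1 \<omega>\<bar>))"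
        unfolding D_def by (simp add: abs_mult[symmetric] algebra_simps)
    qed (use i2 in auto)
    also have "\<dots> = b' * L1 * l * (\<alpha> * (\<integral>\<omega>. \<bar>B1 \<omega>\<bar> * \<bar>B1 \<omega>\<bar> \<partial>M) + \<beta> * (\<integral>\<omega>. \<bar>B2 \<omega>\<bar> * \<bar>B1 \<omega>\<bar> \<partial>M))"
      using i2 by simp
    also have "\<dots> \<le> b' * L1 * l * (\<alpha> * 1 + \<beta> * 1)"
      using e1 ab0 b0 l0 L_nonneg by (intro mult_left_mono add_mono mult_nonneg_nonneg) auto
    finally show ?thesis using iFk by (simp add: mult_ac)
  qed
  have t2: "\<bar>(\<integral>\<omega>. F (Y \<omega>) \<partial>M) - (\<integral>\<omega>. F (?Z \<omega>) \<partial>M)\<bar> \<le> b' * L1 * (\<alpha> + \<beta>)"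
  proof -
    have "\<bar>\<integral>\<omega>. F (Y \<omega>) - F (?Z \<omega>) \<partial>M\<bar> \<le> (\<integral>\<omega>. b' * L1 * (\<alpha> * \<bar>B1 \<omega>\<bar> + \<beta> * \<bar>B2 \<omega>\<bar>) \<partial>M)"
      using FZ i1 by (intro abs_expectation_le) (auto simp: D_def mult.assoc)
    also have "\<dots> = b' * L1 * (\<alpha> * (\<integral>\<omega>. \<bar>B1 \<omega>\<bar> \<partial>M) + \<beta> * (\<integral>\<omega>. \<bar>B2 \<omega>\<bar> \<partial>M))" using i1 by simp
    also have "\<dots> \<le> b' * L1 * (\<alpha> * 1 + \<beta> * 1)"
      using e2 ab0 b0 L_nonneg by (intro mult_left_mono add_mono mult_nonneg_nonneg) auto
    finally show ?thesis using iF by simp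
  qed
  have t3: "\<bar>\<integral>\<omega>. ?k \<omega> \<partial>M\<bar> \<le> l"
  proof -
    have "\<bar>\<integral>\<omega>. ?k \<omega> \<partial>M\<bar> \<le> (\<integral>\<omega>. l * \<bar>B1 \<omega>\<bar> \<partial>M)" using kl i1 by (intro abs_expectation_le) auto
    also have "\<dots> \<le> l" using mult_left_mono[OF e2(1) l0] by simp
    finally show ?thesis .
  qed
  have "\<bar>((\<integral>\<omega>. F (Y \<omega>) \<partial>M) - (\<integral>\<omega>. F (?Z \<omega>) \<partial>M)) * (\<integral>\<omega>. ?k \<omega> \<partial>M)\<bar> \<le> (b' * L1 * (\<alpha> + \<beta>)) * l"
    unfolding abs_mult using t2 t3 by (intro mult_mono) (auto intro: order_trans[OF abs_ge_zero])
  then show ?thesis using t1 unfolding dec by (simp add: algebra_simps)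
qed

end

lemma abs_mult_le:
  fixes a b :: real
  assumes "\<bar>a\<bar> \<le> A" "\<bar>b\<bar> \<le> B"
  shows "\<bar>a * b\<bar> \<le> A * B"
  unfolding abs_mult using assms by (intro mult_mono) (auto intro: order_trans[OF abs_ge_zero])

section \<open>Decorrelation of two-point products and the Stein bound\<close>

context stein_setup begin

lemma inner_diff:
  assumes "U \<in> lin_span X" "B \<in> lin_span X" "W \<in> lin_span X"
  shows "(\<integral>\<omega>. (U \<omega> - a * B \<omega>) * W \<omega> \<partial>M) = (\<integral>\<omega>. U \<omega> * W \<omega> \<partial>M) - a * (\<integral>\<omega>. B \<omega> * W \<omega> \<partial>M)"
  using lin_span_integrable_mult[OF assms(1,3)] lin_span_integrable_mult[OF assms(2,3)]
  by (simp add: left_diff_distrib mult.assoc)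

lemma inner_diff2:
  assumes "U \<in> lin_span X" "B1 \<in> lin_span X" "B2 \<in> lin_span X" "W \<in> lin_span X"
  shows "(\<integral>\<omega>. (U \<omega> - a * B1 \<omega> - b * B2 \<omega>) * W \<omega> \<partial>M) =
    (\<integral>\<omega>. U \<omega> * W \<omega> \<partial>M) - a * (\<integral>\<omega>. B1 \<omega> * W \<omega> \<partial>M) - b * (\<integral>\<omega>. B2 \<omega> * W \<omega> \<partial>M)"
  using inner_diff[OF lin_span_diff[OF assms(1) lin_span_scale[OF assms(2), of a]] assms(3,4), of b]
    inner_diff[OF assms(1,2,4), of a] by simp

lemma residual_variance: "(\<integral>\<omega>. (X s \<omega> - r s t * X t \<omega>)\<^sup>2 \<partial>M) = 1 - (r s t)\<^sup>2"
  and residual_orth: "(\<integral>\<omega>. (X s \<omega> - r s t * X t \<omega>) * X t \<omega> \<partial>M) = 0"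
proof -
  let ?e = "\<lambda>\<omega>. X s \<omega> - r s t * X t \<omega>"
  have e: "?e \<in> lin_span X" by (intro lin_span_diff lin_span_scale lin_span_base)
  show o: "(\<integral>\<omega>. ?e \<omega> * X t \<omega> \<partial>M) = 0"
    using inner_diff[OF lin_span_base lin_span_base lin_span_base, of s "r s t" t t] by (simp add: cov unit)
  have "(\<integral>\<omega>. ?e \<omega> * ?e \<omega> \<partial>M) = (\<integral>\<omega>. X s \<omega> * ?e \<omega> \<partial>M) - r s t * (\<integral>\<omega>. X t \<omega> * ?e \<omega> \<partial>M)"
    by (rule inner_diff[OF lin_span_base lin_span_base e])
  also have "(\<integral>\<omega>. X t \<omega> * ?e \<omega> \<partial>M) = 0" using o by (simp add: mult.commute)
  also have "(\<integral>\<omega>. X s \<omega> * ?e \<omega> \<partial>M) = (\<integral>\<omega>. ?e \<omega> * X s \<omega> \<partial>M)" by (simp add: mult.commute)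
  also have "\<dots> = 1 - r s t * r s t"
    using inner_diff[OF lin_span_base lin_span_base lin_span_base, of s "r s t" t s] by (simp add: cov unit r_sym)
  finally show "(\<integral>\<omega>. (?e \<omega>)\<^sup>2 \<partial>M) = 1 - (r s t)\<^sup>2" by (simp add: power2_eq_square)
qed

text \<open>\<open>X t\<close> is independent of the residual and \<open>g\<close> has mean 0.
  Hence, in a covariance with \<open>g (X t)\<close>, one may subtract from \<open>g (X s)\<close>
  its value at the residual, which gains a factor \<open>r s t\<close>.\<close>

lemma g_residual: "(\<integral>\<omega>. g (X t \<omega>) * g (X s \<omega> - r s t * X t \<omega>) \<partial>M) = 0"
proof -
  let ?e = "\<lambda>\<omega>. X s \<omega> - r s t * X t \<omega>"
  have e: "?e \<in> lin_span X" by (intro lin_span_diff lin_span_scale lin_span_base)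
  have "(\<integral>\<omega>. g (X t \<omega>) * (\<lambda>w. g (w (0::nat))) (\<lambda>i\<in>{0}. ?e \<omega>) \<partial>M) =
      (\<integral>\<omega>. g (X t \<omega>) \<partial>M) * (\<integral>\<omega>. (\<lambda>w. g (w (0::nat))) (\<lambda>i\<in>{0}. ?e \<omega>) \<partial>M)"
    using residual_orth g_le
    by (intro orthogonal_decouple[where k = "\<lambda>x y. g x" and K = 1 and L = 1 and ?B2.0 = "\<lambda>_. 0" and I = "{0::nat}"])
       (auto intro: e lin_span_zero lin_span_base)
  then show ?thesis by (simp add: g_mean_X)
qed

text \<open>The product is a function of \<open>X t\<close> and \<open>X s\<close> of size
  proportional to \<open>\<bar>r s t\<bar>\<close>, and leaving these two variables out decorrelates
  it from \<open>F (Y \<omega>)\<close> up to a factor \<delta>. Integrated over \<open>s\<close>,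
  the factor \<open>\<bar>r s t\<bar>\<close> yields a second \<delta>. The free parameter \<kappa>
  separates the two cases of the proof.\<close>

lemma pair_bound:
  fixes F :: "real \<Rightarrow> real"
  assumes F: "\<And>x y. \<bar>F x - F y\<bar> \<le> b * \<bar>x - y\<bar>" and FA: "\<And>x. \<bar>F x\<bar> \<le> A" and \<kappa>: "0 < \<kappa>"
  shows "\<bar>(\<integral>\<omega>. F (Y \<omega>) * (g (X t \<omega>) * (g (X s \<omega>) - g (X s \<omega> - r s t * X t \<omega>))) \<partial>M)
      - (\<integral>\<omega>. F (Y \<omega>) \<partial>M) * (\<integral>\<omega>. g (X t \<omega>) * g (X s \<omega>) \<partial>M)\<bar>
    \<le> \<bar>r s t\<bar> * (2 * b * L1\<^sup>2 * \<delta> * (1 + 2 / \<kappa>) + 2 * A * L2 * \<kappa>)"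
proof -
  let ?c = "r s t"
  define e where "e \<omega> = X s \<omega> - ?c * X t \<omega>" for \<omega>
  define W where "W \<omega> = g (X t \<omega>) * (g (X s \<omega>) - g (X s \<omega> - ?c * X t \<omega>))" for \<omega>
  have e: "e \<in> lin_span X" unfolding e_def[abs_def] by (intro lin_span_diff lin_span_scale lin_span_base)
  have Fc: "continuous_on UNIV F" by (rule lipschitz_real_continuous[OF F])
  have [measurable]: "F \<in> borel_measurable borel" using Fc by (rule borel_measurable_continuous_onI)
  have b0: "0 \<le> b" using F[of 1 0] abs_ge_zero[of "F 1 - F 0"] by simp
  have A0: "0 \<le> A" using FA[of 0] by (rule order_trans[OF abs_ge_zero])
  have gg: "integrable M (\<lambda>\<omega>. g (X t \<omega>) * g (Z \<omega>))" if [measurable]: "Z \<in> borel_measurable M" for Z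
    using g_le by (auto intro!: integrable_bounded_fun[where K = 1] mult_le_one simp: abs_mult)
  have EW: "(\<integral>\<omega>. W \<omega> \<partial>M) = (\<integral>\<omega>. g (X t \<omega>) * g (X s \<omega>) \<partial>M)"
    unfolding W_def using g_residual[of t s] gg by (simp add: right_diff_distrib)
  have Wm[measurable]: "W \<in> borel_measurable M" unfolding W_def by measurable
  have g2: "\<bar>g x - g y\<bar> \<le> 2" for x y using g_le[of x] g_le[of y] by linarith
  have g3: "\<bar>g z * (g x - g y)\<bar> \<le> 2" for x y z
    unfolding abs_mult using mult_mono[OF g_le[of z] g2[of x y]] by simp
  have g4: "\<bar>g z * (g x - g y)\<bar> \<le> L1 * \<bar>x - y\<bar>" for x y z
    unfolding abs_mult using mult_mono[OF g_le[of z] g_lip[of x y]] by simp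
  have e2: "(\<integral>\<omega>. (e \<omega>)\<^sup>2 \<partial>M) = 1 - ?c\<^sup>2" unfolding e_def by (rule residual_variance)
  have eX: "(\<integral>\<omega>. e \<omega> * X t \<omega> \<partial>M) = 0" unfolding e_def by (rule residual_orth)
  have c1: "?c\<^sup>2 \<le> 1" using abs_cov_le_1[of s t] by (simp add: abs_square_le_1)
  define \<tau> where "\<tau> = sqrt (1 - ?c\<^sup>2)"
  have \<tau>2: "\<tau>\<^sup>2 = 1 - ?c\<^sup>2" "0 \<le> \<tau>" using c1 by (simp_all add: \<tau>_def)
  have X2: "(\<integral>\<omega>. X t \<omega> * X t \<omega> \<partial>M) = 1" by (simp add: cov unit)
  have Q1: "0 \<le> 2 * b * L1\<^sup>2 * \<delta>" "0 \<le> 2 * A * L2 * \<kappa>" using b0 A0 L_nonneg \<kappa> by auto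
  \<comment> \<open>Regression on both variables divides by \<open>\<tau>\<close>, so for small \<open>\<tau>\<close> the variable \<open>X s\<close> is replaced by
    the multiple of \<open>X t\<close> that approximates it.\<close>
  show ?thesis
  proof (cases "\<kappa> \<le> \<tau>")
    case True
    then have \<tau>0: "\<tau> > 0" using \<kappa> by simp
    define B2 where "B2 \<omega> = (1 / \<tau>) * e \<omega>" for \<omega>
    have B2: "B2 \<in> lin_span X" unfolding B2_def[abs_def] by (intro lin_span_scale e)
    have B22: "(\<integral>\<omega>. (B2 \<omega>)\<^sup>2 \<partial>M) = 1"
    proof -
      have "(\<integral>\<omega>. (B2 \<omega>)\<^sup>2 \<partial>M) = (1 / \<tau>)\<^sup>2 * \<tau>\<^sup>2"
        unfolding B2_def power_mult_distrib \<tau>2 e2[symmetric] by simp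
      then show ?thesis using \<tau>0 by (simp add: power_divide)
    qed
    have B21: "(\<integral>\<omega>. B2 \<omega> * X t \<omega> \<partial>M) = 0"
      unfolding B2_def mult.assoc using eX by simp
    \<comment> \<open>\<open>X s = ?c * X t + \<tau> * B2\<close> writes the product through an
      orthonormal pair.\<close>
    define k where "k x y = g x * (g (?c * x + \<tau> * y) - g (?c * x + \<tau> * y - ?c * x))" for x y
    have Wk: "W \<omega> = k (X t \<omega>) (B2 \<omega>)" for \<omega>
      unfolding W_def k_def B2_def e_def using \<tau>0 by simp
    have XB2: "(\<integral>\<omega>. X v \<omega> * B2 \<omega> \<partial>M) = (r v s - ?c * r v t) / \<tau>" for v
    proof -
      have "(\<integral>\<omega>. X v \<omega> * B2 \<omega> \<partial>M) = (1 / \<tau>) * (\<integral>\<omega>. e \<omega> * X v \<omega> \<partial>M)"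
        unfolding B2_def by (subst integral_mult_right_zero[symmetric]) (simp add: mult_ac)
      also have "(\<integral>\<omega>. e \<omega> * X v \<omega> \<partial>M) = r s v - ?c * r t v"
        unfolding e_def by (subst inner_diff) (simp_all add: lin_span_base cov)
      finally show ?thesis by (simp add: r_sym[of _ v])
    qed
    have bint: "integrable N (\<lambda>v. (r v s - ?c * r v t) / \<tau>)" using r_integrable by simp
    have bb: "(\<integral>v. \<bar>(r v s - ?c * r v t) / \<tau>\<bar> \<partial>N) \<le> 2 * \<delta> / \<kappa>"
    proof -
      have "(\<integral>v. \<bar>(r v s - ?c * r v t) / \<tau>\<bar> \<partial>N) \<le> (\<integral>v. (\<bar>r v s\<bar> + \<bar>r v t\<bar>) / \<kappa> \<partial>N)"
      proof (intro integral_mono)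
        fix v
        have "\<bar>r v s - ?c * r v t\<bar> \<le> \<bar>r v s\<bar> + \<bar>?c\<bar> * \<bar>r v t\<bar>" unfolding abs_mult[symmetric] by linarith
        also have "\<dots> \<le> \<bar>r v s\<bar> + 1 * \<bar>r v t\<bar>" using abs_cov_le_1 by (intro add_left_mono mult_right_mono) auto
        finally show "\<bar>(r v s - ?c * r v t) / \<tau>\<bar> \<le> (\<bar>r v s\<bar> + \<bar>r v t\<bar>) / \<kappa>"
          using True \<kappa> \<tau>0 unfolding abs_divide by (intro frac_le) auto
      qed (use r_integrable in auto)
      also have "\<dots> = ((\<integral>v. \<bar>r v s\<bar> \<partial>N) + (\<integral>v. \<bar>r v t\<bar> \<partial>N)) / \<kappa>" using r_integrable by simp
      also have "\<dots> \<le> (\<delta> + \<delta>) / \<kappa>" using r_le \<kappa> by (intro divide_right_mono add_mono) auto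
      finally show ?thesis by simp
    qed
    \<comment> \<open>The coefficients of \<open>X v\<close> in the orthonormal pair are
      \<open>r v t\<close> and \<open>(r v s - ?c * r v t) / \<tau>\<close>; the division in the
      second one produces \<open>2 * \<delta> / \<kappa>\<close>.\<close>
    have "\<bar>(\<integral>\<omega>. F (Y \<omega>) * k (X t \<omega>) (B2 \<omega>) \<partial>M) - (\<integral>\<omega>. F (Y \<omega>) \<partial>M) * (\<integral>\<omega>. k (X t \<omega>) (B2 \<omega>) \<partial>M)\<bar>
        \<le> 2 * b * L1 * (\<delta> + 2 * \<delta> / \<kappa>) * (L1 * \<bar>?c\<bar>)"
    proof (rule leave_out[OF lin_span_base B2 _ _ r_integrable[of t] bint r_le bb])
      show "(\<integral>\<omega>. (X v \<omega> - r v t * X t \<omega> - (r v s - ?c * r v t) / \<tau> * B2 \<omega>) * X t \<omega> \<partial>M) = 0" for v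
        by (subst inner_diff2[OF lin_span_base lin_span_base B2 lin_span_base]) (simp add: cov unit B21)
      show "(\<integral>\<omega>. (X v \<omega> - r v t * X t \<omega> - (r v s - ?c * r v t) / \<tau> * B2 \<omega>) * B2 \<omega> \<partial>M) = 0" for v
        using B22 B21 by (subst inner_diff2[OF lin_span_base lin_span_base B2 B2]) (simp add: XB2 power2_eq_square mult.commute[of "X t _"])
      show "(\<lambda>(x, y). k x y) \<in> borel_measurable (borel \<Otimes>\<^sub>M borel)" unfolding k_def by measurable
      show "\<bar>k x y\<bar> \<le> 2" for x y unfolding k_def by (rule g3)
      show "\<bar>k x y\<bar> \<le> L1 * \<bar>?c\<bar> * \<bar>x\<bar>" for x y
        unfolding k_def using g4[of x "?c * x + \<tau> * y" "?c * x + \<tau> * y - ?c * x"] by (simp add: abs_mult mult.assoc)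
    qed (use unit' B22 F in auto)
    also have "\<dots> = \<bar>?c\<bar> * (2 * b * L1\<^sup>2 * \<delta> * (1 + 2 / \<kappa>))" by (simp add: power2_eq_square algebra_simps)
    also have "\<dots> \<le> \<bar>?c\<bar> * (2 * b * L1\<^sup>2 * \<delta> * (1 + 2 / \<kappa>) + 2 * A * L2 * \<kappa>)"
      using Q1 by (intro mult_left_mono) auto
    finally show ?thesis unfolding Wk[symmetric] W_def EW[symmetric] .
  next
    case False
    \<comment> \<open>The residual \<open>e\<close> is dropped from \<open>X s\<close>. By
      \<open>g_lip2\<close> this costs \<open>L2\<close> times \<open>\<bar>e\<bar>\<close> times
      \<open>\<bar>?c * X t\<bar>\<close>, in expectation a multiple of \<kappa> because the
      variance of \<open>e\<close> is below \<open>\<kappa>\<^sup>2\<close>. What remains depends on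
      \<open>X t\<close> alone.\<close>
    define k where "k x y = g x * (g (?c * x) - g (?c * x - ?c * x))" for x y :: real
    define V where "V \<omega> = k (X t \<omega>) 0" for \<omega>
    have [measurable]: "V \<in> borel_measurable M" unfolding V_def[abs_def] k_def by measurable
    have ebound: "(\<integral>\<omega>. \<bar>e \<omega>\<bar> * \<bar>X t \<omega>\<bar> \<partial>M) \<le> \<kappa>"
    proof (rule expectation_abs_mult_le[OF e lin_span_base \<kappa>])
      have "\<tau>\<^sup>2 \<le> \<kappa>\<^sup>2" using False \<tau>2 by (intro power_mono) auto
      then show "(\<integral>\<omega>. (e \<omega>)\<^sup>2 \<partial>M) \<le> \<kappa>\<^sup>2" using e2 \<tau>2 by simp
    qed (simp add: unit')
    have ei: "integrable M (\<lambda>\<omega>. \<bar>e \<omega>\<bar> * \<bar>X t \<omega>\<bar>)"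
      using integrable_abs[OF lin_span_integrable_mult[OF e lin_span_base]] by (simp only: abs_mult)
    have WV: "\<bar>W \<omega> - V \<omega>\<bar> \<le> L2 * \<bar>?c\<bar> * (\<bar>e \<omega>\<bar> * \<bar>X t \<omega>\<bar>)" for \<omega>
    proof -
      have "\<bar>W \<omega> - V \<omega>\<bar> = \<bar>g (X t \<omega>)\<bar> * \<bar>(g (X s \<omega>) - g (X s \<omega> - ?c * X t \<omega>)) - (g (?c * X t \<omega>) - g (?c * X t \<omega> - ?c * X t \<omega>))\<bar>"
        unfolding W_def V_def k_def abs_mult[symmetric] by (simp add: algebra_simps)
      also have "\<dots> \<le> 1 * (L2 * \<bar>X s \<omega> - ?c * X t \<omega>\<bar> * \<bar>?c * X t \<omega>\<bar>)"
        by (intro mult_mono g_le g_lip2) auto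
      finally show ?thesis by (simp add: e_def abs_mult mult_ac)
    qed
    have FWV: "\<bar>f \<omega> * W \<omega> - f \<omega> * V \<omega>\<bar> \<le> A * (L2 * \<bar>?c\<bar> * (\<bar>e \<omega>\<bar> * \<bar>X t \<omega>\<bar>))" if "\<bar>f \<omega>\<bar> \<le> A" for f \<omega>
      unfolding right_diff_distrib[symmetric] abs_mult using WV that by (intro mult_mono) (auto intro: A0)
    have iW: "integrable M (\<lambda>\<omega>. f \<omega> * W \<omega>)" "integrable M (\<lambda>\<omega>. f \<omega> * V \<omega>)"
      if [measurable]: "f \<in> borel_measurable M" and "\<And>\<omega>. \<bar>f \<omega>\<bar> \<le> A" for f
      using that(2) g3 A0 by (auto intro!: integrable_bounded_fun[where K = "A * 2"] mult_mono simp: abs_mult[of "f _"] W_def V_def k_def)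
    have EFWV: "\<bar>(\<integral>\<omega>. f \<omega> * W \<omega> \<partial>M) - (\<integral>\<omega>. f \<omega> * V \<omega> \<partial>M)\<bar> \<le> A * (L2 * \<bar>?c\<bar> * \<kappa>)"
      if [measurable]: "f \<in> borel_measurable M" and fA: "\<And>\<omega>. \<bar>f \<omega>\<bar> \<le> A" for f
    proof -
      have "\<bar>\<integral>\<omega>. f \<omega> * W \<omega> - f \<omega> * V \<omega> \<partial>M\<bar> \<le> (\<integral>\<omega>. A * (L2 * \<bar>?c\<bar> * (\<bar>e \<omega>\<bar> * \<bar>X t \<omega>\<bar>)) \<partial>M)"
        using FWV fA ei by (intro abs_expectation_le) auto
      also have "\<dots> = A * (L2 * \<bar>?c\<bar> * (\<integral>\<omega>. \<bar>e \<omega>\<bar> * \<bar>X t \<omega>\<bar> \<partial>M))" using ei by simp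
      also have "\<dots> \<le> A * (L2 * \<bar>?c\<bar> * \<kappa>)" using ebound A0 L_nonneg by (intro mult_left_mono) auto
      finally show ?thesis using iW[OF that] by simp
    qed
    have "\<bar>(\<integral>\<omega>. F (Y \<omega>) * k (X t \<omega>) 0 \<partial>M) - (\<integral>\<omega>. F (Y \<omega>) \<partial>M) * (\<integral>\<omega>. k (X t \<omega>) 0 \<partial>M)\<bar>
        \<le> 2 * b * L1 * (\<delta> + 0) * (L1 * \<bar>?c\<bar>)"
    proof (rule leave_out[OF lin_span_base lin_span_zero _ _ r_integrable[of t] _ r_le, where b = "\<lambda>_. 0"])
      show "(\<integral>\<omega>. (X v \<omega> - r v t * X t \<omega> - 0 * 0) * X t \<omega> \<partial>M) = 0" for v
        using residual_orth[of v t] by simp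
      show "(\<lambda>(x, y). k x y) \<in> borel_measurable (borel \<Otimes>\<^sub>M borel)" unfolding k_def by measurable
      show "\<bar>k x y\<bar> \<le> 2" for x y unfolding k_def by (rule g3)
      show "\<bar>k x y\<bar> \<le> L1 * \<bar>?c\<bar> * \<bar>x\<bar>" for x y
        unfolding k_def using g4[of x "?c * x" "?c * x - ?c * x"] by (simp add: abs_mult mult.assoc)
    qed (use unit' F in auto)
    then have t1: "\<bar>(\<integral>\<omega>. F (Y \<omega>) * V \<omega> \<partial>M) - (\<integral>\<omega>. F (Y \<omega>) \<partial>M) * (\<integral>\<omega>. V \<omega> \<partial>M)\<bar> \<le> 2 * b * L1\<^sup>2 * \<delta> * \<bar>?c\<bar>"
      unfolding V_def by (simp add: power2_eq_square mult_ac)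
    have t2: "\<bar>(\<integral>\<omega>. F (Y \<omega>) * W \<omega> \<partial>M) - (\<integral>\<omega>. F (Y \<omega>) * V \<omega> \<partial>M)\<bar> \<le> A * (L2 * \<bar>?c\<bar> * \<kappa>)"
      using FA by (intro EFWV) auto
    have EFA: "\<bar>\<integral>\<omega>. F (Y \<omega>) \<partial>M\<bar> \<le> A"
    proof -
      have "\<bar>\<integral>\<omega>. F (Y \<omega>) \<partial>M\<bar> \<le> (\<integral>\<omega>. A \<partial>M)" using FA by (intro abs_expectation_le) auto
      then show ?thesis using prob_space by simp
    qed
    have t3: "\<bar>(\<integral>\<omega>. F (Y \<omega>) \<partial>M) * (\<integral>\<omega>. W \<omega> \<partial>M) - (\<integral>\<omega>. F (Y \<omega>) \<partial>M) * (\<integral>\<omega>. V \<omega> \<partial>M)\<bar> \<le> A * (L2 * \<bar>?c\<bar> * \<kappa>)"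
      using EFWV[of "\<lambda>_. \<integral>\<omega>. F (Y \<omega>) \<partial>M"] EFA by simp
    \<comment> \<open>The factor \<open>1 + 2 / \<kappa>\<close> does not arise in this case; it is
      inserted to give both cases the same bound.\<close>
    have "2 * b * L1\<^sup>2 * \<delta> * \<bar>?c\<bar> \<le> 2 * b * L1\<^sup>2 * \<delta> * \<bar>?c\<bar> * (1 + 2 / \<kappa>)"
      using Q1 \<kappa> mult_left_mono[of 1 "1 + 2/\<kappa>" "2 * b * L1\<^sup>2 * \<delta> * \<bar>?c\<bar>"] by simp
    then have "\<bar>(\<integral>\<omega>. F (Y \<omega>) * W \<omega> \<partial>M) - (\<integral>\<omega>. F (Y \<omega>) \<partial>M) * (\<integral>\<omega>. W \<omega> \<partial>M)\<bar>
        \<le> 2 * b * L1\<^sup>2 * \<delta> * \<bar>?c\<bar> * (1 + 2 / \<kappa>) + 2 * (A * (L2 * \<bar>?c\<bar> * \<kappa>))"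
      using t1 t2 t3 by linarith
    also have "\<dots> = \<bar>?c\<bar> * (2 * b * L1\<^sup>2 * \<delta> * (1 + 2 / \<kappa>) + 2 * A * L2 * \<kappa>)" by (simp add: algebra_simps)
    finally show ?thesis unfolding EW[symmetric] W_def .
  qed
qed

text \<open>\<open>E Y f(Y)\<close> is the integral over \<open>t\<close> of
  \<open>E f(Y) g(X t)\<close>. Let \<open>Z\<close> be the functional with \<open>X t\<close> left
  out, so that \<open>E g(X t) f(Z) = 0\<close>. Taylor's formula replaces
  \<open>f(Y) - f(Z)\<close> by \<open>f'(Y) (Y - Z)\<close>; the difference \<open>Y - Z\<close> is
  an integral over \<open>s\<close>, to which \<open>pair_bound\<close> applies with
  \<open>F = f'\<close> and pulls \<open>E f'(Y)\<close> out. Integrating over \<open>t\<close>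
  turns what remains into the second moment of \<open>Y\<close>.\<close>

theorem stein_bound:
  fixes f f' :: "real \<Rightarrow> real"
  assumes f: "\<And>x. (f has_real_derivative f' x) (at x)"
    and f'A: "\<And>x. \<bar>f' x\<bar> \<le> A" and f'B: "\<And>x y. \<bar>f' x - f' y\<bar> \<le> b * \<bar>x - y\<bar>" and \<kappa>: "0 < \<kappa>"
  shows "\<bar>(\<integral>\<omega>. Y \<omega> * f (Y \<omega>) \<partial>M) - (\<integral>\<omega>. (Y \<omega>)\<^sup>2 \<partial>M) * (\<integral>\<omega>. f' (Y \<omega>) \<partial>M)\<bar>
    \<le> n * (b * L1\<^sup>2 * \<delta>\<^sup>2 + \<delta> * (2 * b * L1\<^sup>2 * \<delta> * (1 + 2 / \<kappa>) + 2 * A * L2 * \<kappa>))"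
proof -
  define Q where "Q = 2 * b * L1\<^sup>2 * \<delta> * (1 + 2 / \<kappa>) + 2 * A * L2 * \<kappa>"
  have A0: "0 \<le> A" using f'A[of 0] by (rule order_trans[OF abs_ge_zero])
  have b0: "0 \<le> b" using f'B[of 1 0] abs_ge_zero[of "f' 1 - f' 0"] by simp
  have Q0: "0 \<le> Q" unfolding Q_def using A0 b0 L_nonneg \<kappa> by auto
  have fc: "continuous_on UNIV f" using f by (intro continuous_at_imp_continuous_on) (auto intro: DERIV_isCont)
  have [measurable]: "f \<in> borel_measurable borel" using fc by (rule borel_measurable_continuous_onI)
  have [measurable]: "f' \<in> borel_measurable borel"
    using lipschitz_real_continuous[OF f'B] by (rule borel_measurable_continuous_onI)
  have mvt: "\<exists>z. \<bar>z - x\<bar> \<le> \<bar>y - x\<bar> \<and> f y - f x = (y - x) * f' z" for x y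
  proof (cases x y rule: linorder_cases)
    case less
    then show ?thesis using MVT2[OF less, of f f'] f by force
  next
    case greater
    then obtain z where "y < z" "z < x" "f x - f y = (x - y) * f' z" using MVT2[of y x f f'] f by blast
    then show ?thesis by (intro exI[of _ z]) (auto simp: algebra_simps)
  qed auto
  have flip: "\<bar>f x - f y\<bar> \<le> A * \<bar>x - y\<bar>" for x y
  proof -
    obtain z where "f x - f y = (x - y) * f' z" using mvt[of y x] by blast
    then show ?thesis using mult_right_mono[OF f'A[of z], of "\<bar>x - y\<bar>"] by (simp add: abs_mult mult.commute)
  qed
  have taylor: "\<bar>f x - f y - f' x * (x - y)\<bar> \<le> b * (x - y)\<^sup>2" for x y
  proof -
    obtain z where z: "\<bar>z - x\<bar> \<le> \<bar>y - x\<bar>" "f y - f x = (y - x) * f' z" using mvt[of x y] by blast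
    have "f x - f y - f' x * (x - y) = (x - y) * (f' z - f' x)" using z(2) by (simp add: algebra_simps)
    then have "\<bar>f x - f y - f' x * (x - y)\<bar> = \<bar>x - y\<bar> * \<bar>f' z - f' x\<bar>" by (simp add: abs_mult)
    also have "\<dots> \<le> \<bar>x - y\<bar> * (b * \<bar>x - y\<bar>)"
      using f'B[of z x] mult_left_mono[OF z(1) b0] by (intro mult_left_mono) (auto simp: abs_minus_commute)
    finally show ?thesis by (simp add: power2_eq_square mult_ac)
  qed
  note fYb = lipschitz_Y_bounded[of f A, OF flip]
  let ?Ef = "\<integral>\<omega>. f' (Y \<omega>) \<partial>M"
  let ?C = "\<bar>f 0\<bar> + A * n"
  have step: "\<bar>(\<integral>\<omega>. f (Y \<omega>) * g (X t \<omega>) \<partial>M) - ?Ef * (\<integral>\<omega>. Y \<omega> * g (X t \<omega>) \<partial>M)\<bar> \<le> b * L1\<^sup>2 * \<delta>\<^sup>2 + \<delta> * Q" for t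
  proof -
    \<comment> \<open>The vanishing summand \<open>0 * 0\<close> gives the residual the shape of
      \<open>occ_perturb\<close> with zero second coefficient and zero second variable.\<close>
    define R where "R v \<omega> = X v \<omega> - r v t * X t \<omega> - 0 * 0" for v \<omega>
    have Rs: "R v \<in> lin_span X" for v
      unfolding R_def[abs_def] using lin_span_diff[OF lin_span_base lin_span_scale[OF lin_span_base]] by simp
    have [measurable]: "(\<lambda>v. r v t) \<in> borel_measurable N" using r_integrable by auto
    have Rm[measurable]: "case_prod R \<in> borel_measurable (N \<Otimes>\<^sub>M M)" unfolding R_def[abs_def] by measurable
    have orth: "(\<integral>\<omega>. R v \<omega> * X t \<omega> \<partial>M) = 0" for v using residual_orth[of v t] by (simp add: R_def)
    let ?Z = "occ g R"
    have D: "\<bar>Y \<omega> - ?Z \<omega>\<bar> \<le> L1 * (\<delta> * \<bar>X t \<omega>\<bar>)" if "\<omega> \<in> space M" for \<omega>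
      using occ_perturb[OF lin_span_base lin_span_zero r_integrable _ r_le _ that, of "\<lambda>_. 0" 0 t t] by (simp add: R_def[abs_def])
    have Zb: "\<bar>?Z \<omega>\<bar> \<le> n" for \<omega> using occ_bounded[of g 1, OF g_le] by simp
    have z: "(\<integral>\<omega>. g (X t \<omega>) * f (?Z \<omega>) \<partial>M) = 0"
      using occ_decouple[OF Rs lin_span_base lin_span_zero orth _ _ _ g_measurable Rm g_le fc, where k = "\<lambda>x y. g x" and K = 1] g_le g_mean_X
      by simp
    define c where "c \<omega> = g (X t \<omega>) * f' (Y \<omega>)" for \<omega>
    have [measurable]: "c \<in> borel_measurable M" unfolding c_def by measurable
    have cb: "\<bar>c \<omega>\<bar> \<le> A" for \<omega> unfolding c_def abs_mult using mult_mono[OF g_le f'A] by simp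
    have C0: "0 \<le> ?C" using fYb[of X] abs_ge_zero order_trans by blast
    have iY: "integrable M (\<lambda>\<omega>. g (X t \<omega>) * f (Y \<omega>))" and iZ: "integrable M (\<lambda>\<omega>. g (X t \<omega>) * f (?Z \<omega>))"
      using abs_mult_le[OF g_le fYb] by (auto intro!: integrable_bounded_fun[where K = "1 * ?C"])
    have icY: "integrable M (\<lambda>\<omega>. c \<omega> * Y \<omega>)" and icZ: "integrable M (\<lambda>\<omega>. c \<omega> * ?Z \<omega>)"
      using abs_mult_le[OF cb Y_bounded] abs_mult_le[OF cb Zb] by (auto intro!: integrable_bounded_fun[where K = "A * n"])
    have t1: "\<bar>(\<integral>\<omega>. g (X t \<omega>) * f (Y \<omega>) \<partial>M) - ((\<integral>\<omega>. c \<omega> * Y \<omega> \<partial>M) - (\<integral>\<omega>. c \<omega> * ?Z \<omega> \<partial>M))\<bar> \<le> b * L1\<^sup>2 * \<delta>\<^sup>2"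
    proof -
      have "\<bar>\<integral>\<omega>. (g (X t \<omega>) * f (Y \<omega>) - g (X t \<omega>) * f (?Z \<omega>)) - (c \<omega> * Y \<omega> - c \<omega> * ?Z \<omega>) \<partial>M\<bar> \<le> (\<integral>\<omega>. b * L1\<^sup>2 * \<delta>\<^sup>2 * (X t \<omega>)\<^sup>2 \<partial>M)"
      proof (rule abs_expectation_le)
        fix \<omega> assume w: "\<omega> \<in> space M"
        have "\<bar>(g (X t \<omega>) * f (Y \<omega>) - g (X t \<omega>) * f (?Z \<omega>)) - (c \<omega> * Y \<omega> - c \<omega> * ?Z \<omega>)\<bar>
           = \<bar>g (X t \<omega>)\<bar> * \<bar>f (Y \<omega>) - f (?Z \<omega>) - f' (Y \<omega>) * (Y \<omega> - ?Z \<omega>)\<bar>"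
          unfolding abs_mult[symmetric] c_def by (simp add: algebra_simps)
        also have "\<dots> \<le> 1 * (b * (Y \<omega> - ?Z \<omega>)\<^sup>2)" by (intro mult_mono g_le taylor) auto
        also have "\<dots> \<le> b * (L1 * (\<delta> * \<bar>X t \<omega>\<bar>))\<^sup>2"
          using D[OF w] power_mono[OF D[OF w] abs_ge_zero, of 2] b0 by (simp add: mult_left_mono)
        finally show "\<bar>(g (X t \<omega>) * f (Y \<omega>) - g (X t \<omega>) * f (?Z \<omega>)) - (c \<omega> * Y \<omega> - c \<omega> * ?Z \<omega>)\<bar> \<le> b * L1\<^sup>2 * \<delta>\<^sup>2 * (X t \<omega>)\<^sup>2"
          by (simp add: power_mult_distrib mult.assoc)
      qed (use lin_span_integrable[OF lin_span_base] in auto)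
      also have "\<dots> = b * L1\<^sup>2 * \<delta>\<^sup>2" using unit' by simp
      finally show ?thesis using iY iZ icY icZ z by simp
    qed
    \<comment> \<open>\<open>Y - ?Z\<close> is opened into an integral over \<open>s\<close>, and
      the expected integrand is compared with \<open>?Ef\<close> times the covariance of
      \<open>g (X t)\<close> and \<open>g (X s)\<close>.\<close>
    have t2: "\<bar>((\<integral>\<omega>. c \<omega> * Y \<omega> \<partial>M) - (\<integral>\<omega>. c \<omega> * ?Z \<omega> \<partial>M)) - ?Ef * (\<integral>\<omega>. g (X t \<omega>) * Y \<omega> \<partial>M)\<bar> \<le> \<delta> * Q"
    proof -
      note fY = occ_fubini[OF g_measurable X_joint _ g_le cb] and fZ = occ_fubini[OF g_measurable Rm _ g_le cb]
      note fg = occ_fubini[OF g_measurable X_joint _ g_le, of "\<lambda>\<omega>. g (X t \<omega>)" 1]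
      have icX: "integrable M (\<lambda>\<omega>. c \<omega> * g (Z \<omega>))" if [measurable]: "Z \<in> borel_measurable M" for Z
        using abs_mult_le[OF cb g_le] by (auto intro!: integrable_bounded_fun[where K = "A * 1"])
      have [measurable]: "R s \<in> borel_measurable M" for s using lin_span_measurable[OF Rs] .
      have "((\<integral>\<omega>. c \<omega> * Y \<omega> \<partial>M) - (\<integral>\<omega>. c \<omega> * ?Z \<omega> \<partial>M)) - ?Ef * (\<integral>\<omega>. g (X t \<omega>) * Y \<omega> \<partial>M) =
         (\<integral>s. (\<integral>\<omega>. c \<omega> * g (X s \<omega>) \<partial>M) - (\<integral>\<omega>. c \<omega> * g (R s \<omega>) \<partial>M) - ?Ef * (\<integral>\<omega>. g (X t \<omega>) * g (X s \<omega>) \<partial>M) \<partial>N)"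
        using fY fZ fg g_le by simp
      also have "\<bar>\<dots>\<bar> \<le> (\<integral>s. \<bar>r s t\<bar> * Q \<partial>N)"
      proof (rule order_trans[OF integral_abs_bound], rule integral_mono)
        fix s
        have "(\<integral>\<omega>. c \<omega> * g (X s \<omega>) \<partial>M) - (\<integral>\<omega>. c \<omega> * g (R s \<omega>) \<partial>M) = (\<integral>\<omega>. f' (Y \<omega>) * (g (X t \<omega>) * (g (X s \<omega>) - g (X s \<omega> - r s t * X t \<omega>))) \<partial>M)"
          using icX[of "X s"] icX[of "R s"]
          by (subst Bochner_Integration.integral_diff[symmetric]) (auto simp: c_def R_def algebra_simps)
        then show "\<bar>(\<integral>\<omega>. c \<omega> * g (X s \<omega>) \<partial>M) - (\<integral>\<omega>. c \<omega> * g (R s \<omega>) \<partial>M) - ?Ef * (\<integral>\<omega>. g (X t \<omega>) * g (X s \<omega>) \<partial>M)\<bar> \<le> \<bar>r s t\<bar> * Q"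
          using pair_bound[OF f'B f'A \<kappa>, of t s] by (simp add: Q_def)
      qed (use fY fZ fg g_le r_integrable in auto)
      also have "\<dots> = (\<integral>s. \<bar>r s t\<bar> \<partial>N) * Q" using r_integrable by simp
      also have "\<dots> \<le> \<delta> * Q" using r_le Q0 by (intro mult_right_mono)
      finally show ?thesis .
    qed
    show ?thesis using t1 t2 by (simp add: mult.commute)
  qed
  have f1: "(\<integral>\<omega>. f (Y \<omega>) * Y \<omega> \<partial>M) = (\<integral>t. (\<integral>\<omega>. f (Y \<omega>) * g (X t \<omega>) \<partial>M) \<partial>N)" "integrable N (\<lambda>t. \<integral>\<omega>. f (Y \<omega>) * g (X t \<omega>) \<partial>M)"
    using occ_fubini[OF g_measurable X_joint _ g_le fYb] by simp_all
  have f2: "(\<integral>\<omega>. Y \<omega> * Y \<omega> \<partial>M) = (\<integral>t. (\<integral>\<omega>. Y \<omega> * g (X t \<omega>) \<partial>M) \<partial>N)" "integrable N (\<lambda>t. \<integral>\<omega>. Y \<omega> * g (X t \<omega>) \<partial>M)"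
    using occ_fubini[OF g_measurable X_joint _ g_le Y_bounded] by simp_all
  have "(\<integral>\<omega>. Y \<omega> * f (Y \<omega>) \<partial>M) - (\<integral>\<omega>. (Y \<omega>)\<^sup>2 \<partial>M) * ?Ef =
     (\<integral>t. (\<integral>\<omega>. f (Y \<omega>) * g (X t \<omega>) \<partial>M) - ?Ef * (\<integral>\<omega>. Y \<omega> * g (X t \<omega>) \<partial>M) \<partial>N)"
    using f1 f2 by (simp add: power2_eq_square mult.commute)
  also have "\<bar>\<dots>\<bar> \<le> (\<integral>t. b * L1\<^sup>2 * \<delta>\<^sup>2 + \<delta> * Q \<partial>N)"
    using f1 f2 step by (intro order_trans[OF integral_abs_bound] integral_mono) auto
  also have "\<dots> = n * (b * L1\<^sup>2 * \<delta>\<^sup>2 + \<delta> * Q)" by (simp add: space_N)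
  finally show ?thesis unfolding Q_def .
qed

end

section \<open>From Stein bounds to Lipschitz test functions\<close>

text \<open>Dominated convergence along sequences: by the mean value theorem every difference
  quotient is a value of the derivative at a nearby point and so is dominated by
  \<open>w\<close>.\<close>

lemma has_real_derivative_integral:
  fixes F G :: "real \<Rightarrow> 'a \<Rightarrow> real"
  assumes e: "e > 0" and F: "\<And>t. \<bar>t - a\<bar> < e \<Longrightarrow> integrable M (F t)"
    and d: "\<And>t x. x \<in> space M \<Longrightarrow> \<bar>t - a\<bar> < e \<Longrightarrow> ((\<lambda>t. F t x) has_real_derivative G t x) (at t)"
    and b: "\<And>t x. x \<in> space M \<Longrightarrow> \<bar>t - a\<bar> < e \<Longrightarrow> \<bar>G t x\<bar> \<le> w x" and w: "integrable M w"
  shows "((\<lambda>t. \<integral>x. F t x \<partial>M) has_real_derivative (\<integral>x. G a x \<partial>M)) (at a)"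
  unfolding DERIV_def tendsto_at_iff_sequentially
proof (intro allI impI)
  fix X :: "nat \<Rightarrow> real" assume X0: "\<forall>i. X i \<in> UNIV - {0}" and X: "X \<longlonglongrightarrow> 0"
  obtain K where K: "\<And>i. i \<ge> K \<Longrightarrow> \<bar>X i\<bar> < e" using LIMSEQ_D[OF X e] by auto
  \<comment> \<open>Only indices beyond \<open>K\<close> keep \<open>a + Z i\<close> in the range
    where the hypotheses hold.\<close>
  define Z where "Z i = X (i + K)" for i
  have Z0: "Z i \<noteq> 0" and Ze: "\<bar>Z i\<bar> < e" for i using X0 K by (auto simp: Z_def)
  have Z: "Z \<longlonglongrightarrow> 0" unfolding Z_def using X by (rule LIMSEQ_ignore_initial_segment)
  define s where "s i x = (F (a + Z i) x - F a x) / Z i" for i x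
  have si: "integrable M (s i)" for i unfolding s_def using F[of "a + Z i"] F[of a] Ze[of i] e by simp
  have lim: "(\<lambda>i. s i x) \<longlonglongrightarrow> G a x" if "x \<in> space M" for x
  proof -
    have "((\<lambda>h. (F (a + h) x - F a x) / h) \<longlongrightarrow> G a x) (at 0)" using d[OF that, of a] e by (simp add: DERIV_def)
    then show ?thesis using Z Z0 unfolding tendsto_at_iff_sequentially s_def[abs_def] comp_def by auto
  qed
  have bd: "\<bar>s i x\<bar> \<le> w x" if x: "x \<in> space M" for i x
  proof -
    have "\<exists>z. \<bar>z - a\<bar> < e \<and> F (a + Z i) x - F a x = Z i * G z x"
    proof (cases "Z i > 0")
      case True
      have "\<exists>z. a < z \<and> z < a + Z i \<and> F (a + Z i) x - F a x = (a + Z i - a) * G z x"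
        using True Ze[of i] by (intro MVT2 d[OF x]) auto
      then show ?thesis using Ze[of i] by force
    next
      case False
      then have "Z i < 0" using Z0[of i] by linarith
      have "\<exists>z. a + Z i < z \<and> z < a \<and> F a x - F (a + Z i) x = (a - (a + Z i)) * G z x"
        using \<open>Z i < 0\<close> Ze[of i] by (intro MVT2 d[OF x]) auto
      then obtain z where "a + Z i < z" "z < a" "F a x - F (a + Z i) x = - Z i * G z x" by auto
      then show ?thesis using Ze[of i] by (intro exI[of _ z]) auto
    qed
    then obtain z where z: "\<bar>z - a\<bar> < e" "F (a + Z i) x - F a x = Z i * G z x" by blast
    then have "s i x = G z x" using Z0[of i] by (simp add: s_def)
    then show ?thesis using b[OF x z(1)] by simp
  qed
  have Gm: "G a \<in> borel_measurable M" by (rule borel_measurable_LIMSEQ_metric[where f = s]) (use si lim in auto)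
  have "(\<lambda>i. \<integral>x. s i x \<partial>M) \<longlonglongrightarrow> (\<integral>x. G a x \<partial>M)"
    by (rule integral_dominated_convergence[OF Gm _ w]) (use si lim bd in \<open>auto intro!: AE_I2\<close>)
  moreover have "(\<integral>x. s i x \<partial>M) = ((\<integral>x. F (a + Z i) x \<partial>M) - (\<integral>x. F a x \<partial>M)) / Z i" for i
    unfolding s_def using F[of "a + Z i"] F[of a] Ze[of i] e by simp
  ultimately have "(\<lambda>i. (((\<lambda>h. ((\<integral>x. F (a + h) x \<partial>M) - (\<integral>x. F a x \<partial>M)) / h) \<circ> X) (i + K))) \<longlonglongrightarrow> (\<integral>x. G a x \<partial>M)"
    by (simp add: Z_def)
  then show "((\<lambda>h. ((\<integral>x. F (a + h) x \<partial>M) - (\<integral>x. F a x \<partial>M)) / h) \<circ> X) \<longlonglongrightarrow> (\<integral>x. G a x \<partial>M)"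
    by (rule LIMSEQ_offset)
qed

section \<open>Gaussian integration by parts\<close>

lemma std_normal_density_deriv: "(std_normal_density has_real_derivative - x * std_normal_density x) (at x)"
proof -
  have "((\<lambda>x. c * exp (- x\<^sup>2 / 2)) has_real_derivative - x * (c * exp (- x\<^sup>2 / 2))) (at x)" for c
    by (auto intro!: derivative_eq_intros)
  then show ?thesis unfolding std_normal_density_def .
qed

lemma std_normal_density_tendsto_0:
  "(std_normal_density \<longlongrightarrow> 0) at_top" "(std_normal_density \<longlongrightarrow> 0) at_bot"
  unfolding std_normal_density_def by real_asymp+

lemma integral_gam:
  fixes f :: "real \<Rightarrow> real"
  assumes [measurable]: "f \<in> borel_measurable borel"
  shows "(\<integral>x. f x \<partial>gam) = (\<integral>x. std_normal_density x * f x \<partial>lborel)"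
    and "integrable gam f \<longleftrightarrow> integrable lborel (\<lambda>x. std_normal_density x * f x)"
  by (simp_all add: integral_density integrable_density)

lemma integrable_gam_abs: "integrable gam (\<lambda>x. \<bar>x\<bar>)"
  using gam_moments(1) by (rule integrable_abs)

lemma integrable_gam_bounded:
  fixes f :: "real \<Rightarrow> real"
  assumes "f \<in> borel_measurable borel" "\<And>x. \<bar>f x\<bar> \<le> K"
  shows "integrable gam f"
  using prob_space.integrable_bounded_fun[OF prob_space_gam, of f K] assms by simp

text \<open>With the density included, the integrand of the difference is the derivative of
  \<open>k x * std_normal_density x\<close>, which vanishes at both ends of the line.\<close>

lemma gaussian_integration_by_parts:
  fixes k k' :: "real \<Rightarrow> real"
  assumes d: "\<And>x. (k has_real_derivative k' x) (at x)" and c: "continuous_on UNIV k'"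
    and K: "\<And>x. \<bar>k x\<bar> \<le> K" and A: "\<And>x. \<bar>k' x\<bar> \<le> A"
  shows "(\<integral>x. x * k x \<partial>gam) = (\<integral>x. k' x \<partial>gam)"
proof -
  let ?p = std_normal_density
  have kc: "continuous_on UNIV k" using d by (intro continuous_at_imp_continuous_on) (auto intro: DERIV_isCont)
  have [measurable]: "k \<in> borel_measurable borel" "k' \<in> borel_measurable borel"
    using kc c by (auto intro: borel_measurable_continuous_onI)
  have i1: "integrable gam k'" using A by (intro integrable_gam_bounded) auto
  have i2: "integrable gam (\<lambda>x. x * k x)"
  proof (rule Bochner_Integration.integrable_bound)
    show "integrable gam (\<lambda>x. K * x)" using gam_moments by simp
    show "AE x in gam. norm (x * k x) \<le> norm (K * x)"
      using abs_mult_le[OF order_refl order_trans[OF K abs_ge_self]] by (intro AE_I2) (simp add: mult.commute[of K] abs_mult)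
  qed simp
  define F where "F x = k x * ?p x" for x
  define f where "f x = ?p x * k' x - ?p x * (x * k x)" for x
  have if': "integrable lborel f"
    unfolding f_def using i1 i2 by (intro Bochner_Integration.integrable_diff) (simp_all add: integral_gam)
  have pc: "isCont ?p x" for x using std_normal_density_deriv by (rule DERIV_isCont)
  have lim0: "(F \<longlongrightarrow> 0) at_top" "(F \<longlongrightarrow> 0) at_bot"
  proof -
    have "\<bar>F x\<bar> \<le> K * ?p x" for x unfolding F_def using abs_mult_le[OF K[of x] order_refl, of "?p x"] by simp
    then have b: "\<forall>\<^sub>F x in G. norm (F x) \<le> K * ?p x" for G by simp
    show "(F \<longlongrightarrow> 0) at_top" "(F \<longlongrightarrow> 0) at_bot"
      using tendsto_mult_right_zero[OF std_normal_density_tendsto_0(1), of K] tendsto_mult_right_zero[OF std_normal_density_tendsto_0(2), of K]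
      by (auto intro: Lim_null_comparison[OF b])
  qed
  have "(LBINT x=-\<infinity>..\<infinity>. f x) = 0 - 0"
  proof (rule interval_integral_FTC_integrable)
    show "(F has_vector_derivative f x) (at x)" for x
      unfolding has_real_derivative_iff_has_vector_derivative[symmetric] F_def[abs_def] f_def
      by (rule derivative_eq_intros d std_normal_density_deriv refl)+ (simp add: algebra_simps)
    show "isCont f x" for x
      unfolding f_def[abs_def] using pc c kc by (intro continuous_intros) (auto simp: continuous_on_eq_continuous_at)
    show "set_integrable lborel (einterval (-\<infinity>) \<infinity>) f" using if' by (simp add: set_integrable_def)
    show "((F \<circ> real_of_ereal) \<longlongrightarrow> 0) (at_right (- \<infinity>))" "((F \<circ> real_of_ereal) \<longlongrightarrow> 0) (at_left \<infinity>)"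
      using lim0 by (simp_all add: ereal_tendsto_simps)
  qed simp
  then have "(\<integral>x. f x \<partial>lborel) = 0" by (simp add: interval_lebesgue_integral_def set_lebesgue_integral_def)
  then show ?thesis
    unfolding f_def using i1 i2 by (subst (asm) Bochner_Integration.integral_diff) (simp_all add: integral_gam)
qed

lemma derivative_bound_lipschitz:
  fixes f f' :: "real \<Rightarrow> real"
  assumes "\<And>x. (f has_real_derivative f' x) (at x)" "\<And>x. \<bar>f' x\<bar> \<le> c"
  shows "\<bar>f x - f y\<bar> \<le> c * \<bar>x - y\<bar>"
  using field_differentiable_bound[of UNIV f f' c y x] assms by (simp add: abs_minus_commute)

text \<open>Differentiate \<open>E h(sin \<theta> Y + cos \<theta> \<sigma> Z)\<close> along \<open>\<theta> \<in> [0, \<pi>/2]\<close>; in contrast to the solution of Stein's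
  equation this needs no lower bound on \<open>\<sigma>\<close>.\<close>

theorem stein_interpolation:
  fixes Y :: "'a \<Rightarrow> real" and h h' h'' :: "real \<Rightarrow> real"
  assumes "prob_space M" and Y[measurable]: "Y \<in> borel_measurable M" and Yb: "\<And>\<omega>. \<bar>Y \<omega>\<bar> \<le> n" and \<sigma>: "0 \<le> \<sigma>"
    and h: "\<And>x. (h has_real_derivative h' x) (at x)" and h': "\<And>x. (h' has_real_derivative h'' x) (at x)"
    and h'1: "\<And>x. \<bar>h' x\<bar> \<le> 1" and h''A: "\<And>x. \<bar>h'' x\<bar> \<le> A" and h''B: "\<And>x y. \<bar>h'' x - h'' y\<bar> \<le> B * \<bar>x - y\<bar>"
    and stein: "\<And>f f'. (\<And>x. (f has_real_derivative f' x) (at x)) \<Longrightarrow> (\<And>x. \<bar>f' x\<bar> \<le> A) \<Longrightarrow>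
      (\<And>x y. \<bar>f' x - f' y\<bar> \<le> B * \<bar>x - y\<bar>) \<Longrightarrow> \<bar>(\<integral>\<omega>. Y \<omega> * f (Y \<omega>) \<partial>M) - \<sigma>\<^sup>2 * (\<integral>\<omega>. f' (Y \<omega>) \<partial>M)\<bar> \<le> D"
  shows "\<bar>(\<integral>\<omega>. h (Y \<omega>) \<partial>M) - (\<integral>z. h (\<sigma> * z) \<partial>gam)\<bar> \<le> D * (pi / 2)"
proof -
  interpret M: prob_space M by fact
  interpret G: prob_space gam by (rule prob_space_gam)
  interpret MG: pair_prob_space M gam ..
  have A0: "0 \<le> A" using h''A[of 0] by (rule order_trans[OF abs_ge_zero])
  have B0: "0 \<le> B" using h''B[of 1 0] abs_ge_zero[of "h'' 1 - h'' 0"] by simp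
  have cont: "continuous_on UNIV h" "continuous_on UNIV h'" "continuous_on UNIV h''"
    using h h' lipschitz_real_continuous[OF h''B] by (auto intro!: continuous_at_imp_continuous_on DERIV_isCont)
  have [measurable]: "h \<in> borel_measurable borel" "h' \<in> borel_measurable borel" "h'' \<in> borel_measurable borel"
    using cont by (auto intro: borel_measurable_continuous_onI)
  have h1: "\<bar>h x\<bar> \<le> \<bar>h 0\<bar> + \<bar>x\<bar>" for x using derivative_bound_lipschitz[OF h h'1, of x 0] by simp
  \<comment> \<open>A quarter turn from \<open>\<sigma> * z\<close> at angle 0 to \<open>y\<close>
    at \<open>pi / 2\<close>. If \<open>y\<close> were an independent centred normal variable of
    variance \<open>\<sigma>\<^sup>2\<close>, the law of \<open>U\<close> would not depend on the
    angle.\<close>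
  define U where "U \<theta> y z = sin \<theta> * y + cos \<theta> * (\<sigma> * z)" for \<theta> y z :: real
  have \<sigma>z: "\<bar>\<sigma> * z\<bar> = \<sigma> * \<bar>z\<bar>" for z using \<sigma> by (simp add: abs_mult)
  have Ub: "\<bar>U \<theta> (Y \<omega>) z\<bar> \<le> n + \<sigma> * \<bar>z\<bar>" for \<theta> \<omega> z
    unfolding U_def using abs_mult_le[OF abs_sin_le_one Yb, of \<theta> \<omega>] abs_mult_le[OF abs_cos_le_one order_refl, of \<theta> "\<sigma> * z"] \<sigma>z[of z]
    by linarith
  have wb: "\<bar>cos t * Y \<omega> - sin t * (\<sigma> * z)\<bar> \<le> n + \<sigma> * \<bar>z\<bar>" for t \<omega> z
    using abs_mult_le[OF abs_cos_le_one Yb, of t \<omega>] abs_mult_le[OF abs_sin_le_one order_refl, of t "\<sigma> * z"] \<sigma>z[of z]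
    by linarith
  have [measurable]: "(\<lambda>p. U \<theta> (Y (fst p)) (snd p)) \<in> borel_measurable (M \<Otimes>\<^sub>M gam)" for \<theta>
    unfolding U_def by measurable
  have iz: "integrable (M \<Otimes>\<^sub>M gam) (\<lambda>p. \<bar>snd p\<bar>)"
    by (intro MG.Fubini_integrable) (simp_all add: integrable_gam_abs)
  define P where "P \<theta> = (\<integral>p. h (U \<theta> (Y (fst p)) (snd p)) \<partial>(M \<Otimes>\<^sub>M gam))" for \<theta>
  have iP: "integrable (M \<Otimes>\<^sub>M gam) (\<lambda>p. h (U \<theta> (Y (fst p)) (snd p)))" for \<theta>
  proof (rule Bochner_Integration.integrable_bound)
    show "integrable (M \<Otimes>\<^sub>M gam) (\<lambda>p. \<bar>h 0\<bar> + (n + \<sigma> * \<bar>snd p\<bar>))" using iz by simp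
    show "AE p in M \<Otimes>\<^sub>M gam. norm (h (U \<theta> (Y (fst p)) (snd p))) \<le> norm (\<bar>h 0\<bar> + (n + \<sigma> * \<bar>snd p\<bar>))"
      unfolding real_norm_def using order_trans[OF order_trans[OF h1 add_left_mono[OF Ub]] abs_ge_self] by (intro AE_I2)
  qed simp
  define Q where "Q \<theta> = (\<lambda>p. h' (U \<theta> (Y (fst p)) (snd p)) * (cos \<theta> * Y (fst p) - sin \<theta> * (\<sigma> * snd p)))" for \<theta>
  have P': "(P has_real_derivative (\<integral>p. Q \<theta> p \<partial>(M \<Otimes>\<^sub>M gam))) (at \<theta>)" for \<theta>
    unfolding P_def
  proof (rule has_real_derivative_integral[OF zero_less_one iP])
    show "integrable (M \<Otimes>\<^sub>M gam) (\<lambda>p. n + \<sigma> * \<bar>snd p\<bar>)" using iz by simp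
    fix t and p :: "'a \<times> real"
    show "((\<lambda>t. h (U t (Y (fst p)) (snd p))) has_real_derivative Q t p) (at t)"
      unfolding U_def Q_def by (rule derivative_eq_intros DERIV_chain2[OF h] refl)+ (simp add: algebra_simps)
    have "\<bar>cos t * Y (fst p) - sin t * (\<sigma> * snd p)\<bar> \<le> n + \<sigma> * \<bar>snd p\<bar>"
      by (rule wb)
    then show "\<bar>Q t p\<bar> \<le> n + \<sigma> * \<bar>snd p\<bar>" unfolding Q_def using abs_mult_le[OF h'1] by force
  qed
  have Qb: "\<bar>\<integral>p. Q \<theta> p \<partial>(M \<Otimes>\<^sub>M gam)\<bar> \<le> D" for \<theta>
  proof -
    \<comment> \<open>\<open>f\<close> averages \<open>h'\<close> over the Gaussian variable at a
      fixed angle. It inherits the bounds \<open>A\<close> and \<open>B\<close> of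
      \<open>h''\<close>, so \<open>stein\<close> applies to it, and integration by parts in
      \<open>z\<close> shows that the derivative in the angle is \<open>cos \<theta>\<close> times
      the Stein expression of \<open>f\<close>.\<close>
    define f where "f y = (\<integral>z. h' (U \<theta> y z) \<partial>gam)" for y
    define f' where "f' y = (\<integral>z. h'' (U \<theta> y z) * sin \<theta> \<partial>gam)" for y
    have Um[measurable]: "(\<lambda>z. U \<theta> y z) \<in> borel_measurable borel" for y unfolding U_def by measurable
    have ih': "integrable gam (\<lambda>z. h' (U \<theta> y z))" for y using h'1 by (intro integrable_gam_bounded) auto
    have ih'': "integrable gam (\<lambda>z. h'' (U \<theta> y z))" for y using h''A by (intro integrable_gam_bounded) auto
    have As: "\<bar>h'' x * sin \<theta>\<bar> \<le> A" for x using abs_mult_le[OF h''A abs_sin_le_one] by simp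
    have fd: "(f has_real_derivative f' y) (at y)" for y
      unfolding f_def f'_def
    proof (rule has_real_derivative_integral[OF zero_less_one ih'])
      show "((\<lambda>t. h' (U \<theta> t x)) has_real_derivative h'' (U \<theta> t x) * sin \<theta>) (at t)" for t x
        unfolding U_def by (rule derivative_eq_intros DERIV_chain2[OF h'] refl)+ simp
    qed (use As in auto)
    have f'A: "\<bar>f' y\<bar> \<le> A" for y
    proof -
      have "\<bar>f' y\<bar> \<le> (\<integral>z. A \<partial>gam)" unfolding f'_def using As by (intro G.abs_expectation_le) auto
      then show ?thesis using G.prob_space by simp
    qed
    have f'B: "\<bar>f' x - f' y\<bar> \<le> B * \<bar>x - y\<bar>" for x y
    proof -
      have "\<bar>\<integral>z. h'' (U \<theta> x z) * sin \<theta> - h'' (U \<theta> y z) * sin \<theta> \<partial>gam\<bar> \<le> (\<integral>z. B * \<bar>x - y\<bar> \<partial>gam)"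
      proof (rule G.abs_expectation_le)
        fix z
        have "\<bar>U \<theta> x z - U \<theta> y z\<bar> \<le> \<bar>x - y\<bar>"
          unfolding U_def using abs_mult_le[OF abs_sin_le_one order_refl, of \<theta> "x - y"] by (simp add: algebra_simps)
        then have "\<bar>h'' (U \<theta> x z) - h'' (U \<theta> y z)\<bar> \<le> B * \<bar>x - y\<bar>"
          using h''B[of "U \<theta> x z" "U \<theta> y z"] B0 mult_left_mono order_trans by blast
        from abs_mult_le[OF this abs_sin_le_one, of \<theta>]
        show "\<bar>h'' (U \<theta> x z) * sin \<theta> - h'' (U \<theta> y z) * sin \<theta>\<bar> \<le> B * \<bar>x - y\<bar>" by (simp add: left_diff_distrib)
      qed simp
      then show ?thesis unfolding f'_def using ih'' G.prob_space by simp
    qed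
    have fc: "continuous_on UNIV f" using fd by (auto intro!: continuous_at_imp_continuous_on DERIV_isCont)
    have f'c: "continuous_on UNIV f'" by (rule lipschitz_real_continuous[OF f'B])
    have [measurable]: "f \<in> borel_measurable borel" "f' \<in> borel_measurable borel"
      using fc f'c by (auto intro: borel_measurable_continuous_onI)
    have ibp: "(\<integral>z. z * h' (U \<theta> y z) \<partial>gam) = cos \<theta> * \<sigma> * (\<integral>z. h'' (U \<theta> y z) \<partial>gam)" for y
    proof -
      have "(\<integral>z. z * h' (U \<theta> y z) \<partial>gam) = (\<integral>z. h'' (U \<theta> y z) * (cos \<theta> * \<sigma>) \<partial>gam)"
      proof (rule gaussian_integration_by_parts)
        show "((\<lambda>z. h' (U \<theta> y z)) has_real_derivative h'' (U \<theta> y z) * (cos \<theta> * \<sigma>)) (at z)" for z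
          unfolding U_def by (rule derivative_eq_intros DERIV_chain2[OF h'] refl)+ simp
        show "continuous_on UNIV (\<lambda>z. h'' (U \<theta> y z) * (cos \<theta> * \<sigma>))"
          unfolding U_def by (intro continuous_intros continuous_on_compose2[OF cont(3)]) auto
        show "\<bar>h' (U \<theta> y z)\<bar> \<le> 1" for z by (rule h'1)
        show "\<bar>h'' (U \<theta> y z) * (cos \<theta> * \<sigma>)\<bar> \<le> A * \<bar>cos \<theta> * \<sigma>\<bar>" for z by (rule abs_mult_le[OF h''A order_refl])
      qed
      then show ?thesis by simp
    qed
    have iQ: "integrable (M \<Otimes>\<^sub>M gam) (Q \<theta>)"
    proof (rule Bochner_Integration.integrable_bound)
      show "integrable (M \<Otimes>\<^sub>M gam) (\<lambda>p. n + \<sigma> * \<bar>snd p\<bar>)" using iz by simp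
      show "AE p in M \<Otimes>\<^sub>M gam. norm (Q \<theta> p) \<le> norm (n + \<sigma> * \<bar>snd p\<bar>)"
      proof (intro AE_I2)
        fix p :: "'a \<times> real"
        have "\<bar>cos \<theta> * Y (fst p) - sin \<theta> * (\<sigma> * snd p)\<bar> \<le> n + \<sigma> * \<bar>snd p\<bar>"
          by (rule wb)
        then have "\<bar>Q \<theta> p\<bar> \<le> n + \<sigma> * \<bar>snd p\<bar>" unfolding Q_def using abs_mult_le[OF h'1] by force
        then show "norm (Q \<theta> p) \<le> norm (n + \<sigma> * \<bar>snd p\<bar>)" by simp
      qed
    qed (unfold Q_def, measurable)
    have izh: "integrable gam (\<lambda>z. z * h' (U \<theta> y z))" for y
    proof (rule Bochner_Integration.integrable_bound[OF gam_moments(1)])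
      show "AE z in gam. norm (z * h' (U \<theta> y z)) \<le> norm z"
        using abs_mult_le[OF order_refl h'1] by (intro AE_I2) simp
    qed simp
    have "(\<integral>p. Q \<theta> p \<partial>(M \<Otimes>\<^sub>M gam)) = (\<integral>\<omega>. (\<integral>z. Q \<theta> (\<omega>, z) \<partial>gam) \<partial>M)"
      using MG.integral_fst'[OF iQ] by simp
    also have "\<dots> = (\<integral>\<omega>. cos \<theta> * (Y \<omega> * f (Y \<omega>) - \<sigma>\<^sup>2 * f' (Y \<omega>)) \<partial>M)"
    proof (intro Bochner_Integration.integral_cong refl)
      fix \<omega>
      have "(\<integral>z. Q \<theta> (\<omega>, z) \<partial>gam) = (\<integral>z. cos \<theta> * Y \<omega> * h' (U \<theta> (Y \<omega>) z) - sin \<theta> * \<sigma> * (z * h' (U \<theta> (Y \<omega>) z)) \<partial>gam)"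
        by (simp add: Q_def algebra_simps)
      also have "\<dots> = cos \<theta> * Y \<omega> * f (Y \<omega>) - sin \<theta> * \<sigma> * (\<integral>z. z * h' (U \<theta> (Y \<omega>) z) \<partial>gam)"
        using ih' izh by (simp add: f_def)
      also have "\<dots> = cos \<theta> * (Y \<omega> * f (Y \<omega>) - \<sigma>\<^sup>2 * f' (Y \<omega>))"
        unfolding ibp f'_def by (simp add: algebra_simps power2_eq_square)
      finally show "(\<integral>z. Q \<theta> (\<omega>, z) \<partial>gam) = cos \<theta> * (Y \<omega> * f (Y \<omega>) - \<sigma>\<^sup>2 * f' (Y \<omega>))" .
    qed
    also have "\<dots> = cos \<theta> * ((\<integral>\<omega>. Y \<omega> * f (Y \<omega>) \<partial>M) - \<sigma>\<^sup>2 * (\<integral>\<omega>. f' (Y \<omega>) \<partial>M))"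
    proof -
      have fb: "\<bar>f y\<bar> \<le> 1" for y
      proof -
        have "\<bar>f y\<bar> \<le> (\<integral>z. 1 \<partial>gam)" unfolding f_def using h'1 by (intro G.abs_expectation_le) auto
        then show ?thesis using G.prob_space by simp
      qed
      have "integrable M (\<lambda>\<omega>. Y \<omega> * f (Y \<omega>))" "integrable M (\<lambda>\<omega>. f' (Y \<omega>))"
        using abs_mult_le[OF Yb fb] f'A by (auto intro!: M.integrable_bounded_fun)
      then show ?thesis by simp
    qed
    finally have e: "(\<integral>p. Q \<theta> p \<partial>(M \<Otimes>\<^sub>M gam)) = cos \<theta> * ((\<integral>\<omega>. Y \<omega> * f (Y \<omega>) \<partial>M) - \<sigma>\<^sup>2 * (\<integral>\<omega>. f' (Y \<omega>) \<partial>M))" .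
    show ?thesis unfolding e using abs_mult_le[OF abs_cos_le_one stein[OF fd f'A f'B], of \<theta>] by simp
  qed
  have "\<bar>P (pi / 2) - P 0\<bar> \<le> D * \<bar>pi / 2 - 0\<bar>" by (rule derivative_bound_lipschitz[OF P' Qb])
  moreover have "P (pi / 2) = (\<integral>\<omega>. h (Y \<omega>) \<partial>M)"
    using MG.integral_fst'[OF iP[of "pi/2"]] G.prob_space by (simp add: P_def U_def)
  moreover have "P 0 = (\<integral>z. h (\<sigma> * z) \<partial>gam)"
    using MG.integral_fst'[OF iP[of 0]] M.prob_space by (simp add: P_def U_def)
  ultimately show ?thesis by simp
qed

text \<open>The average of \<open>h\<close> over a window of length \<open>e\<close> to the right
  gains one derivative and, by the mean value theorem, equals a value of \<open>h\<close> in the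
  window.\<close>

lemma moving_average:
  fixes h :: "real \<Rightarrow> real"
  assumes h: "continuous_on UNIV h" and e: "e > 0"
  obtains h1 where "\<And>x. (h1 has_real_derivative (h (x + e) - h x) / e) (at x)" "\<And>x. \<exists>s. 0 \<le> s \<and> s \<le> e \<and> h1 x = h (x + s)"
proof -
  obtain H where "\<And>x. (H has_vector_derivative h x) (at x)"
    using einterval_antiderivative[of "-\<infinity>" \<infinity> h] h by (auto simp: continuous_on_eq_continuous_at)
  then have H: "(H has_real_derivative h x) (at x)" for x by (simp add: has_real_derivative_iff_has_vector_derivative)
  have H': "((\<lambda>x. H (x + e)) has_real_derivative h (x + e)) (at x)" for x
    using DERIV_shift[of H "h (x + e)" x e] H by simp
  show ?thesis
  proof (rule that[of "\<lambda>x. (H (x + e) - H x) / e"])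
    show "((\<lambda>x. (H (x + e) - H x) / e) has_real_derivative (h (x + e) - h x) / e) (at x)" for x
      by (intro DERIV_cdivide DERIV_diff H H')
    show "\<exists>s. 0 \<le> s \<and> s \<le> e \<and> (H (x + e) - H x) / e = h (x + s)" for x
    proof -
      obtain z where "x < z" "z < x + e" "H (x + e) - H x = (x + e - x) * h z" using MVT2[of x "x + e" H h] H e by auto
      then show ?thesis using e by (intro exI[of _ "z - x"]) auto
    qed
  qed
qed

text \<open>Two moving averages of width \<open>e\<close> give a test function whose second
  derivative is a second difference quotient of \<open>h\<close>: bounded by \<open>2 / e\<close>
  and Lipschitz with constant \<open>4 / e\<^sup>2\<close>. The averages move the argument by at
  most \<open>2 * e\<close>, and the replacement is made for both laws, hence
  \<open>4 * e\<close>.\<close>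

theorem stein_lipschitz:
  fixes Y :: "'a \<Rightarrow> real" and h :: "real \<Rightarrow> real"
  assumes "prob_space M" and [measurable]: "Y \<in> borel_measurable M" and Yb: "\<And>\<omega>. \<bar>Y \<omega>\<bar> \<le> n" and \<sigma>: "0 \<le> \<sigma>"
    and h: "\<And>x y. \<bar>h x - h y\<bar> \<le> \<bar>x - y\<bar>" and e: "e > 0"
    and stein: "\<And>f f'. (\<And>x. (f has_real_derivative f' x) (at x)) \<Longrightarrow> (\<And>x. \<bar>f' x\<bar> \<le> 2 / e) \<Longrightarrow>
      (\<And>x y. \<bar>f' x - f' y\<bar> \<le> 4 / e\<^sup>2 * \<bar>x - y\<bar>) \<Longrightarrow> \<bar>(\<integral>\<omega>. Y \<omega> * f (Y \<omega>) \<partial>M) - \<sigma>\<^sup>2 * (\<integral>\<omega>. f' (Y \<omega>) \<partial>M)\<bar> \<le> D"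
  shows "\<bar>(\<integral>\<omega>. h (Y \<omega>) \<partial>M) - (\<integral>z. h (\<sigma> * z) \<partial>gam)\<bar> \<le> 4 * e + D * (pi / 2)"
proof -
  interpret M: prob_space M by fact
  interpret G: prob_space gam by (rule prob_space_gam)
  have hc: "continuous_on UNIV h" by (rule lipschitz_real_continuous[of h 1]) (use h in simp)
  obtain h1 where h1: "\<And>x. (h1 has_real_derivative (h (x + e) - h x) / e) (at x)" "\<And>x. \<exists>s. 0 \<le> s \<and> s \<le> e \<and> h1 x = h (x + s)"
    using moving_average[OF hc e] by blast
  have h1b: "\<bar>(h (x + e) - h x) / e\<bar> \<le> 1" for x using h[of "x + e" x] e by (simp add: divide_le_eq)
  have h1l: "\<bar>h1 x - h1 y\<bar> \<le> 1 * \<bar>x - y\<bar>" for x y by (rule derivative_bound_lipschitz[OF h1(1) h1b])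
  have h1c: "continuous_on UNIV h1" by (rule lipschitz_real_continuous[OF h1l])
  obtain h2 where h2: "\<And>x. (h2 has_real_derivative (h1 (x + e) - h1 x) / e) (at x)" "\<And>x. \<exists>s. 0 \<le> s \<and> s \<le> e \<and> h2 x = h1 (x + s)"
    using moving_average[OF h1c e] by blast
  define h' where "h' x = (h1 (x + e) - h1 x) / e" for x
  define k where "k x = (h (x + e) - h x) / e" for x
  define h'' where "h'' x = (k (x + e) - k x) / e" for x
  have d2: "(h' has_real_derivative h'' x) (at x)" for x
    unfolding h'_def[abs_def] h''_def k_def
    using h1(1)[of "x + e", unfolded DERIV_shift] h1(1)[of x] by (intro DERIV_cdivide DERIV_diff)
  have h'1: "\<bar>h' x\<bar> \<le> 1" for x unfolding h'_def using h1l[of "x + e" x] e by (simp add: divide_le_eq)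
  have kb: "\<bar>k x\<bar> \<le> 1" for x unfolding k_def by (rule h1b)
  have h''A: "\<bar>h'' x\<bar> \<le> 2 / e" for x
    unfolding h''_def abs_divide using kb[of "x + e"] kb[of x] e by (intro frac_le) auto
  have kl: "\<bar>k x - k y\<bar> \<le> 2 * \<bar>x - y\<bar> / e" for x y
  proof -
    have "k x - k y = ((h (x + e) - h (y + e)) - (h x - h y)) / e" unfolding k_def by (simp add: diff_divide_distrib)
    moreover have "\<bar>(h (x + e) - h (y + e)) - (h x - h y)\<bar> \<le> 2 * \<bar>x - y\<bar>" using add_mono[OF h[of "x + e" "y + e"] h[of x y]] by (intro order_trans[OF abs_triangle_ineq4]) simp
    ultimately show ?thesis using e by (simp only: abs_divide abs_of_pos) (intro divide_right_mono; simp)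
  qed
  have h''B: "\<bar>h'' x - h'' y\<bar> \<le> 4 / e\<^sup>2 * \<bar>x - y\<bar>" for x y
  proof -
    have "h'' x - h'' y = ((k (x + e) - k (y + e)) - (k x - k y)) / e" unfolding h''_def by (simp add: diff_divide_distrib)
    then have "\<bar>h'' x - h'' y\<bar> \<le> (2 * \<bar>x - y\<bar> / e + 2 * \<bar>x - y\<bar> / e) / e"
      using e order_trans[OF abs_triangle_ineq4 add_mono[OF kl[of "x + e" "y + e"] kl[of x y]]] by (simp only: abs_divide abs_of_pos) (intro divide_right_mono; simp)
    then show ?thesis by (simp add: power2_eq_square)
  qed
  have main: "\<bar>(\<integral>\<omega>. h2 (Y \<omega>) \<partial>M) - (\<integral>z. h2 (\<sigma> * z) \<partial>gam)\<bar> \<le> D * (pi / 2)"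
    using stein_interpolation[OF assms(1,2) Yb \<sigma> h2(1)[folded h'_def] d2 h'1 h''A h''B stein] .
  have close: "\<bar>h x - h2 x\<bar> \<le> 2 * e" for x
  proof -
    obtain s where s: "0 \<le> s" "s \<le> e" "h2 x = h1 (x + s)" using h2(2) by blast
    obtain s' where s': "0 \<le> s'" "s' \<le> e" "h1 (x + s) = h (x + s + s')" using h1(2) by blast
    show ?thesis using h[of x "x + s + s'"] s s' by simp
  qed
  have h2c: "continuous_on UNIV h2" using h2(1) by (auto intro!: continuous_at_imp_continuous_on DERIV_isCont)
  have [measurable]: "h \<in> borel_measurable borel" "h2 \<in> borel_measurable borel"
    using hc h2c by (auto intro: borel_measurable_continuous_onI)
  have hb: "\<bar>h x\<bar> \<le> \<bar>h 0\<bar> + \<bar>x\<bar>" for x using h[of x 0] by simp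
  have h2b: "\<bar>h2 x\<bar> \<le> \<bar>h 0\<bar> + 2 * e + \<bar>x\<bar>" for x using close[of x] hb[of x] by linarith
  have "\<bar>h (Y \<omega>)\<bar> \<le> \<bar>h 0\<bar> + 2 * e + n" "\<bar>h2 (Y \<omega>)\<bar> \<le> \<bar>h 0\<bar> + 2 * e + n" for \<omega>
    using hb[of "Y \<omega>"] h2b[of "Y \<omega>"] Yb[of \<omega>] e by linarith+
  then have iY: "integrable M (\<lambda>\<omega>. h (Y \<omega>))" "integrable M (\<lambda>\<omega>. h2 (Y \<omega>))"
    by (auto intro!: M.integrable_bounded_fun)
  have ig: "integrable gam (\<lambda>z. g (\<sigma> * z))" if [measurable]: "g \<in> borel_measurable borel" and "\<And>x. \<bar>g x\<bar> \<le> \<bar>h 0\<bar> + 2 * e + \<bar>x\<bar>" for g :: "real \<Rightarrow> real"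
  proof (rule Bochner_Integration.integrable_bound)
    show "integrable gam (\<lambda>z. \<bar>h 0\<bar> + 2 * e + \<bar>\<sigma> * z\<bar>)" using integrable_gam_abs by (simp add: abs_mult)
    show "AE z in gam. norm (g (\<sigma> * z)) \<le> norm (\<bar>h 0\<bar> + 2 * e + \<bar>\<sigma> * z\<bar>)"
      unfolding real_norm_def using order_trans[OF that(2) abs_ge_self] by (intro AE_I2)
  qed simp
  have hb': "\<bar>h x\<bar> \<le> \<bar>h 0\<bar> + 2 * e + \<bar>x\<bar>" for x using hb[of x] e by linarith
  have d1: "\<bar>(\<integral>\<omega>. h (Y \<omega>) \<partial>M) - (\<integral>\<omega>. h2 (Y \<omega>) \<partial>M)\<bar> \<le> 2 * e"
  proof -
    have "\<bar>\<integral>\<omega>. h (Y \<omega>) - h2 (Y \<omega>) \<partial>M\<bar> \<le> (\<integral>\<omega>. 2 * e \<partial>M)" using close by (intro M.abs_expectation_le) auto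
    then show ?thesis using iY M.prob_space by simp
  qed
  have d3: "\<bar>(\<integral>z. h (\<sigma> * z) \<partial>gam) - (\<integral>z. h2 (\<sigma> * z) \<partial>gam)\<bar> \<le> 2 * e"
  proof -
    have "\<bar>\<integral>z. h (\<sigma> * z) - h2 (\<sigma> * z) \<partial>gam\<bar> \<le> (\<integral>z. 2 * e \<partial>gam)" using close by (intro G.abs_expectation_le) auto
    then show ?thesis using ig[of h] ig[of h2] hb' h2b G.prob_space by simp
  qed
  show ?thesis using main d1 d3 by linarith
qed

section \<open>Bivariate normal tails and Hermite polynomials\<close>

lemma std_normal_density_le_1: "std_normal_density x \<le> 1"
proof -
  have "1 / sqrt (2 * pi) \<le> 1" using pi_gt3 by (simp add: real_le_rsqrt)
  moreover have "exp (- x\<^sup>2 / 2) \<le> 1" by simp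
  ultimately have "1 / sqrt (2 * pi) * exp (- x\<^sup>2 / 2) \<le> 1 * 1" by (intro mult_mono) auto
  then show ?thesis by (simp add: std_normal_density_def)
qed

lemma normal_tail_eq_gam: "normal_tail u = (\<integral>x. indicator {u..} x \<partial>gam)"
  unfolding normal_tail_def set_lebesgue_integral_def by (subst integral_gam) (simp_all add: mult.commute)

lemma normal_tail_bounds: "0 \<le> normal_tail u" "normal_tail u \<le> 1"
proof -
  interpret prob_space gam by (rule prob_space_gam)
  show "0 \<le> normal_tail u" unfolding normal_tail_eq_gam by simp
  have "normal_tail u = measure gam {u..}" unfolding normal_tail_eq_gam by simp
  then show "normal_tail u \<le> 1" using prob_le_1 by simp
qed

lemma normal_tail_deriv: "(normal_tail has_real_derivative - std_normal_density u) (at u)"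
proof -
  let ?p = std_normal_density
  have pc: "isCont ?p x" for x using std_normal_density_deriv by (rule DERIV_isCont)
  obtain H where "\<And>x. (H has_vector_derivative ?p x) (at x)"
    using einterval_antiderivative[of "-\<infinity>" \<infinity> ?p] pc by auto
  then have H: "(H has_real_derivative ?p x) (at x)" for x by (simp add: has_real_derivative_iff_has_vector_derivative)
  have d: "normal_tail a - normal_tail b = H b - H a" if "a \<le> b" for a b
  proof -
    have "normal_tail a - normal_tail b = (\<integral>x. indicator {a..} x * ?p x - indicator {b..} x * ?p x \<partial>lborel)"
      unfolding normal_tail_def set_lebesgue_integral_def
      by (subst Bochner_Integration.integral_diff) (auto intro!: integrable_real_mult_indicator simp: mult.commute[of "indicator _ _"])
    also have "\<dots> = (\<integral>x. ?p x * indicator {a .. b} x \<partial>lborel)"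
      using AE_lborel_singleton[of b] that by (intro integral_cong_AE) (auto elim!: eventually_mono split: split_indicator)
    also have "\<dots> = H b - H a" using that H pc by (intro integral_FTC_Icc_real)
    finally show ?thesis .
  qed
  have "normal_tail x = (normal_tail 0 + H 0) - H x" for x
    using d[of 0 x] d[of x 0] by (cases "0 \<le> x") auto
  then have "normal_tail = (\<lambda>x. (normal_tail 0 + H 0) - H x)" by (rule ext)
  moreover have "((\<lambda>x. (normal_tail 0 + H 0) - H x) has_real_derivative - ?p u) (at u)"
    using DERIV_diff[OF DERIV_const H, of "normal_tail 0 + H 0"] by simp
  ultimately show ?thesis by simp
qed

lemma normal_tail_measurable[measurable]: "normal_tail \<in> borel_measurable borel"
  using normal_tail_deriv by (intro borel_measurable_continuous_onI continuous_at_imp_continuous_on) (auto intro: DERIV_isCont)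

text \<open>For \<open>\<bar>\<rho>\<bar> < 1\<close>, the probability that both variables of a
  standard normal pair with correlation \<rho> reach \<open>u\<close>, conditioned on the first one.
  As a one-dimensional integral with \<rho> in the integrand it can be differentiated
  directly.\<close>

definition bivariate_tail :: "real \<Rightarrow> real \<Rightarrow> real" where
  "bivariate_tail u \<rho> = (\<integral>x. indicator {u..} x * normal_tail ((u - \<rho> * x) / sqrt (1 - \<rho>\<^sup>2)) \<partial>gam)"

lemma bivariate_tail_bounds: "0 \<le> bivariate_tail u \<rho>" "bivariate_tail u \<rho> \<le> 1"
proof -
  interpret prob_space gam by (rule prob_space_gam)
  have b: "0 \<le> indicator {u..} x * normal_tail y" "indicator {u..} x * normal_tail y \<le> 1" for x y
    using normal_tail_bounds[of y] by (auto split: split_indicator)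
  show "0 \<le> bivariate_tail u \<rho>" unfolding bivariate_tail_def using b by (intro Bochner_Integration.integral_nonneg) auto
  have "\<bar>bivariate_tail u \<rho>\<bar> \<le> (\<integral>x. 1 \<partial>gam)" unfolding bivariate_tail_def using b by (intro abs_expectation_le) auto
  then show "bivariate_tail u \<rho> \<le> 1" using prob_space by simp
qed

lemma bivariate_tail_0: "bivariate_tail u 0 = (normal_tail u)\<^sup>2"
proof -
  have "normal_tail u = measure gam {u..}" unfolding normal_tail_eq_gam by simp
  then show ?thesis by (simp add: bivariate_tail_def power2_eq_square)
qed

text \<open>Density at \<open>(u, u)\<close> of a standard normal pair with correlation \<rho>; it
  is the derivative in Plackett's identity.\<close>

definition plackett :: "real \<Rightarrow> real \<Rightarrow> real" where
  "plackett u \<rho> = std_normal_density u * std_normal_density ((u - \<rho> * u) / sqrt (1 - \<rho>\<^sup>2)) / sqrt (1 - \<rho>\<^sup>2)"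

lemma one_minus_square_pos: "\<bar>t\<bar> < 1 \<Longrightarrow> 0 < 1 - t\<^sup>2" for t :: real
  by (simp add: abs_square_less_1)

text \<open>After differentiation under the integral the integrand has an explicit antiderivative in
  \<open>x\<close>, namely minus the joint density at \<open>(x, u)\<close>; only the boundary term
  at \<open>x = u\<close> survives.\<close>

lemma bivariate_tail_deriv:
  assumes a: "\<bar>a\<bar> < 1"
  shows "((bivariate_tail u) has_real_derivative plackett u a) (at a)"
proof -
  interpret prob_space gam by (rule prob_space_gam)
  let ?p = std_normal_density
  define G where "G t x = indicator {u..} x * (?p ((u - t * x) / sqrt (1 - t\<^sup>2)) * ((x - t * u) / sqrt (1 - t\<^sup>2) ^ 3))" for t x
  have Gm: "G t \<in> borel_measurable borel" for t unfolding G_def[abs_def] by measurable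
  define m where "m = (1 + \<bar>a\<bar>) / 2"
  define c where "c = sqrt (1 - m\<^sup>2)"
  have m: "0 \<le> m" "m < 1" using a by (auto simp: m_def)
  then have c0: "c > 0" unfolding c_def using one_minus_square_pos[of m] by simp
  have tm: "\<bar>t\<bar> < m" if "\<bar>t - a\<bar> < (1 - \<bar>a\<bar>) / 2" for t using that abs_triangle_ineq[of a "t - a"] by (simp add: m_def field_simps)
  have tc: "c \<le> sqrt (1 - t\<^sup>2)" if "\<bar>t\<bar> < m" for t
  proof -
    have "t\<^sup>2 \<le> m\<^sup>2" using that m by (simp add: abs_le_square_iff[symmetric])
    then show ?thesis unfolding c_def by simp
  qed
  have Gb: "\<bar>G t x\<bar> \<le> (\<bar>x\<bar> + \<bar>u\<bar>) / c ^ 3" if "\<bar>t\<bar> < m" for t x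
  proof -
    have "\<bar>t * u\<bar> \<le> \<bar>u\<bar>" using abs_mult_le[of t 1 u "\<bar>u\<bar>"] that m by simp
    then have "\<bar>x - t * u\<bar> \<le> \<bar>x\<bar> + \<bar>u\<bar>" by linarith
    then have 1: "\<bar>(x - t * u) / sqrt (1 - t\<^sup>2) ^ 3\<bar> \<le> (\<bar>x\<bar> + \<bar>u\<bar>) / c ^ 3"
      using tc[OF that] c0 power_mono[OF tc[OF that], of 3] unfolding abs_divide by (intro frac_le) auto
    have 2: "\<bar>?p y\<bar> \<le> 1" for y using std_normal_density_le_1 by simp
    have 3: "\<bar>indicator {u..} x\<bar> \<le> (1::real)" by (simp split: split_indicator)
    show ?thesis unfolding G_def using abs_mult_le[OF 3 abs_mult_le[OF 2 1]] by simp
  qed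
  have w: "integrable gam (\<lambda>x. (\<bar>x\<bar> + \<bar>u\<bar>) / c ^ 3)" using integrable_gam_abs by simp
  have d: "((bivariate_tail u) has_real_derivative (\<integral>x. G a x \<partial>gam)) (at a)"
    unfolding bivariate_tail_def
  proof (rule has_real_derivative_integral[where e = "(1 - \<bar>a\<bar>) / 2"])
    show "0 < (1 - \<bar>a\<bar>) / 2" using a by simp
    show "integrable gam (\<lambda>x. (\<bar>x\<bar> + \<bar>u\<bar>) / c ^ 3)" by (rule w)
    show "integrable gam (\<lambda>x. indicator {u..} x * normal_tail ((u - t * x) / sqrt (1 - t\<^sup>2)))" for t
      using normal_tail_bounds by (intro integrable_gam_bounded[where K = 1]) (auto split: split_indicator)
    fix t x assume t: "\<bar>t - a\<bar> < (1 - \<bar>a\<bar>) / 2"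
    have t1: "\<bar>t\<bar> < 1" using tm[OF t] m by simp
    have p: "0 < 1 - t\<^sup>2" using one_minus_square_pos[OF t1] .
    define s where "s = sqrt (1 - t\<^sup>2)"
    have s: "s > 0" "s\<^sup>2 = 1 - t\<^sup>2" using p by (simp_all add: s_def)
    have "((\<lambda>t. (u - t * x) / sqrt (1 - t\<^sup>2)) has_real_derivative (- x * s - (u - t * x) * (inverse s / 2 * (- (2 * t)))) / (s * s)) (at t)"
      unfolding s_def using p by (auto intro!: derivative_eq_intros)
    moreover have "(- x * s - (u - t * x) * (inverse s / 2 * (- (2 * t)))) / (s * s) = - ((x - t * u) / s ^ 3)"
    proof -
      have "(- x * s - (u - t * x) * (inverse s / 2 * (- (2 * t)))) / (s * s) = (- x * s\<^sup>2 + (u - t * x) * t) / s ^ 3"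
        using s(1) by (simp add: field_simps power2_eq_square power3_eq_cube)
      also have "- x * s\<^sup>2 + (u - t * x) * t = - (x - t * u)" unfolding s(2) by (simp add: algebra_simps power2_eq_square)
      finally show ?thesis unfolding minus_divide_left .
    qed
    ultimately have e: "((\<lambda>t. (u - t * x) / sqrt (1 - t\<^sup>2)) has_real_derivative - ((x - t * u) / s ^ 3)) (at t)" by simp
    have "((\<lambda>t. normal_tail ((u - t * x) / sqrt (1 - t\<^sup>2))) has_real_derivative - ?p ((u - t * x) / s) * - ((x - t * u) / s ^ 3)) (at t)"
      unfolding s_def by (rule DERIV_chain2[OF normal_tail_deriv e[unfolded s_def]])
    from DERIV_cmult[OF this, of "indicator {u..} x"]
    show "((\<lambda>t. indicator {u..} x * normal_tail ((u - t * x) / sqrt (1 - t\<^sup>2))) has_real_derivative G t x) (at t)"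
      by (simp add: G_def s_def)
    show "\<bar>G t x\<bar> \<le> (\<bar>x\<bar> + \<bar>u\<bar>) / c ^ 3" by (rule Gb[OF tm[OF t]])
  qed
  define s where "s = sqrt (1 - a\<^sup>2)"
  have p: "0 < 1 - a\<^sup>2" using one_minus_square_pos[OF a] .
  have s: "s > 0" "s\<^sup>2 = 1 - a\<^sup>2" using p by (simp_all add: s_def)
  define g where "g x = ?p x * (?p ((u - a * x) / s) * ((x - a * u) / s ^ 3))" for x
  define F where "F x = - (1 / s) * (?p x * ?p ((u - a * x) / s))" for x
  have am: "\<bar>a\<bar> < m" using a by (simp add: m_def)
  have iG: "integrable gam (G a)"
  proof (rule Bochner_Integration.integrable_bound[OF w])
    show "AE x in gam. norm (G a x) \<le> norm ((\<bar>x\<bar> + \<bar>u\<bar>) / c ^ 3)"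
      unfolding real_norm_def using order_trans[OF Gb[OF am] abs_ge_self] by (intro AE_I2)
  qed (unfold G_def[abs_def], measurable)
  have [measurable]: "g \<in> borel_measurable borel" unfolding g_def by measurable
  have ig: "integrable lborel (\<lambda>x. indicator {u..} x * g x)"
  proof -
    have "integrable lborel (\<lambda>x. ?p x * G a x)" using iG unfolding integral_gam(2)[OF Gm] .
    then show ?thesis by (simp add: G_def g_def s_def mult_ac)
  qed
  have e0: "(\<integral>x. G a x \<partial>gam) = (\<integral>x. indicator {u..} x * g x \<partial>lborel)"
    unfolding integral_gam(1)[OF Gm] by (simp add: G_def g_def s_def mult_ac)
  have AEi: "AE x in lborel. indicator {u..} x * g x = indicator (einterval (ereal u) \<infinity>) x * g x"
    using AE_lborel_singleton[of u] by (rule eventually_mono) (auto simp: einterval_def split: split_indicator)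
  have Fd: "(F has_real_derivative g x) (at x)" for x
  proof -
    have e: "((\<lambda>x. (u - a * x) / s) has_real_derivative - a / s) (at x)"
      using s(1) by (auto intro!: derivative_eq_intros)
    have d': "(F has_real_derivative - (1 / s) * ((- x * ?p x) * ?p ((u - a * x) / s) + (- ((u - a * x) / s) * ?p ((u - a * x) / s) * (- a / s)) * ?p x)) (at x)"
      unfolding F_def[abs_def] by (intro DERIV_cmult DERIV_mult std_normal_density_deriv DERIV_chain2[OF std_normal_density_deriv e])
    have "- (1 / s) * ((- x * P) * Q + (- ((u - a * x) / s) * Q * (- a / s)) * P) = P * (Q * ((x * s\<^sup>2 - a * (u - a * x)) / s ^ 3))" for P Q
      using s(1) by (simp add: field_simps power2_eq_square power3_eq_cube)
    moreover have "x * s\<^sup>2 - a * (u - a * x) = x - a * u" unfolding s(2) by (simp add: algebra_simps power2_eq_square)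
    ultimately show ?thesis using d' by (simp add: g_def)
  qed
  have Fc: "isCont F x" for x using Fd by (rule DERIV_isCont)
  have gc: "isCont g x" for x
  proof -
    have e: "((\<lambda>x. (u - a * x) / s) has_real_derivative - a / s) (at x)"
      using s(1) by (auto intro!: derivative_eq_intros)
    have "isCont (\<lambda>x. ?p ((u - a * x) / s)) x"
      by (rule DERIV_isCont[OF DERIV_chain2[OF std_normal_density_deriv e]])
    moreover have "isCont (\<lambda>x. (x - a * u) / s ^ 3) x" using s(1) by (auto intro!: continuous_intros)
    ultimately show ?thesis
      unfolding g_def[abs_def] by (intro continuous_mult DERIV_isCont[OF std_normal_density_deriv])
  qed
  have Flim: "(F \<longlongrightarrow> 0) at_top"
  proof (rule Lim_null_comparison)
    show "((\<lambda>x. (1 / s) * ?p x) \<longlongrightarrow> 0) at_top"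
      using tendsto_mult_right_zero[OF std_normal_density_tendsto_0(1)] .
    have "\<bar>F x\<bar> \<le> (1 / s) * (?p x * 1)" for x
      unfolding F_def using s(1) std_normal_density_le_1 by (simp add: abs_mult mult_left_le divide_right_mono)
    then show "\<forall>\<^sub>F x in at_top. norm (F x) \<le> (1 / s) * ?p x" by simp
  qed
  have "(LBINT x=ereal u..\<infinity>. g x) = 0 - F u"
  proof (rule interval_integral_FTC_integrable)
    show "(F has_vector_derivative g x) (at x)" for x using Fd by (simp add: has_real_derivative_iff_has_vector_derivative)
    show "set_integrable lborel (einterval (ereal u) \<infinity>) g"
      unfolding set_integrable_def real_scaleR_def using AEi ig
      by (subst integrable_cong_AE[where g = "\<lambda>x. indicator {u..} x * g x"]) (auto elim!: eventually_mono)
    show "((F \<circ> real_of_ereal) \<longlongrightarrow> F u) (at_right (ereal u))"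
      using Fc[of u] by (simp add: ereal_tendsto_simps isCont_def tendsto_within_subset[where S = UNIV])
    show "((F \<circ> real_of_ereal) \<longlongrightarrow> 0) (at_left \<infinity>)" using Flim by (simp add: ereal_tendsto_simps)
  qed (use gc in auto)
  also have "(LBINT x=ereal u..\<infinity>. g x) = (\<integral>x. indicator {u..} x * g x \<partial>lborel)"
    unfolding interval_lebesgue_integral_def set_lebesgue_integral_def
    using AEi by (simp, intro integral_cong_AE) (auto elim!: eventually_mono)
  finally have "(\<integral>x. G a x \<partial>gam) = plackett u a" unfolding e0 by (simp add: F_def plackett_def s_def)
  then show ?thesis using d by simp
qed

section \<open>Mehler's formula on the diagonal\<close>

definition hermite_weight :: "real \<Rightarrow> nat \<Rightarrow> real" where
  "hermite_weight u n = (hermite n u)\<^sup>2 / fact n"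

lemma hermite_weight_nonneg: "0 \<le> hermite_weight u n" by (simp add: hermite_weight_def)

text \<open>The square of the recurrence is split by Young's inequality with parameter \<epsilon>.
  After division by the factorial the term from degree \<open>n\<close> has ratio at most 1, and the
  term from degree \<open>n + 1\<close> carries a factor \<open>u\<^sup>2 / (n + 2)\<close>, which
  is eventually negligible. Thus the weights grow more slowly than any exponential.\<close>

lemma hermite_weight_growth:
  assumes \<epsilon>: "\<epsilon> > 0" and n: "(1 + 1 / \<epsilon>) * u\<^sup>2 \<le> \<epsilon> * real (Suc (Suc n))"
  shows "hermite_weight u (Suc (Suc n)) \<le> (1 + \<epsilon>) * hermite_weight u n + \<epsilon> * hermite_weight u (Suc n)"
proof -
  define p q N where "p = hermite n u" and "q = hermite (Suc n) u" and "N = real (Suc n)"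
  have N: "N > 0" by (simp add: N_def)
  have f: "fact (Suc n) = N * (fact n::real)" "fact (Suc (Suc n)) = (N + 1) * N * (fact n::real)" by (simp_all add: N_def)
  have amgm: "(x - y)\<^sup>2 \<le> (1 + \<epsilon>) * y\<^sup>2 + (1 + 1 / \<epsilon>) * x\<^sup>2" for x y
  proof -
    have "0 \<le> (\<epsilon> * y + x)\<^sup>2 / \<epsilon>" using \<epsilon> by simp
    also have "\<dots> = (1 + \<epsilon>) * y\<^sup>2 + (1 + 1 / \<epsilon>) * x\<^sup>2 - (x - y)\<^sup>2"
      using \<epsilon> by (simp add: power2_eq_square field_simps)
    finally show ?thesis by simp
  qed
  have "(u * q - N * p)\<^sup>2 \<le> (1 + \<epsilon>) * (N * p)\<^sup>2 + (1 + 1 / \<epsilon>) * (u * q)\<^sup>2" by (rule amgm)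
  also have "\<dots> = (1 + \<epsilon>) * (N * N) * p\<^sup>2 + ((1 + 1 / \<epsilon>) * u\<^sup>2) * q\<^sup>2" by (simp add: power2_eq_square)
  also have "\<dots> \<le> (1 + \<epsilon>) * ((N + 1) * N) * p\<^sup>2 + (\<epsilon> * (N + 1)) * q\<^sup>2"
    using n N \<epsilon> by (intro add_mono mult_right_mono mult_left_mono) (auto simp: N_def)
  finally have "(u * q - N * p)\<^sup>2 / ((N + 1) * N * fact n) \<le> ((1 + \<epsilon>) * ((N + 1) * N) * p\<^sup>2 + (\<epsilon> * (N + 1)) * q\<^sup>2) / ((N + 1) * N * fact n)"
    using N by (intro divide_right_mono) auto
  also have "\<dots> = (1 + \<epsilon>) * (p\<^sup>2 / fact n) + \<epsilon> * (q\<^sup>2 / (N * fact n))"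
  proof -
    have "((1 + \<epsilon>) * (K * N) * P + (\<epsilon> * K) * Q) / (K * N * F) = (1 + \<epsilon>) * (P / F) + \<epsilon> * (Q / (N * F))"
      if "K \<noteq> 0" "F \<noteq> 0" for K P Q F :: real
      using that N by (simp add: add_divide_distrib)
    from this[of "N + 1" "fact n"] show ?thesis using N by simp
  qed
  finally show ?thesis unfolding hermite_weight_def f p_def q_def by (simp add: N_def)
qed

lemma hermite_weight_summable:
  assumes x: "\<bar>x\<bar> < 1"
  shows "summable (\<lambda>n. hermite_weight u n * x ^ n)"
proof -
  define y where "y = (1 + \<bar>x\<bar>) / 2"
  have y: "0 < y" "y < 1" "\<bar>x\<bar> < y" using x by (auto simp: y_def)
  \<comment> \<open>With this choice \<open>(1 + 2 * \<epsilon>) * y\<close> equals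
    \<open>(1 + y) / 2\<close>, a ratio below 1. The maximum of two consecutive weights is followed
    because the growth bound reaches back two degrees.\<close>
  define \<epsilon> where "\<epsilon> = (1 - y) / (4 * y)"
  have \<epsilon>: "\<epsilon> > 0" "(1 + 2 * \<epsilon>) * y < 1" using y by (simp_all add: \<epsilon>_def field_simps)
  define M where "M n = max (hermite_weight u n) (hermite_weight u (Suc n))" for n
  have M0: "0 \<le> M n" for n by (simp add: M_def hermite_weight_nonneg le_max_iff_disj)
  obtain K where K: "(1 + 1 / \<epsilon>) * u\<^sup>2 / \<epsilon> \<le> real K" using real_arch_simple by blast
  have step: "M (Suc n) \<le> (1 + 2 * \<epsilon>) * M n" if "n \<ge> K" for n
  proof -
    have "(1 + 1 / \<epsilon>) * u\<^sup>2 / \<epsilon> \<le> real (Suc (Suc n))" using K that by linarith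
    then have "(1 + 1 / \<epsilon>) * u\<^sup>2 \<le> \<epsilon> * real (Suc (Suc n))" using \<epsilon>(1) by (simp add: pos_divide_le_eq mult.commute)
    note hermite_weight_growth[OF \<epsilon>(1) this]
    also have "(1 + \<epsilon>) * hermite_weight u n + \<epsilon> * hermite_weight u (Suc n) \<le> (1 + \<epsilon>) * M n + \<epsilon> * M n"
      using \<epsilon> by (intro add_mono mult_left_mono) (auto simp: M_def)
    finally have "hermite_weight u (Suc (Suc n)) \<le> (1 + 2 * \<epsilon>) * M n" by (simp add: algebra_simps)
    moreover have "hermite_weight u (Suc n) \<le> (1 + 2 * \<epsilon>) * M n"
      using \<epsilon> M0[of n] mult_right_mono[of 1 "1 + 2 * \<epsilon>" "M n"] by (auto simp: M_def)
    ultimately show ?thesis by (simp add: M_def)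
  qed
  have "summable (\<lambda>n. M n * y ^ n)"
  proof (rule summable_ratio_test[OF \<epsilon>(2)])
    fix n assume "n \<ge> K"
    have "M (Suc n) * y ^ Suc n \<le> ((1 + 2 * \<epsilon>) * M n) * y ^ Suc n" using step[OF \<open>n \<ge> K\<close>] y by (intro mult_right_mono) auto
    then show "norm (M (Suc n) * y ^ Suc n) \<le> (1 + 2 * \<epsilon>) * y * norm (M n * y ^ n)"
      using M0 y by (simp add: abs_mult mult_ac)
  qed
  then show ?thesis
  proof (rule summable_comparison_test'[where N = 0])
    fix n
    have "\<bar>x ^ n\<bar> \<le> y ^ n" unfolding power_abs using y by (intro power_mono) auto
    then have "\<bar>hermite_weight u n * x ^ n\<bar> \<le> M n * y ^ n"
      using hermite_weight_nonneg by (intro abs_mult_le) (auto simp: M_def)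
    then show "norm (hermite_weight u n * x ^ n) \<le> M n * y ^ n" by simp
  qed
qed

lemma sums_power_shift:
  fixes f :: "nat \<Rightarrow> real"
  assumes "(\<lambda>n. f n * x ^ n) sums s"
  shows "(\<lambda>n. (case n of 0 \<Rightarrow> 0 | Suc m \<Rightarrow> f m) * x ^ n) sums (x * s)"
proof -
  have "(\<lambda>n. x * (f n * x ^ n)) sums (x * s)" using assms by (rule sums_mult)
  then have "(\<lambda>n. (case Suc n of 0 \<Rightarrow> 0 | Suc m \<Rightarrow> f m) * x ^ Suc n) sums (x * s)" by (simp add: mult_ac)
  then show ?thesis by (subst (asm) sums_Suc_iff) simp
qed

text \<open>This is the differential equation
  \<open>(1 + x - x\<^sup>2 - x\<^sup>3) S' = (u\<^sup>2 + (1 - u\<^sup>2) x + x\<^sup>2) S\<close>, solved by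
  \<open>(1 - x\<^sup>2) powr (-1/2) * exp (u\<^sup>2 x / (1 + x))\<close>.\<close>

lemma hermite_weight_recurrence:
  fixes u :: real
  defines "a \<equiv> hermite_weight u" and "c \<equiv> u\<^sup>2"
  defines "d \<equiv> \<lambda>n. real (Suc n) * a (Suc n)"
  shows "d 0 = c * a 0" "d (Suc 0) + d 0 = c * a (Suc 0) + (1 - c) * a 0"
    "d (Suc (Suc 0)) + d (Suc 0) - d 0 = c * a (Suc (Suc 0)) + (1 - c) * a (Suc 0) + a 0"
    "d (Suc (Suc (Suc n))) + d (Suc (Suc n)) - d (Suc n) - d n =
      c * a (Suc (Suc (Suc n))) + (1 - c) * a (Suc (Suc n)) + a (Suc n)"
proof -
  have d: "d n = (hermite (Suc n) u)\<^sup>2 / fact n" for n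
  proof -
    have "fact (Suc n) = real (Suc n) * fact n" by simp
    then show ?thesis unfolding d_def a_def hermite_weight_def by (simp del: of_nat_Suc fact_Suc)
  qed
  show "d 0 = c * a 0" "d (Suc 0) + d 0 = c * a (Suc 0) + (1 - c) * a 0"
    "d (Suc (Suc 0)) + d (Suc 0) - d 0 = c * a (Suc (Suc 0)) + (1 - c) * a (Suc 0) + a 0"
    unfolding d by (simp_all add: a_def c_def hermite_weight_def power2_eq_square field_simps)
  define w p N F where "w = hermite (Suc n) u" and "p = hermite (Suc (Suc n)) u" and "N = real n" and "F = (fact n :: real)"
  define q where "q = u * p - (N + 2) * w"
  have q: "hermite (Suc (Suc (Suc n))) u = q" by (simp add: q_def p_def w_def N_def)
  have q': "hermite (Suc (Suc (Suc (Suc n)))) u = u * q - (N + 3) * p"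
    by (subst hermite.simps(3)) (simp only: q, simp add: p_def N_def)
  have F: "F \<noteq> 0" and N: "N \<ge> 0" by (simp_all add: F_def N_def)
  have f: "fact (Suc n) = (N + 1) * F" "fact (Suc (Suc n)) = (N + 2) * ((N + 1) * F)"
     "fact (Suc (Suc (Suc n))) = (N + 3) * ((N + 2) * ((N + 1) * F))" by (simp_all add: F_def N_def add.commute)
  \<comment> \<open>The last case of the recurrence over the common denominator \<open>D\<close>:
    all four Hermite values are expressed through \<open>w\<close> and \<open>p\<close>, and the
    equation becomes a polynomial identity.\<close>
  have e: "(u * q - (N + 3) * p)\<^sup>2 + (N + 3) * q\<^sup>2 - (N + 3) * (N + 2) * p\<^sup>2 - (N + 3) * (N + 2) * (N + 1) * w\<^sup>2
     = u\<^sup>2 * q\<^sup>2 + (1 - u\<^sup>2) * (N + 3) * p\<^sup>2 + (N + 3) * (N + 2) * w\<^sup>2"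
    unfolding q_def by (simp add: power2_eq_square algebra_simps)
  define D where "D = (N + 3) * ((N + 2) * ((N + 1) * F))"
  have D0: "D \<noteq> 0" "N + 1 \<noteq> 0" "N + 2 \<noteq> 0" "N + 3 \<noteq> 0" using F N by (auto simp: D_def)
  have r: "z / ((N + 2) * ((N + 1) * F)) = (N + 3) * z / D" "z / ((N + 1) * F) = (N + 3) * (N + 2) * z / D"
     "z / F = (N + 3) * (N + 2) * (N + 1) * z / D" for z
    using F D0 by (simp_all add: D_def)
  show "d (Suc (Suc (Suc n))) + d (Suc (Suc n)) - d (Suc n) - d n =
      c * a (Suc (Suc (Suc n))) + (1 - c) * a (Suc (Suc n)) + a (Suc n)"
    unfolding d a_def c_def hermite_weight_def q q' f F_def[symmetric] w_def[symmetric] p_def[symmetric]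
    unfolding D_def[symmetric] r
    using e by (simp add: add_divide_distrib[symmetric] diff_divide_distrib[symmetric] mult_ac)
qed

lemma hermite_generating:
  assumes x: "\<bar>x\<bar> < 1"
  shows "(\<Sum>n. hermite_weight u n * x ^ n) = exp (u\<^sup>2 * x / (1 + x)) / sqrt (1 - x\<^sup>2)"
proof -
  let ?a = "hermite_weight u"
  define S where "S y = (\<Sum>n. ?a n * y ^ n)" for y
  define S' where "S' y = (\<Sum>n. diffs ?a n * y ^ n)" for y
  have half: "\<bar>y\<bar> < (1 + \<bar>y\<bar>) / 2" "(1 + \<bar>y\<bar>) / 2 < 1" if "\<bar>y\<bar> < 1" for y :: real using that by auto
  have Sd: "(S has_real_derivative S' y) (at y)" if y: "\<bar>y\<bar> < 1" for y
    unfolding S_def[abs_def] S'_def using half[OF y]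
    by (intro termdiffs_strong[where K = "(1 + \<bar>y\<bar>) / 2"] hermite_weight_summable) auto
  have ode: "(1 + y - y\<^sup>2 - y ^ 3) * S' y = (u\<^sup>2 + (1 - u\<^sup>2) * y + y\<^sup>2) * S y" if y: "\<bar>y\<bar> < 1" for y
  proof -
    have sS: "(\<lambda>n. ?a n * y ^ n) sums S y" unfolding S_def using hermite_weight_summable[OF y] by (rule summable_sums)
    have sS': "(\<lambda>n. diffs ?a n * y ^ n) sums S' y"
      unfolding S'_def using half[OF y]
      by (intro summable_sums termdiff_converges[where K = "(1 + \<bar>y\<bar>) / 2"] hermite_weight_summable) auto
    note s1 = sums_power_shift[OF sS] and d1 = sums_power_shift[OF sS']
    note s2 = sums_power_shift[OF s1] and d2 = sums_power_shift[OF d1]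
    note d3 = sums_power_shift[OF d2]
    \<comment> \<open>Coefficientwise form of the differential equation; each nested
      \<open>case\<close> is a shift of the coefficients and stands for one more factor
      \<open>y\<close>.\<close>
    have L: "(\<lambda>n. diffs ?a n * y ^ n + (case n of 0 \<Rightarrow> 0 | Suc m \<Rightarrow> diffs ?a m) * y ^ n
        - (case n of 0 \<Rightarrow> 0 | Suc m \<Rightarrow> (case m of 0 \<Rightarrow> 0 | Suc m \<Rightarrow> diffs ?a m)) * y ^ n
        - (case n of 0 \<Rightarrow> 0 | Suc m \<Rightarrow> (case m of 0 \<Rightarrow> 0 | Suc m \<Rightarrow> (case m of 0 \<Rightarrow> 0 | Suc m \<Rightarrow> diffs ?a m))) * y ^ n)
       sums (S' y + y * S' y - y * (y * S' y) - y * (y * (y * S' y)))"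
      by (intro sums_add sums_diff sS' d1 d2 d3)
    have R: "(\<lambda>n. u\<^sup>2 * (?a n * y ^ n) + (1 - u\<^sup>2) * ((case n of 0 \<Rightarrow> 0 | Suc m \<Rightarrow> ?a m) * y ^ n)
        + (case n of 0 \<Rightarrow> 0 | Suc m \<Rightarrow> (case m of 0 \<Rightarrow> 0 | Suc m \<Rightarrow> ?a m)) * y ^ n)
       sums (u\<^sup>2 * S y + (1 - u\<^sup>2) * (y * S y) + y * (y * S y))"
      by (intro sums_add sums_mult sS s1 s2)
    have "diffs ?a n + (case n of 0 \<Rightarrow> 0 | Suc m \<Rightarrow> diffs ?a m)
        - (case n of 0 \<Rightarrow> 0 | Suc m \<Rightarrow> (case m of 0 \<Rightarrow> 0 | Suc m \<Rightarrow> diffs ?a m))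
        - (case n of 0 \<Rightarrow> 0 | Suc m \<Rightarrow> (case m of 0 \<Rightarrow> 0 | Suc m \<Rightarrow> (case m of 0 \<Rightarrow> 0 | Suc m \<Rightarrow> diffs ?a m)))
       = u\<^sup>2 * ?a n + (1 - u\<^sup>2) * (case n of 0 \<Rightarrow> 0 | Suc m \<Rightarrow> ?a m)
        + (case n of 0 \<Rightarrow> 0 | Suc m \<Rightarrow> (case m of 0 \<Rightarrow> 0 | Suc m \<Rightarrow> ?a m))" for n
    proof -
      consider "n = 0" | "n = Suc 0" | "n = Suc (Suc 0)" | m where "n = Suc (Suc (Suc m))"
        by (metis not0_implies_Suc)
      then show ?thesis
      proof cases
        case 1
        then show ?thesis using hermite_weight_recurrence(1)[of u] by (simp add: diffs_def del: of_nat_Suc)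
      next
        case 2
        then show ?thesis using hermite_weight_recurrence(2)[of u] by (simp add: diffs_def del: of_nat_Suc)
      next
        case 3
        then show ?thesis using hermite_weight_recurrence(3)[of u] by (simp add: diffs_def del: of_nat_Suc)
      next
        case 4
        then show ?thesis using hermite_weight_recurrence(4)[where u = u and n = m] by (simp add: diffs_def del: of_nat_Suc)
      qed
    qed
    then have "S' y + y * S' y - y * (y * S' y) - y * (y * (y * S' y)) = u\<^sup>2 * S y + (1 - u\<^sup>2) * (y * S y) + y * (y * S y)"
      using sums_unique2[OF L] R by (simp only: distrib_right[symmetric] left_diff_distrib[symmetric] mult.assoc[symmetric])
    then show ?thesis by (simp add: algebra_simps power2_eq_square power3_eq_cube)
  qed
  \<comment> \<open>Quotient of the series by the claimed closed form; it will turn out to be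
    constant.\<close>
  define B where "B y = S y * (sqrt (1 - y\<^sup>2) * exp (- (u\<^sup>2 * y / (1 + y))))" for y
  have Bd: "(B has_real_derivative 0) (at y within {-1<..<1})" if "y \<in> {-1<..<1}" for y
  proof -
    have y: "\<bar>y\<bar> < 1" using that by auto
    have y1: "1 + y > 0" using that by auto
    have p: "0 < 1 - y\<^sup>2" using one_minus_square_pos[OF y] .
    define s where "s = sqrt (1 - y\<^sup>2)"
    have s: "s > 0" "s\<^sup>2 = 1 - y\<^sup>2" using p by (simp_all add: s_def)
    let ?E = "exp (- (u\<^sup>2 * y / (1 + y)))"
    have e1: "((\<lambda>y. sqrt (1 - y\<^sup>2)) has_real_derivative - y / s) (at y)"
      unfolding s_def using p by (auto intro!: derivative_eq_intros simp: field_simps)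
    have e2: "((\<lambda>y. exp (- (u\<^sup>2 * y / (1 + y)))) has_real_derivative ?E * - (u\<^sup>2 / (1 + y)\<^sup>2)) (at y)"
    proof -
      have "((\<lambda>y. u\<^sup>2 * y / (1 + y)) has_real_derivative u\<^sup>2 / (1 + y)\<^sup>2) (at y)"
        using y1 by (auto intro!: derivative_eq_intros simp: field_simps power2_eq_square)
      then show ?thesis by (intro DERIV_chain2[OF DERIV_exp] DERIV_minus)
    qed
    have "(B has_real_derivative S' y * (s * ?E) + (- y / s * ?E + ?E * - (u\<^sup>2 / (1 + y)\<^sup>2) * s) * S y) (at y)"
      unfolding B_def[abs_def] s_def using DERIV_mult[OF Sd[OF y] DERIV_mult[OF e1 e2]] by (simp only: s_def)
    moreover have "S' y * (s * ?E) + (- y / s * ?E + ?E * - (u\<^sup>2 / (1 + y)\<^sup>2) * s) * S y = 0"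
    proof -
      have gen: "(T' * (s * E) + (- z / s * E + E * - (V / W) * s) * T) * (s * W) = E * (T' * s\<^sup>2 * W - z * W * T - V * s\<^sup>2 * T)"
        if "W \<noteq> 0" "s \<noteq> 0" for W s T' E z V T :: real
        using that by (simp add: field_simps power2_eq_square)
      have "(S' y * (s * ?E) + (- y / s * ?E + ?E * - (u\<^sup>2 / (1 + y)\<^sup>2) * s) * S y) * (s * (1 + y)\<^sup>2)
        = ?E * (S' y * s\<^sup>2 * (1 + y)\<^sup>2 - y * (1 + y)\<^sup>2 * S y - u\<^sup>2 * s\<^sup>2 * S y)"
        using gen[of "(1 + y)\<^sup>2" s "S' y" ?E y "u\<^sup>2" "S y"] s(1) y1 by simp
      \<comment> \<open>The factorisation
        \<open>1 + y - y\<^sup>2 - y ^ 3 = (1 + y) * (1 - y\<^sup>2)\<close> brings in the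
        differential equation.\<close>
      also have "S' y * s\<^sup>2 * (1 + y)\<^sup>2 - y * (1 + y)\<^sup>2 * S y - u\<^sup>2 * s\<^sup>2 * S y
        = (1 + y) * ((1 + y - y\<^sup>2 - y ^ 3) * S' y - (u\<^sup>2 + (1 - u\<^sup>2) * y + y\<^sup>2) * S y)"
        unfolding s(2) by (simp add: algebra_simps power2_eq_square power3_eq_cube)
      also have "\<dots> = 0" using ode[OF y] by simp
      finally have "(S' y * (s * ?E) + (- y / s * ?E + ?E * - (u\<^sup>2 / (1 + y)\<^sup>2) * s) * S y) * (s * (1 + y)\<^sup>2) = 0" by simp
      then show ?thesis using s(1) y1 by simp
    qed
    ultimately show ?thesis by (auto intro: has_field_derivative_at_within)
  qed
  have "B x = B 0"
    using has_field_derivative_zero_constant[of "{-1<..<1}" B] Bd x by (auto simp: abs_less_iff)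
  moreover have "S 0 = hermite_weight u 0" unfolding S_def by (rule powser_zero)
  then have "B 0 = 1" by (simp add: B_def hermite_weight_def)
  ultimately have "S x * (sqrt (1 - x\<^sup>2) * exp (- (u\<^sup>2 * x / (1 + x)))) = 1" by (simp add: B_def)
  then show ?thesis
    using one_minus_square_pos[OF x] by (simp add: S_def exp_minus field_simps)
qed

section \<open>Covariance of two indicators as a power series in the correlation\<close>

definition tail_coeff :: "real \<Rightarrow> nat \<Rightarrow> real" where
  "tail_coeff u n = (std_normal_density u)\<^sup>2 * (hermite n u)\<^sup>2 / fact (Suc n)"

text \<open>For \<open>\<bar>x\<bar> < 1\<close>, the covariance of the indicators of
  \<open>{u..}\<close> at two standard normal variables with correlation \<open>x\<close>. In the
  Hermite expansion of this indicator degree \<open>n + 1\<close> carries the variance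
  \<open>tail_coeff u n\<close>; the constant term is absent, hence the shift of the index.\<close>

definition tail_cov :: "real \<Rightarrow> real \<Rightarrow> real" where
  "tail_cov u x = (\<Sum>n. tail_coeff u n * x ^ Suc n)"

lemma tail_coeff_nonneg: "0 \<le> tail_coeff u n" by (simp add: tail_coeff_def)

lemma tail_coeff_le_weight: "tail_coeff u n \<le> hermite_weight u n"
proof -
  have "(std_normal_density u)\<^sup>2 \<le> 1" using power_mono[OF std_normal_density_le_1, of u 2] by simp
  then have "(std_normal_density u)\<^sup>2 * (hermite n u)\<^sup>2 \<le> 1 * (hermite n u)\<^sup>2" by (intro mult_right_mono) auto
  then show ?thesis unfolding tail_coeff_def hermite_weight_def
    by (intro frac_le) (auto intro!: fact_mono simp del: fact_Suc)
qed

lemma tail_coeff_summable_power: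
  assumes "\<bar>x\<bar> < 1"
  shows "summable (\<lambda>n. tail_coeff u n * x ^ Suc n)"
proof -
  have "summable (\<lambda>n. hermite_weight u n * \<bar>x\<bar> ^ n)" using assms by (intro hermite_weight_summable) simp
  then show ?thesis
  proof (rule summable_comparison_test'[where N = 0])
    fix n
    have "\<bar>x ^ Suc n\<bar> \<le> \<bar>x\<bar> ^ n" using assms by (simp add: abs_mult power_abs mult_left_le_one_le)
    then show "norm (tail_coeff u n * x ^ Suc n) \<le> hermite_weight u n * \<bar>x\<bar> ^ n"
      unfolding real_norm_def using tail_coeff_nonneg tail_coeff_le_weight by (intro abs_mult_le) auto
  qed
qed

text \<open>Completing the square in the exponent of the density turns it into the closed form of
  Mehler's formula.\<close>

lemma plackett_eq:
  assumes x: "\<bar>x\<bar> < 1"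
  shows "plackett u x = (std_normal_density u)\<^sup>2 * (\<Sum>n. hermite_weight u n * x ^ n)"
proof -
  have x1: "1 + x > 0" "1 - x > 0" using x by auto
  define c where "c = 1 / sqrt (2 * pi)"
  have "(u - x * u)\<^sup>2 = u\<^sup>2 * (1 - x) * (1 - x)" "1 - x\<^sup>2 = (1 + x) * (1 - x)"
    by (simp_all add: power2_eq_square algebra_simps)
  then have "((u - x * u) / sqrt (1 - x\<^sup>2))\<^sup>2 = u\<^sup>2 * (1 - x) * (1 - x) / ((1 + x) * (1 - x))"
    using one_minus_square_pos[OF x] by (simp only: power_divide real_sqrt_pow2 less_imp_le)
  also have "\<dots> = u\<^sup>2 * (1 - x) / (1 + x)" using x1 by simp
  also have "\<dots> = u\<^sup>2 - 2 * (u\<^sup>2 * x / (1 + x))" using x1 by (simp add: field_simps)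
  finally have e: "- ((u - x * u) / sqrt (1 - x\<^sup>2))\<^sup>2 / 2 = - u\<^sup>2 / 2 + u\<^sup>2 * x / (1 + x)" by simp
  have "std_normal_density u * std_normal_density ((u - x * u) / sqrt (1 - x\<^sup>2)) = (std_normal_density u)\<^sup>2 * exp (u\<^sup>2 * x / (1 + x))"
    unfolding std_normal_density_def c_def[symmetric] e exp_add by (simp only: power2_eq_square mult_ac)
  then show ?thesis unfolding plackett_def hermite_generating[OF x] by simp
qed

lemma tail_cov_deriv:
  assumes x: "\<bar>x\<bar> < 1"
  shows "(tail_cov u has_real_derivative plackett u x) (at x)"
proof -
  \<comment> \<open>Termwise differentiation is applied to a series starting at degree 0, hence the
    coefficient 0 in front.\<close>
  define c where "c n = (case n of 0 \<Rightarrow> 0 | Suc m \<Rightarrow> tail_coeff u m)" for n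
  have sc: "(\<lambda>n. c n * y ^ n) sums tail_cov u y" if "\<bar>y\<bar> < 1" for y
  proof -
    have "(\<lambda>n. c (Suc n) * y ^ Suc n) sums tail_cov u y"
      unfolding tail_cov_def c_def using tail_coeff_summable_power[OF that] by (simp add: summable_sums)
    then show ?thesis by (subst (asm) sums_Suc_iff) (simp add: c_def)
  qed
  have d: "((\<lambda>y. \<Sum>n. c n * y ^ n) has_real_derivative (\<Sum>n. diffs c n * x ^ n)) (at x)"
    using x by (intro termdiffs_strong[where K = "(1 + \<bar>x\<bar>) / 2"] sums_summable[OF sc]) auto
  have "diffs c n = (std_normal_density u)\<^sup>2 * hermite_weight u n" for n
  proof -
    have "fact (Suc n) = real (Suc n) * fact n" by simp
    then show ?thesis by (simp add: diffs_def c_def tail_coeff_def hermite_weight_def del: of_nat_Suc fact_Suc)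
  qed
  then have e: "(\<Sum>n. diffs c n * x ^ n) = plackett u x"
    unfolding plackett_eq[OF x] using suminf_mult[OF hermite_weight_summable[OF x]] by (simp add: mult.assoc)
  show ?thesis
  proof (rule DERIV_cong_ev[THEN iffD1, OF refl _ refl])
    show "\<forall>\<^sub>F y in nhds x. (\<Sum>n. c n * y ^ n) = tail_cov u y"
    proof (rule eventually_mono)
      have "open {-1<..<(1::real)}" "x \<in> {-1<..<1}" using x by auto
      then show "\<forall>\<^sub>F y in nhds x. y \<in> {-1<..<1}" by (rule eventually_nhds_in_open)
      show "(\<Sum>n. c n * y ^ n) = tail_cov u y" if "y \<in> {-1<..<1}" for y
        using sums_unique[OF sc[of y]] that by (auto simp: abs_less_iff)
    qed
    show "((\<lambda>y. \<Sum>n. c n * y ^ n) has_real_derivative plackett u x) (at x)" using d unfolding e .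
  qed
qed

text \<open>The joint tail and the series have the same derivative \<open>plackett u\<close> on the
  open interval, and at 0 the pair is independent.\<close>

lemma bivariate_tail_eq:
  assumes x: "\<bar>x\<bar> < 1"
  shows "bivariate_tail u x = (normal_tail u)\<^sup>2 + tail_cov u x"
proof -
  define B where "B y = bivariate_tail u y - tail_cov u y" for y
  have "(B has_real_derivative 0) (at y within {-1<..<1})" if "y \<in> {-1<..<1}" for y
  proof -
    have "\<bar>y\<bar> < 1" using that by auto
    then show ?thesis unfolding B_def[abs_def]
      using DERIV_diff[OF bivariate_tail_deriv[of y u] tail_cov_deriv[of y u]] by (auto intro: has_field_derivative_at_within)
  qed
  then obtain c where c: "\<And>y. y \<in> {-1<..<1} \<Longrightarrow> B y = c"
    using has_field_derivative_zero_constant[of "{-1<..<1}" B] by auto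
  have "B x = B 0" using c[of x] c[of 0] x by (simp add: abs_less_iff)
  moreover have "tail_cov u 0 = 0" by (simp add: tail_cov_def)
  ultimately show ?thesis using bivariate_tail_0[of u] by (simp add: B_def)
qed

lemma tail_cov_partial:
  assumes "0 \<le> r" "r \<le> s" "s < 1"
  shows "(\<Sum>n<N. tail_coeff u n * (s ^ Suc n - r ^ Suc n)) \<le> tail_cov u s - tail_cov u r"
proof -
  have s: "summable (\<lambda>n. tail_coeff u n * s ^ Suc n)" "summable (\<lambda>n. tail_coeff u n * r ^ Suc n)"
    using assms by (auto intro!: tail_coeff_summable_power simp del: power_Suc)
  have "(\<Sum>n<N. tail_coeff u n * s ^ Suc n - tail_coeff u n * r ^ Suc n) \<le> (\<Sum>n. tail_coeff u n * s ^ Suc n - tail_coeff u n * r ^ Suc n)"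
    using s assms tail_coeff_nonneg[of u]
    by (intro sum_le_suminf summable_diff) (auto simp del: power_Suc intro!: mult_left_mono power_mono)
  also have "\<dots> = tail_cov u s - tail_cov u r"
    unfolding tail_cov_def using suminf_diff[OF s] by simp
  finally show ?thesis by (simp only: right_diff_distrib)
qed

text \<open>A one-sided Abel argument: finite sums are continuous up to \<open>s = 1\<close>,
  whereas the whole series is controlled only for \<open>s < 1\<close>. Nonnegative coefficients let
  the bound pass to every partial sum.\<close>

lemma tail_coeff_partial_limit:
  assumes r: "0 \<le> r" "r < 1" and b: "\<And>s. r \<le> s \<Longrightarrow> s < 1 \<Longrightarrow> tail_cov u s - tail_cov u r \<le> b"
  shows "(\<Sum>n<N. tail_coeff u n * (1 - r ^ Suc n)) \<le> b"
proof (rule tendsto_upperbound)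
  show "((\<lambda>s. \<Sum>n<N. tail_coeff u n * (s ^ Suc n - r ^ Suc n)) \<longlongrightarrow> (\<Sum>n<N. tail_coeff u n * (1 - r ^ Suc n))) (at_left 1)"
    by (rule tendsto_eq_intros refl)+ simp
  show "\<forall>\<^sub>F s in at_left 1. (\<Sum>n<N. tail_coeff u n * (s ^ Suc n - r ^ Suc n)) \<le> b"
    using eventually_at_left_real[OF r(2)]
  proof (rule eventually_mono)
    fix s assume "s \<in> {r<..<1}"
    then have s: "r \<le> s" "s < 1" by auto
    show "(\<Sum>n<N. tail_coeff u n * (s ^ Suc n - r ^ Suc n)) \<le> b"
      by (rule order_trans[OF tail_cov_partial[OF r(1) s] b[OF s]])
  qed
qed simp

text \<open>Bessel's inequality for the indicator, obtained from the fact that a joint tail is at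
  most 1. The bound is the same for all levels.\<close>

lemma tail_coeff_summable: "summable (tail_coeff u)"
  and tail_coeff_suminf_le: "(\<Sum>n. tail_coeff u n) \<le> 1"
proof -
  have "(\<Sum>n<N. tail_coeff u n * (1 - 0 ^ Suc n)) \<le> 1" for N
  proof (rule tail_coeff_partial_limit)
    fix s :: real assume "0 \<le> s" "s < 1"
    then have "tail_cov u s = bivariate_tail u s - (normal_tail u)\<^sup>2" using bivariate_tail_eq[of s u] by simp
    moreover have "0 \<le> (normal_tail u)\<^sup>2" "tail_cov u 0 = 0" by (simp_all add: tail_cov_def)
    ultimately show "tail_cov u s - tail_cov u 0 \<le> 1"
      using bivariate_tail_bounds(2)[of u s] by linarith
  qed auto
  then have *: "(\<Sum>n<N. tail_coeff u n) \<le> 1" for N by simp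
  show s: "summable (tail_coeff u)" using * tail_coeff_nonneg by (intro summableI_nonneg_bounded) auto
  show "(\<Sum>n. tail_coeff u n) \<le> 1" using s * by (rule suminf_le_const)
qed

text \<open>The derivative \<open>plackett u x\<close> of \<open>tail_cov\<close> is at most
  \<open>1 / sqrt (1 - x)\<close> at every level, and this has the primitive
  \<open>- 2 * sqrt (1 - x)\<close>. The sum measures the variance that a step of correlation
  \<open>r\<close> takes away from the indicator.\<close>

lemma tail_coeff_smoothing:
  assumes r: "0 \<le> r" "r < 1"
  shows "summable (\<lambda>n. tail_coeff u n * (1 - r ^ Suc n))" "(\<Sum>n. tail_coeff u n * (1 - r ^ Suc n)) \<le> 2 * sqrt (1 - r)"
proof -
  have "(\<Sum>n<N. tail_coeff u n * (1 - r ^ Suc n)) \<le> 2 * sqrt (1 - r)" for N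
  proof (rule tail_coeff_partial_limit[OF r])
    fix s assume s: "r \<le> s" "s < 1"
    define B where "B x = tail_cov u x + 2 * sqrt (1 - x)" for x
    have Bd: "\<exists>y. (B has_real_derivative y) (at x) \<and> y \<le> 0" if "r \<le> x" "x \<le> s" for x
    proof -
      have x: "0 \<le> x" "x < 1" using that s r by auto
      have "((\<lambda>x. 2 * sqrt (1 - x)) has_real_derivative - (1 / sqrt (1 - x))) (at x)"
        using x by (auto intro!: derivative_eq_intros simp: field_simps)
      then have d: "(B has_real_derivative plackett u x + - (1 / sqrt (1 - x))) (at x)"
        unfolding B_def[abs_def] using x by (intro DERIV_add tail_cov_deriv) auto
      have "x\<^sup>2 \<le> x" using x by (simp add: power2_eq_square mult_left_le)
      then have "sqrt (1 - x) \<le> sqrt (1 - x\<^sup>2)" by simp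
      moreover have "std_normal_density u * std_normal_density ((u - x * u) / sqrt (1 - x\<^sup>2)) \<le> 1 * 1"
        using std_normal_density_le_1 by (intro mult_mono) auto
      ultimately have "plackett u x \<le> 1 / sqrt (1 - x)"
        unfolding plackett_def using x by (intro frac_le) auto
      then show ?thesis using d by (intro exI[of _ "plackett u x + - (1 / sqrt (1 - x))"]) auto
    qed
    have "B s \<le> B r" using s(1) Bd by (rule DERIV_nonpos_imp_nonincreasing)
    then show "tail_cov u s - tail_cov u r \<le> 2 * sqrt (1 - r)"
      using s by (simp add: B_def) (smt (verit) real_sqrt_ge_zero)
  qed
  note * = this
  have nn: "0 \<le> tail_coeff u n * (1 - r ^ Suc n)" for n
    using tail_coeff_nonneg r by (intro mult_nonneg_nonneg) (auto simp del: power_Suc intro!: power_le_one)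
  show s: "summable (\<lambda>n. tail_coeff u n * (1 - r ^ Suc n))" using * nn by (intro summableI_nonneg_bounded) auto
  show "(\<Sum>n. tail_coeff u n * (1 - r ^ Suc n)) \<le> 2 * sqrt (1 - r)" using s * by (rule suminf_le_const)
qed

section \<open>Ornstein--Uhlenbeck smoothing of an indicator\<close>

lemma gam_pair_prob: "pair_prob_space gam gam"
  by (simp add: pair_prob_space_def pair_sigma_finite_def prob_space_gam prob_space_imp_sigma_finite)

lemma gam_pair_trig:
  "(\<integral>p. cos (\<alpha> * fst p + \<beta> * snd p) \<partial>(gam \<Otimes>\<^sub>M gam)) = exp (- (\<alpha>\<^sup>2 + \<beta>\<^sup>2) / 2)"
  "(\<integral>p. sin (\<alpha> * fst p + \<beta> * snd p) \<partial>(gam \<Otimes>\<^sub>M gam)) = 0"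
proof -
  interpret G: prob_space gam by (rule prob_space_gam)
  interpret GG: pair_prob_space gam gam by (rule gam_pair_prob)
  have ig: "integrable gam (\<lambda>z. cos (c * z))" "integrable gam (\<lambda>z. sin (c * z))" for c
    by (auto intro!: integrable_gam_bounded[where K = 1])
  have i: "integrable (gam \<Otimes>\<^sub>M gam) (\<lambda>p. cos (\<alpha> * fst p + \<beta> * snd p))" "integrable (gam \<Otimes>\<^sub>M gam) (\<lambda>p. sin (\<alpha> * fst p + \<beta> * snd p))"
    by (auto intro!: GG.integrable_bounded_fun[where K = 1])
  show "(\<integral>p. cos (\<alpha> * fst p + \<beta> * snd p) \<partial>(gam \<Otimes>\<^sub>M gam)) = exp (- (\<alpha>\<^sup>2 + \<beta>\<^sup>2) / 2)"
    unfolding GG.integral_fst'[OF i(1), symmetric]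
    using ig by (simp add: cos_add gam_moments exp_add[symmetric] add_divide_distrib)
  show "(\<integral>p. sin (\<alpha> * fst p + \<beta> * snd p) \<partial>(gam \<Otimes>\<^sub>M gam)) = 0"
    unfolding GG.integral_fst'[OF i(2), symmetric] using ig by (simp add: sin_add gam_moments)
qed

text \<open>The characteristic function determines the pair, which therefore has the law of
  \<open>(x, c * x + sqrt (1 - c\<^sup>2) * z)\<close> with independent \<open>x\<close> and
  \<open>z\<close>. In this form the inner integral of a two-point expectation is a smoothing
  step.\<close>

lemma gaussian_pair_law:
  fixes k :: "real \<Rightarrow> real \<Rightarrow> real"
  assumes "prob_space P" and [measurable]: "A \<in> borel_measurable P" "B \<in> borel_measurable P"
    and cos: "\<And>a b. (\<integral>x. cos (a * A x + b * B x) \<partial>P) = exp (- (a\<^sup>2 + 2 * a * b * c + b\<^sup>2) / 2)"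
    and sin: "\<And>a b. (\<integral>x. sin (a * A x + b * B x) \<partial>P) = 0" and c: "\<bar>c\<bar> \<le> 1"
    and k[measurable]: "case_prod k \<in> borel_measurable (borel \<Otimes>\<^sub>M borel)" and kb: "\<And>x y. \<bar>k x y\<bar> \<le> K"
  shows "(\<integral>x. k (A x) (B x) \<partial>P) = (\<integral>x. (\<integral>z. k x (c * x + sqrt (1 - c\<^sup>2) * z) \<partial>gam) \<partial>gam)"
proof -
  interpret P: prob_space P by fact
  interpret GG: pair_prob_space gam gam by (rule gam_pair_prob)
  define V where "V i x = (if i then A x else B x)" for i x
  define V' where "V' i p = (if i then fst p else c * fst p + sqrt (1 - c\<^sup>2) * snd p)" for i and p :: "real \<times> real"
  have c2: "c\<^sup>2 \<le> 1" using c by (simp add: abs_square_le_1)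
  have [measurable]: "V i \<in> borel_measurable P" for i unfolding V_def[abs_def] by simp
  have [measurable]: "V' i \<in> borel_measurable (gam \<Otimes>\<^sub>M gam)" for i unfolding V'_def[abs_def] by simp
  have s: "(\<Sum>i\<in>UNIV. a i * V i x) = a True * A x + a False * B x" for a x by (simp add: UNIV_bool V_def add.commute)
  have s': "(\<Sum>i\<in>UNIV. a i * V' i p) = (a True + a False * c) * fst p + (a False * sqrt (1 - c\<^sup>2)) * snd p" for a p
    by (simp add: UNIV_bool V'_def algebra_simps)
  have law: "distr P (PiM UNIV (\<lambda>_. borel)) (\<lambda>x. \<lambda>i\<in>UNIV. V i x) = distr (gam \<Otimes>\<^sub>M gam) (PiM UNIV (\<lambda>_. borel)) (\<lambda>x. \<lambda>i\<in>UNIV. V' i x)"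
  proof (rule joint_law_eqI)
    show "(\<integral>x. cos (\<Sum>i\<in>UNIV. a i * V i x) \<partial>P) = (\<integral>x. cos (\<Sum>i\<in>UNIV. a i * V' i x) \<partial>(gam \<Otimes>\<^sub>M gam))" for a
      unfolding s s' gam_pair_trig cos using c2 by (simp add: power_mult_distrib) (simp add: power2_eq_square algebra_simps)
    show "(\<integral>x. sin (\<Sum>i\<in>UNIV. a i * V i x) \<partial>P) = (\<integral>x. sin (\<Sum>i\<in>UNIV. a i * V' i x) \<partial>(gam \<Otimes>\<^sub>M gam))" for a
      unfolding s s' gam_pair_trig sin ..
  qed (auto intro: \<open>prob_space P\<close> GG.prob_space_axioms)
  have m: "(\<lambda>w. k (w True) (w False)) \<in> borel_measurable (PiM UNIV (\<lambda>_. borel))" by measurable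
  have "(\<integral>x. k (A x) (B x) \<partial>P) = (\<integral>w. k (w True) (w False) \<partial>distr P (PiM UNIV (\<lambda>_. borel)) (\<lambda>x. \<lambda>i\<in>UNIV. V i x))"
    by (subst integral_distr[OF _ m]) (auto simp: V_def intro!: measurable_restrict)
  also have "\<dots> = (\<integral>p. k (fst p) (c * fst p + sqrt (1 - c\<^sup>2) * snd p) \<partial>(gam \<Otimes>\<^sub>M gam))"
    unfolding law by (subst integral_distr[OF _ m]) (auto simp: V'_def intro!: measurable_restrict)
  also have "\<dots> = (\<integral>x. (\<integral>z. k x (c * x + sqrt (1 - c\<^sup>2) * z) \<partial>gam) \<partial>gam)"
  proof -
    have "integrable (gam \<Otimes>\<^sub>M gam) (\<lambda>p. k (fst p) (c * fst p + sqrt (1 - c\<^sup>2) * snd p))"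
      using kb by (intro GG.integrable_bounded_fun[where K = K]) auto
    from GG.integral_fst'[OF this] show ?thesis by simp
  qed
  finally show ?thesis .
qed

text \<open>Rotation invariance: after normalisation, \<open>a * x + b * z\<close> is the first
  coordinate \<open>A\<close> of a rotated pair with the same law, and \<open>B\<close> completes
  the rotation.\<close>

lemma gam_convolution:
  fixes f :: "real \<Rightarrow> real"
  assumes [measurable]: "f \<in> borel_measurable borel" and fb: "\<And>x. \<bar>f x\<bar> \<le> K"
  shows "(\<integral>x. (\<integral>z. f (a * x + b * z) \<partial>gam) \<partial>gam) = (\<integral>z. f (sqrt (a\<^sup>2 + b\<^sup>2) * z) \<partial>gam)"
proof (cases "a\<^sup>2 + b\<^sup>2 = 0")
  case True
  then show ?thesis by (simp add: sum_power2_eq_zero_iff prob_space.prob_space[OF prob_space_gam, simplified])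
next
  case False
  interpret G: prob_space gam by (rule prob_space_gam)
  interpret GG: pair_prob_space gam gam by (rule gam_pair_prob)
  define R where "R = sqrt (a\<^sup>2 + b\<^sup>2)"
  have R: "R > 0" "R\<^sup>2 = a\<^sup>2 + b\<^sup>2" using False by (auto simp: R_def sum_power2_gt_zero_iff)
  define A where "A p = (a / R) * fst p + (b / R) * snd p" for p :: "real \<times> real"
  define B where "B p = (- b / R) * fst p + (a / R) * snd p" for p :: "real \<times> real"
  have AB: "s * A p + t * B p = (s * (a / R) - t * (b / R)) * fst p + (s * (b / R) + t * (a / R)) * snd p" for s t p
    by (simp add: A_def B_def algebra_simps)
  have one: "(a / R)\<^sup>2 + (b / R)\<^sup>2 = 1" using R(2) False by (simp add: power_divide add_divide_distrib[symmetric])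
  have q: "(s * (a / R) - t * (b / R))\<^sup>2 + (s * (b / R) + t * (a / R))\<^sup>2 = s\<^sup>2 + 2 * s * t * 0 + t\<^sup>2" for s t
  proof -
    have "(s * x - t * y)\<^sup>2 + (s * y + t * x)\<^sup>2 = (s\<^sup>2 + t\<^sup>2) * (x\<^sup>2 + y\<^sup>2)" for x y :: real
      by (simp add: power2_eq_square algebra_simps)
    then show ?thesis by (simp only: one) simp
  qed
  have "(\<integral>p. f (R * A p) \<partial>(gam \<Otimes>\<^sub>M gam)) = (\<integral>x. (\<integral>z. f (R * x) \<partial>gam) \<partial>gam)"
  proof (rule gaussian_pair_law[where k = "\<lambda>x y. f (R * x)" and B = B and c = 0 and K = K])
    show "A \<in> borel_measurable (gam \<Otimes>\<^sub>M gam)" "B \<in> borel_measurable (gam \<Otimes>\<^sub>M gam)"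
      unfolding A_def[abs_def] B_def[abs_def] by auto
    show "(\<integral>x. cos (s * A x + t * B x) \<partial>(gam \<Otimes>\<^sub>M gam)) = exp (- (s\<^sup>2 + 2 * s * t * 0 + t\<^sup>2) / 2)" for s t
      unfolding AB gam_pair_trig q ..
    show "(\<integral>x. sin (s * A x + t * B x) \<partial>(gam \<Otimes>\<^sub>M gam)) = 0" for s t
      unfolding AB gam_pair_trig ..
  qed (auto simp: fb intro: GG.prob_space_axioms)
  moreover have "R * A p = a * fst p + b * snd p" for p using R by (simp add: A_def distrib_left)
  moreover have "integrable (gam \<Otimes>\<^sub>M gam) (\<lambda>p. f (a * fst p + b * snd p))"
    using fb by (intro GG.integrable_bounded_fun[where K = K]) auto
  ultimately show ?thesis
    using GG.integral_fst'[of "\<lambda>p. f (a * fst p + b * snd p)"] G.prob_space by (simp add: R_def)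
qed

text \<open>The Ornstein-Uhlenbeck operator with correlation \<open>r\<close> applied to the
  indicator of \<open>{u..}\<close>, as \<open>ou_step_eq\<close> shows. The closed form makes
  derivatives in \<open>x\<close> explicit.\<close>

definition ou_step :: "real \<Rightarrow> real \<Rightarrow> real \<Rightarrow> real" where
  "ou_step u r x = normal_tail ((u - r * x) / sqrt (1 - r\<^sup>2))"

lemma ou_step_measurable[measurable]: "ou_step u r \<in> borel_measurable borel"
  unfolding ou_step_def[abs_def] by measurable

lemma ou_step_bounds: "0 \<le> ou_step u r x" "ou_step u r x \<le> 1" "\<bar>ou_step u r x\<bar> \<le> 1"
  using normal_tail_bounds unfolding ou_step_def by auto

lemma ou_step_eq:
  assumes "\<bar>r\<bar> < 1"
  shows "ou_step u r x = (\<integral>z. indicator {u..} (r * x + sqrt (1 - r\<^sup>2) * z) \<partial>gam)"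
proof -
  have s: "sqrt (1 - r\<^sup>2) > 0" using one_minus_square_pos[OF assms] by simp
  have "indicator {(u - r * x) / sqrt (1 - r\<^sup>2)..} z = (indicator {u..} (r * x + sqrt (1 - r\<^sup>2) * z) :: real)" for z
    using s by (auto simp: indicator_def field_simps)
  then show ?thesis unfolding ou_step_def normal_tail_eq_gam by (intro Bochner_Integration.integral_cong[OF refl])
qed

text \<open>The independent noises of the two steps add up to variance \<open>r\<^sup>2 * (1 -
  c\<^sup>2) + (1 - r\<^sup>2) = 1 - (r * c)\<^sup>2\<close>. The case
  \<open>\<bar>c\<bar> = 1\<close> is included, as it occurs when both points of the field
  coincide.\<close>

lemma ou_step_semigroup:
  assumes r: "\<bar>r\<bar> < 1" and c: "\<bar>c\<bar> \<le> 1"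
  shows "(\<integral>z. ou_step u r (c * x + sqrt (1 - c\<^sup>2) * z) \<partial>gam) = ou_step u (r * c) x"
proof -
  have c2: "c\<^sup>2 \<le> 1" and r2: "r\<^sup>2 < 1" using c r by (simp_all add: abs_square_le_1 abs_square_less_1)
  have rc: "\<bar>r * c\<bar> < 1" using r c abs_mult_le[OF order_refl c, of r] by linarith
  have "(\<integral>z. ou_step u r (c * x + sqrt (1 - c\<^sup>2) * z) \<partial>gam) =
     (\<integral>z. (\<integral>z'. (\<lambda>y. indicator {u..} (r * c * x + y)) (r * sqrt (1 - c\<^sup>2) * z + sqrt (1 - r\<^sup>2) * z') \<partial>gam) \<partial>gam)"
    unfolding ou_step_eq[OF r] by (simp add: algebra_simps)
  also have "\<dots> = (\<integral>z. (\<lambda>y. indicator {u..} (r * c * x + y)) (sqrt ((r * sqrt (1 - c\<^sup>2))\<^sup>2 + (sqrt (1 - r\<^sup>2))\<^sup>2) * z) \<partial>gam)"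
    by (rule gam_convolution[where K = 1]) (auto simp: indicator_def)
  also have "(r * sqrt (1 - c\<^sup>2))\<^sup>2 + (sqrt (1 - r\<^sup>2))\<^sup>2 = 1 - (r * c)\<^sup>2"
    using c2 r2 by (simp add: power_mult_distrib algebra_simps)
  also have "(\<integral>z. (\<lambda>y. indicator {u..} (r * c * x + y)) (sqrt (1 - (r * c)\<^sup>2) * z) \<partial>gam) = ou_step u (r * c) x"
    unfolding ou_step_eq[OF rc] ..
  finally show ?thesis .
qed

lemma ou_step_mean:
  assumes r: "\<bar>r\<bar> < 1"
  shows "(\<integral>x. ou_step u r x \<partial>gam) = normal_tail u"
  \<comment> \<open>A step with \<open>c = 0\<close> forgets its starting point.\<close>
  using ou_step_semigroup[OF r, of 0 u 0] by (simp add: ou_step_def)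

lemma bivariate_tail_ou: "bivariate_tail u c = (\<integral>x. indicator {u..} x * ou_step u c x \<partial>gam)"
  by (simp add: bivariate_tail_def ou_step_def)

text \<open>The operator is self-adjoint: the smoothing of the first factor is written as an extra
  Gaussian variable \<open>A\<close> with correlation \<open>r\<close> to \<open>x\<close>, and the
  pair is read in the opposite order. The smoothing then falls on the second factor, where
  \<open>ou_step_semigroup\<close> collects it.\<close>

lemma ou_step_inner:
  assumes r: "\<bar>r\<bar> < 1" and c: "\<bar>c\<bar> < 1"
  shows "(\<integral>x. ou_step u r x * ou_step u c x \<partial>gam) = bivariate_tail u (r * c)"
proof -
  interpret G: prob_space gam by (rule prob_space_gam)
  interpret GG: pair_prob_space gam gam by (rule gam_pair_prob)
  define A where "A p = r * fst p + sqrt (1 - r\<^sup>2) * snd p" for p :: "real \<times> real"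
  have [measurable]: "A \<in> borel_measurable (gam \<Otimes>\<^sub>M gam)" unfolding A_def[abs_def] by auto
  have r2: "r\<^sup>2 < 1" using r by (simp add: abs_square_less_1)
  have AB: "a * A p + b * fst p = (a * r + b) * fst p + (a * sqrt (1 - r\<^sup>2)) * snd p" for a b p
    by (simp add: A_def algebra_simps)
  have q: "(a * r + b)\<^sup>2 + (a * sqrt (1 - r\<^sup>2))\<^sup>2 = a\<^sup>2 + 2 * a * b * r + b\<^sup>2" for a b
    using r2 by (simp add: power_mult_distrib) (simp add: power2_eq_square algebra_simps)
  have kb: "\<bar>indicator {u..} x * ou_step u c y\<bar> \<le> 1 * 1" for x y
    using ou_step_bounds by (intro abs_mult_le) (auto simp: indicator_def)
  have i: "integrable (gam \<Otimes>\<^sub>M gam) (\<lambda>p. indicator {u..} (A p) * ou_step u c (fst p))"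
    using kb by (intro GG.integrable_bounded_fun[where K = 1]) auto
  have "(\<integral>x. ou_step u r x * ou_step u c x \<partial>gam) = (\<integral>x. (\<integral>z. indicator {u..} (A (x, z)) * ou_step u c x \<partial>gam) \<partial>gam)"
    unfolding ou_step_eq[OF r] by (simp add: A_def)
  also have "\<dots> = (\<integral>p. indicator {u..} (A p) * ou_step u c (fst p) \<partial>(gam \<Otimes>\<^sub>M gam))"
    using GG.integral_fst'[OF i] by simp
  also have "\<dots> = (\<integral>x. (\<integral>z. indicator {u..} x * ou_step u c (r * x + sqrt (1 - r\<^sup>2) * z) \<partial>gam) \<partial>gam)"
  proof (rule gaussian_pair_law[where k = "\<lambda>x y. indicator {u..} x * ou_step u c y" and K = 1])
    show "(\<integral>x. cos (a * A x + b * fst x) \<partial>(gam \<Otimes>\<^sub>M gam)) = exp (- (a\<^sup>2 + 2 * a * b * r + b\<^sup>2) / 2)" for a b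
      unfolding AB gam_pair_trig q ..
    show "(\<integral>x. sin (a * A x + b * fst x) \<partial>(gam \<Otimes>\<^sub>M gam)) = 0" for a b unfolding AB gam_pair_trig ..
  qed (use r kb in \<open>auto intro: GG.prob_space_axioms\<close>)
  also have "\<dots> = (\<integral>x. indicator {u..} x * ou_step u (c * r) x \<partial>gam)"
    using r by (simp add: ou_step_semigroup[OF c])
  finally show ?thesis by (simp add: bivariate_tail_ou mult.commute)
qed

lemma std_normal_density_deriv_le: "\<bar>x * std_normal_density x\<bar> \<le> 1"
proof -
  have "\<bar>x\<bar> \<le> 1 + x\<^sup>2 / 2" using sum_squares_bound[of "\<bar>x\<bar>" 1] by simp
  also have "\<dots> \<le> exp (x\<^sup>2 / 2)" by (rule exp_ge_add_one_self)
  finally have 1: "\<bar>x\<bar> * exp (- x\<^sup>2 / 2) \<le> 1" by (simp add: exp_minus field_simps)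
  have "1 / sqrt (2 * pi) \<le> 1" using pi_gt3 by (simp add: real_le_rsqrt)
  then have "1 / sqrt (2 * pi) * (\<bar>x\<bar> * exp (- x\<^sup>2 / 2)) \<le> 1 * 1" using 1 by (intro mult_mono) auto
  then show ?thesis by (simp add: std_normal_density_def abs_mult mult_ac)
qed

text \<open>Each derivative of the smoothed indicator costs a factor
  \<open>\<bar>r\<bar> / sqrt (1 - r\<^sup>2)\<close>; the mixed difference is controlled by the
  second derivative.\<close>

lemma ou_step_lipschitz:
  assumes r: "\<bar>r\<bar> < 1"
  shows "\<bar>ou_step u r x - ou_step u r y\<bar> \<le> 1 / sqrt (1 - r\<^sup>2) * \<bar>x - y\<bar>"
    and "\<bar>(ou_step u r x - ou_step u r (x - z)) - (ou_step u r y - ou_step u r (y - z))\<bar> \<le> 1 / (1 - r\<^sup>2) * \<bar>x - y\<bar> * \<bar>z\<bar>"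
proof -
  define s where "s = sqrt (1 - r\<^sup>2)"
  have s: "s > 0" "s\<^sup>2 = 1 - r\<^sup>2" using one_minus_square_pos[OF r] by (simp_all add: s_def)
  define d where "d x = std_normal_density ((u - r * x) / s) * (r / s)" for x
  have e: "((\<lambda>x. (u - r * x) / s) has_real_derivative - r / s) (at x)" for x
    using s(1) by (auto intro!: derivative_eq_intros)
  have d: "(ou_step u r has_real_derivative d x) (at x)" for x
    unfolding ou_step_def[abs_def] s_def[symmetric] d_def using DERIV_chain2[OF normal_tail_deriv e, of x] by simp
  have rs: "\<bar>r / s\<bar> \<le> 1 / s" unfolding abs_divide using s(1) r by (intro frac_le) auto
  have db: "\<bar>d x\<bar> \<le> 1 / s" for x
    unfolding d_def using abs_mult_le[OF _ rs, of "std_normal_density ((u - r * x) / s)" 1] std_normal_density_le_1 by simp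
  show "\<bar>ou_step u r x - ou_step u r y\<bar> \<le> 1 / sqrt (1 - r\<^sup>2) * \<bar>x - y\<bar>"
    using derivative_bound_lipschitz[OF d db] by (simp add: s_def)
  have d2: "(d has_real_derivative (- ((u - r * x) / s) * std_normal_density ((u - r * x) / s) * (- r / s)) * (r / s)) (at x)" for x
    unfolding d_def[abs_def] by (intro DERIV_cmult_right DERIV_chain2[OF std_normal_density_deriv e])
  have d2b: "\<bar>(- ((u - r * x) / s) * std_normal_density ((u - r * x) / s) * (- r / s)) * (r / s)\<bar> \<le> 1 * (1 / s) * (1 / s)" for x
    using std_normal_density_deriv_le[of "(u - r * x) / s"] rs by (intro abs_mult_le) (auto simp: abs_mult)
  have dl: "\<bar>d x - d y\<bar> \<le> 1 / (1 - r\<^sup>2) * \<bar>x - y\<bar>" for x y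
    using derivative_bound_lipschitz[OF d2 d2b, of x y] unfolding s(2)[symmetric] by (simp add: power2_eq_square)
  have "((\<lambda>x. ou_step u r x - ou_step u r (x - z)) has_real_derivative d x - d (x - z)) (at x)" for x
    using DERIV_shift[of "ou_step u r" "d (x - z)" x "- z"] d by (intro DERIV_diff) simp_all
  from derivative_bound_lipschitz[OF this, of "1 / (1 - r\<^sup>2) * \<bar>z\<bar>" x y] dl[of _ "_ - z"]
  show "\<bar>(ou_step u r x - ou_step u r (x - z)) - (ou_step u r y - ou_step u r (y - z))\<bar> \<le> 1 / (1 - r\<^sup>2) * \<bar>x - y\<bar> * \<bar>z\<bar>"
    using dl[of x "x - z" for x] by (simp add: mult_ac)
qed

section \<open>Two-point expectations of indicators and their smoothings\<close>

context gaussian_occupation begin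

lemma pair_law:
  fixes k :: "real \<Rightarrow> real \<Rightarrow> real"
  assumes k: "case_prod k \<in> borel_measurable (borel \<Otimes>\<^sub>M borel)" and kb: "\<And>x y. \<bar>k x y\<bar> \<le> K"
  shows "(\<integral>\<omega>. k (X s \<omega>) (X t \<omega>) \<partial>M) = (\<integral>x. (\<integral>z. k x (r s t * x + sqrt (1 - (r s t)\<^sup>2) * z) \<partial>gam) \<partial>gam)"
proof (rule gaussian_pair_law[OF prob_space_axioms _ _ _ _ _ k kb])
  have sp: "(\<lambda>\<omega>. a * X s \<omega> + b * X t \<omega>) \<in> lin_span X" for a b
    by (intro lin_span_add lin_span_scale lin_span_base)
  have v: "(\<integral>\<omega>. (a * X s \<omega> + b * X t \<omega>)\<^sup>2 \<partial>M) = a\<^sup>2 + 2 * a * b * r s t + b\<^sup>2" for a b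
  proof -
    have i: "integrable M (\<lambda>\<omega>. X s \<omega> * X t \<omega>)" for s t by (intro lin_span_integrable_mult lin_span_base)
    have "(\<integral>\<omega>. (a * X s \<omega> + b * X t \<omega>)\<^sup>2 \<partial>M) =
      (\<integral>\<omega>. a\<^sup>2 * (X s \<omega> * X s \<omega>) + 2 * a * b * (X s \<omega> * X t \<omega>) + b\<^sup>2 * (X t \<omega> * X t \<omega>) \<partial>M)"
      by (simp add: power2_eq_square algebra_simps)
    also have "\<dots> = a\<^sup>2 * r s s + 2 * a * b * r s t + b\<^sup>2 * r t t" using i by (simp add: cov)
    finally show ?thesis by (simp add: unit)
  qed
  show "(\<integral>\<omega>. cos (a * X s \<omega> + b * X t \<omega>) \<partial>M) = exp (- (a\<^sup>2 + 2 * a * b * r s t + b\<^sup>2) / 2)" for a b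
    using lin_span_trig(1)[OF sp, of a b] by (simp add: v)
  show "(\<integral>\<omega>. sin (a * X s \<omega> + b * X t \<omega>) \<partial>M) = 0" for a b using lin_span_trig(2)[OF sp] .
qed (simp_all add: abs_cov_le_1)

lemma mean_X:
  fixes f :: "real \<Rightarrow> real"
  assumes [measurable]: "f \<in> borel_measurable borel" and "\<And>x. \<bar>f x\<bar> \<le> K"
  shows "(\<integral>\<omega>. f (X t \<omega>) \<partial>M) = (\<integral>x. f x \<partial>gam)"
  using pair_law[of "\<lambda>x y. f x" K t t] assms prob_space.prob_space[OF prob_space_gam] by simp

lemma indicator_cov:
  assumes c: "\<bar>r s t\<bar> < 1"
  shows "(\<integral>\<omega>. indicator {u..} (X s \<omega>) * indicator {u..} (X t \<omega>) \<partial>M) = bivariate_tail u (r s t)"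
proof -
  have "(\<integral>\<omega>. indicator {u..} (X s \<omega>) * indicator {u..} (X t \<omega>) \<partial>M)
     = (\<integral>x. (\<integral>z. (indicator {u..} x :: real) * indicator {u..} (r s t * x + sqrt (1 - (r s t)\<^sup>2) * z) \<partial>gam) \<partial>gam)"
    by (rule pair_law[where k = "\<lambda>x y. indicator {u..} x * indicator {u..} y" and K = 1]) (auto simp: indicator_def)
  then show ?thesis by (simp add: bivariate_tail_ou ou_step_eq[OF c])
qed

lemma indicator_ou_cov:
  assumes a: "\<bar>a\<bar> < 1"
  shows "(\<integral>\<omega>. indicator {u..} (X s \<omega>) * ou_step u a (X t \<omega>) \<partial>M) = bivariate_tail u (a * r s t)"
proof -
  have "\<bar>indicator {u..} x * ou_step u a y\<bar> \<le> 1 * 1" for x y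
    using ou_step_bounds by (intro abs_mult_le) (auto simp: indicator_def)
  then have "(\<integral>\<omega>. indicator {u..} (X s \<omega>) * ou_step u a (X t \<omega>) \<partial>M)
     = (\<integral>x. (\<integral>z. indicator {u..} x * ou_step u a (r s t * x + sqrt (1 - (r s t)\<^sup>2) * z) \<partial>gam) \<partial>gam)"
    by (intro pair_law[where k = "\<lambda>x y. indicator {u..} x * ou_step u a y" and K = 1]) auto
  then show ?thesis by (simp add: bivariate_tail_ou ou_step_semigroup[OF a abs_cov_le_1])
qed

text \<open>Smoothing at both points multiplies the correlation by \<open>a\<close> twice, which
  keeps it below 1 in absolute value also for \<open>s = t\<close>.\<close>

lemma ou_cov:
  assumes a: "\<bar>a\<bar> < 1"
  shows "(\<integral>\<omega>. ou_step u a (X s \<omega>) * ou_step u a (X t \<omega>) \<partial>M) = bivariate_tail u (a\<^sup>2 * r s t)"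
proof -
  have "\<bar>ou_step u a x * ou_step u a y\<bar> \<le> 1 * 1" for x y
    using ou_step_bounds by (intro abs_mult_le) auto
  then have "(\<integral>\<omega>. ou_step u a (X s \<omega>) * ou_step u a (X t \<omega>) \<partial>M)
     = (\<integral>x. (\<integral>z. ou_step u a x * ou_step u a (r s t * x + sqrt (1 - (r s t)\<^sup>2) * z) \<partial>gam) \<partial>gam)"
    by (intro pair_law[where k = "\<lambda>x y. ou_step u a x * ou_step u a y" and K = 1]) auto
  also have "\<dots> = (\<integral>x. ou_step u a x * ou_step u (a * r s t) x \<partial>gam)"
    by (simp add: ou_step_semigroup[OF a abs_cov_le_1])
  also have "\<dots> = bivariate_tail u (a * (a * r s t))"
    using a abs_mult_le[OF order_refl abs_cov_le_1, of a s t] by (intro ou_step_inner) auto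
  finally show ?thesis by (simp add: power2_eq_square mult.assoc)
qed

end

section \<open>Translations and averages over cubes\<close>

lemma lborel_translate:
  fixes f :: "'a::euclidean_space \<Rightarrow> real"
  assumes [measurable]: "f \<in> borel_measurable borel"
  shows "(\<integral>t. f (t + c) \<partial>lborel) = (\<integral>t. f t \<partial>lborel)" "integrable lborel (\<lambda>t. f (t + c)) \<longleftrightarrow> integrable lborel f"
proof -
  have d: "distr lborel borel ((+) c) = (lborel :: 'a measure)" by (rule lborel_distr_plus)
  have "(\<integral>t. f t \<partial>lborel) = (\<integral>t. f (c + t) \<partial>lborel)" by (subst d[symmetric], subst integral_distr) auto
  then show "(\<integral>t. f (t + c) \<partial>lborel) = (\<integral>t. f t \<partial>lborel)" by (simp add: add.commute)
  have "integrable lborel f \<longleftrightarrow> integrable lborel (\<lambda>t. f (c + t))" by (subst d[symmetric], subst integrable_distr_eq) auto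
  then show "integrable lborel (\<lambda>t. f (t + c)) \<longleftrightarrow> integrable lborel f" by (simp add: add.commute)
qed

lemma integrable_indicator_bounded:
  fixes f :: "'a \<Rightarrow> real"
  assumes [measurable]: "A \<in> sets M" "f \<in> borel_measurable M" and "emeasure M A < \<infinity>" "\<And>x. x \<in> A \<Longrightarrow> \<bar>f x\<bar> \<le> K"
  shows "integrable M (\<lambda>x. indicator A x * f x)"
proof (rule Bochner_Integration.integrable_bound)
  show "integrable M (\<lambda>x. K * indicator A x :: real)" using assms by (intro integrable_mult_right integrable_real_indicator) auto
  show "AE x in M. norm (indicator A x * f x) \<le> norm (K * indicator A x :: real)"
    using assms(4) by (intro AE_I2) (force split: split_indicator)
qed simp

text \<open>A Lebesgue measurable function is almost everywhere a limit of continuous ones;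
  truncation to values between -1 and 1 leaves the limit unchanged and gives a dominating
  constant.\<close>

lemma measurable_ae_limit_continuous:
  fixes f :: "'a::euclidean_space \<Rightarrow> real"
  assumes f: "f \<in> borel_measurable borel" and fb: "\<And>x. \<bar>f x\<bar> \<le> 1"
  obtains g where "\<And>n::nat. continuous_on UNIV (g n)" "\<And>n x. \<bar>g n x\<bar> \<le> 1" "AE x in lborel. (\<lambda>n. g n x) \<longlonglongrightarrow> f x"
proof -
  have "f \<in> borel_measurable lebesgue" using f by (intro measurable_completion) simp
  then have "f measurable_on UNIV" by (rule lebesgue_measurable_imp_measurable_on) simp
  then obtain N g where N: "negligible N" and g: "\<And>n. continuous_on UNIV (g n)" and lim: "\<And>x. x \<notin> N \<Longrightarrow> (\<lambda>n. g n x) \<longlonglongrightarrow> f x"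
    unfolding measurable_on_def by auto
  show ?thesis
  proof (rule that[of "\<lambda>n x. max (- 1) (min 1 (g n x))"])
    show "continuous_on UNIV (\<lambda>x. max (- 1) (min 1 (g n x)))" for n using g by (intro continuous_intros)
    show "\<bar>max (- 1) (min 1 (g n x))\<bar> \<le> 1" for n x by auto
    have "AE x in lebesgue. x \<notin> N" using N by (intro AE_not_in) (simp add: negligible_iff_null_sets)
    then have "AE x in lborel. x \<notin> N" by (simp add: AE_completion_iff)
    then show "AE x in lborel. (\<lambda>n. max (- 1) (min 1 (g n x))) \<longlonglongrightarrow> f x"
    proof eventually_elim
      case (elim x)
      have "(\<lambda>n. max (- 1) (min 1 (g n x))) \<longlonglongrightarrow> max (- 1) (min 1 (f x))"
        using lim[OF elim] by (intro tendsto_max tendsto_min tendsto_const)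
      then show ?case using fb[of x] by (simp add: abs_le_iff max_def min_def split: if_splits)
    qed
  qed
qed

text \<open>Paths of the field are merely measurable, and this is the continuity that remains for
  them. The approximation by continuous functions is measured on the ball of radius 2, into which
  translations by vectors of norm at most 1 carry the unit ball.\<close>

lemma translation_continuous_L1:
  fixes f :: "'a::euclidean_space \<Rightarrow> real" and h :: "nat \<Rightarrow> 'a"
  assumes f[measurable]: "f \<in> borel_measurable borel" and fb: "\<And>x. \<bar>f x\<bar> \<le> 1" and h: "h \<longlonglongrightarrow> 0"
  shows "(\<lambda>i. \<integral>t. indicator (cball 0 1) t * \<bar>f (t + h i) - f t\<bar> \<partial>lborel) \<longlonglongrightarrow> 0"
proof -
  obtain g where gc: "\<And>n::nat. continuous_on UNIV (g n)" and gb: "\<And>n x. \<bar>g n x\<bar> \<le> 1" and glim: "AE x in lborel. (\<lambda>n. g n x) \<longlonglongrightarrow> f x"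
    using measurable_ae_limit_continuous[OF f fb] by blast
  have [measurable]: "g n \<in> borel_measurable borel" for n using gc by (rule borel_measurable_continuous_onI)
  let ?B = "cball (0::'a) 1" and ?B2 = "cball (0::'a) 2"
  have [measurable]: "cball (0::'a) r \<in> sets borel" for r by (intro borel_closed closed_cball)
  have fin: "emeasure lborel (cball (0::'a) r) < \<infinity>" for r by (rule emeasure_bounded_finite) simp
  define e where "e n = (\<integral>t. indicator ?B2 t * \<bar>f t - g n t\<bar> \<partial>lborel)" for n
  have d2: "\<bar>\<bar>x - y\<bar>\<bar> \<le> 2" if "\<bar>x\<bar> \<le> 1" "\<bar>y\<bar> \<le> 1" for x y :: real using that by linarith
  have e0: "e \<longlonglongrightarrow> (\<integral>t. 0 \<partial>(lborel :: 'a measure))"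
    unfolding e_def
  proof (rule integral_dominated_convergence[where w = "\<lambda>t. indicator ?B2 t * 2"])
    show "integrable lborel (\<lambda>t. indicator ?B2 t * 2 :: real)"
      using integrable_indicator_bounded[of ?B2 lborel "\<lambda>_. 2" 2] fin by simp
    show "AE t in lborel. (\<lambda>n. indicator ?B2 t * \<bar>f t - g n t\<bar>) \<longlonglongrightarrow> 0"
      using glim
    proof eventually_elim
      case (elim t)
      have "(\<lambda>n. indicator ?B2 t * \<bar>f t - g n t\<bar>) \<longlonglongrightarrow> indicator ?B2 t * \<bar>f t - f t\<bar>"
        by (intro tendsto_intros elim)
      then show ?case by simp
    qed
    show "AE t in lborel. norm (indicator ?B2 t * \<bar>f t - g n t\<bar>) \<le> indicator ?B2 t * 2" for n
      using d2[OF fb gb] by (intro AE_I2) (auto split: split_indicator)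
  qed auto
  have m0: "(\<lambda>i. \<integral>t. indicator ?B t * \<bar>g n (t + h i) - g n t\<bar> \<partial>lborel) \<longlonglongrightarrow> (\<integral>t. 0 \<partial>(lborel :: 'a measure))" for n
  proof (rule integral_dominated_convergence[where w = "\<lambda>t. indicator ?B t * 2"])
    show "integrable lborel (\<lambda>t. indicator ?B t * 2 :: real)"
      using integrable_indicator_bounded[of ?B lborel "\<lambda>_. 2" 2] fin by simp
    show "AE t in lborel. (\<lambda>i. indicator ?B t * \<bar>g n (t + h i) - g n t\<bar>) \<longlonglongrightarrow> 0"
    proof (intro AE_I2)
      fix t
      have "(\<lambda>i. t + h i) \<longlonglongrightarrow> t + 0" using h by (intro tendsto_intros)
      then have "(\<lambda>i. g n (t + h i)) \<longlonglongrightarrow> g n t"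
        using gc[of n] by (intro continuous_on_tendsto_compose[OF gc[of n]]) auto
      then have "(\<lambda>i. indicator ?B t * \<bar>g n (t + h i) - g n t\<bar>) \<longlonglongrightarrow> indicator ?B t * \<bar>g n t - g n t\<bar>"
        by (intro tendsto_intros)
      then show "(\<lambda>i. indicator ?B t * \<bar>g n (t + h i) - g n t\<bar>) \<longlonglongrightarrow> 0" by simp
    qed
    show "AE t in lborel. norm (indicator ?B t * \<bar>g n (t + h i) - g n t\<bar>) \<le> indicator ?B t * 2" for i
      using d2[OF gb gb] by (intro AE_I2) (auto split: split_indicator)
  qed auto
  have ie2: "integrable lborel (\<lambda>t. indicator ?B2 t * \<bar>f t - g n t\<bar>)" for n
    using d2[OF fb gb] fin by (intro integrable_indicator_bounded) auto
  have ie1: "integrable lborel (\<lambda>t. indicator ?B t * \<bar>f t - g n t\<bar>)" for n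
    using d2[OF fb gb] fin by (intro integrable_indicator_bounded) auto
  have bound: "(\<integral>t. indicator ?B t * \<bar>f (t + c) - f t\<bar> \<partial>lborel) \<le> 2 * e n + (\<integral>t. indicator ?B t * \<bar>g n (t + c) - g n t\<bar> \<partial>lborel)"
    if c: "norm c \<le> 1" for c n
  proof -
    have i1: "integrable lborel (\<lambda>t. indicator ?B2 (t + c) * \<bar>f (t + c) - g n (t + c)\<bar>)"
      using lborel_translate(2)[of "\<lambda>t. indicator ?B2 t * \<bar>f t - g n t\<bar>" c] ie2 by simp
    have i2: "integrable lborel (\<lambda>t. indicator ?B t * \<bar>g n (t + c) - g n t\<bar>)"
      using d2[OF gb gb] fin by (intro integrable_indicator_bounded) auto
    have i3: "integrable lborel (\<lambda>t. indicator ?B t * \<bar>f (t + c) - f t\<bar>)"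
      using d2[OF fb fb] fin by (intro integrable_indicator_bounded) auto
    have p: "indicator ?B t * \<bar>f (t + c) - f t\<bar> \<le> indicator ?B2 (t + c) * \<bar>f (t + c) - g n (t + c)\<bar>
        + indicator ?B t * \<bar>g n (t + c) - g n t\<bar> + indicator ?B2 t * \<bar>f t - g n t\<bar>" for t
    proof (cases "t \<in> ?B")
      case True
      then have "t + c \<in> ?B2" "t \<in> ?B2" using norm_triangle_ineq[of t c] c by auto
      then show ?thesis using True by (simp add: abs_if)
    next
      case False
      then show ?thesis by (simp split: split_indicator)
    qed
    have "(\<integral>t. indicator ?B t * \<bar>f (t + c) - f t\<bar> \<partial>lborel) \<le> (\<integral>t. indicator ?B2 (t + c) * \<bar>f (t + c) - g n (t + c)\<bar>
        + indicator ?B t * \<bar>g n (t + c) - g n t\<bar> + indicator ?B2 t * \<bar>f t - g n t\<bar> \<partial>lborel)"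
      by (intro integral_mono Bochner_Integration.integrable_add i1 i2 i3 ie2 p)
    also have "\<dots> = (\<integral>t. indicator ?B2 (t + c) * \<bar>f (t + c) - g n (t + c)\<bar> \<partial>lborel)
        + (\<integral>t. indicator ?B t * \<bar>g n (t + c) - g n t\<bar> \<partial>lborel) + e n"
      using i1 i2 ie2 by (simp add: e_def)
    also have "(\<integral>t. indicator ?B2 (t + c) * \<bar>f (t + c) - g n (t + c)\<bar> \<partial>lborel) = e n"
      unfolding e_def using lborel_translate(1)[of "\<lambda>t. indicator ?B2 t * \<bar>f t - g n t\<bar>" c] by simp
    finally show ?thesis by simp
  qed
  show ?thesis
  proof (rule LIMSEQ_I)
    fix \<epsilon> :: real assume \<epsilon>: "\<epsilon> > 0"
    obtain n where n: "\<bar>e n\<bar> < \<epsilon> / 4" using LIMSEQ_D[OF e0, of "\<epsilon> / 4"] \<epsilon> by auto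
    obtain I where I: "\<And>i. i \<ge> I \<Longrightarrow> \<bar>\<integral>t. indicator ?B t * \<bar>g n (t + h i) - g n t\<bar> \<partial>lborel\<bar> < \<epsilon> / 2"
      using LIMSEQ_D[OF m0[of n], of "\<epsilon> / 2"] \<epsilon> by auto
    obtain J where J: "\<And>i. i \<ge> J \<Longrightarrow> norm (h i) < 1" using LIMSEQ_D[OF h, of 1] by auto
    have "\<bar>\<integral>t. indicator ?B t * \<bar>f (t + h i) - f t\<bar> \<partial>lborel\<bar> < \<epsilon>" if "i \<ge> max I J" for i
    proof -
      have "0 \<le> (\<integral>t. indicator ?B t * \<bar>f (t + h i) - f t\<bar> \<partial>lborel)" by (intro Bochner_Integration.integral_nonneg) simp
      moreover have "(\<integral>t. indicator ?B t * \<bar>f (t + h i) - f t\<bar> \<partial>lborel) \<le> 2 * e n + (\<integral>t. indicator ?B t * \<bar>g n (t + h i) - g n t\<bar> \<partial>lborel)"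
        using J[of i] that by (intro bound) auto
      ultimately show ?thesis using n I[of i] that by auto
    qed
    then show "\<exists>no. \<forall>i\<ge>no. norm ((\<integral>t. indicator ?B t * \<bar>f (t + h i) - f t\<bar> \<partial>lborel) - 0) < \<epsilon>"
      by (intro exI[of _ "max I J"]) simp
  qed
qed

section \<open>Averages over cubes\<close>

definition cube :: "real \<Rightarrow> (real ^ 'd) set" where "cube T = cbox 0 (\<chi> i. T)"

lemma cube_sets[measurable]: "cube T \<in> sets borel" by (simp add: cube_def)

lemma measure_const_cbox:
  "a \<le> b \<Longrightarrow> measure lborel (cbox (\<chi> i. a) (\<chi> i. b) :: (real ^ 'd) set) = (b - a) ^ CARD('d)"
  by (subst content_cbox_cart) (simp_all add: interval_ne_empty_cart)

lemma cube_eq: "(cube T :: (real ^ 'd) set) = cbox (\<chi> i. 0) (\<chi> i. T)"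
proof -
  have "(0 :: real ^ 'd) = (\<chi> i. 0)" by (simp add: vec_eq_iff)
  then show ?thesis by (simp add: cube_def)
qed

lemma measure_cube: "0 \<le> T \<Longrightarrow> measure lborel (cube T :: (real ^ 'd) set) = T ^ CARD('d)"
  unfolding cube_eq by (subst measure_const_cbox) auto

lemma emeasure_cube_finite: "emeasure lborel (cube T :: (real ^ 'd) set) < \<infinity>"
  unfolding cube_def by (rule emeasure_bounded_finite) simp

definition tail_integral :: "(real ^ 'd \<Rightarrow> real) \<Rightarrow> real \<Rightarrow> real" where
  "tail_integral K a = (LINT t:(UNIV - cbox (\<chi> i. - a) (\<chi> i. a))|lborel. \<bar>K t\<bar>)"

text \<open>With \<open>K\<close> the covariance function of a stationary field, this is the
  variance of the integral of the field over the cube.\<close>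

definition box_average :: "(real ^ 'd \<Rightarrow> real) \<Rightarrow> real \<Rightarrow> real" where
  "box_average K T = (\<integral>s. indicator (cube T) s * (\<integral>t. indicator (cube T) t * K (t - s) \<partial>lborel) \<partial>lborel)"

text \<open>For \<open>s\<close> at distance at least \<open>a\<close> from the faces the shifted
  cube contains the cube of half-width \<open>a\<close> around 0, and the inner integral misses at
  most the tail of \<open>K\<close>. The remaining shell has volume
  \<open>T ^ CARD('d) - (T - 2 * a) ^ CARD('d)\<close>, and there the whole norm of \<open>K\<close>
  is given away.\<close>

lemma box_average_error:
  fixes K :: "real ^ 'd \<Rightarrow> real"
  assumes K: "integrable lborel K" and a: "0 < a" "2 * a \<le> T"
  shows "\<bar>box_average K T - T ^ CARD('d) * (\<integral>t. K t \<partial>lborel)\<bar>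
    \<le> T ^ CARD('d) * tail_integral K a + (T ^ CARD('d) - (T - 2 * a) ^ CARD('d)) * (\<integral>t. \<bar>K t\<bar> \<partial>lborel)"
proof -
  let ?Q = "cube T :: (real ^ 'd) set" and ?R = "cbox (\<chi> i. a) (\<chi> i. T - a) :: (real ^ 'd) set"
  let ?C = "cbox (\<chi> i. - a) (\<chi> i. a) :: (real ^ 'd) set"
  let ?N = "\<integral>t. \<bar>K t\<bar> \<partial>lborel"
  have [measurable]: "K \<in> borel_measurable borel" using K by auto
  have T: "T > 0" using a by simp
  have Ks: "integrable lborel (\<lambda>t. K (t - s))" for s using lborel_translate(2)[of K "- s"] K by simp
  have Ki: "(\<integral>t. K (t - s) \<partial>lborel) = (\<integral>t. K t \<partial>lborel)" for s using lborel_translate(1)[of K "- s"] by simp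
  have Ka: "(\<integral>t. \<bar>K (t - s)\<bar> \<partial>lborel) = ?N" for s using lborel_translate(1)[of "\<lambda>t. \<bar>K t\<bar>" "- s"] by simp
  have Qi: "integrable lborel (\<lambda>t. indicator ?Q t * K (t - s))" for s
    using Ks[of s] by (rule Bochner_Integration.integrable_bound) (auto split: split_indicator)
  define \<phi> where "\<phi> s = (\<integral>t. indicator ?Q t * K (t - s) \<partial>lborel)" for s
  have \<phi>m[measurable]: "\<phi> \<in> borel_measurable borel" unfolding \<phi>_def[abs_def] by measurable
  have \<phi>b: "\<bar>\<phi> s\<bar> \<le> ?N" for s
  proof -
    have "\<bar>\<phi> s\<bar> \<le> (\<integral>t. \<bar>indicator ?Q t * K (t - s)\<bar> \<partial>lborel)" unfolding \<phi>_def by (rule integral_abs_bound)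
    also have "\<dots> \<le> (\<integral>t. \<bar>K (t - s)\<bar> \<partial>lborel)" using Qi Ks by (intro integral_mono) (auto split: split_indicator)
    finally show ?thesis by (simp add: Ka)
  qed
  have tail: "tail_integral K a = (\<integral>t. indicator (UNIV - ?C) t * \<bar>K t\<bar> \<partial>lborel)"
    by (simp add: tail_integral_def set_lebesgue_integral_def)
  have tail0: "0 \<le> tail_integral K a" unfolding tail by (intro Bochner_Integration.integral_nonneg) simp
  have N0: "0 \<le> ?N" by (intro Bochner_Integration.integral_nonneg) simp
  have pt: "\<bar>\<phi> s - (\<integral>t. K t \<partial>lborel)\<bar> \<le> tail_integral K a + indicator (?Q - ?R) s * ?N" if s: "s \<in> ?Q" for s
  proof -
    have "\<phi> s - (\<integral>t. K t \<partial>lborel) = (\<integral>t. indicator ?Q t * K (t - s) - K (t - s) \<partial>lborel)"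
      unfolding \<phi>_def using Qi[of s] Ks[of s] Ki[of s] by simp
    then have "\<bar>\<phi> s - (\<integral>t. K t \<partial>lborel)\<bar> \<le> (\<integral>t. \<bar>indicator ?Q t * K (t - s) - K (t - s)\<bar> \<partial>lborel)"
      by (simp only: integral_abs_bound)
    also have "\<dots> \<le> tail_integral K a + indicator (?Q - ?R) s * ?N"
    proof (cases "s \<in> ?R")
      case True
      have out: "t - s \<notin> ?C" if "t \<notin> ?Q" for t
      proof
        assume "t - s \<in> ?C"
        then have "- a \<le> t $ i - s $ i \<and> t $ i - s $ i \<le> a" for i by (simp add: mem_box_cart)
        moreover have "a \<le> s $ i \<and> s $ i \<le> T - a" for i using True by (simp add: mem_box_cart)
        ultimately have "0 \<le> t $ i \<and> t $ i \<le> T" for i by (smt (verit))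
        then show False using that by (simp add: cube_def mem_box_cart)
      qed
      have i: "integrable lborel (\<lambda>t. indicator (UNIV - ?C) t * \<bar>K t\<bar>)"
        using integrable_abs[OF K] by (rule Bochner_Integration.integrable_bound) (auto split: split_indicator)
      have "(\<integral>t. \<bar>indicator ?Q t * K (t - s) - K (t - s)\<bar> \<partial>lborel) \<le> (\<integral>t. indicator (UNIV - ?C) (t - s) * \<bar>K (t - s)\<bar> \<partial>lborel)"
        using out lborel_translate(2)[of "\<lambda>t. indicator (UNIV - ?C) t * \<bar>K t\<bar>" "- s"] i Qi[of s] Ks[of s]
        by (intro integral_mono) (auto split: split_indicator)
      also have "\<dots> = tail_integral K a"
        unfolding tail using lborel_translate(1)[of "\<lambda>t. indicator (UNIV - ?C) t * \<bar>K t\<bar>" "- s"] by simp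
      finally show ?thesis using N0 by (simp add: add_increasing2)
    next
      case False
      have "(\<integral>t. \<bar>indicator ?Q t * K (t - s) - K (t - s)\<bar> \<partial>lborel) \<le> (\<integral>t. \<bar>K (t - s)\<bar> \<partial>lborel)"
        using Qi[of s] Ks[of s] by (intro integral_mono) (auto split: split_indicator)
      then show ?thesis using False s tail0 by (simp add: Ka)
    qed
    finally show ?thesis .
  qed
  have fQ: "emeasure lborel ?Q < \<infinity>" by (rule emeasure_cube_finite)
  have fD: "emeasure lborel (?Q - ?R) < \<infinity>"
    using emeasure_mono[of "?Q - ?R" ?Q lborel] fQ by (auto intro: le_less_trans)
  have sub: "?R \<subseteq> ?Q"
  proof
    fix x assume "x \<in> ?R"
    then have x: "a \<le> x $ i \<and> x $ i \<le> T - a" for i by (simp add: mem_box_cart)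
    have "0 \<le> x $ i \<and> x $ i \<le> T" for i using x[of i] a by linarith
    then show "x \<in> ?Q" by (simp add: cube_def mem_box_cart)
  qed
  have mD: "measure lborel (?Q - ?R) = T ^ CARD('d) - (T - 2 * a) ^ CARD('d)"
    using measure_Diff[of lborel ?Q ?R] sub fQ T a measure_const_cbox[of a "T - a", where 'd = 'd] by (simp add: measure_cube)
  have iQ: "integrable lborel (\<lambda>s. indicator ?Q s * \<phi> s)" using \<phi>b fQ by (intro integrable_indicator_bounded) auto
  have iQ': "integrable lborel (\<lambda>s. indicator ?Q s :: real)" using fQ by (intro integrable_real_indicator) auto
  have iD: "integrable lborel (\<lambda>s. indicator (?Q - ?R) s :: real)" using fD by (intro integrable_real_indicator) auto
  have "box_average K T - T ^ CARD('d) * (\<integral>t. K t \<partial>lborel) = (\<integral>s. indicator ?Q s * (\<phi> s - (\<integral>t. K t \<partial>lborel)) \<partial>lborel)"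
    unfolding right_diff_distrib box_average_def \<phi>_def[symmetric] using iQ iQ' T by (simp add: measure_cube)
  also have "\<bar>\<dots>\<bar> \<le> (\<integral>s. indicator ?Q s * tail_integral K a + indicator (?Q - ?R) s * ?N \<partial>lborel)"
  proof (rule order_trans[OF integral_abs_bound], rule integral_mono)
    show "integrable lborel (\<lambda>s. \<bar>indicator ?Q s * (\<phi> s - (\<integral>t. K t \<partial>lborel))\<bar>)"
      unfolding right_diff_distrib using iQ iQ' by simp
    show "integrable lborel (\<lambda>s. indicator ?Q s * tail_integral K a + indicator (?Q - ?R) s * ?N)"
      using iQ' iD by simp
    show "\<bar>indicator ?Q s * (\<phi> s - (\<integral>t. K t \<partial>lborel))\<bar> \<le> indicator ?Q s * tail_integral K a + indicator (?Q - ?R) s * ?N" for s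
      using pt[of s] by (cases "s \<in> ?Q") auto
  qed
  also have "\<dots> = T ^ CARD('d) * tail_integral K a + (T ^ CARD('d) - (T - 2 * a) ^ CARD('d)) * ?N"
    using iQ' iD T by (simp add: measure_cube mD)
  finally show ?thesis .
qed

lemma box_average_nonneg_imp:
  fixes K :: "real ^ 'd \<Rightarrow> real"
  assumes K: "integrable lborel K" and nn: "\<And>T. 0 \<le> box_average K T"
  shows "0 \<le> (\<integral>t. K t \<partial>lborel)"
proof -
  let ?N = "\<integral>t. \<bar>K t\<bar> \<partial>lborel"
  let ?C = "\<lambda>n::nat. cbox (\<chi> i. - real n) (\<chi> i. real n) :: (real ^ 'd) set"
  have [measurable]: "K \<in> borel_measurable borel" using K by auto
  have tl: "(\<lambda>n. tail_integral K (real n)) \<longlonglongrightarrow> (\<integral>t. 0 \<partial>(lborel :: (real ^ 'd) measure))"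
    unfolding tail_integral_def set_lebesgue_integral_def
  proof (rule integral_dominated_convergence[where w = "\<lambda>t. \<bar>K t\<bar>"])
    show "integrable lborel (\<lambda>t. \<bar>K t\<bar>)" using K by simp
    show "AE t in lborel. (\<lambda>n. indicator (UNIV - ?C n) t *\<^sub>R \<bar>K t\<bar>) \<longlonglongrightarrow> 0"
    proof (intro AE_I2 tendsto_eventually)
      fix t :: "real ^ 'd"
      obtain m where m: "norm t \<le> real m" using real_arch_simple by blast
      show "\<forall>\<^sub>F n in sequentially. indicator (UNIV - ?C n) t *\<^sub>R \<bar>K t\<bar> = 0"
        using eventually_ge_at_top[of m]
      proof eventually_elim
        case (elim n)
        have "\<bar>t $ i\<bar> \<le> real n" for i using component_le_norm_cart[of t i] m elim by linarith
        then have "t \<in> ?C n" by (simp add: mem_box_cart abs_le_iff minus_le_iff)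
        then show ?case by simp
      qed
    qed
    show "AE t in lborel. norm (indicator (UNIV - ?C n) t *\<^sub>R \<bar>K t\<bar>) \<le> \<bar>K t\<bar>" for n
      by (intro AE_I2) (auto split: split_indicator)
  qed auto
  have lim: "(\<lambda>n. - (tail_integral K (real n) + (1 - (1 - 2 / real n) ^ CARD('d)) * ?N)) \<longlonglongrightarrow> - (0 + (1 - (1 - 0) ^ CARD('d)) * ?N)"
    using tl by (intro tendsto_intros lim_const_over_n) simp
  have "\<forall>\<^sub>F n in sequentially. - (tail_integral K (real n) + (1 - (1 - 2 / real n) ^ CARD('d)) * ?N) \<le> (\<integral>t. K t \<partial>lborel)"
    using eventually_ge_at_top[of 2]
  proof eventually_elim
    case (elim n)
    \<comment> \<open>With side \<open>n * n\<close> and margin \<open>n\<close> both the tail of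
      \<open>K\<close> and the relative margin \<open>2 / n\<close> tend to 0.\<close>
    define T where "T = real n * real n"
    have T: "T > 0" "2 * real n \<le> T" using elim by (auto simp: T_def)
    have "(T - 2 * real n) = T * (1 - 2 / real n)" using elim by (simp add: T_def field_simps)
    then have e: "(T - 2 * real n) ^ CARD('d) = T ^ CARD('d) * (1 - 2 / real n) ^ CARD('d)" by (simp add: power_mult_distrib)
    have "\<bar>box_average K T - T ^ CARD('d) * (\<integral>t. K t \<partial>lborel)\<bar>
       \<le> T ^ CARD('d) * tail_integral K (real n) + (T ^ CARD('d) - (T - 2 * real n) ^ CARD('d)) * ?N"
      using elim T by (intro box_average_error[OF K]) auto
    then have "- (T ^ CARD('d) * tail_integral K (real n) + (T ^ CARD('d) - T ^ CARD('d) * (1 - 2 / real n) ^ CARD('d)) * ?N) \<le> T ^ CARD('d) * (\<integral>t. K t \<partial>lborel)"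
      unfolding e using nn[of T] by linarith
    then have "T ^ CARD('d) * - (tail_integral K (real n) + (1 - (1 - 2 / real n) ^ CARD('d)) * ?N) \<le> T ^ CARD('d) * (\<integral>t. K t \<partial>lborel)"
      by (simp add: algebra_simps)
    then show ?case using T(1) by (simp only: mult_le_cancel_left_pos zero_less_power)
  qed
  from tendsto_upperbound[OF lim this] show ?thesis by simp
qed

section \<open>Covariance functions of measurable stationary Gaussian fields\<close>

lemma (in centered_gaussian) inner_square_le:
  assumes U: "U \<in> lin_span X" and V: "V \<in> lin_span X" and V1: "(\<integral>\<omega>. V \<omega> * V \<omega> \<partial>M) = 1"
  shows "(\<integral>\<omega>. U \<omega> * V \<omega> \<partial>M)\<^sup>2 \<le> (\<integral>\<omega>. U \<omega> * U \<omega> \<partial>M)"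
proof -
  let ?c = "\<integral>\<omega>. U \<omega> * V \<omega> \<partial>M"
  have i: "integrable M (\<lambda>\<omega>. U \<omega> * U \<omega>)" "integrable M (\<lambda>\<omega>. U \<omega> * V \<omega>)" "integrable M (\<lambda>\<omega>. V \<omega> * V \<omega>)"
    using U V by (auto intro: lin_span_integrable_mult)
  have "0 \<le> (\<integral>\<omega>. (U \<omega> - ?c * V \<omega>) * (U \<omega> - ?c * V \<omega>) \<partial>M)" by (intro Bochner_Integration.integral_nonneg) simp
  also have "\<dots> = (\<integral>\<omega>. U \<omega> * U \<omega> - 2 * ?c * (U \<omega> * V \<omega>) + ?c\<^sup>2 * (V \<omega> * V \<omega>) \<partial>M)"
    by (simp add: power2_eq_square algebra_simps)
  also have "\<dots> = (\<integral>\<omega>. U \<omega> * U \<omega> \<partial>M) - ?c\<^sup>2" using i V1 by (simp add: power2_eq_square)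
  finally show ?thesis by simp
qed

text \<open>Stationarity enters through the form \<open>\<rho> (t - s)\<close> of the covariance.
  The field is only assumed jointly measurable, so every regularity property of \<rho> has to be
  derived.\<close>

locale stationary_gaussian = centered_gaussian M X
  for M :: "'w measure" and X :: "real ^ 'd \<Rightarrow> 'w \<Rightarrow> real" +
  fixes \<rho> :: "real ^ 'd \<Rightarrow> real"
  assumes joint[measurable]: "case_prod X \<in> borel_measurable (lborel \<Otimes>\<^sub>M M)"
    and covariance: "\<And>s t. (\<integral>\<omega>. X s \<omega> * X t \<omega> \<partial>M) = \<rho> (t - s)"
    and \<rho>_zero: "\<rho> 0 = 1"
    and \<rho>_integrable: "integrable lborel \<rho>"
begin

lemma \<rho>_measurable[measurable]: "\<rho> \<in> borel_measurable borel"
  using borel_measurable_integrable[OF \<rho>_integrable] by simp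

lemma \<rho>_sym: "\<rho> (- t) = \<rho> t"
  using covariance[of t 0] covariance[of 0 t] by (simp add: mult.commute)

lemma combo_variance: "(\<integral>\<omega>. (X a \<omega> - \<sigma> * X b \<omega>) * (X a \<omega> - \<sigma> * X b \<omega>) \<partial>M) = 1 - 2 * \<sigma> * \<rho> (b - a) + \<sigma>\<^sup>2"
proof -
  have i: "integrable M (\<lambda>\<omega>. X s \<omega> * X t \<omega>)" for s t by (intro lin_span_integrable_mult lin_span_base)
  have "(\<integral>\<omega>. (X a \<omega> - \<sigma> * X b \<omega>) * (X a \<omega> - \<sigma> * X b \<omega>) \<partial>M)
     = (\<integral>\<omega>. X a \<omega> * X a \<omega> - 2 * \<sigma> * (X a \<omega> * X b \<omega>) + \<sigma>\<^sup>2 * (X b \<omega> * X b \<omega>) \<partial>M)"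
    by (simp add: power2_eq_square algebra_simps)
  also have "\<dots> = \<rho> 0 - 2 * \<sigma> * \<rho> (b - a) + \<sigma>\<^sup>2 * \<rho> 0" using i by (simp add: covariance)
  finally show ?thesis by (simp add: \<rho>_zero)
qed

text \<open>The difference is the inner product of \<open>X a - \<sigma> * X b\<close> with the unit
  vector \<open>X 0\<close>, so Cauchy-Schwarz applies. The sign \<sigma> serves values of \<rho>
  near 1 and near -1 at once.\<close>

lemma \<rho>_increment:
  assumes "\<sigma>\<^sup>2 = 1"
  shows "(\<rho> a - \<sigma> * \<rho> b)\<^sup>2 \<le> 2 * (1 - \<sigma> * \<rho> (b - a))"
proof -
  have sp: "(\<lambda>\<omega>. X a \<omega> - \<sigma> * X b \<omega>) \<in> lin_span X" by (intro lin_span_diff lin_span_scale lin_span_base)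
  have i: "integrable M (\<lambda>\<omega>. X s \<omega> * X t \<omega>)" for s t by (intro lin_span_integrable_mult lin_span_base)
  have "(\<integral>\<omega>. (X a \<omega> - \<sigma> * X b \<omega>) * X 0 \<omega> \<partial>M) = (\<integral>\<omega>. X a \<omega> * X 0 \<omega> - \<sigma> * (X b \<omega> * X 0 \<omega>) \<partial>M)"
    by (simp add: algebra_simps)
  also have "\<dots> = \<rho> a - \<sigma> * \<rho> b" using i by (simp add: covariance \<rho>_sym)
  finally have e: "(\<integral>\<omega>. (X a \<omega> - \<sigma> * X b \<omega>) * X 0 \<omega> \<partial>M) = \<rho> a - \<sigma> * \<rho> b" .
  have "(\<integral>\<omega>. X 0 \<omega> * X 0 \<omega> \<partial>M) = 1" by (simp add: covariance \<rho>_zero)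
  from inner_square_le[OF sp lin_span_base this] show ?thesis unfolding e combo_variance using assms by simp
qed

lemma \<rho>_abs_le_1: "\<bar>\<rho> t\<bar> \<le> 1"
proof -
  have "0 \<le> 2 * (1 - 1 * \<rho> t)" "0 \<le> 2 * (1 - (- 1) * \<rho> t)"
    using order_trans[OF zero_le_power2 \<rho>_increment[of 1 0 t]] order_trans[OF zero_le_power2 \<rho>_increment[of "- 1" 0 t]] by simp_all
  then show ?thesis by simp
qed

text \<open>Translation is continuous in mean for the bounded functions
  \<open>cos (X t \<omega>)\<close> and \<open>sin (X t \<omega>)\<close>, path by path. Integrated
  over \<omega>, this forces the expectation of \<open>cos (X (t + h) - X t)\<close> to tend to 1,
  and for a Gaussian increment that expectation is \<open>exp (\<rho> h - 1)\<close>.\<close>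

lemma \<rho>_continuous_0: "isCont \<rho> 0"
  unfolding continuous_at_sequentially
proof (intro allI impI)
  fix h :: "nat \<Rightarrow> real ^ 'd" assume h: "h \<longlonglongrightarrow> 0"
  interpret LM: pair_sigma_finite lborel M ..
  let ?B = "cball (0::real ^ 'd) 1"
  have Bm[measurable]: "?B \<in> sets borel" by (intro borel_closed closed_cball)
  have fin: "emeasure lborel ?B < \<infinity>" by (rule emeasure_bounded_finite) simp
  have iB: "integrable lborel (indicator ?B :: _ \<Rightarrow> real)" using fin by (intro integrable_real_indicator) auto
  define V where "V = measure lborel ?B"
  have V0: "V > 0" unfolding V_def by (subst content_cball) auto
  \<comment> \<open>Cosine and sine stand for \<open>X\<close> itself, which is unbounded; together
    they control the cosine of the increment.\<close>
  define D where "D i t \<omega> = \<bar>cos (X (t + h i) \<omega>) - cos (X t \<omega>)\<bar> + \<bar>sin (X (t + h i) \<omega>) - sin (X t \<omega>)\<bar>" for i t \<omega>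
  have Db: "0 \<le> D i t \<omega>" "D i t \<omega> \<le> 4" for i t \<omega>
    unfolding D_def
    using cos_le_one[of "X (t + h i) \<omega>"] cos_ge_minus_one[of "X (t + h i) \<omega>"] cos_le_one[of "X t \<omega>"] cos_ge_minus_one[of "X t \<omega>"]
       sin_le_one[of "X (t + h i) \<omega>"] sin_ge_minus_one[of "X (t + h i) \<omega>"] sin_le_one[of "X t \<omega>"] sin_ge_minus_one[of "X t \<omega>"]
    by linarith+
  have [measurable]: "(\<lambda>p. X (fst p + h i) (snd p)) \<in> borel_measurable (lborel \<Otimes>\<^sub>M M)" for i
  proof -
    have "(\<lambda>p. (fst p + h i, snd p)) \<in> measurable (lborel \<Otimes>\<^sub>M M) (lborel \<Otimes>\<^sub>M M)" by measurable
    from measurable_compose[OF this joint] show ?thesis by simp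
  qed
  have [measurable]: "(\<lambda>p. X (fst p) (snd p)) \<in> borel_measurable (lborel \<Otimes>\<^sub>M M)" using joint by (simp add: split_beta')
  have Dm[measurable]: "(\<lambda>p. D i (fst p) (snd p)) \<in> borel_measurable (lborel \<Otimes>\<^sub>M M)" for i
    unfolding D_def[abs_def] by measurable
  have iD: "integrable (lborel \<Otimes>\<^sub>M M) (\<lambda>(t, \<omega>). indicator ?B t * D i t \<omega>)" for i
  proof (rule Bochner_Integration.integrable_bound)
    have "integrable (lborel \<Otimes>\<^sub>M M) (\<lambda>p. indicator ?B (fst p) * 4 :: real)"
      using iB by (intro LM.Fubini_integrable) (auto simp: prob_space)
    then show "integrable (lborel \<Otimes>\<^sub>M M) (\<lambda>p. indicator ?B (fst p) * 4 :: real)" .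
    show "(\<lambda>(t, \<omega>). indicator ?B t * D i t \<omega>) \<in> borel_measurable (lborel \<Otimes>\<^sub>M M)" by (simp add: split_beta')
    show "AE p in lborel \<Otimes>\<^sub>M M. norm (case p of (t, \<omega>) \<Rightarrow> indicator ?B t * D i t \<omega>) \<le> norm (indicator ?B (fst p) * 4 :: real)"
      using Db by (intro AE_I2) (auto split: split_indicator simp: split_beta)
  qed
  have lower: "V * (1 - exp (\<rho> (h i) - 1)) \<le> (\<integral>\<omega>. (\<integral>t. indicator ?B t * D i t \<omega> \<partial>lborel) \<partial>M)" for i
  proof -
    have E: "1 - exp (\<rho> (h i) - 1) \<le> (\<integral>\<omega>. D i t \<omega> \<partial>M)" for t
    proof -
      have sp: "(\<lambda>\<omega>. X (t + h i) \<omega> - 1 * X t \<omega>) \<in> lin_span X" by (intro lin_span_diff lin_span_scale lin_span_base)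
      have v: "(\<integral>\<omega>. (X (t + h i) \<omega> - 1 * X t \<omega>)\<^sup>2 \<partial>M) = 2 - 2 * \<rho> (h i)"
        unfolding power2_eq_square combo_variance using \<rho>_sym[of "h i"] by simp
      have c: "(\<integral>\<omega>. cos (X (t + h i) \<omega> - X t \<omega>) \<partial>M) = exp (\<rho> (h i) - 1)"
        using lin_span_trig(1)[OF sp] unfolding v by simp
      \<comment> \<open>\<open>2 * (1 - cos (a - b))\<close> is the squared distance of two points
        of the unit circle, and their coordinates differ by at most 2.\<close>
      have p: "1 - cos (a - b) \<le> \<bar>cos a - cos b\<bar> + \<bar>sin a - sin b\<bar>" for a b :: real
      proof -
        have "2 * (1 - cos (a - b)) = (cos a - cos b)\<^sup>2 + (sin a - sin b)\<^sup>2"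
          using sin_cos_squared_add[of a] sin_cos_squared_add[of b] by (simp add: cos_diff power2_diff algebra_simps)
        moreover have "(x - y)\<^sup>2 \<le> 2 * \<bar>x - y\<bar>" if "\<bar>x\<bar> \<le> 1" "\<bar>y\<bar> \<le> 1" for x y :: real
        proof -
          have "\<bar>x - y\<bar> \<le> 2" using that by linarith
          then have "\<bar>x - y\<bar> * \<bar>x - y\<bar> \<le> 2 * \<bar>x - y\<bar>" by (intro mult_right_mono) auto
          then show ?thesis by (simp add: power2_eq_square abs_mult[symmetric])
        qed
        from this[of "cos a" "cos b"] this[of "sin a" "sin b"]
        have "(cos a - cos b)\<^sup>2 + (sin a - sin b)\<^sup>2 \<le> 2 * \<bar>cos a - cos b\<bar> + 2 * \<bar>sin a - sin b\<bar>" by simp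
        ultimately show ?thesis by simp
      qed
      have "(\<integral>\<omega>. 1 - cos (X (t + h i) \<omega> - X t \<omega>) \<partial>M) \<le> (\<integral>\<omega>. D i t \<omega> \<partial>M)"
      proof (rule integral_mono)
        show "integrable M (\<lambda>\<omega>. 1 - cos (X (t + h i) \<omega> - X t \<omega>))"
          by (intro Bochner_Integration.integrable_diff integrable_const integrable_bounded_fun[where K = 1]) auto
        show "integrable M (D i t)"
          using Db by (intro integrable_bounded_fun[where K = 4]) (auto simp: D_def[abs_def])
        show "1 - cos (X (t + h i) \<omega> - X t \<omega>) \<le> D i t \<omega>" for \<omega> unfolding D_def by (rule p)
      qed
      moreover have "(\<integral>\<omega>. 1 - cos (X (t + h i) \<omega> - X t \<omega>) \<partial>M) = 1 - exp (\<rho> (h i) - 1)"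
        unfolding c[symmetric] using prob_space
        by (subst Bochner_Integration.integral_diff) (auto intro!: integrable_bounded_fun[where K = 1])
      ultimately show ?thesis by simp
    qed
    have "V * (1 - exp (\<rho> (h i) - 1)) = (\<integral>t. indicator ?B t * (1 - exp (\<rho> (h i) - 1)) \<partial>lborel)" by (simp add: V_def)
    also have "\<dots> \<le> (\<integral>t. (\<integral>\<omega>. indicator ?B t * D i t \<omega> \<partial>M) \<partial>lborel)"
    proof (rule integral_mono)
      show "integrable lborel (\<lambda>t. indicator ?B t * (1 - exp (\<rho> (h i) - 1)))" using iB by simp
      show "integrable lborel (\<lambda>t. \<integral>\<omega>. indicator ?B t * D i t \<omega> \<partial>M)" using LM.integrable_fst[OF iD] .
      show "indicator ?B t * (1 - exp (\<rho> (h i) - 1)) \<le> (\<integral>\<omega>. indicator ?B t * D i t \<omega> \<partial>M)" for t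
        using E[of t] by (simp split: split_indicator)
    qed
    also have "\<dots> = (\<integral>\<omega>. (\<integral>t. indicator ?B t * D i t \<omega> \<partial>lborel) \<partial>M)"
      using LM.Fubini_integral[OF iD] by simp
    finally show ?thesis .
  qed
  have upper: "(\<lambda>i. \<integral>\<omega>. (\<integral>t. indicator ?B t * D i t \<omega> \<partial>lborel) \<partial>M) \<longlonglongrightarrow> (\<integral>\<omega>. 0 \<partial>M)"
  proof (rule integral_dominated_convergence[where w = "\<lambda>_. 4 * V"])
    show "(\<lambda>\<omega>. \<integral>t. indicator ?B t * D i t \<omega> \<partial>lborel) \<in> borel_measurable M" for i
      using borel_measurable_integrable[OF LM.integrable_snd[OF iD[of i]]] .
    show "AE \<omega> in M. norm (\<integral>t. indicator ?B t * D i t \<omega> \<partial>lborel) \<le> 4 * V" for i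
    proof (intro AE_I2)
      fix \<omega> assume [simp]: "\<omega> \<in> space M"
      have m: "(\<lambda>t. D i t \<omega>) \<in> borel_measurable borel"
      proof -
        have "(\<lambda>t. (t, \<omega>)) \<in> measurable borel (lborel \<Otimes>\<^sub>M M)" by measurable
        from measurable_compose[OF this Dm] show ?thesis by simp
      qed
      have i: "integrable lborel (\<lambda>t. indicator ?B t * D i t \<omega>)"
        using Db m fin by (intro integrable_indicator_bounded[where K = 4]) auto
      have "norm (\<integral>t. indicator ?B t * D i t \<omega> \<partial>lborel) \<le> (\<integral>t. \<bar>indicator ?B t * D i t \<omega>\<bar> \<partial>lborel)" by simp
      also have "\<dots> \<le> (\<integral>t. 4 * indicator ?B t \<partial>lborel)"
        using i iB Db by (intro integral_mono) (auto split: split_indicator)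
      finally show "norm (\<integral>t. indicator ?B t * D i t \<omega> \<partial>lborel) \<le> 4 * V" by (simp add: V_def)
    qed
    show "AE \<omega> in M. (\<lambda>i. \<integral>t. indicator ?B t * D i t \<omega> \<partial>lborel) \<longlonglongrightarrow> 0"
    proof (intro AE_I2)
      fix \<omega> assume [simp]: "\<omega> \<in> space M"
      have Xm: "(\<lambda>t. X t \<omega>) \<in> borel_measurable borel"
      proof -
        have "(\<lambda>t. (t, \<omega>)) \<in> measurable borel (lborel \<Otimes>\<^sub>M M)" by measurable
        from measurable_compose[OF this joint] show ?thesis by simp
      qed
      have c: "(\<lambda>t. cos (X t \<omega>)) \<in> borel_measurable borel" "(\<lambda>t. sin (X t \<omega>)) \<in> borel_measurable borel" using Xm by auto
      have XmT: "(\<lambda>t. X (t + h i) \<omega>) \<in> borel_measurable borel" for i using Xm by measurable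
      have d2: "\<bar>\<bar>x - y\<bar>\<bar> \<le> 2" if "\<bar>x\<bar> \<le> 1" "\<bar>y\<bar> \<le> 1" for x y :: real using that by linarith
      have i1: "integrable lborel (\<lambda>t. indicator ?B t * \<bar>cos (X (t + h i) \<omega>) - cos (X t \<omega>)\<bar>)"
        and i2: "integrable lborel (\<lambda>t. indicator ?B t * \<bar>sin (X (t + h i) \<omega>) - sin (X t \<omega>)\<bar>)" for i
        using d2[OF abs_cos_le_one abs_cos_le_one] d2[OF abs_sin_le_one abs_sin_le_one] Xm XmT fin
        by (auto intro!: integrable_indicator_bounded[where K = 2])
      have "(\<lambda>i. (\<integral>t. indicator ?B t * \<bar>cos (X (t + h i) \<omega>) - cos (X t \<omega>)\<bar> \<partial>lborel)
          + (\<integral>t. indicator ?B t * \<bar>sin (X (t + h i) \<omega>) - sin (X t \<omega>)\<bar> \<partial>lborel)) \<longlonglongrightarrow> 0 + 0"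
        using c h by (intro tendsto_add translation_continuous_L1) auto
      then show "(\<lambda>i. \<integral>t. indicator ?B t * D i t \<omega> \<partial>lborel) \<longlonglongrightarrow> 0"
        using i1 i2 by (simp add: D_def distrib_left)
    qed
  qed auto
  have z: "(\<lambda>i. V * (1 - exp (\<rho> (h i) - 1))) \<longlonglongrightarrow> 0"
  proof (rule tendsto_sandwich[OF _ _ tendsto_const])
    show "\<forall>\<^sub>F i in sequentially. 0 \<le> V * (1 - exp (\<rho> (h i) - 1))"
      using V0 \<rho>_abs_le_1 by (intro always_eventually allI mult_nonneg_nonneg) (auto simp: abs_le_iff)
    show "\<forall>\<^sub>F i in sequentially. V * (1 - exp (\<rho> (h i) - 1)) \<le> (\<integral>\<omega>. (\<integral>t. indicator ?B t * D i t \<omega> \<partial>lborel) \<partial>M)"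
      using lower by simp
  qed (use upper in simp)
  have "(\<lambda>i. 1 - (V * (1 - exp (\<rho> (h i) - 1))) / V) \<longlonglongrightarrow> 1 - 0 / V"
    using V0 by (intro tendsto_intros z) auto
  then have "(\<lambda>i. exp (\<rho> (h i) - 1)) \<longlonglongrightarrow> 1" using V0 by simp
  then have "(\<lambda>i. ln (exp (\<rho> (h i) - 1))) \<longlonglongrightarrow> ln 1" by (rule tendsto_ln) simp
  then have "(\<lambda>i. (\<rho> (h i) - 1) + 1) \<longlonglongrightarrow> 0 + 1" by (intro tendsto_add tendsto_const) simp
  then show "(\<rho> \<circ> h) \<longlonglongrightarrow> \<rho> 0" by (simp add: \<rho>_zero comp_def)
qed

lemma \<rho>_near_0:
  assumes "\<eta> > 0"
  obtains \<delta> where "\<delta> > 0" "\<And>t. norm t < \<delta> \<Longrightarrow> \<rho> t > 1 - \<eta>"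
proof -
  obtain \<delta> where "\<delta> > 0" "\<And>t. dist t 0 < \<delta> \<Longrightarrow> dist (\<rho> t) (\<rho> 0) < \<eta>"
    using \<rho>_continuous_0 assms unfolding continuous_at_eps_delta by blast
  then show ?thesis using that[of \<delta>] by (force simp: dist_norm \<rho>_zero dist_real_def abs_le_iff)
qed

text \<open>If \<open>\<bar>\<rho> t\<bar>\<close> is close to 1, then translation by
  \<open>t\<close> nearly preserves each variable up to sign, and each further translation costs
  \<open>sqrt (2 * \<eta>)\<close>.\<close>

lemma \<rho>_multiples:
  assumes \<eta>: "0 \<le> \<eta>" and t: "\<bar>\<rho> t\<bar> \<ge> 1 - \<eta>"
  shows "\<bar>\<rho> (real j *\<^sub>R t)\<bar> \<ge> 1 - real j * sqrt (2 * \<eta>)"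
proof (induction j)
  case 0
  then show ?case by (simp add: \<rho>_zero)
next
  case (Suc j)
  define \<sigma> :: real where "\<sigma> = (if \<rho> t \<ge> 0 then 1 else - 1)"
  have \<sigma>: "\<sigma>\<^sup>2 = 1" "\<sigma> * \<rho> t = \<bar>\<rho> t\<bar>" "\<bar>\<sigma>\<bar> = 1" by (auto simp: \<sigma>_def)
  have "real j *\<^sub>R t - real (Suc j) *\<^sub>R t = - t" by (simp add: algebra_simps)
  then have "(\<rho> (real (Suc j) *\<^sub>R t) - \<sigma> * \<rho> (real j *\<^sub>R t))\<^sup>2 \<le> 2 * (1 - \<bar>\<rho> t\<bar>)"
    using \<rho>_increment[OF \<sigma>(1), of "real (Suc j) *\<^sub>R t" "real j *\<^sub>R t"] by (simp only: \<rho>_sym \<sigma>(2))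
  also have "\<dots> \<le> 2 * \<eta>" using t by simp
  finally have "\<bar>\<rho> (real (Suc j) *\<^sub>R t) - \<sigma> * \<rho> (real j *\<^sub>R t)\<bar> \<le> sqrt (2 * \<eta>)"
    by (rule real_le_rsqrt[of "\<bar>_\<bar>", unfolded power2_abs])
  moreover have "\<bar>\<sigma> * \<rho> (real j *\<^sub>R t)\<bar> = \<bar>\<rho> (real j *\<^sub>R t)\<bar>" using \<sigma>(3) by (simp add: abs_mult)
  ultimately have "\<bar>\<rho> (real (Suc j) *\<^sub>R t)\<bar> \<ge> \<bar>\<rho> (real j *\<^sub>R t)\<bar> - sqrt (2 * \<eta>)" by linarith
  then show ?case using Suc.IH by (simp add: algebra_simps)
qed

text \<open>If \<open>\<rho>\<close> came close to \<open>\<plusminus>1\<close> far from the origin, at \<open>t\<close> say, then it would also do so at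
  many multiples of \<open>t\<close>, hence be bounded away from zero on many disjoint balls.\<close>

lemma \<rho>_bounded_away:
  assumes \<delta>: "\<delta> > 0" and near: "\<And>t. norm t < 2 * \<delta> \<Longrightarrow> \<rho> t > 31 / 32"
  obtains \<eta> where "0 < \<eta>" "\<eta> < 1" "\<And>t. norm t \<ge> 2 * \<delta> \<Longrightarrow> \<bar>\<rho> t\<bar> \<le> 1 - \<eta>"
proof -
  define R where "R = (\<integral>t. \<bar>\<rho> t\<bar> \<partial>lborel)"
  define v where "v = measure lborel (ball (0::real ^ 'd) \<delta>)"
  have vb: "measure lborel (ball (c::real ^ 'd) \<delta>) = v" for c
    unfolding v_def using \<delta> by (simp add: content_ball)
  have v0: "v > 0" unfolding v_def using \<delta> by (simp add: content_ball)
  \<comment> \<open>\<open>J\<close> disjoint balls on which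
    \<open>\<bar>\<rho>\<bar> \<ge> 1 / 2\<close> contribute \<open>real J * v / 2\<close> to the
    norm of \<rho>, and this is to exceed \<open>R\<close>.\<close>
  obtain J0 :: nat where "2 * R / v < real J0" using reals_Archimedean2 by blast
  then have "2 * R / v < real (Suc J0)" by simp
  then obtain J where J: "2 * R / v < real J" "J \<ge> 1" by (metis Suc_leI zero_less_Suc One_nat_def)
  \<comment> \<open>Then \<open>sqrt (2 * \<eta>) = 1 / (4 * real J)\<close>, so that the multiples
    of \<open>t\<close> by numbers below \<open>J\<close> lose at most \<open>1 / 4\<close>.\<close>
  define \<eta> where "\<eta> = 1 / (32 * (real J)\<^sup>2)"
  have Jp: "real J \<ge> 1" using J by simp
  have \<eta>: "0 < \<eta>" "\<eta> < 1"
  proof -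
    have "1 \<le> (real J)\<^sup>2" using Jp by simp
    then have "1 < 32 * (real J)\<^sup>2" by linarith
    then show "0 < \<eta>" "\<eta> < 1" unfolding \<eta>_def using Jp by (simp_all add: divide_less_eq)
  qed
  have sq: "sqrt (2 * \<eta>) = 1 / (4 * real J)"
  proof (rule real_sqrt_unique)
    show "(1 / (4 * real J))\<^sup>2 = 2 * \<eta>" unfolding \<eta>_def by (simp add: power_divide power_mult_distrib)
  qed simp
  show ?thesis
  proof (rule that[OF \<eta>])
    fix t :: "real ^ 'd" assume t: "norm t \<ge> 2 * \<delta>"
    show "\<bar>\<rho> t\<bar> \<le> 1 - \<eta>"
    proof (rule ccontr)
      assume "\<not> \<bar>\<rho> t\<bar> \<le> 1 - \<eta>"
      then have c: "\<bar>\<rho> t\<bar> \<ge> 1 - \<eta>" by simp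
      have big: "\<bar>\<rho> (real j *\<^sub>R t)\<bar> \<ge> 3 / 4" if "j < J" for j
      proof -
        have "real j * (1 / (4 * real J)) \<le> real J * (1 / (4 * real J))" using that by (intro mult_right_mono) auto
        also have "\<dots> = 1 / 4" using Jp by simp
        finally show ?thesis using \<rho>_multiples[OF less_imp_le[OF \<eta>(1)] c, of j] unfolding sq by simp
      qed
      \<comment> \<open>\<open>2 * (1 - 31 / 32) = (1 / 4)\<^sup>2\<close> explains the constant
        \<open>31 / 32\<close>: inside the ball \<rho> varies by at most \<open>1 / 4\<close> from
        its value at the centre, which leaves \<open>1 / 2\<close> of the \<open>3 / 4\<close>
        there.\<close>
      have half: "\<bar>\<rho> x\<bar> \<ge> 1 / 2" if j: "j < J" and x: "x \<in> ball (real j *\<^sub>R t) \<delta>" for j x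
      proof -
        have "norm (real j *\<^sub>R t - x) < 2 * \<delta>" using x \<delta> by (simp add: dist_norm)
        from near[OF this] have "(\<rho> x - 1 * \<rho> (real j *\<^sub>R t))\<^sup>2 \<le> (1 / 4)\<^sup>2"
          using \<rho>_increment[of 1 x "real j *\<^sub>R t"] by (simp add: power2_eq_square)
        then have "\<bar>\<rho> x - \<rho> (real j *\<^sub>R t)\<bar> \<le> 1 / 4" using abs_le_square_iff[of "\<rho> x - \<rho> (real j *\<^sub>R t)" "1/4"] by simp
        then show ?thesis using big[OF j] by linarith
      qed
      let ?U = "\<Union>j\<in>{..<J}. ball (real j *\<^sub>R t) \<delta>"
      have disj: "disjoint_family_on (\<lambda>j. ball (real j *\<^sub>R t) \<delta>) {..<J}"
        unfolding disjoint_family_on_def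
      proof (intro ballI impI, rule ccontr)
        fix j k assume "j \<noteq> k" "ball (real j *\<^sub>R t) \<delta> \<inter> ball (real k *\<^sub>R t) \<delta> \<noteq> {}"
        then obtain x where "dist (real j *\<^sub>R t) x < \<delta>" "dist (real k *\<^sub>R t) x < \<delta>" by auto
        then have "dist (real j *\<^sub>R t) (real k *\<^sub>R t) < 2 * \<delta>" using dist_triangle2[of "real j *\<^sub>R t" "real k *\<^sub>R t" x] by linarith
        then have "\<bar>real j - real k\<bar> * norm t < 2 * \<delta>" by (simp add: dist_norm scaleR_diff_left[symmetric])
        moreover have "1 \<le> \<bar>real j - real k\<bar>" using \<open>j \<noteq> k\<close> by linarith
        then have "1 * norm t \<le> \<bar>real j - real k\<bar> * norm t" by (rule mult_right_mono) simp
        ultimately show False using t by simp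
      qed
      have Um: "?U \<in> sets borel" by (intro borel_open open_UN) auto
      have Uf: "emeasure lborel ?U < \<infinity>" by (rule emeasure_bounded_finite) (auto intro: bounded_UN)
      have mU: "measure lborel ?U = real J * v"
      proof -
        have "emeasure lborel (ball c \<delta>) \<noteq> top" for c :: "real ^ 'd" using emeasure_bounded_finite[of "ball c \<delta>"] by auto
        then show ?thesis using disj by (subst measure_finite_Union) (auto simp: vb)
      qed
      have iU: "integrable lborel (indicator ?U :: _ \<Rightarrow> real)" using Um Uf by (intro integrable_real_indicator) auto
      have "(\<integral>x. indicator ?U x * (1 / 2) \<partial>lborel) \<le> R"
        unfolding R_def
      proof (rule integral_mono)
        show "indicator ?U x * (1 / 2) \<le> \<bar>\<rho> x\<bar>" for x using half by (auto split: split_indicator)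
      qed (use iU \<rho>_integrable in auto)
      then have "real J * v / 2 \<le> R" using mU by simp
      moreover have "2 * R < real J * v" using J(1) v0 by (simp add: pos_divide_less_eq)
      ultimately show False by simp
    qed
  qed
qed

text \<open>With \<open>\<eta> = 0\<close>, \<open>\<rho>_multiples\<close> would carry the value 1
  of \<open>\<bar>\<rho>\<bar>\<close> to all multiples of \<open>t\<close>, arbitrarily far out,
  against \<open>\<rho>_bounded_away\<close>.\<close>

lemma \<rho>_abs_less_1:
  assumes "t \<noteq> 0"
  shows "\<bar>\<rho> t\<bar> < 1"
proof (rule ccontr)
  assume "\<not> \<bar>\<rho> t\<bar> < 1"
  then have c: "\<bar>\<rho> t\<bar> \<ge> 1 - 0" by simp
  obtain d where d: "d > 0" "\<And>t. norm t < d \<Longrightarrow> \<rho> t > 1 - 1 / 32" using \<rho>_near_0[of "1/32"] by auto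
  have "d / 2 > 0" "\<And>t. norm t < 2 * (d / 2) \<Longrightarrow> \<rho> t > 31 / 32" using d by auto
  then obtain \<eta> where \<eta>: "0 < \<eta>" "\<And>t. norm t \<ge> 2 * (d / 2) \<Longrightarrow> \<bar>\<rho> t\<bar> \<le> 1 - \<eta>"
    using \<rho>_bounded_away[of "d / 2"] by metis
  obtain j :: nat where j: "d / norm t < real j" using reals_Archimedean2 by blast
  then have "d \<le> norm (real j *\<^sub>R t)" using assms by (simp add: pos_divide_less_eq)
  then have "\<bar>\<rho> (real j *\<^sub>R t)\<bar> \<le> 1 - \<eta>" using \<eta>(2)[of "real j *\<^sub>R t"] by simp
  moreover have "\<bar>\<rho> (real j *\<^sub>R t)\<bar> \<ge> 1" using \<rho>_multiples[OF order_refl c, of j] by simp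
  ultimately show False using \<eta>(1) by simp
qed

lemma \<rho>_power_integrable:
  assumes "n \<ge> 1"
  shows "integrable lborel (\<lambda>t. \<rho> t ^ n)" "(\<integral>t. \<bar>\<rho> t ^ n\<bar> \<partial>lborel) \<le> (\<integral>t. \<bar>\<rho> t\<bar> \<partial>lborel)"
proof -
  have b: "\<bar>\<rho> t ^ n\<bar> \<le> \<bar>\<rho> t\<bar>" for t
  proof -
    obtain m where "n = Suc m" using assms by (cases n) auto
    then show ?thesis using \<rho>_abs_le_1[of t] by (simp add: abs_mult power_abs mult_left_le power_le_one)
  qed
  show i: "integrable lborel (\<lambda>t. \<rho> t ^ n)"
    using \<rho>_integrable by (rule Bochner_Integration.integrable_bound) (auto simp: b)
  show "(\<integral>t. \<bar>\<rho> t ^ n\<bar> \<partial>lborel) \<le> (\<integral>t. \<bar>\<rho> t\<bar> \<partial>lborel)"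
    using i \<rho>_integrable b by (intro integral_mono) auto
qed

text \<open>Near 0 the power exceeds \<open>q ^ n\<close>, and far out its absolute value is at most
  \<open>m ^ (n - 1) * \<bar>\<rho> t\<bar>\<close> with \<open>m < q\<close>; in between \<rho> is
  positive. The first contribution wins since \<open>(m / q) ^ n\<close> tends to 0.\<close>

lemma \<rho>_power_positive:
  obtains n0 where "\<And>n. n \<ge> n0 \<Longrightarrow> 0 < (\<integral>t. \<rho> t ^ n \<partial>lborel)"
proof -
  define R where "R = (\<integral>t. \<bar>\<rho> t\<bar> \<partial>lborel)"
  have R0: "0 \<le> R" unfolding R_def by (intro Bochner_Integration.integral_nonneg) simp
  obtain d where d: "d > 0" "\<And>t. norm t < d \<Longrightarrow> \<rho> t > 1 - 1 / 32" using \<rho>_near_0[of "1/32"] by auto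
  have "d / 2 > 0" "\<And>t. norm t < 2 * (d / 2) \<Longrightarrow> \<rho> t > 31 / 32" using d by auto
  then obtain \<eta> where \<eta>: "0 < \<eta>" "\<eta> < 1" "\<And>t. norm t \<ge> 2 * (d / 2) \<Longrightarrow> \<bar>\<rho> t\<bar> \<le> 1 - \<eta>"
    using \<rho>_bounded_away[of "d / 2"] by metis
  obtain e where e: "e > 0" "\<And>t. norm t < e \<Longrightarrow> \<rho> t > 1 - \<eta> / 2" using \<rho>_near_0[of "\<eta> / 2"] \<eta>(1) by auto
  define m where "m = 1 - \<eta>"
  define q where "q = 1 - \<eta> / 2"
  have mq: "0 < m" "m < q" "0 < q" using \<eta> by (auto simp: m_def q_def)
  define b where "b = min d e"
  let ?B = "ball (0::real ^ 'd) b"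
  have b0: "b > 0" using d e by (simp add: b_def)
  define v where "v = measure lborel ?B"
  have v0: "v > 0" unfolding v_def using b0 by (simp add: content_ball)
  have iB: "integrable lborel (indicator ?B :: _ \<Rightarrow> real)"
    using emeasure_bounded_finite[of ?B] by (intro integrable_real_indicator) auto
  have "(\<lambda>n. (m / q) ^ n) \<longlonglongrightarrow> 0" using mq by (intro LIMSEQ_realpow_zero) auto
  moreover have "0 < v * m / (R + 1)" using v0 mq R0 by simp
  ultimately obtain n1 where n1: "\<And>n. n \<ge> n1 \<Longrightarrow> norm ((m / q) ^ n - 0) < v * m / (R + 1)" using LIMSEQ_D by blast
  show ?thesis
  proof (rule that)
    fix n assume n: "n \<ge> max n1 1"
    then obtain k where k: "n = Suc k" by (cases n) auto
    have lower: "indicator ?B t * q ^ n - m ^ k * \<bar>\<rho> t\<bar> \<le> \<rho> t ^ n" for t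
    proof (cases "norm t < d")
      case True
      then have pos: "\<rho> t > 0" using d(2)[OF True] by simp
      have "indicator ?B t * q ^ n \<le> \<rho> t ^ n"
        using e(2)[of t] mq pos by (auto split: split_indicator simp: b_def q_def intro!: power_mono)
      moreover have "0 \<le> m ^ k * \<bar>\<rho> t\<bar>" using mq by simp
      ultimately show ?thesis by linarith
    next
      case False
      then have a: "\<bar>\<rho> t\<bar> \<le> m" using \<eta>(3)[of t] by (simp add: m_def)
      have "\<bar>\<rho> t ^ n\<bar> = \<bar>\<rho> t\<bar> ^ k * \<bar>\<rho> t\<bar>" by (simp add: k abs_mult power_abs mult.commute)
      also have "\<dots> \<le> m ^ k * \<bar>\<rho> t\<bar>" using a by (intro mult_right_mono power_mono) auto
      finally show ?thesis using False by (simp add: b_def split: split_indicator)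
    qed
    have "(m / q) ^ n < v * m / (R + 1)" using n1[of n] n mq by simp
    then have "(m / q) ^ n * (R + 1) < v * m" using R0 by (simp add: pos_less_divide_eq)
    then have "m ^ n * (R + 1) < v * m * q ^ n" using mq by (simp add: power_divide field_simps)
    then have "m * (m ^ k * (R + 1)) < m * (v * q ^ n)" by (simp add: k mult_ac)
    then have "m ^ k * (R + 1) < v * q ^ n" using mq by simp
    moreover have "m ^ k * R \<le> m ^ k * (R + 1)" using mq by simp
    ultimately have "0 < v * q ^ n - m ^ k * R" by linarith
    also have "\<dots> = (\<integral>t. indicator ?B t * q ^ n - m ^ k * \<bar>\<rho> t\<bar> \<partial>lborel)"
      using iB \<rho>_integrable by (simp add: R_def v_def)
    also have "\<dots> \<le> (\<integral>t. \<rho> t ^ n \<partial>lborel)"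
      using iB \<rho>_integrable \<rho>_power_integrable(1)[of n] n lower by (intro integral_mono) auto
    finally show "0 < (\<integral>t. \<rho> t ^ n \<partial>lborel)" .
  qed
qed

text \<open>The argument of Schur's product theorem: one factor \<rho> is written as the expectation
  of \<open>X s * X t\<close>, which turns the form with weight \<open>a\<close> into the
  expectation of forms with weight \<open>a t * X t \<omega>\<close> and one power less. This is why
  the weight is general. Its square stays integrable for almost every \<omega>, and the support in a
  cube then makes the weight itself integrable.\<close>

lemma power_positive_definite:
  fixes a :: "real ^ 'd \<Rightarrow> real"
  assumes [measurable]: "a \<in> borel_measurable borel" and "integrable lborel (\<lambda>t. (a t)\<^sup>2)"
    and "\<And>t. t \<notin> cube T \<Longrightarrow> a t = 0"
  shows "integrable lborel a \<and> 0 \<le> (\<integral>p. a (fst p) * a (snd p) * \<rho> (snd p - fst p) ^ n \<partial>(lborel \<Otimes>\<^sub>M lborel))"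
  using assms
proof (induction n arbitrary: a)
  case (0 a)
  have [measurable]: "a \<in> borel_measurable borel" by fact
  have ia: "integrable lborel a"
  proof (rule Bochner_Integration.integrable_bound)
    have "integrable lborel (indicator (cube T) :: real ^ 'd \<Rightarrow> real)" using emeasure_cube_finite[of T] by (intro integrable_real_indicator) auto
    then show "integrable lborel (\<lambda>t. indicator (cube T) t + (a t)\<^sup>2)" using 0 by simp
    have "\<bar>a t\<bar> \<le> 1 + (a t)\<^sup>2" for t using sum_squares_bound[of "\<bar>a t\<bar>" 1] by simp
    then show "AE t in lborel. norm (a t) \<le> norm (indicator (cube T) t + (a t)\<^sup>2)"
      using 0(3) by (intro AE_I2) (auto split: split_indicator)
  qed simp
  have "(\<integral>p. a (fst p) * a (snd p) \<partial>(lborel \<Otimes>\<^sub>M lborel)) = (\<integral>s. (\<integral>t. a s * a t \<partial>lborel) \<partial>lborel)"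
  proof -
    have "integrable (lborel \<Otimes>\<^sub>M lborel) (\<lambda>p. a (fst p) * a (snd p))"
      using ia by (intro lborel_pair.Fubini_integrable) (auto simp: abs_mult)
    from lborel_pair.integral_fst'[OF this] show ?thesis by simp
  qed
  also have "\<dots> = (\<integral>s. a s \<partial>lborel) * (\<integral>t. a t \<partial>lborel)" by simp
  finally show ?case using ia by simp
next
  case (Suc n a)
  have [measurable]: "a \<in> borel_measurable borel" by fact
  let ?L2 = "lborel \<Otimes>\<^sub>M lborel :: ((real ^ 'd) \<times> (real ^ 'd)) measure"
  interpret L2: sigma_finite_measure ?L2 by (rule sigma_finite_pair_measure) standard+
  interpret L2M: pair_sigma_finite ?L2 M ..
  interpret LM: pair_sigma_finite lborel M ..
  have ia: "integrable lborel a" using Suc.IH[OF Suc.prems] by blast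
  define f where "f p \<omega> = a (fst p) * a (snd p) * \<rho> (snd p - fst p) ^ n * (X (fst p) \<omega> * X (snd p) \<omega>)" for p \<omega>
  have iaa: "integrable ?L2 (\<lambda>p. \<bar>a (fst p)\<bar> * \<bar>a (snd p)\<bar>)"
    using ia by (intro lborel_pair.Fubini_integrable) (auto simp: abs_mult)
  have Xint: "integrable M (\<lambda>\<omega>. X s \<omega> * X t \<omega>)" for s t by (intro lin_span_integrable_mult lin_span_base)
  have [measurable]: "(\<lambda>q. X (fst (fst q)) (snd q)) \<in> borel_measurable (?L2 \<Otimes>\<^sub>M M)" "(\<lambda>q. X (snd (fst q)) (snd q)) \<in> borel_measurable (?L2 \<Otimes>\<^sub>M M)"
    using measurable_compose[OF _ joint, of "\<lambda>q. (fst (fst q), snd q)" "?L2 \<Otimes>\<^sub>M M"] measurable_compose[OF _ joint, of "\<lambda>q. (snd (fst q), snd q)" "?L2 \<Otimes>\<^sub>M M"]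
    by simp_all
  have fm: "(\<lambda>q. f (fst q) (snd q)) \<in> borel_measurable (?L2 \<Otimes>\<^sub>M M)" unfolding f_def by measurable
  have XX: "(\<integral>\<omega>. \<bar>X s \<omega> * X t \<omega>\<bar> \<partial>M) \<le> 1" for s t
    using expectation_abs_mult_le[OF lin_span_base lin_span_base, of 1 s t] covariance[of s s] covariance[of t t]
    by (simp add: abs_mult power2_eq_square \<rho>_zero)
  have rn: "\<bar>\<rho> t ^ n\<bar> \<le> 1" for t unfolding power_abs using \<rho>_abs_le_1 by (intro power_le_one) auto
  have fint: "integrable (?L2 \<Otimes>\<^sub>M M) (\<lambda>q. f (fst q) (snd q))"
  proof (rule L2M.Fubini_integrable[OF fm])
    show "AE p in ?L2. integrable M (\<lambda>\<omega>. f (fst (p, \<omega>)) (snd (p, \<omega>)))" using Xint by (simp add: f_def)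
    have m: "(\<lambda>p. \<integral>\<omega>. norm (f (fst (p, \<omega>)) (snd (p, \<omega>))) \<partial>M) \<in> borel_measurable ?L2"
    proof -
      have "(\<lambda>q. norm (f (fst q) (snd q))) \<in> borel_measurable (?L2 \<Otimes>\<^sub>M M)" using fm by simp
      then have "case_prod (\<lambda>p \<omega>. norm (f (fst (p, \<omega>)) (snd (p, \<omega>)))) \<in> borel_measurable (?L2 \<Otimes>\<^sub>M M)" by (simp add: split_beta')
      then show ?thesis by (rule borel_measurable_lebesgue_integral)
    qed
    show "integrable ?L2 (\<lambda>p. \<integral>\<omega>. norm (f (fst (p, \<omega>)) (snd (p, \<omega>))) \<partial>M)"
    proof (rule Bochner_Integration.integrable_bound[OF iaa m], intro AE_I2)
      fix p
      have "(\<integral>\<omega>. norm (f (fst (p, \<omega>)) (snd (p, \<omega>))) \<partial>M) = \<bar>a (fst p) * a (snd p) * \<rho> (snd p - fst p) ^ n\<bar> * (\<integral>\<omega>. \<bar>X (fst p) \<omega> * X (snd p) \<omega>\<bar> \<partial>M)"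
        by (simp add: f_def abs_mult)
      also have "\<bar>\<dots>\<bar> \<le> (\<bar>a (fst p)\<bar> * \<bar>a (snd p)\<bar> * 1) * 1"
        using XX rn by (intro abs_mult_le) (auto simp: abs_mult intro!: mult_left_mono mult_nonneg_nonneg mult_left_le)
      finally show "norm (\<integral>\<omega>. norm (f (fst (p, \<omega>)) (snd (p, \<omega>))) \<partial>M) \<le> norm (\<bar>a (fst p)\<bar> * \<bar>a (snd p)\<bar>)"
        by (simp add: abs_mult)
    qed
  qed
  have fe: "(\<integral>\<omega>. f p \<omega> \<partial>M) = a (fst p) * a (snd p) * \<rho> (snd p - fst p) ^ n * \<rho> (snd p - fst p)" for p
    unfolding f_def by (simp only: integral_mult_right_zero covariance)
  have "(\<integral>p. a (fst p) * a (snd p) * \<rho> (snd p - fst p) ^ Suc n \<partial>?L2) = (\<integral>p. (\<integral>\<omega>. f p \<omega> \<partial>M) \<partial>?L2)"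
    by (simp only: fe power_Suc mult_ac)
  also have "\<dots> = (\<integral>\<omega>. (\<integral>p. f p \<omega> \<partial>?L2) \<partial>M)"
    using L2M.Fubini_integral[of f] fint by (simp add: split_beta')
  also have "0 \<le> \<dots>"
  proof (rule integral_nonneg_AE)
    have "integrable (lborel \<Otimes>\<^sub>M M) (\<lambda>q. (a (fst q) * X (fst q) (snd q))\<^sup>2)"
    proof (rule LM.Fubini_integrable)
      have "(\<lambda>q. X (fst q) (snd q)) \<in> borel_measurable (lborel \<Otimes>\<^sub>M M)" using joint by (simp add: split_beta')
      then show "(\<lambda>q. (a (fst q) * X (fst q) (snd q))\<^sup>2) \<in> borel_measurable (lborel \<Otimes>\<^sub>M M)" by measurable
      have v: "(\<integral>\<omega>. (X s \<omega>)\<^sup>2 \<partial>M) = 1" for s using covariance[of s s] by (simp add: power2_eq_square \<rho>_zero)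
      show "integrable lborel (\<lambda>s. \<integral>\<omega>. norm ((a (fst (s, \<omega>)) * X (fst (s, \<omega>)) (snd (s, \<omega>)))\<^sup>2) \<partial>M)"
        using Suc.prems(2) by (simp add: power_mult_distrib v)
      show "AE s in lborel. integrable M (\<lambda>\<omega>. (a (fst (s, \<omega>)) * X (fst (s, \<omega>)) (snd (s, \<omega>)))\<^sup>2)"
        using lin_span_integrable(2)[OF lin_span_base] by (simp add: power_mult_distrib)
    qed
    then have "integrable (lborel \<Otimes>\<^sub>M M) (\<lambda>(s, \<omega>). (a s * X s \<omega>)\<^sup>2)" by (simp add: split_beta')
    from LM.AE_integrable_snd[OF this] AE_space
    show "AE \<omega> in M. 0 \<le> (\<integral>p. f p \<omega> \<partial>?L2)"
    proof eventually_elim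
      case (elim \<omega>)
      have "(\<lambda>t. X t \<omega>) \<in> borel_measurable borel"
      proof -
        have "(\<lambda>t. (t, \<omega>)) \<in> measurable borel (lborel \<Otimes>\<^sub>M M)" using elim(2) by measurable
        from measurable_compose[OF this joint] show ?thesis by simp
      qed
      then have "(\<lambda>t. a t * X t \<omega>) \<in> borel_measurable borel" by measurable
      from Suc.IH[OF this elim(1)] Suc.prems(3)
      have "0 \<le> (\<integral>p. (a (fst p) * X (fst p) \<omega>) * (a (snd p) * X (snd p) \<omega>) * \<rho> (snd p - fst p) ^ n \<partial>?L2)" by auto
      then show ?case by (simp add: f_def mult_ac)
    qed
  qed
  finally show ?case using ia by simp
qed

text \<open>The quadratic form with the indicator of the cube as weight is a
  \<open>box_average\<close>, and averages over large cubes determine the sign of the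
  integral.\<close>

lemma \<rho>_power_nonneg:
  assumes n: "n \<ge> 1"
  shows "0 \<le> (\<integral>t. \<rho> t ^ n \<partial>lborel)"
proof (rule box_average_nonneg_imp[OF \<rho>_power_integrable(1)[OF n]])
  fix T
  let ?L2 = "lborel \<Otimes>\<^sub>M lborel :: ((real ^ 'd) \<times> (real ^ 'd)) measure"
  let ?I = "indicator (cube T) :: real ^ 'd \<Rightarrow> real"
  have iI: "integrable lborel ?I" using emeasure_cube_finite[of T] by (intro integrable_real_indicator) auto
  have sq: "(\<lambda>t. (?I t)\<^sup>2) = ?I" by (auto split: split_indicator)
  have nn: "0 \<le> (\<integral>p. ?I (fst p) * ?I (snd p) * \<rho> (snd p - fst p) ^ n \<partial>?L2)"
    using power_positive_definite[of ?I T n] iI by (simp add: sq)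
  have "integrable ?L2 (\<lambda>p. ?I (fst p) * ?I (snd p) * \<rho> (snd p - fst p) ^ n)"
  proof (rule Bochner_Integration.integrable_bound)
    show "integrable ?L2 (\<lambda>p. ?I (fst p) * ?I (snd p))"
      using iI by (intro lborel_pair.Fubini_integrable) (auto simp: abs_mult)
    have "\<bar>\<rho> t ^ n\<bar> \<le> 1" for t unfolding power_abs using \<rho>_abs_le_1 by (intro power_le_one) auto
    then show "AE p in ?L2. norm (?I (fst p) * ?I (snd p) * \<rho> (snd p - fst p) ^ n) \<le> norm (?I (fst p) * ?I (snd p))"
      by (intro AE_I2) (auto split: split_indicator)
  qed measurable
  from lborel_pair.integral_fst'[OF this] nn
  show "0 \<le> box_average (\<lambda>t. \<rho> t ^ n) T" by (simp add: box_average_def mult.assoc)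
qed

end

section \<open>Excursion volumes\<close>

lemma suminf_abs_le:
  fixes f g :: "nat \<Rightarrow> real"
  assumes f: "\<And>n. \<bar>f n\<bar> \<le> c * g n" and g: "summable g" "(\<Sum>n. g n) \<le> B" and c: "0 \<le> c"
  shows "summable f" "\<bar>\<Sum>n. f n\<bar> \<le> c * B"
proof -
  have cg: "summable (\<lambda>n. c * g n)" using g(1) by (rule summable_mult)
  show s: "summable f" by (rule summable_comparison_test'[OF cg, where N = 0]) (simp add: f)
  have a: "summable (\<lambda>n. \<bar>f n\<bar>)" by (rule summable_comparison_test'[OF cg, where N = 0]) (simp add: f)
  have "\<bar>\<Sum>n. f n\<bar> \<le> (\<Sum>n. \<bar>f n\<bar>)" using a by (rule summable_rabs)
  also have "\<dots> \<le> (\<Sum>n. c * g n)" using f a cg by (rule suminf_le)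
  also have "\<dots> \<le> c * B" using g c by (simp add: suminf_mult mult_left_mono)
  finally show "\<bar>\<Sum>n. f n\<bar> \<le> c * B" .
qed

lemma abs_power_Suc_le: "\<bar>x\<bar> \<le> 1 \<Longrightarrow> \<bar>x ^ Suc n\<bar> \<le> \<bar>x\<bar>" for x :: real
  by (simp add: abs_mult power_abs mult_left_le power_le_one)

lemma tail_cov_summable:
  assumes "\<bar>x\<bar> \<le> 1"
  shows "summable (\<lambda>n. tail_coeff u n * x ^ Suc n)" "\<bar>tail_cov u x\<bar> \<le> \<bar>x\<bar>"
proof -
  have "\<bar>tail_coeff u n * x ^ Suc n\<bar> \<le> \<bar>x\<bar> * tail_coeff u n" for n
    using abs_mult_le[OF order_refl abs_power_Suc_le[OF assms], of "tail_coeff u n" n] tail_coeff_nonneg[of u n]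
    by (simp add: mult.commute)
  from suminf_abs_le[OF this tail_coeff_summable tail_coeff_suminf_le]
  show "summable (\<lambda>n. tail_coeff u n * x ^ Suc n)" "\<bar>tail_cov u x\<bar> \<le> \<bar>x\<bar>" by (simp_all add: tail_cov_def)
qed

text \<open>One factor \<open>\<bar>x\<bar>\<close> is kept outside the series, so that with
  \<open>x = \<rho> t\<close> the bound can be integrated over \<open>t\<close>; the remaining
  weights are those of \<open>tail_coeff_smoothing\<close>.\<close>

lemma tail_cov_weighted_le:
  assumes x: "\<bar>x\<bar> \<le> 1" and b: "0 \<le> b" "b < 1" and w: "\<And>n. \<bar>w n\<bar> \<le> 1 - b ^ Suc n"
  shows "\<bar>\<Sum>n. tail_coeff u n * x ^ Suc n * w n\<bar> \<le> \<bar>x\<bar> * (2 * sqrt (1 - b))"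
proof (rule suminf_abs_le(2))
  show "\<bar>tail_coeff u n * x ^ Suc n * w n\<bar> \<le> \<bar>x\<bar> * (tail_coeff u n * (1 - b ^ Suc n))" for n
  proof -
    have "\<bar>tail_coeff u n * x ^ Suc n * w n\<bar> \<le> \<bar>tail_coeff u n\<bar> * \<bar>x\<bar> * (1 - b ^ Suc n)"
      by (intro abs_mult_le order_refl abs_power_Suc_le x w)
    then show ?thesis using tail_coeff_nonneg[of u n] by (simp add: mult_ac)
  qed
qed (use tail_coeff_smoothing[OF b, of u] in auto)

lemma tail_cov_contract:
  assumes x: "\<bar>x\<bar> \<le> 1" and b: "0 \<le> b" "b < 1"
  shows "\<bar>tail_cov u x - tail_cov u (b * x)\<bar> \<le> \<bar>x\<bar> * (2 * sqrt (1 - b))"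
proof -
  have bx: "\<bar>b * x\<bar> \<le> 1" using abs_mult_le[of b 1 x 1] x b by simp
  have "tail_cov u x - tail_cov u (b * x) = (\<Sum>n. tail_coeff u n * x ^ Suc n - tail_coeff u n * (b * x) ^ Suc n)"
    unfolding tail_cov_def using tail_cov_summable(1)[OF x] tail_cov_summable(1)[OF bx] by (rule suminf_diff)
  also have "\<dots> = (\<Sum>n. tail_coeff u n * x ^ Suc n * (1 - b ^ Suc n))"
  proof (intro arg_cong[where f = suminf] ext)
    fix n
    have "v * y - v * (p * y) = v * y * (1 - p)" for v y p :: real by (simp add: algebra_simps)
    from this[of "tail_coeff u n" "x ^ Suc n" "b ^ Suc n"]
    show "tail_coeff u n * x ^ Suc n - tail_coeff u n * (b * x) ^ Suc n = tail_coeff u n * x ^ Suc n * (1 - b ^ Suc n)"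
      by (simp only: power_mult_distrib)
  qed
  finally show ?thesis using tail_cov_weighted_le[OF x b, of "\<lambda>n. 1 - b ^ Suc n"] b
    by (simp del: power_Suc add: power_le_one)
qed

text \<open>At correlation \<open>x\<close> in the open interval this is the covariance of the
  smoothing errors at two points: degree \<open>n + 1\<close> carries the weight
  \<open>(1 - a ^ Suc n)\<^sup>2\<close>, which is at most \<open>1 - a ^ Suc n\<close>.\<close>

lemma tail_cov_second_difference:
  assumes x: "\<bar>x\<bar> \<le> 1" and a: "0 \<le> a" "a < 1"
  shows "\<bar>tail_cov u x - 2 * tail_cov u (a * x) + tail_cov u (a\<^sup>2 * x)\<bar> \<le> \<bar>x\<bar> * (2 * sqrt (1 - a))"
proof -
  have ax: "\<bar>a * x\<bar> \<le> 1" using abs_mult_le[of a 1 x 1] x a by simp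
  have aax: "\<bar>a\<^sup>2 * x\<bar> \<le> 1" using abs_mult_le[of a 1 "a * x" 1] ax a by (simp add: power2_eq_square mult.assoc)
  note s = tail_cov_summable(1)[OF x, of u] tail_cov_summable(1)[OF ax, of u] tail_cov_summable(1)[OF aax, of u]
  have "tail_cov u x - 2 * tail_cov u (a * x) + tail_cov u (a\<^sup>2 * x) =
     (\<Sum>n. (tail_coeff u n * x ^ Suc n - 2 * (tail_coeff u n * (a * x) ^ Suc n)) + tail_coeff u n * (a\<^sup>2 * x) ^ Suc n)"
    unfolding tail_cov_def suminf_mult[OF s(2), symmetric]
    using s by (subst suminf_add[symmetric] suminf_diff; (intro summable_diff summable_mult)?; simp only: suminf_diff[symmetric] summable_mult)+
  also have "\<dots> = (\<Sum>n. tail_coeff u n * x ^ Suc n * (1 - a ^ Suc n)\<^sup>2)"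
  proof (intro arg_cong[where f = suminf] ext)
    fix n
    have "v * y - 2 * (v * (p * y)) + v * (p * p * y) = v * y * (1 - p)\<^sup>2" for v y p :: real
      by (simp add: power2_eq_square algebra_simps)
    from this[of "tail_coeff u n" "x ^ Suc n" "a ^ Suc n"]
    show "(tail_coeff u n * x ^ Suc n - 2 * (tail_coeff u n * (a * x) ^ Suc n)) + tail_coeff u n * (a\<^sup>2 * x) ^ Suc n
       = tail_coeff u n * x ^ Suc n * (1 - a ^ Suc n)\<^sup>2"
      by (simp only: power_mult_distrib power2_eq_square)
  qed
  also have "\<bar>\<dots>\<bar> \<le> \<bar>x\<bar> * (2 * sqrt (1 - a))"
  proof (rule tail_cov_weighted_le[OF x a])
    fix n
    have "0 \<le> 1 - a ^ Suc n" "1 - a ^ Suc n \<le> 1" using a by (simp_all del: power_Suc add: power_le_one)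
    then show "\<bar>(1 - a ^ Suc n)\<^sup>2\<bar> \<le> 1 - a ^ Suc n" by (simp only: power2_eq_square abs_mult abs_of_nonneg mult_left_le)
  qed
  finally show ?thesis .
qed

lemma tail_cov_measurable[measurable]: "tail_cov u \<in> borel_measurable borel"
  unfolding tail_cov_def[abs_def] by measurable

text \<open>By the recurrence a common zero would descend to degree 0, where the polynomial is
  1.\<close>

lemma hermite_consecutive: "\<not> (hermite n u = 0 \<and> hermite (Suc n) u = 0)"
  by (induction n) auto

section \<open>The asymptotic variance\<close>

context stationary_gaussian begin

definition total :: real where "total = (\<integral>t. \<bar>\<rho> t\<bar> \<partial>lborel)"

lemma total_nonneg: "0 \<le> total" unfolding total_def by (intro Bochner_Integration.integral_nonneg) simp

lemma variance_term_eq: "variance_term \<rho> u (Suc n) = tail_coeff u n * (\<integral>t. \<rho> t ^ Suc n \<partial>lborel)"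
  by (simp add: variance_term_def tail_coeff_def)

text \<open>The norms of the terms are at most \<open>tail_coeff u n * total\<close>, hence
  summable, which allows the exchange of series and integral. The integral form is the one that
  averages over cubes approximate.\<close>

lemma variance_series:
  shows variance_summable: "summable (\<lambda>n. variance_term \<rho> u (Suc n))"
    and variance_integral: "asymptotic_variance \<rho> u = (\<integral>t. tail_cov u (\<rho> t) \<partial>lborel)"
proof -
  let ?f = "\<lambda>n t. tail_coeff u n * \<rho> t ^ Suc n"
  have i: "integrable lborel (?f n)" for n using \<rho>_power_integrable(1)[of "Suc n"] by simp
  have s1: "AE t in lborel. summable (\<lambda>n. norm (?f n t))"
  proof (intro AE_I2)
    fix t
    have "summable (\<lambda>n. tail_coeff u n * \<bar>\<rho> t\<bar> ^ Suc n)" using \<rho>_abs_le_1 by (intro tail_cov_summable) simp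
    then show "summable (\<lambda>n. norm (?f n t))" using tail_coeff_nonneg by (simp add: abs_mult power_abs)
  qed
  have s2: "summable (\<lambda>n. \<integral>t. norm (?f n t) \<partial>lborel)"
  proof (rule summable_comparison_test'[where N = 0])
    show "summable (\<lambda>n. tail_coeff u n * total)" using tail_coeff_summable by (rule summable_mult2)
    fix n
    have "(\<integral>t. norm (?f n t) \<partial>lborel) = tail_coeff u n * (\<integral>t. \<bar>\<rho> t ^ Suc n\<bar> \<partial>lborel)"
      using tail_coeff_nonneg[of u n] by (simp add: abs_mult del: power_Suc)
    also have "\<dots> \<le> tail_coeff u n * total"
      unfolding total_def using \<rho>_power_integrable(2)[of "Suc n"] tail_coeff_nonneg[of u n] by (intro mult_left_mono) auto
    finally have "(\<integral>t. norm (?f n t) \<partial>lborel) \<le> tail_coeff u n * total" .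
    moreover have "0 \<le> (\<integral>t. norm (?f n t) \<partial>lborel)" by (intro Bochner_Integration.integral_nonneg) simp
    ultimately show "norm (\<integral>t. norm (?f n t) \<partial>lborel) \<le> tail_coeff u n * total" by simp
  qed
  have e: "(\<integral>t. ?f n t \<partial>lborel) = variance_term \<rho> u (Suc n)" for n unfolding variance_term_eq by simp
  show "summable (\<lambda>n. variance_term \<rho> u (Suc n))"
    using summable_integral[OF i s1 s2] unfolding e .
  show "asymptotic_variance \<rho> u = (\<integral>t. tail_cov u (\<rho> t) \<partial>lborel)"
    using integral_suminf[OF i s1 s2] unfolding e by (simp add: asymptotic_variance_def tail_cov_def)
qed

lemma variance_positive: "0 < asymptotic_variance \<rho> u"
proof -
  have nn: "0 \<le> variance_term \<rho> u (Suc n)" for n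
    unfolding variance_term_eq using tail_coeff_nonneg \<rho>_power_nonneg[of "Suc n"] by (intro mult_nonneg_nonneg) auto
  obtain n0 where n0: "\<And>n. n \<ge> n0 \<Longrightarrow> 0 < (\<integral>t. \<rho> t ^ n \<partial>lborel)" using \<rho>_power_positive by blast
  \<comment> \<open>\<open>m\<close> can be taken as \<open>n0\<close> or its successor.\<close>
  obtain m where m: "m \<ge> n0" "hermite m u \<noteq> 0" using hermite_consecutive[of n0 u] le_SucI by blast
  have "0 < tail_coeff u m"
    unfolding tail_coeff_def using m(2) normal_density_pos[of 1 0 u] by (intro divide_pos_pos mult_pos_pos) auto
  then have "0 < variance_term \<rho> u (Suc m)" unfolding variance_term_eq using n0[of "Suc m"] m(1) by (intro mult_pos_pos) auto
  then show ?thesis unfolding asymptotic_variance_def using variance_summable nn by (intro suminf_pos2) auto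
qed

text \<open>The density is the inverse square root of the volume, not the inverse volume: integrals
  against this measure are already normalised, and its mass is
  \<open>sqrt (T ^ CARD('d))\<close>.\<close>

definition obs :: "real \<Rightarrow> (real ^ 'd) measure" where
  "obs T = density lborel (\<lambda>t. ennreal (1 / sqrt (T ^ CARD('d)) * indicator (cube T) t))"

lemma sets_obs[measurable_cong]: "sets (obs T) = sets borel" by (simp add: obs_def)

lemma obs_integral:
  assumes T: "T > 0" and [measurable]: "f \<in> borel_measurable borel"
  shows "(\<integral>t. f t \<partial>obs T) = 1 / sqrt (T ^ CARD('d)) * (\<integral>t. indicator (cube T) t * f t \<partial>lborel)"
    and "integrable (obs T) f \<longleftrightarrow> integrable lborel (\<lambda>t. indicator (cube T) t * f t)"
proof -
  have s: "sqrt (T ^ CARD('d)) > 0" using T by simp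
  show "(\<integral>t. f t \<partial>obs T) = 1 / sqrt (T ^ CARD('d)) * (\<integral>t. indicator (cube T) t * f t \<partial>lborel)"
    unfolding obs_def using s by (subst integral_density) (auto simp: mult.assoc)
  have "integrable (obs T) f \<longleftrightarrow> integrable lborel (\<lambda>t. (1 / sqrt (T ^ CARD('d)) * indicator (cube T) t) *\<^sub>R f t)"
    unfolding obs_def using s by (intro integrable_density) auto
  also have "\<dots> \<longleftrightarrow> integrable lborel (\<lambda>t. 1 / sqrt (T ^ CARD('d)) * (indicator (cube T) t * f t))" by (simp add: mult.assoc)
  also have "\<dots> \<longleftrightarrow> integrable lborel (\<lambda>t. indicator (cube T) t * f t)" unfolding integrable_mult_left_iff using s T by simp
  finally show "integrable (obs T) f \<longleftrightarrow> integrable lborel (\<lambda>t. indicator (cube T) t * f t)" .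
qed

lemma obs_finite:
  assumes T: "T > 0"
  shows "finite_measure (obs T)" "measure (obs T) UNIV = sqrt (T ^ CARD('d))"
proof -
  have s: "T ^ CARD('d) > 0" using T by simp
  have "emeasure (obs T) UNIV = (\<integral>\<^sup>+t. ennreal (1 / sqrt (T ^ CARD('d)) * indicator (cube T) t) * indicator UNIV t \<partial>(lborel :: (real ^ 'd) measure))"
    unfolding obs_def by (rule emeasure_density) auto
  also have "\<dots> = (\<integral>\<^sup>+t. ennreal (1 / sqrt (T ^ CARD('d))) * indicator (cube T) t \<partial>(lborel :: (real ^ 'd) measure))"
    by (rule nn_integral_cong) (simp split: split_indicator)
  also have "\<dots> = ennreal (1 / sqrt (T ^ CARD('d))) * emeasure lborel (cube T :: (real ^ 'd) set)"
    by (subst nn_integral_cmult_indicator) auto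
  also have "emeasure lborel (cube T :: (real ^ 'd) set) = ennreal (T ^ CARD('d))"
    using emeasure_cube_finite[of T, where 'd = 'd] T by (subst emeasure_eq_ennreal_measure) (auto simp: measure_cube)
  also have "ennreal (1 / sqrt (T ^ CARD('d))) * ennreal (T ^ CARD('d)) = ennreal (sqrt (T ^ CARD('d)))"
    using s by (simp add: ennreal_mult[symmetric] real_div_sqrt)
  finally have e: "emeasure (obs T) UNIV = ennreal (sqrt (T ^ CARD('d)))" .
  have sp: "space (obs T) = UNIV" by (simp add: obs_def)
  show "finite_measure (obs T)" by (rule finite_measureI) (simp add: sp e)
  show "measure (obs T) UNIV = sqrt (T ^ CARD('d))" using e T by (simp add: measure_def)
qed

lemma occupation:
  assumes T: "T > 0"
  shows "gaussian_occupation M X (obs T) (\<lambda>s t. \<rho> (t - s))"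
proof -
  interpret N: finite_measure "obs T" by (rule obs_finite[OF T])
  show ?thesis
  proof unfold_locales
    show "space (obs T) = UNIV" by (simp add: obs_def)
    have "sets (obs T \<Otimes>\<^sub>M M) = sets (lborel \<Otimes>\<^sub>M M)" by (intro sets_pair_measure_cong) (simp_all add: sets_obs)
    then show "case_prod X \<in> borel_measurable (obs T \<Otimes>\<^sub>M M)" using joint by (simp cong: measurable_cong_sets)
    show "(\<lambda>(s, t). \<rho> (t - s)) \<in> borel_measurable (obs T \<Otimes>\<^sub>M obs T)" by measurable
    show "(\<integral>\<omega>. X s \<omega> * X t \<omega> \<partial>M) = \<rho> (t - s)" for s t by (rule covariance)
    show "\<rho> (t - t) = 1" for t by (simp add: \<rho>_zero)
  qed
qed

lemma obs_\<rho>: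
  assumes T: "T > 0"
  shows "integrable (obs T) (\<lambda>v. \<rho> (t - v))" "(\<integral>v. \<bar>\<rho> (t - v)\<bar> \<partial>obs T) \<le> total / sqrt (T ^ CARD('d))"
proof -
  have e: "\<rho> (t - v) = \<rho> (v + - t)" for v using \<rho>_sym[of "v - t"] by simp
  have i: "integrable lborel (\<lambda>v. \<rho> (t - v))" unfolding e using lborel_translate(2)[of \<rho> "- t"] \<rho>_integrable by simp
  have it: "integrable lborel (\<lambda>v. indicator (cube T) v * \<rho> (t - v))"
    using i by (rule Bochner_Integration.integrable_bound) (auto split: split_indicator)
  then show "integrable (obs T) (\<lambda>v. \<rho> (t - v))" using obs_integral(2)[OF T] by simp
  have "(\<integral>v. \<bar>\<rho> (t - v)\<bar> \<partial>obs T) = 1 / sqrt (T ^ CARD('d)) * (\<integral>v. indicator (cube T) v * \<bar>\<rho> (t - v)\<bar> \<partial>lborel)"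
    by (rule obs_integral(1)[OF T]) simp
  also have "(\<integral>v. indicator (cube T) v * \<bar>\<rho> (t - v)\<bar> \<partial>lborel) \<le> (\<integral>v. \<bar>\<rho> (t - v)\<bar> \<partial>lborel)"
    using integrable_abs[OF it] integrable_abs[OF i] by (intro integral_mono) (auto simp: abs_mult split: split_indicator)
  also have "\<dots> = total" unfolding e total_def using lborel_translate(1)[of "\<lambda>v. \<bar>\<rho> v\<bar>" "- t"] by simp
  finally show "(\<integral>v. \<bar>\<rho> (t - v)\<bar> \<partial>obs T) \<le> total / sqrt (T ^ CARD('d))"
    using T by (simp add: divide_right_mono)
qed

text \<open>The covariance formula for two indicators holds off the diagonal, where
  \<open>\<bar>\<rho>\<bar> < 1\<close>, and the diagonal is a null set. The bound
  \<open>total / sqrt (T ^ CARD('d))\<close> for the inner integral of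
  \<open>\<bar>\<rho>\<bar>\<close> cancels against the mass of the outer measure.\<close>

lemma obs_double_le:
  assumes T: "T > 0" and m: "case_prod k \<in> borel_measurable (borel \<Otimes>\<^sub>M borel)"
    and k: "\<And>s t. s \<noteq> t \<Longrightarrow> \<bar>k s t\<bar> \<le> c * \<bar>\<rho> (t - s)\<bar>" and c: "0 \<le> c"
    and i: "integrable (obs T) (\<lambda>t. \<integral>s. k s t \<partial>obs T)"
  shows "\<bar>\<integral>t. (\<integral>s. k s t \<partial>obs T) \<partial>obs T\<bar> \<le> c * total"
proof -
  interpret N: finite_measure "obs T" by (rule obs_finite[OF T])
  have km: "(\<lambda>s. k s t) \<in> borel_measurable borel" for t
    using measurable_compose[OF _ m, of "\<lambda>s. (s, t)" borel] by simp
  have inner: "\<bar>\<integral>s. k s t \<partial>obs T\<bar> \<le> c * (total / sqrt (T ^ CARD('d)))" for t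
  proof -
    have AE: "AE s in obs T. s \<noteq> t"
      unfolding obs_def using AE_lborel_singleton[of t] by (subst AE_density) (auto elim!: eventually_mono)
    have ir: "integrable (obs T) (\<lambda>s. c * \<bar>\<rho> (t - s)\<bar>)" using obs_\<rho>(1)[OF T] by simp
    have ik: "integrable (obs T) (\<lambda>s. k s t)"
      using ir by (rule Bochner_Integration.integrable_bound) (use km AE k c in \<open>auto elim!: eventually_mono simp: abs_mult\<close>)
    have "\<bar>\<integral>s. k s t \<partial>obs T\<bar> \<le> (\<integral>s. \<bar>k s t\<bar> \<partial>obs T)" by (rule integral_abs_bound)
    also have "\<dots> \<le> (\<integral>s. c * \<bar>\<rho> (t - s)\<bar> \<partial>obs T)"
      using ik ir AE k by (intro integral_mono_AE) (auto elim!: eventually_mono)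
    also have "\<dots> = c * (\<integral>s. \<bar>\<rho> (t - s)\<bar> \<partial>obs T)" by simp
    also have "\<dots> \<le> c * (total / sqrt (T ^ CARD('d)))" using obs_\<rho>(2)[OF T] c by (intro mult_left_mono)
    finally show ?thesis .
  qed
  have "\<bar>\<integral>t. (\<integral>s. k s t \<partial>obs T) \<partial>obs T\<bar> \<le> (\<integral>t. \<bar>\<integral>s. k s t \<partial>obs T\<bar> \<partial>obs T)" by (rule integral_abs_bound)
  also have "\<dots> \<le> (\<integral>t. c * (total / sqrt (T ^ CARD('d))) \<partial>obs T)" using i inner by (intro integral_mono) auto
  also have "\<dots> = c * total" using T obs_finite(2)[OF T] by (simp add: obs_def)
  finally show ?thesis .
qed

lemma normalized_excursion_occ:
  assumes T: "T > 0" and w: "\<omega> \<in> space M"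
  shows "normalized_excursion_volume X T u \<omega> = (\<integral>t. indicator {u..} (X t \<omega>) - normal_tail u \<partial>obs T)"
proof -
  have Xm[measurable]: "(\<lambda>t. X t \<omega>) \<in> borel_measurable borel"
  proof -
    have "(\<lambda>t. (t, \<omega>)) \<in> measurable borel (lborel \<Otimes>\<^sub>M M)" using w by measurable
    from measurable_compose[OF this joint] show ?thesis by simp
  qed
  have s: "T ^ CARD('d) > 0" using T by simp
  have i1: "integrable lborel (\<lambda>t. indicator (cube T) t * indicator {u..} (X t \<omega>) :: real)"
    using emeasure_cube_finite[of T] by (intro integrable_indicator_bounded[where K = 1]) (auto simp: indicator_def)
  have i2: "integrable lborel (\<lambda>t. indicator (cube T) t :: real)"
    using emeasure_cube_finite[of T] by (intro integrable_real_indicator) auto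
  have "(\<integral>t. indicator {u..} (X t \<omega>) - normal_tail u \<partial>obs T) = 1 / sqrt (T ^ CARD('d)) *
     (\<integral>t. indicator (cube T) t * (indicator {u..} (X t \<omega>) - normal_tail u) \<partial>lborel)"
    by (rule obs_integral(1)[OF T]) simp
  also have "(\<integral>t. indicator (cube T) t * (indicator {u..} (X t \<omega>) - normal_tail u) \<partial>lborel)
     = (\<integral>t. indicator (cube T) t * indicator {u..} (X t \<omega>) \<partial>lborel) - T ^ CARD('d) * normal_tail u"
    unfolding right_diff_distrib using T
    by (subst Bochner_Integration.integral_diff[OF i1 integrable_mult_left[OF i2]]) (simp_all add: measure_cube)
  also have "(\<integral>t. indicator (cube T) t * indicator {u..} (X t \<omega>) \<partial>lborel) = excursion_volume X T u \<omega>"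
    unfolding excursion_volume_def set_lebesgue_integral_def cube_def
    by (intro Bochner_Integration.integral_cong) (auto simp: indicator_def)
  finally show ?thesis by (simp add: normalized_excursion_volume_def)
qed

text \<open>All parameters are still free: \<open>a\<close> is the correlation of the smoothing
  step, \<kappa> the threshold of \<open>pair_bound\<close>, \<epsilon> the width of the averages of
  the test function, \<open>x\<close> the margin in the cube, and \<open>c\<close> the weight in the
  estimate of the smoothing error. The first summand is that error, \<open>4 * \<epsilon>\<close>
  comes from the test function, the term with \<open>V\<close> is the error in the variance, and the
  rest comes from \<open>stein_bound\<close>.\<close>

lemma main_estimate:
  fixes h :: "real \<Rightarrow> real"
  assumes T: "T > 0" and a: "0 \<le> a" "a < 1" and \<kappa>: "\<kappa> > 0" and \<epsilon>: "\<epsilon> > 0" and c: "c > 0" and x: "x > 0" "2 * x \<le> T"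
    and h: "\<And>x y. \<bar>h x - h y\<bar> \<le> \<bar>x - y\<bar>"
  defines "S \<equiv> sqrt (T ^ CARD('d))" and "L \<equiv> 1 / (1 - a\<^sup>2)"
  defines "V \<equiv> tail_integral \<rho> x + (1 - (1 - 2 * x / T) ^ CARD('d)) * total + total * (2 * sqrt (1 - a\<^sup>2))"
  shows "normalized_excursion_volume X T u \<in> borel_measurable M"
    and "\<bar>(\<integral>\<omega>. h (normalized_excursion_volume X T u \<omega>) \<partial>M) - (\<integral>z. h (sqrt (asymptotic_variance \<rho> u) * z) \<partial>gam)\<bar>
     \<le> (c + 2 * sqrt (1 - a) * total / c) / 2 + (4 * \<epsilon> + (2 / \<epsilon> * V +
        (4 / \<epsilon>\<^sup>2 * L * total\<^sup>2 / S + total * (8 / \<epsilon>\<^sup>2 * L * total / S * (1 + 2 / \<kappa>) + 4 / \<epsilon> * L * \<kappa>))) * (pi / 2))"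
proof -
  interpret O: gaussian_occupation M X "obs T" "\<lambda>s t. \<rho> (t - s)" by (rule occupation[OF T])
  define g where "g x = ou_step u a x - normal_tail u" for x
  have a1: "\<bar>a\<bar> < 1" using a by simp
  have a2: "0 < 1 - a\<^sup>2" using one_minus_square_pos[OF a1] .
  have S: "S > 0" "S * S = T ^ CARD('d)" using T by (simp_all add: S_def)
  interpret G: prob_space gam by (rule prob_space_gam)
  interpret St: stein_setup M X "obs T" "\<lambda>s t. \<rho> (t - s)" g "1 / sqrt (1 - a\<^sup>2)" L "total / S"
  proof
    show "\<bar>g x\<bar> \<le> 1" for x using ou_step_bounds[of u a x] normal_tail_bounds[of u] unfolding g_def by linarith
    show "\<bar>g x - g y\<bar> \<le> 1 / sqrt (1 - a\<^sup>2) * \<bar>x - y\<bar>" for x y using ou_step_lipschitz(1)[OF a1] by (simp add: g_def)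
    show "\<bar>(g x - g (x - z)) - (g y - g (y - z))\<bar> \<le> L * \<bar>x - y\<bar> * \<bar>z\<bar>" for x y z
      using ou_step_lipschitz(2)[OF a1, of u x z y] by (simp add: g_def L_def)
    show "(\<integral>x. g x \<partial>gam) = 0"
      unfolding g_def using ou_step_mean[OF a1, of u] ou_step_bounds integrable_gam_bounded[of "ou_step u a" 1] G.prob_space by simp
    show "integrable (obs T) (\<lambda>v. \<rho> (t - v))" "(\<integral>v. \<bar>\<rho> (t - v)\<bar> \<partial>obs T) \<le> total / S" for t
      using obs_\<rho>[OF T] by (simp_all add: S_def)
  qed
  \<comment> \<open>Difference between the indicator and its smoothing; \<open>?Z\<close> is the
    total error of that replacement, while \<open>f\<close> and \<open>g\<close> are the centred
    versions of the two.\<close>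
  define q where "q x = indicator {u..} x - ou_step u a x" for x
  have qm[measurable]: "q \<in> borel_measurable borel" unfolding q_def[abs_def] by measurable
  have qb: "\<bar>q x\<bar> \<le> 1" for x using ou_step_bounds[of u a x] by (auto simp: q_def split: split_indicator)
  define f where "f x = indicator {u..} x - normal_tail u" for x
  have fm[measurable]: "f \<in> borel_measurable borel" unfolding f_def[abs_def] by measurable
  have fb: "\<bar>f x\<bar> \<le> 1" for x using normal_tail_bounds[of u] by (auto simp: f_def split: split_indicator)
  let ?F = "O.occ f X" and ?Z = "O.occ q X" and ?Y = "O.occ g X"
  have Fm: "?F \<in> borel_measurable M" by (rule O.occ_measurable[OF fm O.X_joint])
  have Zm: "?Z \<in> borel_measurable M" by (rule O.occ_measurable[OF qm O.X_joint])
  have nF: "normalized_excursion_volume X T u \<omega> = ?F \<omega>" if "\<omega> \<in> space M" for \<omega>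
    using normalized_excursion_occ[OF T that] by (simp add: O.occ_def f_def)
  show "normalized_excursion_volume X T u \<in> borel_measurable M"
    using Fm nF by (subst measurable_cong[where g = ?F]) auto
  have FY: "?F \<omega> - ?Y \<omega> = ?Z \<omega>" if w: "\<omega> \<in> space M" for \<omega>
  proof -
    have "integrable (obs T) (\<lambda>t. f (X t \<omega>))" "integrable (obs T) (\<lambda>t. g (X t \<omega>))"
      using O.occ_integrable[OF fm O.X_joint fb w] O.occ_integrable[OF St.g_measurable O.X_joint St.g_le w] .
    then show ?thesis unfolding O.occ_def by (subst Bochner_Integration.integral_diff[symmetric]) (simp_all add: f_def g_def q_def)
  qed
  have n_eq: "measure (obs T) UNIV = S" using obs_finite(2)[OF T] by (simp add: S_def)
  have Zb: "\<bar>?Z \<omega>\<bar> \<le> S" "\<bar>?F \<omega>\<bar> \<le> S" for \<omega>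
    using O.occ_bounded[of q 1 X \<omega>, OF qb] O.occ_bounded[of f 1 X \<omega>, OF fb] by (simp_all add: n_eq)
  have mX[measurable]: "X t \<in> borel_measurable M" for t by (rule X_measurable)
  have bq: "integrable M (\<lambda>\<omega>. k1 (X s \<omega>) * k2 (X t \<omega>))"
    if [measurable]: "k1 \<in> borel_measurable borel" "k2 \<in> borel_measurable borel" and "\<And>x. \<bar>k1 x\<bar> \<le> 1" "\<And>x. \<bar>k2 x\<bar> \<le> 1" for k1 k2 :: "real \<Rightarrow> real" and s t
    using abs_mult_le[OF that(3) that(4)] by (intro integrable_bounded_fun[where K = "1 * 1"]) auto
  have ib: "\<bar>indicator {u..} x\<bar> \<le> (1::real)" for x by (simp add: indicator_def)
  have im: "indicator {u..} \<in> borel_measurable (borel :: real measure)" by simp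
  have double: "(\<integral>\<omega>. O.occ k X \<omega> * O.occ k X \<omega> \<partial>M) = (\<integral>t. (\<integral>s. (\<integral>\<omega>. k (X t \<omega>) * k (X s \<omega>) \<partial>M) \<partial>obs T) \<partial>obs T) \<and>
      integrable (obs T) (\<lambda>t. \<integral>s. (\<integral>\<omega>. k (X t \<omega>) * k (X s \<omega>) \<partial>M) \<partial>obs T)"
    if km[measurable]: "k \<in> borel_measurable borel" and kb: "\<And>x. \<bar>k x\<bar> \<le> 1" for k
  proof -
    have om: "O.occ k X \<in> borel_measurable M" by (rule O.occ_measurable[OF km O.X_joint])
    have ob: "\<bar>O.occ k X \<omega>\<bar> \<le> S" for \<omega> using O.occ_bounded[of k 1 X \<omega>, OF kb] by (simp add: n_eq)
    have kX: "(\<lambda>\<omega>. k (X t \<omega>)) \<in> borel_measurable M" for t by measurable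
    note f1 = O.occ_fubini[OF km O.X_joint om kb ob]
    have "(\<integral>\<omega>. O.occ k X \<omega> * k (X t \<omega>) \<partial>M) = (\<integral>s. (\<integral>\<omega>. k (X t \<omega>) * k (X s \<omega>) \<partial>M) \<partial>obs T)" for t
      using O.occ_fubini(1)[OF km O.X_joint kX kb kb, of t] by (simp add: mult.commute)
    then show ?thesis using f1 by simp
  qed
  have Z2: "(\<integral>\<omega>. ?Z \<omega> * ?Z \<omega> \<partial>M) \<le> 2 * sqrt (1 - a) * total"
  proof -
    define k where "k s t = (\<integral>\<omega>. q (X t \<omega>) * q (X s \<omega>) \<partial>M)" for s t
    \<comment> \<open>The expression of \<open>k\<close> through \<open>tail_cov\<close>, valid off
      the diagonal. It obeys the bound at all pairs of points and is visibly measurable in both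
      variables.\<close>
    define k' where "k' s t = (let c = \<rho> (t - s) in tail_cov u c - 2 * tail_cov u (a * c) + tail_cov u (a\<^sup>2 * c))" for s t
    have kk': "k s t = k' s t" if "s \<noteq> t" for s t
    proof -
      let ?r = "\<rho> (t - s)"
      have r: "\<bar>?r\<bar> < 1" using that by (intro \<rho>_abs_less_1) simp
      have sym: "\<rho> (s - t) = ?r" using \<rho>_sym[of "t - s"] by simp
      have ar: "\<bar>a * ?r\<bar> < 1" using abs_mult_le[of a 1 ?r "\<bar>?r\<bar>"] a r by simp
      have aar: "\<bar>a\<^sup>2 * ?r\<bar> < 1" using abs_mult_le[of a 1 "a * ?r" "\<bar>a * ?r\<bar>"] a ar by (simp add: power2_eq_square mult.assoc)
      note ob = ou_step_bounds(3)[of u a] and om = ou_step_measurable[of u a]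
      have "k s t = (\<integral>\<omega>. (indicator {u..} (X t \<omega>) * indicator {u..} (X s \<omega>) - indicator {u..} (X t \<omega>) * ou_step u a (X s \<omega>))
          - (indicator {u..} (X s \<omega>) * ou_step u a (X t \<omega>) - ou_step u a (X t \<omega>) * ou_step u a (X s \<omega>)) \<partial>M)"
        unfolding k_def q_def by (intro Bochner_Integration.integral_cong) (auto simp: algebra_simps)
      also have "\<dots> = (bivariate_tail u ?r - bivariate_tail u (a * ?r)) - (bivariate_tail u (a * ?r) - bivariate_tail u (a\<^sup>2 * ?r))"
        using bq[OF im im ib ib] bq[OF im om ib ob] bq[OF om om ob ob] 
          O.indicator_cov[where s = t and t = s and u = u] O.indicator_ou_cov[OF a1, where s = t and t = s and u = u] O.indicator_ou_cov[OF a1, where s = s and t = t and u = u] O.ou_cov[OF a1, where s = t and t = s and u = u] r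
        by (simp add: sym)
      also have "\<dots> = k' s t" using bivariate_tail_eq[OF r, of u] bivariate_tail_eq[OF ar, of u] bivariate_tail_eq[OF aar, of u]
        by (simp add: k'_def Let_def)
      finally show ?thesis .
    qed
    have qq: "(\<integral>\<omega>. ?Z \<omega> * ?Z \<omega> \<partial>M) = (\<integral>t. (\<integral>s. k s t \<partial>obs T) \<partial>obs T)" and qi: "integrable (obs T) (\<lambda>t. \<integral>s. k s t \<partial>obs T)"
      using double[OF qm qb] unfolding k_def by blast+
    have inner: "(\<integral>s. k s t \<partial>obs T) = (\<integral>s. k' s t \<partial>obs T)" for t
    proof -
      have AE: "AE s in obs T. k s t = k' s t"
        unfolding obs_def using AE_lborel_singleton[of t] kk' by (subst AE_density) (auto elim!: eventually_mono)
      have m': "(\<lambda>s. k' s t) \<in> borel_measurable (obs T)" unfolding k'_def Let_def by measurable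
      have m: "(\<lambda>s. k s t) \<in> borel_measurable (obs T)"
        using borel_measurable_integrable[OF O.occ_fubini(2)[OF qm O.X_joint _ qb qb, of "X t"]] unfolding k_def by simp
      show ?thesis using AE m m' by (intro integral_cong_AE)
    qed
    have "\<bar>\<integral>t. (\<integral>s. k' s t \<partial>obs T) \<partial>obs T\<bar> \<le> (2 * sqrt (1 - a)) * total"
    proof (rule obs_double_le[OF T])
      show "case_prod k' \<in> borel_measurable (borel \<Otimes>\<^sub>M borel)" unfolding k'_def Let_def by measurable
      show "\<bar>k' s t\<bar> \<le> 2 * sqrt (1 - a) * \<bar>\<rho> (t - s)\<bar>" for s t
        unfolding k'_def Let_def using tail_cov_second_difference[OF \<rho>_abs_le_1 a, of u "t - s"] by (simp add: mult.commute)
      show "integrable (obs T) (\<lambda>t. \<integral>s. k' s t \<partial>obs T)" using qi unfolding inner .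
    qed (use a in simp)
    then show ?thesis unfolding qq inner by simp
  qed
  have EZ: "(\<integral>\<omega>. \<bar>?Z \<omega>\<bar> \<partial>M) \<le> (c + 2 * sqrt (1 - a) * total / c) / 2"
  proof -
    \<comment> \<open>Young's inequality with the free weight \<open>c\<close> in place of the root
      of the second moment.\<close>
    have z: "\<bar>z\<bar> \<le> c / 2 + z * z / (2 * c)" for z
    proof -
      have "\<bar>z\<bar> = 2 * \<bar>z\<bar> * c / (2 * c)" using c by simp
      also have "\<dots> \<le> (\<bar>z\<bar>\<^sup>2 + c\<^sup>2) / (2 * c)" using c sum_squares_bound[of "\<bar>z\<bar>" c] by (intro divide_right_mono) auto
      also have "\<dots> = c / 2 + z * z / (2 * c)" using c by (simp add: power2_eq_square add_divide_distrib)
      finally show ?thesis .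
    qed
    have i: "integrable M (\<lambda>\<omega>. ?Z \<omega> * ?Z \<omega>)" "integrable M (\<lambda>\<omega>. \<bar>?Z \<omega>\<bar>)"
      using abs_mult_le[OF Zb(1) Zb(1)] Zm Zb(1) by (auto intro!: integrable_bounded_fun)
    have "(\<integral>\<omega>. \<bar>?Z \<omega>\<bar> \<partial>M) \<le> (\<integral>\<omega>. c / 2 + ?Z \<omega> * ?Z \<omega> / (2 * c) \<partial>M)"
      using i z by (intro integral_mono) auto
    also have "\<dots> = c / 2 + (\<integral>\<omega>. ?Z \<omega> * ?Z \<omega> \<partial>M) / (2 * c)" using i prob_space by simp
    also have "\<dots> \<le> c / 2 + (2 * sqrt (1 - a) * total) / (2 * c)" using Z2 c by (intro add_left_mono divide_right_mono) auto
    finally show ?thesis by (simp add: add_divide_distrib)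
  qed
  have hc: "continuous_on UNIV h" by (rule lipschitz_real_continuous[of h 1]) (use h in simp)
  have [measurable]: "h \<in> borel_measurable borel" using hc by (rule borel_measurable_continuous_onI)
  have hb: "\<bar>h y\<bar> \<le> \<bar>h 0\<bar> + \<bar>y\<bar>" for y using h[of y 0] by simp
  have part1: "\<bar>(\<integral>\<omega>. h (normalized_excursion_volume X T u \<omega>) \<partial>M) - (\<integral>\<omega>. h (?Y \<omega>) \<partial>M)\<bar> \<le> (c + 2 * sqrt (1 - a) * total / c) / 2"
  proof -
    have e: "(\<integral>\<omega>. h (normalized_excursion_volume X T u \<omega>) \<partial>M) = (\<integral>\<omega>. h (?F \<omega>) \<partial>M)"
      using nF by (intro Bochner_Integration.integral_cong) auto
    have Yb: "\<bar>?Y \<omega>\<bar> \<le> S" for \<omega> using St.Y_bounded by (simp add: n_eq)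
    have b: "\<bar>h (?F \<omega>)\<bar> \<le> \<bar>h 0\<bar> + S" "\<bar>h (?Y \<omega>)\<bar> \<le> \<bar>h 0\<bar> + S" for \<omega>
      using hb[of "?F \<omega>"] hb[of "?Y \<omega>"] Zb(2)[of \<omega>] Yb[of \<omega>] by linarith+
    have i: "integrable M (\<lambda>\<omega>. h (?F \<omega>))" "integrable M (\<lambda>\<omega>. h (?Y \<omega>))"
      using b Fm by (auto intro!: integrable_bounded_fun)
    have "\<bar>\<integral>\<omega>. h (?F \<omega>) - h (?Y \<omega>) \<partial>M\<bar> \<le> (\<integral>\<omega>. \<bar>?Z \<omega>\<bar> \<partial>M)"
    proof (rule abs_expectation_le)
      show "integrable M (\<lambda>\<omega>. \<bar>?Z \<omega>\<bar>)" using Zm Zb(1) by (auto intro!: integrable_bounded_fun)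
      show "\<bar>h (?F \<omega>) - h (?Y \<omega>)\<bar> \<le> \<bar>?Z \<omega>\<bar>" if "\<omega> \<in> space M" for \<omega> using h[of "?F \<omega>" "?Y \<omega>"] FY[OF that] by simp
    qed
    then show ?thesis unfolding e using i EZ by simp
  qed
  \<comment> \<open>Covariance function of the smoothed functional: smoothing at both points
    replaces \<rho> by \<open>a\<^sup>2 * \<rho>\<close>.\<close>
  define K where "K t = tail_cov u (a\<^sup>2 * \<rho> t)" for t
  have aa: "0 \<le> a\<^sup>2" "a\<^sup>2 < 1" using a2 by auto
  have ar1: "\<bar>a\<^sup>2 * \<rho> t\<bar> \<le> \<bar>\<rho> t\<bar>" for t using abs_mult_le[of "a\<^sup>2" 1 "\<rho> t" "\<bar>\<rho> t\<bar>"] aa by simp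
  have Kb: "\<bar>K t\<bar> \<le> \<bar>\<rho> t\<bar>" for t
    unfolding K_def using tail_cov_summable(2)[of "a\<^sup>2 * \<rho> t" u] ar1[of t] \<rho>_abs_le_1[of t] by linarith
  have Km[measurable]: "K \<in> borel_measurable borel" unfolding K_def[abs_def] by measurable
  have Ki: "integrable lborel K" using \<rho>_integrable by (rule Bochner_Integration.integrable_bound) (auto simp: Kb)
  have Y2: "(\<integral>\<omega>. (?Y \<omega>)\<^sup>2 \<partial>M) = box_average K T / T ^ CARD('d)"
  proof -
    have gg: "(\<integral>\<omega>. g (X t \<omega>) * g (X s \<omega>) \<partial>M) = K (s - t)" for s t
    proof -
      note ob = ou_step_bounds(3)[of u a] and om = ou_step_measurable[of u a]
      have r: "\<bar>a\<^sup>2 * \<rho> (s - t)\<bar> < 1"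
      proof -
        have "\<bar>a\<^sup>2 * \<rho> (s - t)\<bar> \<le> a\<^sup>2 * 1" using abs_mult_le[OF order_refl \<rho>_abs_le_1, of "a\<^sup>2" "s - t"] by simp
        then show ?thesis using aa by simp
      qed
      have io: "integrable M (\<lambda>\<omega>. ou_step u a (X t \<omega>))" for t using ob by (intro integrable_bounded_fun[where K = 1]) auto
      have mo: "(\<integral>\<omega>. ou_step u a (X t \<omega>) \<partial>M) = normal_tail u" for t
        using O.mean_X[OF om ob] ou_step_mean[OF a1] by simp
      have "(\<integral>\<omega>. g (X t \<omega>) * g (X s \<omega>) \<partial>M) = (\<integral>\<omega>. ou_step u a (X t \<omega>) * ou_step u a (X s \<omega>) -
          normal_tail u * ou_step u a (X t \<omega>) - normal_tail u * ou_step u a (X s \<omega>) + (normal_tail u)\<^sup>2 \<partial>M)"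
        unfolding g_def by (intro Bochner_Integration.integral_cong) (auto simp: algebra_simps power2_eq_square)
      also have "\<dots> = bivariate_tail u (a\<^sup>2 * \<rho> (s - t)) - (normal_tail u)\<^sup>2"
        using bq[OF om om ob ob] io mo O.ou_cov[OF a1, where s = t and t = s and u = u] prob_space by (simp add: power2_eq_square)
      also have "\<dots> = K (s - t)" unfolding bivariate_tail_eq[OF r] K_def by simp
      finally show ?thesis .
    qed
    have "(\<integral>\<omega>. (?Y \<omega>)\<^sup>2 \<partial>M) = (\<integral>t. (\<integral>s. K (s - t) \<partial>obs T) \<partial>obs T)"
      using double[OF St.g_measurable St.g_le] by (simp add: gg power2_eq_square)
    also have "\<dots> = (\<integral>t. 1 / S * (\<integral>s. indicator (cube T) s * K (s - t) \<partial>lborel) \<partial>obs T)"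
      unfolding S_def by (intro Bochner_Integration.integral_cong obs_integral(1)[OF T]) auto
    also have "\<dots> = 1 / S * (\<integral>t. indicator (cube T) t * (1 / S * (\<integral>s. indicator (cube T) s * K (s - t) \<partial>lborel)) \<partial>lborel)"
      unfolding S_def by (intro obs_integral(1)[OF T]) measurable
    also have "\<dots> = 1 / S * (1 / S) * box_average K T"
      unfolding box_average_def mult.left_commute[of "indicator _ _" "1 / S"] by simp
    finally show ?thesis using S by simp
  qed
  \<comment> \<open>The integral of \<open>K\<close> mediates: \<open>b1\<close> compares it with
    the average over the cube, \<open>b2\<close> with the variance without smoothing.\<close>
  have varb: "\<bar>(\<integral>\<omega>. (?Y \<omega>)\<^sup>2 \<partial>M) - asymptotic_variance \<rho> u\<bar> \<le> V"
  proof -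
    let ?D = "T ^ CARD('d)"
    have D: "?D > 0" using T by simp
    have i\<rho>: "integrable lborel (\<lambda>t. \<bar>\<rho> t\<bar>)" using \<rho>_integrable by simp
    have KN: "(\<integral>t. \<bar>K t\<bar> \<partial>lborel) \<le> total" unfolding total_def using Ki i\<rho> Kb by (intro integral_mono) auto
    have "tail_integral K x \<le> tail_integral \<rho> x"
      unfolding tail_integral_def set_lebesgue_integral_def
    proof (rule integral_mono)
      show "integrable lborel (\<lambda>t. indicator (UNIV - cbox (\<chi> i. - x) (\<chi> i. x)) t *\<^sub>R \<bar>K t\<bar>)"
        using integrable_abs[OF Ki] by (rule Bochner_Integration.integrable_bound) (auto split: split_indicator)
      show "integrable lborel (\<lambda>t. indicator (UNIV - cbox (\<chi> i. - x) (\<chi> i. x)) t *\<^sub>R \<bar>\<rho> t\<bar>)"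
        using i\<rho> by (rule Bochner_Integration.integrable_bound) (auto split: split_indicator)
    qed (use Kb in \<open>auto split: split_indicator\<close>)
    then have tK: "?D * tail_integral K x \<le> ?D * tail_integral \<rho> x" using D by (intro mult_left_mono) auto
    have e: "(T - 2 * x) ^ CARD('d) = ?D * (1 - 2 * x / T) ^ CARD('d)"
    proof -
      have "T - 2 * x = T * (1 - 2 * x / T)" using T by (simp add: field_simps)
      then show ?thesis by (simp only: power_mult_distrib)
    qed
    have p1: "0 \<le> 1 - (1 - 2 * x / T) ^ CARD('d)" using T x by (simp add: power_le_one)
    have "\<bar>box_average K T - ?D * (\<integral>t. K t \<partial>lborel)\<bar> \<le> ?D * tail_integral K x + (?D - (T - 2 * x) ^ CARD('d)) * (\<integral>t. \<bar>K t\<bar> \<partial>lborel)"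
      by (rule box_average_error[OF Ki x])
    also have "?D - (T - 2 * x) ^ CARD('d) = ?D * (1 - (1 - 2 * x / T) ^ CARD('d))" unfolding e by (simp add: algebra_simps)
    also have "?D * tail_integral K x + ?D * (1 - (1 - 2 * x / T) ^ CARD('d)) * (\<integral>t. \<bar>K t\<bar> \<partial>lborel)
        \<le> ?D * tail_integral \<rho> x + ?D * (1 - (1 - 2 * x / T) ^ CARD('d)) * total"
      using tK KN p1 D by (intro add_mono mult_left_mono mult_nonneg_nonneg) auto
    finally have "\<bar>box_average K T - ?D * (\<integral>t. K t \<partial>lborel)\<bar> / ?D \<le> (?D * (tail_integral \<rho> x + (1 - (1 - 2 * x / T) ^ CARD('d)) * total)) / ?D"
      using D by (intro divide_right_mono) (auto simp: algebra_simps)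
    moreover have "\<bar>box_average K T - ?D * (\<integral>t. K t \<partial>lborel)\<bar> / ?D = \<bar>box_average K T / ?D - (\<integral>t. K t \<partial>lborel)\<bar>"
    proof -
      have "box_average K T / ?D - (\<integral>t. K t \<partial>lborel) = (box_average K T - ?D * (\<integral>t. K t \<partial>lborel)) / ?D" using T by (simp add: diff_divide_distrib)
      then show ?thesis using D by (simp only: abs_divide abs_of_pos)
    qed
    ultimately have b1: "\<bar>(\<integral>\<omega>. (?Y \<omega>)\<^sup>2 \<partial>M) - (\<integral>t. K t \<partial>lborel)\<bar> \<le> tail_integral \<rho> x + (1 - (1 - 2 * x / T) ^ CARD('d)) * total"
      unfolding Y2 using T by simp
    have it: "integrable lborel (\<lambda>t. tail_cov u (\<rho> t))"
      using \<rho>_integrable by (rule Bochner_Integration.integrable_bound) (auto simp: tail_cov_summable(2)[OF \<rho>_abs_le_1])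
    have "\<bar>\<integral>t. tail_cov u (\<rho> t) - K t \<partial>lborel\<bar> \<le> (\<integral>t. \<bar>tail_cov u (\<rho> t) - K t\<bar> \<partial>lborel)" by (rule integral_abs_bound)
    also have "\<dots> \<le> (\<integral>t. \<bar>\<rho> t\<bar> * (2 * sqrt (1 - a\<^sup>2)) \<partial>lborel)"
      using it Ki i\<rho> tail_cov_contract[OF \<rho>_abs_le_1 aa] unfolding K_def by (intro integral_mono) auto
    also have "\<dots> = total * (2 * sqrt (1 - a\<^sup>2))" by (simp add: total_def)
    finally have b2: "\<bar>asymptotic_variance \<rho> u - (\<integral>t. K t \<partial>lborel)\<bar> \<le> total * (2 * sqrt (1 - a\<^sup>2))"
      using it Ki by (simp add: variance_integral)
    show ?thesis unfolding V_def using b1 b2 by linarith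
  qed
  have v0: "0 \<le> asymptotic_variance \<rho> u" using variance_positive[of u] by simp
  define D where "D = 2 / \<epsilon> * V + (4 / \<epsilon>\<^sup>2 * L * total\<^sup>2 / S + total * (8 / \<epsilon>\<^sup>2 * L * total / S * (1 + 2 / \<kappa>) + 4 / \<epsilon> * L * \<kappa>))"
  have part2: "\<bar>(\<integral>\<omega>. h (?Y \<omega>) \<partial>M) - (\<integral>z. h (sqrt (asymptotic_variance \<rho> u) * z) \<partial>gam)\<bar> \<le> 4 * \<epsilon> + D * (pi / 2)"
  proof (rule stein_lipschitz[OF prob_space_axioms St.Y_measurable St.Y_bounded _ h \<epsilon>])
    show "0 \<le> sqrt (asymptotic_variance \<rho> u)" using v0 by simp
    fix \<phi> \<phi>' :: "real \<Rightarrow> real"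
    assume d: "\<And>x. (\<phi> has_real_derivative \<phi>' x) (at x)" and A: "\<And>x. \<bar>\<phi>' x\<bar> \<le> 2 / \<epsilon>"
      and B: "\<And>x y. \<bar>\<phi>' x - \<phi>' y\<bar> \<le> 4 / \<epsilon>\<^sup>2 * \<bar>x - y\<bar>"
    have sb: "\<bar>(\<integral>\<omega>. ?Y \<omega> * \<phi> (?Y \<omega>) \<partial>M) - (\<integral>\<omega>. (?Y \<omega>)\<^sup>2 \<partial>M) * (\<integral>\<omega>. \<phi>' (?Y \<omega>) \<partial>M)\<bar>
      \<le> S * (4 / \<epsilon>\<^sup>2 * (1 / sqrt (1 - a\<^sup>2))\<^sup>2 * (total / S)\<^sup>2 + total / S * (2 * (4 / \<epsilon>\<^sup>2) * (1 / sqrt (1 - a\<^sup>2))\<^sup>2 * (total / S) * (1 + 2 / \<kappa>) + 2 * (2 / \<epsilon>) * L * \<kappa>))"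
      using St.stein_bound[OF d A B \<kappa>] by (simp only: n_eq)
    have L: "(1 / sqrt (1 - a\<^sup>2))\<^sup>2 = L" using a2 by (simp add: L_def power_divide)
    have "S * (4 / \<epsilon>\<^sup>2 * L * (total / S)\<^sup>2 + total / S * (2 * (4 / \<epsilon>\<^sup>2) * L * (total / S) * (1 + 2 / \<kappa>) + 2 * (2 / \<epsilon>) * L * \<kappa>))
       = 4 / \<epsilon>\<^sup>2 * L * (S * (total / S)\<^sup>2) + S * (total / S) * (2 * (4 / \<epsilon>\<^sup>2) * L * (total / S) * (1 + 2 / \<kappa>) + 2 * (2 / \<epsilon>) * L * \<kappa>)"
      by (simp only: distrib_left mult_ac)
    also have "S * (total / S)\<^sup>2 = total\<^sup>2 / S" using S(1) by (simp add: power2_eq_square)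
    also have "S * (total / S) = total" using S by simp
    finally have sb': "\<bar>(\<integral>\<omega>. ?Y \<omega> * \<phi> (?Y \<omega>) \<partial>M) - (\<integral>\<omega>. (?Y \<omega>)\<^sup>2 \<partial>M) * (\<integral>\<omega>. \<phi>' (?Y \<omega>) \<partial>M)\<bar>
      \<le> 4 / \<epsilon>\<^sup>2 * L * total\<^sup>2 / S + total * (8 / \<epsilon>\<^sup>2 * L * total / S * (1 + 2 / \<kappa>) + 4 / \<epsilon> * L * \<kappa>)"
      using sb unfolding L by simp
    have "\<bar>\<integral>\<omega>. \<phi>' (?Y \<omega>) \<partial>M\<bar> \<le> (\<integral>\<omega>. 2 / \<epsilon> \<partial>M)" using A by (intro abs_expectation_le) auto
    then have E: "\<bar>\<integral>\<omega>. \<phi>' (?Y \<omega>) \<partial>M\<bar> \<le> 2 / \<epsilon>" using prob_space by simp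
    \<comment> \<open>The second moment of \<open>?Y\<close> in the Stein bound is exchanged for the
      limit variance, at the cost of \<open>V\<close> times the bound \<open>2 / \<epsilon>\<close>
      of \<open>\<phi>'\<close>.\<close>
    have "\<bar>(\<integral>\<omega>. \<phi>' (?Y \<omega>) \<partial>M) * ((\<integral>\<omega>. (?Y \<omega>)\<^sup>2 \<partial>M) - asymptotic_variance \<rho> u)\<bar> \<le> 2 / \<epsilon> * V"
      using E varb by (rule abs_mult_le)
    then show "\<bar>(\<integral>\<omega>. ?Y \<omega> * \<phi> (?Y \<omega>) \<partial>M) - (sqrt (asymptotic_variance \<rho> u))\<^sup>2 * (\<integral>\<omega>. \<phi>' (?Y \<omega>) \<partial>M)\<bar> \<le> D"
      using sb' v0 unfolding D_def by (simp add: right_diff_distrib mult.commute[of "\<integral>\<omega>. \<phi>' (?Y \<omega>) \<partial>M"])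
  qed
  show "\<bar>(\<integral>\<omega>. h (normalized_excursion_volume X T u \<omega>) \<partial>M) - (\<integral>z. h (sqrt (asymptotic_variance \<rho> u) * z) \<partial>gam)\<bar>
     \<le> (c + 2 * sqrt (1 - a) * total / c) / 2 + (4 * \<epsilon> + (2 / \<epsilon> * V +
        (4 / \<epsilon>\<^sup>2 * L * total\<^sup>2 / S + total * (8 / \<epsilon>\<^sup>2 * L * total / S * (1 + 2 / \<kappa>) + 4 / \<epsilon> * L * \<kappa>))) * (pi / 2))"
    using part1 part2 unfolding D_def by linarith
qed

end

section \<open>Choice of the parameters and the rate\<close>

lemma rate_bigo:
  fixes k1 k2 k3 k4 k5 k6 k7 k8 k9 :: real
  shows "(\<lambda>T::real. k1 * T powr (-1/32) + k2 * (sqrt (T powr (-1/8)) / T powr (-1/32)) + k3 * (1 / sqrt (ln T))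
      + k4 * (sqrt (ln T) * (1 / ln (sqrt T))) + k5 * (sqrt (ln T) / sqrt T) + k6 * (sqrt (ln T) * sqrt (T powr (-1/8)))
      + k7 * (ln T / (T powr (-1/8) * sqrt T)) + k8 * (ln T / (T powr (-1/8) * sqrt T * T powr (-1/4)))
      + k9 * (sqrt (ln T) * T powr (-1/4) / T powr (-1/8))) \<in> O[at_top](\<lambda>T. 1 / (ln T) powr (1/12))"
proof -
  \<comment> \<open>The third and fourth functions are of order \<open>(ln T) powr (-1/2)\<close>;
    all others decay like a power of \<open>T\<close> up to logarithms.\<close>
  have f: "(\<lambda>T::real. T powr (-1/32)) \<in> O[at_top](\<lambda>T. 1 / (ln T) powr (1/12))"
    "(\<lambda>T::real. sqrt (T powr (-1/8)) / T powr (-1/32)) \<in> O[at_top](\<lambda>T. 1 / (ln T) powr (1/12))"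
    "(\<lambda>T::real. 1 / sqrt (ln T)) \<in> O[at_top](\<lambda>T. 1 / (ln T) powr (1/12))"
    "(\<lambda>T::real. sqrt (ln T) * (1 / ln (sqrt T))) \<in> O[at_top](\<lambda>T. 1 / (ln T) powr (1/12))"
    "(\<lambda>T::real. sqrt (ln T) / sqrt T) \<in> O[at_top](\<lambda>T. 1 / (ln T) powr (1/12))"
    "(\<lambda>T::real. sqrt (ln T) * sqrt (T powr (-1/8))) \<in> O[at_top](\<lambda>T. 1 / (ln T) powr (1/12))"
    "(\<lambda>T::real. ln T / (T powr (-1/8) * sqrt T)) \<in> O[at_top](\<lambda>T. 1 / (ln T) powr (1/12))"
    "(\<lambda>T::real. ln T / (T powr (-1/8) * sqrt T * T powr (-1/4))) \<in> O[at_top](\<lambda>T. 1 / (ln T) powr (1/12))"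
    "(\<lambda>T::real. sqrt (ln T) * T powr (-1/4) / T powr (-1/8)) \<in> O[at_top](\<lambda>T. 1 / (ln T) powr (1/12))"
    by real_asymp+
  have c: "(\<lambda>T. k * g T) \<in> O[at_top](h)" if "g \<in> O[at_top](h)" for k and g h :: "real \<Rightarrow> real"
    using that by (cases "k = 0") auto
  show ?thesis by (intro sum_in_bigo c f)
qed

lemma (in stationary_gaussian) rate_at:
  fixes h :: "real \<Rightarrow> real"
  assumes T: "T \<ge> 4" and tail: "tail_integral \<rho> (sqrt T) \<le> C0 * (1 / ln (sqrt T))"
    and h: "\<And>x y. \<bar>h x - h y\<bar> \<le> \<bar>x - y\<bar>"
  shows "\<bar>(\<integral>\<omega>. h (normalized_excursion_volume X T u \<omega>) \<partial>M) - (\<integral>z. h (sqrt (asymptotic_variance \<rho> u) * z) \<partial>gam)\<bar> \<le>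
     1/2 * T powr (-1/32) + total * (sqrt (T powr (-1/8)) / T powr (-1/32)) + 4 * (1 / sqrt (ln T))
      + (pi * C0) * (sqrt (ln T) * (1 / ln (sqrt T))) + (2 * pi * real CARD('d) * total) * (sqrt (ln T) / sqrt T)
      + (2 * pi * total * sqrt 2) * (sqrt (ln T) * sqrt (T powr (-1/8)))
      + (6 * pi * total\<^sup>2) * (ln T / (T powr (-1/8) * sqrt T)) + (8 * pi * total\<^sup>2) * (ln T / (T powr (-1/8) * sqrt T * T powr (-1/4)))
      + (2 * pi * total) * (sqrt (ln T) * T powr (-1/4) / T powr (-1/8))"
proof -
  \<comment> \<open>Here \<open>p = 1 - a\<close>. The exponents are chosen so that
    \<open>sqrt p / c\<close>, \<open>\<kappa> / p\<close> and \<open>1 / (p * s * \<kappa>)\<close>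
    all decay like powers of \<open>T\<close>, which absorbs the logarithms. The averages have width
    \<open>1 / l\<close>: the error of order \<open>1 / ln T\<close> in the variance is multiplied
    by \<open>l\<close> and so balances with the width. The margin in the cube is
    \<open>s\<close>.\<close>
  define p where "p = T powr (-1/8)"
  define \<kappa> where "\<kappa> = T powr (-1/4)"
  define c where "c = T powr (-1/32)"
  define l where "l = sqrt (ln T)"
  define s where "s = sqrt T"
  define S where "S = sqrt (T ^ CARD('d))"
  define a where "a = 1 - p"
  have T0: "T > 0" "T > 1" using T by auto
  have p: "0 < p" "p \<le> 1"
  proof -
    have "T powr (-1/8) \<le> T powr 0" using T by (intro powr_mono) auto
    then show "0 < p" "p \<le> 1" using T0 by (simp_all add: p_def)
  qed
  have \<kappa>: "\<kappa> > 0" and c: "c > 0" and s: "s > 0" using T0 by (simp_all add: \<kappa>_def c_def s_def)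
  have l: "l > 0" "l\<^sup>2 = ln T" using T0 by (simp_all add: l_def)
  have s2: "s * s = T" using T0 by (simp add: s_def)
  \<comment> \<open>Twice the margin has to fit into the cube; this is the reason for
    \<open>T \<ge> 4\<close>.\<close>
  have x2: "2 * s \<le> T"
  proof -
    have "2 \<le> s" unfolding s_def using T real_le_rsqrt[of 2 T] by simp
    then show ?thesis using s s2 mult_right_mono[of 2 s s] by simp
  qed
  have a: "0 \<le> a" "a < 1" using p by (auto simp: a_def)
  define L where "L = 1 / (1 - a\<^sup>2)"
  define V where "V = tail_integral \<rho> s + (1 - (1 - 2 * s / T) ^ CARD('d)) * total + total * (2 * sqrt (1 - a\<^sup>2))"
  have aa: "1 - a\<^sup>2 = p * (2 - p)" by (simp add: a_def power2_eq_square algebra_simps)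
  have aab: "p \<le> 1 - a\<^sup>2" "1 - a\<^sup>2 \<le> 2 * p"
    unfolding aa using p mult_left_mono[of 1 "2 - p" p] mult_left_mono[of "2 - p" 2 p] by auto
  have L: "0 < L" "L \<le> 1 / p" unfolding L_def using aab p by (auto intro!: divide_left_mono)
  have Sp: "S > 0" using T0 by (simp add: S_def)
  \<comment> \<open>Dimension one is the worst case, so the powers of \<open>T\<close> in the bound
    do not involve the dimension.\<close>
  have SL: "1 / S \<le> 1 / s"
  proof -
    have "T ^ 1 \<le> T ^ CARD('d)" using T by (intro power_increasing) (auto simp: Suc_le_eq)
    then have "s \<le> S" by (simp add: s_def S_def)
    then show ?thesis using s by (simp add: frac_le)
  qed
  have R: "0 \<le> total" by (rule total_nonneg)
  have est: "\<bar>(\<integral>\<omega>. h (normalized_excursion_volume X T u \<omega>) \<partial>M) - (\<integral>z. h (sqrt (asymptotic_variance \<rho> u) * z) \<partial>gam)\<bar>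
     \<le> (c + 2 * sqrt (1 - a) * total / c) / 2 + (4 * (1 / l) + (2 / (1 / l) * V +
        (4 / (1 / l)\<^sup>2 * L * total\<^sup>2 / S + total * (8 / (1 / l)\<^sup>2 * L * total / S * (1 + 2 / \<kappa>) + 4 / (1 / l) * L * \<kappa>))) * (pi / 2))"
    unfolding V_def L_def S_def using l by (intro main_estimate(2)[OF T0(1) a \<kappa> _ c s x2 h]) simp
  have V: "V \<le> C0 * (1 / ln s) + real CARD('d) * (2 / s) * total + total * (2 * (sqrt 2 * sqrt p))"
  proof -
    have "2 * s / T \<le> 1" using x2 T0 by simp
    \<comment> \<open>Bernoulli's inequality bounds the relative volume of the margin by
      \<open>real CARD('d) * (2 / s)\<close>.\<close>
    then have "1 + real CARD('d) * (- (2 * s / T)) \<le> (1 + - (2 * s / T)) ^ CARD('d)" by (intro Bernoulli_inequality) simp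
    moreover have "2 * s / T = 2 / s" unfolding s2[symmetric] using s by simp
    ultimately have b: "1 - (1 - 2 * s / T) ^ CARD('d) \<le> real CARD('d) * (2 / s)" by simp
    have q: "sqrt (1 - a\<^sup>2) \<le> sqrt 2 * sqrt p" using aab(2) by (simp add: real_sqrt_mult[symmetric])
    show ?thesis unfolding V_def
      using tail b q R by (intro add_mono mult_right_mono mult_left_mono) (auto simp: s_def)
  qed
  have LS: "L * (1 / S) \<le> 1 / p * (1 / s)" using L SL Sp p by (intro mult_mono) auto
  have "(c + 2 * sqrt (1 - a) * total / c) / 2 + (4 * (1 / l) + (2 / (1 / l) * V +
        (4 / (1 / l)\<^sup>2 * L * total\<^sup>2 / S + total * (8 / (1 / l)\<^sup>2 * L * total / S * (1 + 2 / \<kappa>) + 4 / (1 / l) * L * \<kappa>))) * (pi / 2))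
    = (c + 2 * sqrt p * total / c) / 2 + (4 * (1 / l) + (2 * l * V +
        ((4 * l\<^sup>2 * total\<^sup>2) * (L * (1 / S)) + ((8 * l\<^sup>2 * total\<^sup>2 * (1 + 2 / \<kappa>)) * (L * (1 / S)) + (4 * l * total * \<kappa>) * L))) * (pi / 2))"
  proof -
    have e: "2 / (1 / l) = 2 * l" "4 / (1 / l)\<^sup>2 = 4 * l\<^sup>2" "8 / (1 / l)\<^sup>2 = 8 * l\<^sup>2" "4 / (1 / l) = 4 * l"
      by (simp_all add: power_divide)
    have gen: "A * L * R\<^sup>2 * y + R * (B * L * R * y * z + C * L * k) = (A * R\<^sup>2) * (L * y) + ((B * R\<^sup>2 * z) * (L * y) + (C * R * k) * L)"
      for A B C L R y z k :: real
      by (simp add: power2_eq_square algebra_simps)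
    have "4 * l\<^sup>2 * L * total\<^sup>2 / S + total * (8 * l\<^sup>2 * L * total / S * (1 + 2 / \<kappa>) + 4 * l * L * \<kappa>)
      = (4 * l\<^sup>2 * total\<^sup>2) * (L * (1 / S)) + ((8 * l\<^sup>2 * total\<^sup>2 * (1 + 2 / \<kappa>)) * (L * (1 / S)) + (4 * l * total * \<kappa>) * L)"
      using gen[of "4 * l\<^sup>2" L total "1 / S" "8 * l\<^sup>2" "1 + 2 / \<kappa>" "4 * l" \<kappa>] by (simp only: times_divide_eq_right mult_1_right)
    then show ?thesis unfolding e by (simp add: a_def)
  qed
  also have "\<dots> \<le> (c + 2 * sqrt p * total / c) / 2 + (4 * (1 / l) + (2 * l * (C0 * (1 / ln s) + real CARD('d) * (2 / s) * total + total * (2 * (sqrt 2 * sqrt p))) +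
        ((4 * l\<^sup>2 * total\<^sup>2) * (1 / p * (1 / s)) + ((8 * l\<^sup>2 * total\<^sup>2 * (1 + 2 / \<kappa>)) * (1 / p * (1 / s)) + (4 * l * total * \<kappa>) * (1 / p)))) * (pi / 2))"
    using V LS L l(1) R \<kappa> by (intro add_left_mono mult_right_mono add_mono mult_left_mono) auto
  also have "\<dots> = 1/2 * c + total * (sqrt p / c) + 4 * (1 / l) + (pi * C0) * (l * (1 / ln s)) + (2 * pi * real CARD('d) * total) * (l / s)
      + (2 * pi * total * sqrt 2) * (l * sqrt p)
      + (6 * pi * total\<^sup>2) * (l\<^sup>2 / (p * s)) + (8 * pi * total\<^sup>2) * (l\<^sup>2 / (p * s * \<kappa>))
      + (2 * pi * total) * (l * \<kappa> / p)"
  proof -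
    have "(c + 2 * q * R * i) / 2 + (4 * j + (2 * l * (C0 * k + d * (2 * m) * R + R * (2 * (w * q))) +
        ((4 * l\<^sup>2 * R\<^sup>2) * (y * m) + ((8 * l\<^sup>2 * R\<^sup>2 * (1 + 2 * z)) * (y * m) + (4 * l * R * \<kappa>) * y))) * (pi / 2))
      = 1/2 * c + R * (q * i) + 4 * j + (pi * C0) * (l * k) + (2 * pi * d * R) * (l * m) + (2 * pi * R * w) * (l * q)
      + (6 * pi * R\<^sup>2) * (l\<^sup>2 * y * m) + (8 * pi * R\<^sup>2) * (l\<^sup>2 * y * m * z) + (2 * pi * R) * (l * \<kappa> * y)"
      for q R i j k d m w y z :: real
      by (simp add: field_simps)
    from this[of "sqrt p" total "1 / c" "1 / l" "1 / ln s" "real CARD('d)" "1 / s" "sqrt 2" "1 / p" "1 / \<kappa>"]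
    show ?thesis by (simp add: mult.commute mult.left_commute)
  qed
  finally show ?thesis using est unfolding p_def \<kappa>_def c_def l(2) unfolding l_def s_def by linarith
qed

theorem lemmaA1:
  fixes M :: "'w measure"
    and X :: "real ^ 'd \<Rightarrow> 'w \<Rightarrow> real"
    and \<rho> :: "real ^ 'd \<Rightarrow> real"
  assumes "prob_space M"
    and "measurable_field M X"
    and "gaussian_field M X"
    and "stationary_field M X"
    and centered: "\<And>t. (\<integral>\<omega>. X t \<omega> \<partial>M) = 0"
    and unit_variance: "\<And>t. cov M (X t) (X t) = 1"
    and covariance: "\<And>s t. cov M (X s) (X t) = \<rho> (t - s)"
    and "integrable lborel \<rho>"
    and decay: "(\<lambda>a::real. LINT t:(UNIV - cbox (\<chi> i. - a) (\<chi> i. a))|lborel. \<bar>\<rho> t\<bar>)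
                  \<in> O[at_top](\<lambda>a. 1 / ln a)"
  shows "(\<exists>C::real. \<forall>\<^sub>F T in at_top. \<forall>u::real.
            wasserstein (distr M borel (normalized_excursion_volume X T u))
                        (normal_law 0 (asymptotic_variance \<rho> u))
              \<le> ennreal (C / (ln T) powr (1 / 12)))
         \<and> (\<forall>u::real. summable (\<lambda>n. variance_term \<rho> u (Suc n)) \<and> 0 < asymptotic_variance \<rho> u)"
proof -
  interpret prob_space M by fact
  have cv: "(\<integral>\<omega>. X s \<omega> * X t \<omega> \<partial>M) = \<rho> (t - s)" for s t
    using covariance[of s t] by (simp add: cov_def centered)
  interpret stationary_gaussian M X \<rho>
  proof
    show "gaussian_field M X" "\<And>t. (\<integral>\<omega>. X t \<omega> \<partial>M) = 0" by fact+
    show "case_prod X \<in> borel_measurable (lborel \<Otimes>\<^sub>M M)" using assms(2) by (simp add: measurable_field_def)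
    show "\<rho> 0 = 1" using covariance[of 0 0] unit_variance[of 0] by simp
  qed (fact cv assms(8))+
  obtain C0 where C0: "\<forall>\<^sub>F x in at_top. norm (tail_integral \<rho> x) \<le> C0 * norm (1 / ln x)"
    using decay[folded tail_integral_def] by (rule landau_o.bigE)
  \<comment> \<open>The decay is used at the margin \<open>sqrt T\<close>;
    \<open>ln (sqrt T)\<close> is half of \<open>ln T\<close>, so the order is unchanged.\<close>
  have "filterlim sqrt at_top at_top" by real_asymp
  from eventually_compose_filterlim[OF C0 this]
  have C1: "\<forall>\<^sub>F T in at_top. norm (tail_integral \<rho> (sqrt T)) \<le> C0 * norm (1 / ln (sqrt T))" .
  \<comment> \<open>The constants are those of \<open>rate_at\<close>. None of them involves
    \<open>u\<close> or the test function, so \<open>C\<close> can be fixed before both.\<close>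
  note rate = rate_bigo[of "1/2" total 4 "pi * C0" "2 * pi * real CARD('d) * total" "2 * pi * total * sqrt 2" "6 * pi * total\<^sup>2" "8 * pi * total\<^sup>2" "2 * pi * total"]
  obtain C where C: "\<forall>\<^sub>F T in at_top. norm (1/2 * T powr (-1/32) + total * (sqrt (T powr (-1/8)) / T powr (-1/32)) + 4 * (1 / sqrt (ln T))
      + (pi * C0) * (sqrt (ln T) * (1 / ln (sqrt T))) + (2 * pi * real CARD('d) * total) * (sqrt (ln T) / sqrt T)
      + (2 * pi * total * sqrt 2) * (sqrt (ln T) * sqrt (T powr (-1/8)))
      + (6 * pi * total\<^sup>2) * (ln T / (T powr (-1/8) * sqrt T)) + (8 * pi * total\<^sup>2) * (ln T / (T powr (-1/8) * sqrt T * T powr (-1/4)))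
      + (2 * pi * total) * (sqrt (ln T) * T powr (-1/4) / T powr (-1/8))) \<le> C * norm (1 / (ln T) powr (1/12))"
    using rate by (rule landau_o.bigE)
  have "\<forall>\<^sub>F T in at_top. \<forall>u. wasserstein (distr M borel (normalized_excursion_volume X T u)) (normal_law 0 (asymptotic_variance \<rho> u))
      \<le> ennreal (C / (ln T) powr (1 / 12))"
    using C C1 eventually_ge_at_top[of 4]
  proof eventually_elim
    case (elim T)
    show ?case unfolding wasserstein_def
    proof (intro allI SUP_least)
      fix u :: real and h :: "real \<Rightarrow> real" assume "h \<in> {h. 1-lipschitz_on UNIV h}"
      then have h: "\<bar>h x - h y\<bar> \<le> \<bar>x - y\<bar>" for x y using lipschitz_onD[of 1 UNIV h x y] by (simp add: dist_real_def)
      have [measurable]: "h \<in> borel_measurable borel"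
        using lipschitz_real_continuous[of h 1] h by (intro borel_measurable_continuous_onI) simp
      have T: "T > 0" using elim(3) by simp
      \<comment> \<open>Any admissible parameters serve here, since measurability does not depend on
        them.\<close>
      have m: "normalized_excursion_volume X T u \<in> borel_measurable M"
        using main_estimate(1)[OF T, of 0 1 1 1 "T / 2" "\<lambda>_. 0"] T by simp
      have e1: "(\<integral>x. h x \<partial>distr M borel (normalized_excursion_volume X T u)) = (\<integral>\<omega>. h (normalized_excursion_volume X T u \<omega>) \<partial>M)"
        using m by (subst integral_distr) auto
      have e2: "(\<integral>x. h x \<partial>normal_law 0 (asymptotic_variance \<rho> u)) = (\<integral>z. h (sqrt (asymptotic_variance \<rho> u) * z) \<partial>gam)"
        unfolding normal_law_eq_distr[OF less_imp_le[OF variance_positive]] by (subst integral_distr) auto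
      have ln0: "ln (sqrt T) > 0" "ln T > 0" using elim(3) by simp_all
      have tl: "tail_integral \<rho> (sqrt T) \<le> C0 * (1 / ln (sqrt T))" using elim(2) ln0 by simp
      have "\<bar>(\<integral>x. h x \<partial>distr M borel (normalized_excursion_volume X T u)) - (\<integral>x. h x \<partial>normal_law 0 (asymptotic_variance \<rho> u))\<bar>
          \<le> C * norm (1 / (ln T) powr (1/12))"
        unfolding e1 e2 real_norm_def
        by (rule order_trans[OF rate_at[OF elim(3) tl h] order_trans[OF abs_ge_self elim(1)[unfolded real_norm_def]]])
      then show "ennreal \<bar>(\<integral>x. h x \<partial>distr M borel (normalized_excursion_volume X T u)) - (\<integral>x. h x \<partial>normal_law 0 (asymptotic_variance \<rho> u))\<bar>
          \<le> ennreal (C / (ln T) powr (1 / 12))"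
        by (intro ennreal_leI) simp
    qed
  qed
  then show ?thesis using variance_summable variance_positive by blast
qed

end
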